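(* Suppose there exist $R_1\in(0,\infty]$, constants $a_1,a_2,a_3>0$ and $2>\alpha_2\ge\alpha_1>0$ such that $$a_1\Big(\frac Rr\Big)^{1+\alpha_1}\le\frac{\nu(r)}{\nu(R)}\le a_2\Big(\frac Rr\Big)^{1+\alpha_2}\quad\text{for all }0<r\le R<R_1,\qquad \sup_{r\ge R_1}\nu(r)\le a_3$$ (the last condition being vacuous if $R_1=\infty$). Then for every $T>0$ there exists a constant $c_1>1$ such that for all $t\in(0,T]$ and $y\in[0,R_1/2)$, $$c_1^{-1}\big(H^{-1}(1/t)\wedge t\nu(y)\big)\le p(t,tb(t)+y)\le c_1\big(H^{-1}(1/t)\wedge t\nu(y)\big).\quad( * )$$ Therefore, there exists a constant $c_2>1$ such that for all $t\in(0,T]$ and $x\in(0,R_1/2)$, $$c_2^{-1}\min\Big\{H^{-1}(1/t)\exp(-2tH(\sigma)),\,t\nu\big((x-tb(t))_+\big)\Big\}\le p(t,x)\le c_2\min\Big\{H^{-1}(1/t)\exp\big(-\tfrac t2H(\sigma)\big),\,t\nu\big((x-tb(t))_+\big)\Big\}.\quad( ** )$$ Moreover, if in addition there are constants $a_4,a_5>0$ such that $a_4\sup_{u\ge r}\nu(u)\le\nu(r)$ and $a_5\nu(r)\le\nu(2r)$ for all $r\ge R_1/2$, then $( * )$ holds for all $t\in(0,T]$ and $y\in[0,\infty)$, and $( ** )$ holds for all $t\in(0,T]$ and $x\in(0,\infty)$.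
   Context: $S=(S_t)_{t\ge0}$ is a subordinator (non-decreasing Lévy process on $\mathbb R$ with $S_0=0$) without drift. Its Laplace exponent $\phi$ is given by $\mathbb E e^{-\lambda S_t}=e^{-t\phi(\lambda)}$ and $\phi(\lambda)=\int_0^\infty(1-e^{-\lambda s})\nu(s)\,ds$, where the Lévy measure has a density $\nu:(0,\infty)\to[0,\infty)$ with $\int_0^\infty\min\{1,s\}\nu(s)ds<\infty$. (Inequalities on quotients of $\nu$ presuppose $\nu>0$ on the stated range.) Standing assumption: there is $T_0\in[0,\infty)$ with $\liminf_{x\to0}x\nu(x)=1/T_0$, where $1/0=\infty$. (The hypotheses of the claim imply this with $T_0=0$.) For $t>T_0$, $S_t$ has a transition density $p(t,\cdot)$, continuous and bounded on $(0,\infty)$. Notation: $H(\lambda)=\phi(\lambda)-\lambda\phi'(\lambda)$, $H(0)=0$, a strictly increasing bijection of $(0,\infty)$ with inverse $H^{-1}$; $b(t)=\phi'(H^{-1}(1/t))$; $\phi'(0)=\lim_{\lambda\downarrow0}\phi'(\lambda)\in(0,\infty]$; $\sigma=\sigma(t,x)=(\phi')^{-1}(x/t)$ for $t>0$, $0<x<t\phi'(0)$, and $\sigma=0$ for $x\ge t\phi'(0)$. $a\wedge b=\min\{a,b\}$, $z_+=\max\{z,0\}$. Convention: $\nu(0)=\infty$. *)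

theory Defs
  imports "HOL-Probability.Probability"
begin

section \<open>Subordinators\<close>

text \<open>Processes are indexed by real times, but only times \<open>t \<ge> 0\<close> are ever constrained.\<close>

definition levy_process :: "'a measure \<Rightarrow> (real \<Rightarrow> 'a \<Rightarrow> real) \<Rightarrow> bool" where
  "levy_process M S \<longleftrightarrow>
     prob_space M \<and>
     (\<forall>t\<ge>0. S t \<in> borel_measurable M) \<and>
     (AE \<omega> in M. S 0 \<omega> = 0) \<and>
     (\<forall>(\<tau> :: nat \<Rightarrow> real) n. 0 \<le> \<tau> 0 \<longrightarrow> mono \<tau> \<longrightarrow>
        prob_space.indep_vars M (\<lambda>_. borel)
          (\<lambda>i \<omega>. S (\<tau> (Suc i)) \<omega> - S (\<tau> i) \<omega>) {..<n}) \<and>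
     (\<forall>s\<ge>0. \<forall>t\<ge>0.
        distr M borel (\<lambda>\<omega>. S (s + t) \<omega> - S s \<omega>) = distr M borel (S t)) \<and>
     (\<forall>t\<ge>0. \<forall>\<epsilon>>0.
        ((\<lambda>u. measure M {\<omega> \<in> space M. \<epsilon> < \<bar>S u \<omega> - S t \<omega>\<bar>}) \<longlongrightarrow> 0) (at t within {0..})) \<and>
     (AE \<omega> in M.
        (\<forall>t\<ge>0. continuous (at_right t) (\<lambda>u. S u \<omega>)) \<and>
        (\<forall>t>0. \<exists>l. ((\<lambda>u. S u \<omega>) \<longlongrightarrow> l) (at_left t)))"

definition subordinator :: "'a measure \<Rightarrow> (real \<Rightarrow> 'a \<Rightarrow> real) \<Rightarrow> bool" where
  "subordinator M S \<longleftrightarrow>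
     levy_process M S \<and> (AE \<omega> in M. mono_on {0..} (\<lambda>t. S t \<omega>))"

definition has_laplace_exponent ::
    "'a measure \<Rightarrow> (real \<Rightarrow> 'a \<Rightarrow> real) \<Rightarrow> (real \<Rightarrow> real) \<Rightarrow> bool" where
  "has_laplace_exponent M S \<phi> \<longleftrightarrow>
     (\<forall>t\<ge>0. \<forall>l\<ge>0. (\<integral>\<omega>. exp (- l * S t \<omega>) \<partial>M) = exp (- t * \<phi> l))"

text \<open>A L\'evy density is a function on \<open>(0,\<infinity>)\<close>; its values outside are irrelevant.\<close>

definition subordinator_levy_density :: "(real \<Rightarrow> real) \<Rightarrow> bool" where
  "subordinator_levy_density \<nu> \<longleftrightarrow>
     set_borel_measurable borel {0<..} \<nu> \<and>
     (\<forall>s>0. 0 \<le> \<nu> s) \<and>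
     set_integrable lborel {0<..} (\<lambda>s. min 1 s * \<nu> s)"

text \<open>The absence of a drift means that there is no additional linear term here.\<close>

definition laplace_exponent_of_density :: "(real \<Rightarrow> real) \<Rightarrow> real \<Rightarrow> real" where
  "laplace_exponent_of_density \<nu> l =
     (LINT s:{0<..}|lborel. (1 - exp (- l * s)) * \<nu> s)"

text \<open>
  The transition densities \<open>p t\<close>, \<open>t > 0\<close>, are functions on \<open>(0,\<infinity>)\<close>, hence the indicator.
  By continuity, the law of \<open>S t\<close> determines all values \<open>p t x\<close> with \<open>x > 0\<close>.
\<close>

definition transition_density ::
    "'a measure \<Rightarrow> (real \<Rightarrow> 'a \<Rightarrow> real) \<Rightarrow> (real \<Rightarrow> real \<Rightarrow> real) \<Rightarrow> bool" where
  "transition_density M S p \<longleftrightarrow>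
     (\<forall>t>0. (\<forall>x>0. 0 \<le> p t x) \<and>
        distributed M lborel (S t) (\<lambda>x. ennreal (p t x) * indicator {0<..} x) \<and>
        continuous_on {0<..} (p t) \<and>
        bounded (p t ` {0<..}))"


section \<open>Functions derived from the Laplace exponent\<close>

definition H :: "(real \<Rightarrow> real) \<Rightarrow> real \<Rightarrow> real" where
  "H \<phi> l = (if l = 0 then 0 else \<phi> l - l * deriv \<phi> l)"

definition H_inv :: "(real \<Rightarrow> real) \<Rightarrow> real \<Rightarrow> real" where
  "H_inv \<phi> = inv_into {0<..} (H \<phi>)"

definition b :: "(real \<Rightarrow> real) \<Rightarrow> real \<Rightarrow> real" where
  "b \<phi> t = deriv \<phi> (H_inv \<phi> (1 / t))"

text \<open>The right derivative \<open>\<phi>'(0)\<close>, as the possibly infinite limit of \<open>\<phi>'\<close> at \<open>0\<close>.\<close>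

definition deriv_at_0 :: "(real \<Rightarrow> real) \<Rightarrow> ereal" where
  "deriv_at_0 \<phi> = Lim (at_right 0) (\<lambda>l. ereal (deriv \<phi> l))"

definition sigma :: "(real \<Rightarrow> real) \<Rightarrow> real \<Rightarrow> real \<Rightarrow> real" where
  "sigma \<phi> t x =
     (if ereal x < ereal t * deriv_at_0 \<phi> then inv_into {0<..} (deriv \<phi>) (x / t) else 0)"


section \<open>The two-sided bounds\<close>

text \<open>The convention \<open>\<nu>(0) = \<infinity>\<close>, because of which the bounds are stated in \<^typ>\<open>ereal\<close>.\<close>

definition nu_ext :: "(real \<Rightarrow> real) \<Rightarrow> real \<Rightarrow> ereal" where
  "nu_ext \<nu> r = (if r = 0 then \<infinity> else ereal (\<nu> r))"

definition shifted_bounds ::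
    "(real \<Rightarrow> real) \<Rightarrow> (real \<Rightarrow> real) \<Rightarrow> (real \<Rightarrow> real \<Rightarrow> real) \<Rightarrow> real \<Rightarrow> real \<Rightarrow> real \<Rightarrow> bool" where
  "shifted_bounds \<phi> \<nu> p c t y \<longleftrightarrow>
     ereal (1 / c) * min (ereal (H_inv \<phi> (1 / t))) (ereal t * nu_ext \<nu> y)
       \<le> ereal (p t (t * b \<phi> t + y)) \<and>
     ereal (p t (t * b \<phi> t + y))
       \<le> ereal c * min (ereal (H_inv \<phi> (1 / t))) (ereal t * nu_ext \<nu> y)"

definition full_bounds ::
    "(real \<Rightarrow> real) \<Rightarrow> (real \<Rightarrow> real) \<Rightarrow> (real \<Rightarrow> real \<Rightarrow> real) \<Rightarrow> real \<Rightarrow> real \<Rightarrow> real \<Rightarrow> bool" where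
  "full_bounds \<phi> \<nu> p c t x \<longleftrightarrow>
     ereal (1 / c) *
         min (ereal (H_inv \<phi> (1 / t) * exp (- 2 * t * H \<phi> (sigma \<phi> t x))))
             (ereal t * nu_ext \<nu> (max (x - t * b \<phi> t) 0))
       \<le> ereal (p t x) \<and>
     ereal (p t x)
       \<le> ereal c *
         min (ereal (H_inv \<phi> (1 / t) * exp (- (t / 2) * H \<phi> (sigma \<phi> t x))))
             (ereal t * nu_ext \<nu> (max (x - t * b \<phi> t) 0))"

end

theory Submission
  imports Defs
begin

text \<open>
  A law on \<open>[0,\<infinity>)\<close> is determined by its Laplace transform, so splitting a L\'evy density splits the law
  into a convolution, and one bounded factor bounds the density of the whole. Let \<open>h = H\<^sup>-\<^sup>1(1/t)\<close>;
  about one jump of size \<open>1/h\<close> is expected up to time \<open>t\<close>, and the jumps of this size give the bound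
  \<open>O(h)\<close> for the density. To the right of \<open>t b(t)\<close>, at distance \<open>y\<close>, either one jump is comparable to
  \<open>y\<close>, which contributes \<open>O(t \<nu>(y))\<close>, or a Chernoff bound makes the small jumps negligible. To the left,
  the Esscher transform with parameter \<open>\<sigma>\<close> moves the mean to \<open>x\<close>. The lower bounds come from Chebyshev's
  inequality for the position of the process without a suitable class of jumps, followed by exactly one
  such jump, whose density is bounded from below. Bounds for the
  measures of small intervals pass to \<open>p\<close> by continuity.
\<close>

section \<open>Laws with a given L\'evy density\<close>

text \<open>All constants must be uniform over \<open>t \<le> T\<close>, while scaling is known only
  below a finite cutoff \<open>R\<close>. The quantity that governs everything is the jump rate
  \<open>t * (r * n r)\<close>, the order of the expected number of jumps of size about
  \<open>r\<close>. Because 0 < \<alpha>1 and \<alpha>2 < 2, the tail beyond \<open>r\<close> and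
  the second moment below \<open>r\<close> are both controlled by it, so \<open>H (1/r)\<close> is
  comparable to \<open>r * n r\<close>; at \<open>r = 1/h\<close> the rate is of order one. Capping
  this scale at \<open>R\<close> costs only a constant, as \<open>t\<close> is bounded. Time is
  absorbed into the density \<open>t * n\<close>, so that truncating, scaling and tilting act on
  densities alone. Truncated laws may have atoms and are known only by their transforms, so every
  estimate compares measures of Borel sets. With \<open>N = t H(\<sigma>)\<close>, the left upper
  bound is \<open>exp (- N)\<close> times a power of \<open>N\<close>; half of the exponent absorbs
  the power, whence the 1/2 in the claim. The left lower bound spends \<open>N\<close> on undoing
  the tilt, \<open>N/8\<close> on the absence of other large jumps, \<open>N/8\<close> on the tilt
  of the one jump, and \<open>3N/4\<close> on a power of \<open>N\<close>, whence the 2.\<close>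

definition levy_density :: "(real \<Rightarrow> real) \<Rightarrow> bool" where
  "levy_density \<mu> \<longleftrightarrow> \<mu> \<in> borel_measurable borel \<and> (\<forall>s. 0 \<le> \<mu> s) \<and> (\<forall>s\<le>0. \<mu> s = 0) \<and>
     integrable lborel (\<lambda>s. min 1 s * \<mu> s)"

definition lexp :: "(real \<Rightarrow> real) \<Rightarrow> real \<Rightarrow> real" where
  "lexp \<mu> l = (\<integral>s. (1 - exp (- l * s)) * \<mu> s \<partial>lborel)"

text \<open>The law of a driftless subordinator at time one, possibly with an atom at 0; time
  \<open>t\<close> is encoded by the density \<open>t * \<mu>\<close>. The transform is a
  nonnegative integral, so no integrability conditions arise, and \<open>l = 0\<close> gives the
  total mass.\<close>

definition levy_law :: "real measure \<Rightarrow> (real \<Rightarrow> real) \<Rightarrow> bool" where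
  "levy_law P \<mu> \<longleftrightarrow> prob_space P \<and> sets P = sets borel \<and> (AE x in P. 0 \<le> x) \<and>
     (\<forall>l\<ge>0. (\<integral>\<^sup>+x. ennreal (exp (- l * x)) \<partial>P) = ennreal (exp (- lexp \<mu> l)))"

lemma levy_densityD:
  assumes "levy_density \<mu>"
  shows "\<mu> \<in> borel_measurable borel" "0 \<le> \<mu> s" "s \<le> 0 \<Longrightarrow> \<mu> s = 0"
    "integrable lborel (\<lambda>s. min 1 s * \<mu> s)"
  using assms by (auto simp: levy_density_def)

lemma levy_integrable:
  assumes "levy_density \<mu>" and F: "F \<in> borel_measurable borel"
    and "\<And>s. 0 < s \<Longrightarrow> \<bar>F s\<bar> \<le> C * min 1 s"
  shows "integrable lborel (\<lambda>s. F s * \<mu> s)"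
proof (rule Bochner_Integration.integrable_bound)
  show "integrable lborel (\<lambda>s. C * (min 1 s * \<mu> s))"
    using levy_densityD(4)[OF assms(1)] by (rule integrable_mult_right)
  show "(\<lambda>s. F s * \<mu> s) \<in> borel_measurable lborel"
    using F levy_densityD(1)[OF assms(1)] by measurable
  show "AE s in lborel. norm (F s * \<mu> s) \<le> norm (C * (min 1 s * \<mu> s))"
  proof (rule AE_I2)
    fix s :: real
    show "norm (F s * \<mu> s) \<le> norm (C * (min 1 s * \<mu> s))"
    proof (cases "s \<le> 0")
      case True then show ?thesis using levy_densityD(3)[OF assms(1)] by simp
    next
      case False
      have m: "0 \<le> \<mu> s" using levy_densityD(2)[OF assms(1)] .
      have "\<bar>F s\<bar> * \<mu> s \<le> (C * min 1 s) * \<mu> s"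
        using False assms(3)[of s] m by (intro mult_right_mono) auto
      also have "\<dots> \<le> \<bar>C * (min 1 s * \<mu> s)\<bar>" by (simp add: mult.assoc)
      finally show ?thesis using m by (simp add: abs_mult)
    qed
  qed
qed

text \<open>The upper bound on \<open>k\<close> is demanded only where \<open>\<mu>\<close> does not
  vanish, so that \<open>exp (\<theta> * s)\<close> is an admissible factor for a density without
  large jumps.\<close>

lemma levy_density_mult:
  assumes "levy_density \<mu>" and k: "k \<in> borel_measurable borel"
    and "\<And>s. 0 < s \<Longrightarrow> 0 \<le> k s" "\<And>s. 0 < s \<Longrightarrow> \<mu> s \<noteq> 0 \<Longrightarrow> k s \<le> C"
  shows "levy_density (\<lambda>s. k s * \<mu> s)"
proof -
  note [measurable] = levy_densityD(1)[OF assms(1)] k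
  have "integrable lborel (\<lambda>s. min 1 s * (k s * \<mu> s))"
  proof (rule Bochner_Integration.integrable_bound)
    show "integrable lborel (\<lambda>s. C * (min 1 s * \<mu> s))"
      using levy_densityD(4)[OF assms(1)] by (rule integrable_mult_right)
    show "(\<lambda>s. min 1 s * (k s * \<mu> s)) \<in> borel_measurable lborel" by measurable
    show "AE s in lborel. norm (min 1 s * (k s * \<mu> s)) \<le> norm (C * (min 1 s * \<mu> s))"
    proof (rule AE_I2)
      fix s :: real
      show "norm (min 1 s * (k s * \<mu> s)) \<le> norm (C * (min 1 s * \<mu> s))"
      proof (cases "s \<le> 0 \<or> \<mu> s = 0")
        case True then show ?thesis using levy_densityD(3)[OF assms(1)] by auto
      next
        case False
        have m: "0 \<le> \<mu> s" using levy_densityD(2)[OF assms(1)] .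
        have k: "0 \<le> k s" "k s \<le> C" using assms(3,4)[of s] False by auto
        have "k s * (min 1 s * \<mu> s) \<le> C * (min 1 s * \<mu> s)"
          using False k m by (intro mult_right_mono) auto
        then show ?thesis using m k False by (simp add: abs_mult ac_simps)
      qed
    qed
  qed
  moreover have "0 \<le> k s * \<mu> s" for s
    using assms(3)[of s] levy_densityD(2,3)[OF assms(1), of s] by (cases "s \<le> 0") auto
  moreover have "k s * \<mu> s = 0" if "s \<le> 0" for s using levy_densityD(3)[OF assms(1) that] by simp
  moreover have "(\<lambda>s. k s * \<mu> s) \<in> borel_measurable borel" by measurable
  ultimately show ?thesis unfolding levy_density_def by blast
qed

lemma one_minus_exp_bound:
  assumes "0 \<le> l" "0 < (s::real)"
  shows "\<bar>1 - exp (- l * s)\<bar> \<le> max 1 l * min 1 s"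
proof -
  have "1 + - (l * s) \<le> exp (- (l * s))" by (rule exp_ge_add_one_self)
  moreover have "exp (- (l * s)) \<le> 1" using assms by simp
  moreover have "exp (- (l * s)) > 0" by simp
  moreover have "l * s \<le> max 1 l * s" using assms by (intro mult_right_mono) auto
  moreover have "1 \<le> max 1 l" by simp
  ultimately show ?thesis by (cases "1 \<le> s") (auto simp: min_def abs_if intro: order_trans[of _ 1])
qed

lemma integrable_lexp:
  assumes "levy_density \<mu>" "0 \<le> l"
  shows "integrable lborel (\<lambda>s. (1 - exp (- l * s)) * \<mu> s)"
  by (rule levy_integrable[OF assms(1), where C = "max 1 l"])
     (use one_minus_exp_bound[OF assms(2)] in auto)

lemma lexp_nonneg: "levy_density \<mu> \<Longrightarrow> 0 \<le> l \<Longrightarrow> 0 \<le> lexp \<mu> l"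
  unfolding lexp_def
  apply (rule integral_nonneg_AE, rule AE_I2)
  subgoal for s using levy_densityD(2,3)[of \<mu> s] by (cases "s \<le> 0") auto
  done

lemma lexp_add:
  assumes "levy_density \<mu>" "levy_density \<rho>" "0 \<le> l"
  shows "lexp (\<lambda>s. \<mu> s + \<rho> s) l = lexp \<mu> l + lexp \<rho> l"
  using integrable_lexp[OF assms(1,3)] integrable_lexp[OF assms(2,3)]
  unfolding lexp_def by (simp add: ring_distribs)

lemma levy_lawD:
  assumes "levy_law P \<mu>"
  shows "prob_space P" "sets P = sets borel" "AE x in P. 0 \<le> x" "space P = UNIV" "finite_measure P"
    "real_distribution P"
    "0 \<le> l \<Longrightarrow> (\<integral>\<^sup>+x. ennreal (exp (- l * x)) \<partial>P) = ennreal (exp (- lexp \<mu> l))"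
proof -
  show *: "prob_space P" "sets P = sets borel" "AE x in P. 0 \<le> x"
    "0 \<le> l \<Longrightarrow> (\<integral>\<^sup>+x. ennreal (exp (- l * x)) \<partial>P) = ennreal (exp (- lexp \<mu> l))"
    using assms by (auto simp: levy_law_def)
  show "space P = UNIV" using sets_eq_imp_space_eq[OF *(2)] by simp
  then show "real_distribution P" using * by (simp add: real_distribution_def real_distribution_axioms_def)
  show "finite_measure P" using *(1) by (simp add: prob_space_def)
qed

section \<open>Uniqueness of a law with given Laplace transform\<close>

lemma integral_exp_eq:
  assumes "prob_space P" "sets P = sets borel" "AE x in P. 0 \<le> (x::real)" "0 \<le> l"
  shows "integrable P (\<lambda>x. exp (- l * x))"
    "ennreal (\<integral>x. exp (- l * x) \<partial>P) = (\<integral>\<^sup>+x. ennreal (exp (- l * x)) \<partial>P)"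
proof -
  interpret prob_space P by fact
  note [measurable_cong] = assms(2)
  show i: "integrable P (\<lambda>x. exp (- l * x))"
    by (rule integrable_const_bound[where B = 1]) (use assms in auto)
  show "ennreal (\<integral>x. exp (- l * x) \<partial>P) = (\<integral>\<^sup>+x. ennreal (exp (- l * x)) \<partial>P)"
    by (rule nn_integral_eq_integral[symmetric, OF i]) simp
qed

text \<open>The characteristic function of \<open>exp (-X)\<close> is a power series in the values of the Laplace transform
  of \<open>X\<close> at the natural numbers.\<close>

lemma char_exp_minus:
  assumes "real_distribution P" "AE x in P. 0 \<le> x"
  shows "char (distr P borel (\<lambda>x. exp (- x))) \<xi> =
    (\<Sum>n. (\<i> * complex_of_real \<xi>) ^ n /\<^sub>R fact n * complex_of_real (\<integral>x. exp (- real n * x) \<partial>P))"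
proof -
  interpret real_distribution P by fact
  let ?g = "\<lambda>n x. (\<i> * complex_of_real \<xi>) ^ n /\<^sub>R fact n * complex_of_real (exp (- real n * x))"
  have i: "integrable P (\<lambda>x. exp (- real n * x))" for n
    by (rule integrable_const_bound[where B = 1]) (use assms(2) in auto)
  have gi: "integrable P (?g n)" for n
    using i by (intro integrable_mult_right integrable_of_real)
  \<comment> \<open>For nonnegative \<open>x\<close> the factor \<open>exp (- n * x)\<close> is at
    most 1, so the exponential series of \<bar>\<xi>\<bar> dominates and sum and integral may be
    exchanged.\<close>
  have nb: "norm (?g n x) \<le> \<bar>\<xi>\<bar> ^ n /\<^sub>R fact n" if "0 \<le> x" for n x
    using that by (simp add: norm_mult norm_power mult_left_le divide_simps)
  have "char (distr P borel (\<lambda>x. exp (- x))) \<xi> = (\<integral>x. iexp (\<xi> * exp (- x)) \<partial>P)"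
    unfolding char_def by (subst integral_distr) auto
  also have "\<dots> = (\<integral>x. (\<Sum>n. ?g n x) \<partial>P)"
  proof (rule Bochner_Integration.integral_cong)
    fix x
    have "iexp (\<xi> * exp (- x)) = (\<Sum>n. (\<i> * complex_of_real (\<xi> * exp (- x))) ^ n /\<^sub>R fact n)"
      by (simp add: exp_def)
    also have "\<dots> = (\<Sum>n. ?g n x)"
      by (rule arg_cong[where f = suminf], rule ext)
         (simp add: power_mult_distrib exp_of_nat_mult[symmetric] flip: of_real_power)
    finally show "iexp (\<xi> * exp (- x)) = (\<Sum>n. ?g n x)" .
  qed simp
  also have "\<dots> = (\<Sum>n. (\<integral>x. ?g n x \<partial>P))"
  proof (rule integral_suminf[OF gi])
    show "AE x in P. summable (\<lambda>n. norm (?g n x))"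
      using assms(2)
    proof eventually_elim
      case (elim x)
      show ?case
        by (rule summable_comparison_test'[OF summable_exp_generic[of "\<bar>\<xi>\<bar>"], where N = 0])
           (use nb[OF elim] in simp)
    qed
    show "summable (\<lambda>n. \<integral>x. norm (?g n x) \<partial>P)"
    proof (rule summable_comparison_test'[OF summable_exp_generic[of "\<bar>\<xi>\<bar>"], where N = 0])
      fix n
      have "(\<integral>x. norm (?g n x) \<partial>P) \<le> \<bar>\<xi>\<bar> ^ n /\<^sub>R fact n"
      proof (rule integral_le_const)
        show "integrable P (\<lambda>x. norm (?g n x))" by (rule integrable_norm[OF gi])
        show "AE x in P. norm (?g n x) \<le> \<bar>\<xi>\<bar> ^ n /\<^sub>R fact n"
          using assms(2) by eventually_elim (rule nb)
      qed
      then show "norm (\<integral>x. norm (?g n x) \<partial>P) \<le> \<bar>\<xi>\<bar> ^ n /\<^sub>R fact n"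
        by (simp add: Bochner_Integration.integral_nonneg)
    qed
  qed
  also have "\<dots> = (\<Sum>n. (\<i> * complex_of_real \<xi>) ^ n /\<^sub>R fact n * complex_of_real (\<integral>x. exp (- real n * x) \<partial>P))"
    by (subst integral_mult_right_zero, subst integral_complex_of_real) (rule refl)
  finally show ?thesis .
qed

text \<open>Equal transforms, already at the natural numbers, give equal characteristic functions of
  \<open>exp (- X)\<close>. The map \<open>x \<mapsto> exp (- x)\<close> is injective, so taking
  \<open>- ln\<close> of the images recovers the original laws.\<close>

lemma laplace_unique:
  assumes "real_distribution P" "AE x in P. 0 \<le> x" "real_distribution Q" "AE x in Q. 0 \<le> x"
    and "\<And>l. 0 \<le> l \<Longrightarrow> (\<integral>x. exp (- l * x) \<partial>P) = (\<integral>x. exp (- l * x) \<partial>Q)"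
  shows "P = Q"
proof -
  interpret P: real_distribution P by fact
  interpret Q: real_distribution Q by fact
  let ?U = "\<lambda>P. distr P borel (\<lambda>x::real. exp (- x))"
  have "char (?U P) = char (?U Q)"
    by (rule ext) (simp only: char_exp_minus[OF assms(1,2)] char_exp_minus[OF assms(3,4)] assms(5)[OF of_nat_0_le_iff])
  moreover have "real_distribution (?U P)" "real_distribution (?U Q)"
    by (auto intro!: P.real_distribution_distr Q.real_distribution_distr)
  ultimately have "?U P = ?U Q" using Levy_uniqueness by blast
  then have "distr (?U P) borel (\<lambda>u. - ln u) = distr (?U Q) borel (\<lambda>u. - ln u)" by simp
  moreover have "distr (?U P) borel (\<lambda>u. - ln u) = P"
    by (subst distr_distr) (auto simp: comp_def intro!: distr_id2)
  moreover have "distr (?U Q) borel (\<lambda>u. - ln u) = Q"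
    by (subst distr_distr) (auto simp: comp_def intro!: distr_id2)
  ultimately show ?thesis by simp
qed

lemma levy_law_unique:
  assumes "levy_law P \<mu>" "levy_law Q \<mu>"
  shows "P = Q"
proof (rule laplace_unique)
  fix l :: real assume l: "0 \<le> l"
  have "ennreal (\<integral>x. exp (- l * x) \<partial>P) = ennreal (\<integral>x. exp (- l * x) \<partial>Q)"
    using levy_lawD[OF assms(1)] levy_lawD[OF assms(2)] l
    by (simp only: integral_exp_eq levy_lawD)
  then show "(\<integral>x. exp (- l * x) \<partial>P) = (\<integral>x. exp (- l * x) \<partial>Q)"
    by (simp add: Bochner_Integration.integral_nonneg)
qed (use levy_lawD[OF assms(1)] levy_lawD[OF assms(2)] in auto)

section \<open>Compound Poisson laws\<close>

text \<open>\<open>convpow f n\<close> is the convolution power of order \<open>n + 1\<close>. The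
  power of order 0 is the unit mass at 0, which has no density; it becomes the atom of the compound
  Poisson law.\<close>

primrec convpow :: "(real \<Rightarrow> ennreal) \<Rightarrow> nat \<Rightarrow> real \<Rightarrow> ennreal" where
  "convpow f 0 = f"
| "convpow f (Suc n) = (\<lambda>v. \<integral>\<^sup>+s. f s * convpow f n (v - s) \<partial>lborel)"

lemma convpow_measurable [measurable]:
  assumes [measurable]: "f \<in> borel_measurable borel"
  shows "convpow f n \<in> borel_measurable borel"
proof (induction n)
  case (Suc n)
  note [measurable] = Suc
  show ?case unfolding convpow.simps by measurable
qed simp

lemma convpow_nonpos:
  assumes "\<And>s. s \<le> 0 \<Longrightarrow> f s = 0" "v \<le> 0"
  shows "convpow f n v = 0"
  using assms(2)
proof (induction n arbitrary: v)
  case (Suc n)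
  have "f s * convpow f n (v - s) = 0" for s
    using assms(1)[of s] Suc.IH[of "v - s"] Suc.prems by (cases "s \<le> 0") auto
  then show ?case by (simp del: mult_eq_0_iff)
qed (simp add: assms(1))

lemma nn_integral_shift:
  fixes F :: "real \<Rightarrow> ennreal"
  assumes "F \<in> borel_measurable borel"
  shows "(\<integral>\<^sup>+v. F (v - s) \<partial>lborel) = (\<integral>\<^sup>+v. F v \<partial>lborel)"
    "(\<integral>\<^sup>+v. F (s + v) \<partial>lborel) = (\<integral>\<^sup>+v. F v \<partial>lborel)"
  using nn_integral_real_affine[OF assms, of 1 "- s"] nn_integral_real_affine[OF assms, of 1 s]
  by simp_all

text \<open>The exponential is multiplicative, so the transform of a convolution is a product. The
  case \<open>l = 0\<close> gives the total mass of the convolution powers.\<close>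

lemma convpow_laplace:
  assumes [measurable]: "f \<in> borel_measurable borel"
  shows "(\<integral>\<^sup>+v. ennreal (exp (- l * v)) * convpow f n v \<partial>lborel)
    = (\<integral>\<^sup>+v. ennreal (exp (- l * v)) * f v \<partial>lborel) ^ Suc n"
proof (induction n)
  case (Suc n)
  let ?e = "\<lambda>v. ennreal (exp (- l * v))"
  have add: "?e (s + v) = ?e s * ?e v" for s v
    by (simp add: ennreal_mult'[symmetric] exp_add[symmetric] algebra_simps)
  have "(\<integral>\<^sup>+v. ?e v * convpow f (Suc n) v \<partial>lborel)
      = (\<integral>\<^sup>+v. (\<integral>\<^sup>+s. ?e v * (f s * convpow f n (v - s)) \<partial>lborel) \<partial>lborel)"
    by (simp add: nn_integral_cmult)
  also have "\<dots> = (\<integral>\<^sup>+s. (\<integral>\<^sup>+v. ?e v * (f s * convpow f n (v - s)) \<partial>lborel) \<partial>lborel)"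
    by (rule lborel_pair.Fubini') measurable
  also have "\<dots> = (\<integral>\<^sup>+s. ?e s * f s * (\<integral>\<^sup>+v. ?e v * convpow f n v \<partial>lborel) \<partial>lborel)"
  proof (rule nn_integral_cong)
    fix s :: real
    have "(\<integral>\<^sup>+v. ?e v * (f s * convpow f n (v - s)) \<partial>lborel)
        = (\<integral>\<^sup>+v. ?e (s + v) * (f s * convpow f n v) \<partial>lborel)"
      using nn_integral_shift(2)[of "\<lambda>v. ?e v * (f s * convpow f n (v - s))" s] by simp
    also have "\<dots> = (\<integral>\<^sup>+v. (?e s * f s) * (?e v * convpow f n v) \<partial>lborel)"
      by (simp only: add ac_simps)
    also have "\<dots> = ?e s * f s * (\<integral>\<^sup>+v. ?e v * convpow f n v \<partial>lborel)"
      by (rule nn_integral_cmult) measurable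
    finally show "(\<integral>\<^sup>+v. ?e v * (f s * convpow f n (v - s)) \<partial>lborel)
      = ?e s * f s * (\<integral>\<^sup>+v. ?e v * convpow f n v \<partial>lborel)" .
  qed
  also have "\<dots> = (\<integral>\<^sup>+s. ?e s * f s \<partial>lborel) * (\<integral>\<^sup>+v. ?e v * convpow f n v \<partial>lborel)"
    by (rule nn_integral_multc) measurable
  finally show ?case by (simp only: Suc.IH power_Suc)
qed simp

text \<open>One jump keeps its pointwise bound \<open>D\<close>; each of the remaining
  \<open>n\<close> is integrated out and costs its mass \<open>c\<close>.\<close>

lemma convpow_le:
  assumes [measurable]: "f \<in> borel_measurable borel"
    and D: "\<And>s. f s \<le> D" and c: "(\<integral>\<^sup>+s. f s \<partial>lborel) \<le> c"
  shows "convpow f n v \<le> D * c ^ n"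
proof (induction n arbitrary: v)
  case (Suc n)
  have "convpow f (Suc n) v \<le> (\<integral>\<^sup>+s. f s * (D * c ^ n) \<partial>lborel)"
    by (simp, intro nn_integral_mono mult_left_mono Suc) simp
  also have "\<dots> = (\<integral>\<^sup>+s. f s \<partial>lborel) * (D * c ^ n)" by (rule nn_integral_multc) simp
  also have "\<dots> \<le> c * (D * c ^ n)" by (intro mult_right_mono c) simp
  finally show ?case by (simp add: ac_simps)
qed (simp add: D)

text \<open>Among \<open>n + 1\<close> jumps with sum \<open>v\<close> one is at least \<open>v / (n + 1)\<close>.\<close>

lemma convpow_le_largest:
  assumes [measurable]: "f \<in> borel_measurable borel"
    and f0: "\<And>s. s \<le> 0 \<Longrightarrow> f s = 0" and c: "(\<integral>\<^sup>+s. f s \<partial>lborel) \<le> c" and "0 < v"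
  shows "convpow f n v \<le> of_nat (Suc n) * c ^ n * (SUP s\<in>{v / real (Suc n)..}. f s)"
  using \<open>0 < v\<close>
proof (induction n arbitrary: v)
  case 0
  then show ?case by (simp, intro SUP_upper) simp
next
  case (Suc n)
  define B where "B a = (SUP s\<in>{a..}. f s)" for a :: real
  have anti: "a \<le> a' \<Longrightarrow> B a' \<le> B a" for a a'
    unfolding B_def by (rule SUP_subset_mono) auto
  let ?a = "v / real (Suc (Suc n))"
  have "0 < ?a" using Suc.prems by simp
  have *: "f s * convpow f n (v - s) \<le> f s * (of_nat (Suc n) * c ^ n * B ?a) + B ?a * convpow f n (v - s)" for s
  proof (cases "s < ?a")
    case True
    have "?a * real (Suc (Suc n)) = v" by simp
    then have eq: "v - ?a = ?a * real (Suc n)" by (simp only: of_nat_Suc ring_distribs mult_1_right)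
    have "0 < v - ?a" unfolding eq using \<open>0 < ?a\<close> by (intro mult_pos_pos) auto
    then have "0 < v - s" using True by linarith
    have "?a = (v - ?a) / real (Suc n)" unfolding eq by simp
    also have "\<dots> \<le> (v - s) / real (Suc n)" using True by (intro divide_right_mono) auto
    finally have le: "?a \<le> (v - s) / real (Suc n)" .
    have "convpow f n (v - s) \<le> of_nat (Suc n) * c ^ n * B ((v - s) / real (Suc n))"
      using Suc.IH[OF \<open>0 < v - s\<close>] by (simp add: B_def)
    also have "\<dots> \<le> of_nat (Suc n) * c ^ n * B ?a"
      by (intro mult_left_mono anti le) simp
    finally have "f s * convpow f n (v - s) \<le> f s * (of_nat (Suc n) * c ^ n * B ?a)"
      by (intro mult_left_mono) simp_all
    then show ?thesis by (rule order_trans) simp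
  next
    case False
    then have "f s \<le> B ?a" unfolding B_def by (intro SUP_upper) simp
    then have "f s * convpow f n (v - s) \<le> B ?a * convpow f n (v - s)" by (intro mult_right_mono) simp_all
    then show ?thesis by (rule order_trans) simp
  qed
  have mass: "(\<integral>\<^sup>+s. convpow f n (v - s) \<partial>lborel) \<le> c ^ Suc n"
  proof -
    have "(\<integral>\<^sup>+s. convpow f n (v - s) \<partial>lborel) = (\<integral>\<^sup>+s. convpow f n s \<partial>lborel)"
      using nn_integral_real_affine[of "convpow f n" "-1" v] by simp
    also have "\<dots> = (\<integral>\<^sup>+s. f s \<partial>lborel) ^ Suc n"
      using convpow_laplace[of f 0 n] by simp
    also have "\<dots> \<le> c ^ Suc n" by (rule power_mono) (use c in auto)
    finally show ?thesis .
  qed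
  have "convpow f (Suc n) v \<le> (\<integral>\<^sup>+s. f s * (of_nat (Suc n) * c ^ n * B ?a) + B ?a * convpow f n (v - s) \<partial>lborel)"
    unfolding convpow.simps by (rule nn_integral_mono) (rule *)
  also have "\<dots> = (\<integral>\<^sup>+s. f s \<partial>lborel) * (of_nat (Suc n) * c ^ n * B ?a) + B ?a * (\<integral>\<^sup>+s. convpow f n (v - s) \<partial>lborel)"
    by (subst nn_integral_add) (simp_all add: nn_integral_multc nn_integral_cmult)
  also have "\<dots> \<le> c * (of_nat (Suc n) * c ^ n * B ?a) + B ?a * c ^ Suc n"
    by (intro add_mono mult_right_mono mult_left_mono c mass) simp_all
  also have "\<dots> = of_nat (Suc (Suc n)) * c ^ Suc n * B ?a" by (simp add: algebra_simps)
  finally show ?case unfolding B_def .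
qed

text \<open>The sum runs over \<open>n + 1 \<ge> 1\<close> jumps, hence the factorial of
  \<open>Suc n\<close>. The Poisson normalisation \<open>exp (- mass)\<close> is left out and
  supplied in \<open>cpois\<close>, together with the event of no jump.\<close>

definition cpois_dens :: "(real \<Rightarrow> real) \<Rightarrow> real \<Rightarrow> ennreal" where
  "cpois_dens f v = (\<Sum>n. convpow (\<lambda>s. ennreal (f s)) n v * ennreal (1 / fact (Suc n)))"

text \<open>A compound Poisson law is an atom at \<open>0\<close> plus a density on \<open>(0,\<infinity>)\<close>; the atom is
  the image of the interval \<open>[-1,0]\<close>.\<close>

definition cpois :: "(real \<Rightarrow> real) \<Rightarrow> real measure" where
  "cpois f = distr (density lborel (\<lambda>x. ennreal (exp (- (\<integral>s. f s \<partial>lborel))) *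
     (cpois_dens f x + indicator {-1..0} x))) borel (max 0)"

text \<open>The densities of finite total mass: those whose jumps can be exposed explicitly as a
  compound Poisson variable.\<close>

locale jump_density =
  fixes f :: "real \<Rightarrow> real"
  assumes meas [measurable]: "f \<in> borel_measurable borel" and nonneg: "0 \<le> f s"
    and nonpos: "s \<le> 0 \<Longrightarrow> f s = 0" and integrable: "integrable lborel f"
begin

abbreviation "mass \<equiv> (\<integral>s. f s \<partial>lborel)"

lemma mass_nonneg: "0 \<le> mass" using nonneg by simp

lemma nn_mass: "(\<integral>\<^sup>+s. ennreal (f s) \<partial>lborel) = ennreal mass"
  by (rule nn_integral_eq_integral[OF integrable]) (simp add: nonneg)

lemma levy: "levy_density f"
proof -
  have "integrable lborel (\<lambda>s. min 1 s * f s)"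
    apply (rule Bochner_Integration.integrable_bound[OF integrable])
     apply measurable
    apply (rule AE_I2)
    subgoal for s using nonneg[of s] nonpos[of s] by (cases "s \<le> 0") (auto simp: abs_mult intro!: mult_left_le_one_le)
    done
  then show ?thesis using nonneg nonpos by (auto simp: levy_density_def)
qed

lemma dens_measurable [measurable]: "cpois_dens f \<in> borel_measurable borel"
  unfolding cpois_dens_def by measurable

lemma dens_nonpos: "v \<le> 0 \<Longrightarrow> cpois_dens f v = 0"
  unfolding cpois_dens_def by (subst convpow_nonpos) (auto simp: nonpos)

text \<open>The term of exactly one jump. All later lower bounds for densities go through
  it.\<close>

lemma dens_ge: "ennreal (f v) \<le> cpois_dens f v"
proof -
  have "(\<Sum>n<1. convpow (\<lambda>s. ennreal (f s)) n v * ennreal (1 / fact (Suc n))) \<le> cpois_dens f v"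
    unfolding cpois_dens_def by (rule sum_le_suminf) auto
  then show ?thesis by simp
qed

lemma nn_integral_cpois:
  assumes [measurable]: "h \<in> borel_measurable borel"
  shows "(\<integral>\<^sup>+x. h x \<partial>cpois f) = ennreal (exp (- mass)) * (h 0 + (\<integral>\<^sup>+v. cpois_dens f v * h v \<partial>lborel))"
proof -
  have "(\<integral>\<^sup>+x. h x \<partial>cpois f) = (\<integral>\<^sup>+x. ennreal (exp (- mass)) *
      (cpois_dens f x * h x + indicator {-1..0} x * h 0) \<partial>lborel)"
    unfolding cpois_def
    apply (subst nn_integral_distr, measurable)
    apply (subst nn_integral_density, measurable)
    apply (rule nn_integral_cong)
    subgoal for x using dens_nonpos[of x]
      by (cases "x \<le> 0") (auto simp: ac_simps split: split_indicator)
    done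
  also have "\<dots> = ennreal (exp (- mass)) * ((\<integral>\<^sup>+v. cpois_dens f v * h v \<partial>lborel) + (\<integral>\<^sup>+v. indicator {-1..0::real} v * h 0 \<partial>lborel))"
    by (subst nn_integral_cmult, measurable, subst nn_integral_add, measurable)
  also have "(\<integral>\<^sup>+v. indicator {-1..0::real} v * h 0 \<partial>lborel) = h 0"
    by (subst nn_integral_multc) auto
  finally show ?thesis by (simp add: ac_simps)
qed

lemma exp_f_integrable: "0 \<le> l \<Longrightarrow> integrable lborel (\<lambda>s. exp (- l * s) * f s)"
  apply (rule Bochner_Integration.integrable_bound[OF integrable])
   apply measurable
  apply (rule AE_I2)
  subgoal for s using nonneg[of s] nonpos[of s] by (cases "s \<le> 0") (auto simp: abs_mult intro!: mult_left_le_one_le)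
  done

text \<open>With \<open>L\<close> the transform of \<open>f\<close>, the terms with at least one
  jump sum to \<open>exp L - 1\<close> and the atom adds 1, so the transform is
  \<open>exp (L - mass)\<close>, and \<open>mass - L\<close> is the exponent of
  \<open>f\<close>.\<close>

lemma levy_law_cpois: "levy_law (cpois f) f"
proof -
  have sets: "sets (cpois f) = sets borel" by (simp add: cpois_def)
  have lap: "(\<integral>\<^sup>+x. ennreal (exp (- l * x)) \<partial>cpois f) = ennreal (exp (- lexp f l))" if l: "0 \<le> l" for l
  proof -
    define L where "L = (\<integral>s. exp (- l * s) * f s \<partial>lborel)"
    have "0 \<le> L" unfolding L_def using nonneg by (intro Bochner_Integration.integral_nonneg) simp
    have nnL: "(\<integral>\<^sup>+s. ennreal (exp (- l * s)) * ennreal (f s) \<partial>lborel) = ennreal L"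
      unfolding L_def
      by (subst nn_integral_eq_integral[symmetric, OF exp_f_integrable[OF l]])
         (simp_all add: nonneg ennreal_mult)
    have ex: "lexp f l = mass - L"
      unfolding lexp_def L_def using integrable exp_f_integrable[OF l]
      by (simp add: left_diff_distrib)
    have "(\<integral>\<^sup>+v. cpois_dens f v * ennreal (exp (- l * v)) \<partial>lborel)
       = (\<integral>\<^sup>+v. (\<Sum>n. ennreal (exp (- l * v)) * convpow (\<lambda>s. ennreal (f s)) n v * ennreal (1 / fact (Suc n))) \<partial>lborel)"
      unfolding cpois_dens_def by (simp add: ennreal_suminf_multc[symmetric] ac_simps)
    also have "\<dots> = (\<Sum>n. (\<integral>\<^sup>+v. ennreal (exp (- l * v)) * convpow (\<lambda>s. ennreal (f s)) n v * ennreal (1 / fact (Suc n)) \<partial>lborel))"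
      by (rule nn_integral_suminf) measurable
    also have "\<dots> = (\<Sum>n. (\<integral>\<^sup>+v. ennreal (exp (- l * v)) * convpow (\<lambda>s. ennreal (f s)) n v \<partial>lborel) * ennreal (1 / fact (Suc n)))"
      by (rule arg_cong[where f = suminf], rule ext, rule nn_integral_multc) measurable
    also have "\<dots> = (\<Sum>n. ennreal (L ^ Suc n / fact (Suc n)))"
    proof (rule arg_cong[where f = suminf], rule ext)
      fix n
      show "(\<integral>\<^sup>+v. ennreal (exp (- l * v)) * convpow (\<lambda>s. ennreal (f s)) n v \<partial>lborel) * ennreal (1 / fact (Suc n)) = ennreal (L ^ Suc n / fact (Suc n))"
        using \<open>0 \<le> L\<close> by (simp only: convpow_laplace[OF measurable_compose[OF meas measurable_ennreal]] nnL)
          (simp add: ennreal_power ennreal_mult[symmetric] del: power_Suc fact_Suc)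
    qed
    also have "\<dots> = ennreal (exp L - 1)"
    proof (rule suminf_ennreal_eq)
      have "(\<lambda>n. L ^ n /\<^sub>R fact n) sums exp L" by (rule exp_converges)
      then have "(\<lambda>n. L ^ Suc n /\<^sub>R fact (Suc n)) sums (exp L - 1)"
        by (subst sums_Suc_iff) simp
      then show "(\<lambda>n. L ^ Suc n / fact (Suc n)) sums (exp L - 1)"
        by (simp add: divide_inverse ac_simps del: power_Suc fact_Suc)
    qed (use \<open>0 \<le> L\<close> in simp)
    finally have "(\<integral>\<^sup>+x. ennreal (exp (- l * x)) \<partial>cpois f) = ennreal (exp (- mass)) * (1 + ennreal (exp L - 1))"
      by (simp add: nn_integral_cpois)
    also have "1 + ennreal (exp L - 1) = ennreal (exp L)"
      using \<open>0 \<le> L\<close> by (simp add: ennreal_plus[symmetric] flip: ennreal_1 del: ennreal_1)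
    finally show ?thesis by (simp add: ennreal_mult[symmetric] exp_add[symmetric] ex)
  qed
  have "prob_space (cpois f)"
    using lap[of 0] by (intro prob_spaceI) (simp add: lexp_def)
  moreover have "AE x in cpois f. 0 \<le> x"
    unfolding cpois_def by (subst AE_distr_iff) auto
  ultimately show ?thesis using sets lap by (simp add: levy_law_def)
qed

text \<open>Estimating \<open>1 / fact (Suc n)\<close> by \<open>1 / fact n\<close> leaves
  \<open>D * exp mass\<close>, and the normalisation cancels the exponential. The bound is thus
  independent of the mass, which permits exposing arbitrarily many jumps.\<close>

lemma dens_le:
  assumes D: "\<And>s. f s \<le> D"
  shows "ennreal (exp (- mass)) * cpois_dens f v \<le> ennreal D"
proof -
  have "0 \<le> D" using D[of 0] nonneg[of 0] by simp
  have "cpois_dens f v \<le> (\<Sum>n. ennreal (D * (mass ^ n /\<^sub>R fact n)))"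
    unfolding cpois_dens_def
  proof (rule suminf_le)
    fix n
    have "convpow (\<lambda>s. ennreal (f s)) n v \<le> ennreal D * ennreal mass ^ n"
      using convpow_le[of "\<lambda>s. ennreal (f s)" "ennreal D" "ennreal mass" n v] D nn_mass by (simp add: ennreal_leI)
    then have "convpow (\<lambda>s. ennreal (f s)) n v * ennreal (1 / fact (Suc n)) \<le> ennreal D * ennreal mass ^ n * ennreal (1 / fact n)"
      by (intro mult_mono ennreal_leI) (auto intro!: divide_left_mono fact_mono simp del: fact_Suc)
    then show "convpow (\<lambda>s. ennreal (f s)) n v * ennreal (1 / fact (Suc n)) \<le> ennreal (D * (mass ^ n /\<^sub>R fact n))"
      using \<open>0 \<le> D\<close> mass_nonneg by (simp add: ennreal_power ennreal_mult[symmetric] divide_inverse ac_simps del: fact_Suc)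
  qed auto
  also have "\<dots> = ennreal (D * exp mass)"
    using \<open>0 \<le> D\<close> mass_nonneg by (intro suminf_ennreal_eq sums_mult exp_converges) simp
  finally have "ennreal (exp (- mass)) * cpois_dens f v \<le> ennreal (exp (- mass)) * ennreal (D * exp mass)"
    by (intro mult_left_mono) simp_all
  also have "\<dots> = ennreal D" using \<open>0 \<le> D\<close> by (simp add: ennreal_mult[symmetric] exp_minus)
  finally show ?thesis .
qed

text \<open>The polynomial growth in the number \<open>n\<close> of jumps is absorbed by \<open>n ^ k \<le> k! exp n\<close>.\<close>

lemma dens_le_poly:
  assumes B: "\<And>n s. v / real (Suc n) \<le> s \<Longrightarrow> f s \<le> B * real (Suc n) ^ k" and "0 \<le> B" "0 < v"
  shows "cpois_dens f v \<le> ennreal (B * fact k * exp (1 + exp 1 * mass))"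
proof -
  have "cpois_dens f v \<le> (\<Sum>n. ennreal (B * fact k * exp 1 * ((exp 1 * mass) ^ n /\<^sub>R fact n)))"
    unfolding cpois_dens_def
  proof (rule suminf_le)
    fix n
    have "(SUP s\<in>{v / real (Suc n)..}. ennreal (f s)) \<le> ennreal (B * (fact k * exp (real (Suc n))))"
    proof (rule SUP_least, rule ennreal_leI)
      fix s assume "s \<in> {v / real (Suc n)..}"
      then have "f s \<le> B * real (Suc n) ^ k" using B by simp
      also have "real (Suc n) ^ k / fact k \<le> exp (real (Suc n))"
      proof -
        have "(\<Sum>i\<in>{k}. real (Suc n) ^ i /\<^sub>R fact i) \<le> (\<Sum>i. real (Suc n) ^ i /\<^sub>R fact i)"
          by (rule sum_le_suminf[OF summable_exp_generic]) auto
        then show ?thesis by (simp add: exp_def divide_inverse ac_simps)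
      qed
      then have "B * real (Suc n) ^ k \<le> B * (fact k * exp (real (Suc n)))"
        using \<open>0 \<le> B\<close> by (intro mult_left_mono) (simp add: pos_divide_le_eq ac_simps)
      finally show "f s \<le> B * (fact k * exp (real (Suc n)))" .
    qed
    then have "of_nat (Suc n) * ennreal mass ^ n * (SUP s\<in>{v / real (Suc n)..}. ennreal (f s))
        \<le> of_nat (Suc n) * ennreal mass ^ n * ennreal (B * (fact k * exp (real (Suc n))))"
      by (rule mult_left_mono) simp
    moreover have "convpow (\<lambda>s. ennreal (f s)) n v \<le> of_nat (Suc n) * ennreal mass ^ n * (SUP s\<in>{v / real (Suc n)..}. ennreal (f s))"
      by (rule convpow_le_largest) (use nonpos nn_mass \<open>0 < v\<close> in auto)
    ultimately have "convpow (\<lambda>s. ennreal (f s)) n v \<le> of_nat (Suc n) * ennreal mass ^ n * ennreal (B * (fact k * exp (real (Suc n))))"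
      by (rule order_trans[rotated])
    then have "convpow (\<lambda>s. ennreal (f s)) n v * ennreal (1 / fact (Suc n)) \<le>
       of_nat (Suc n) * ennreal mass ^ n * ennreal (B * (fact k * exp (real (Suc n)))) * ennreal (1 / fact (Suc n))"
      by (intro mult_right_mono) simp_all
    also have "\<dots> = ennreal (real (Suc n) * mass ^ n * (B * (fact k * exp (real (Suc n)))) * (1 / fact (Suc n)))"
      using \<open>0 \<le> B\<close> mass_nonneg
      by (simp add: ennreal_of_nat_eq_real_of_nat ennreal_power ennreal_mult[symmetric] del: fact_Suc of_nat_Suc)
    also have "real (Suc n) * mass ^ n * (B * (fact k * exp (real (Suc n)))) * (1 / fact (Suc n))
       = B * fact k * exp 1 * ((exp 1 * mass) ^ n /\<^sub>R fact n)"
    proof -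
      have "real (Suc n) * (1 / fact (Suc n)) = 1 / (fact n :: real)"
        by (simp only: fact_Suc of_nat_mult) (simp del: of_nat_Suc)
      moreover have "exp (real (Suc n)) = exp 1 * exp 1 ^ n"
        by (simp add: exp_add flip: exp_of_nat_mult)
      ultimately show ?thesis
        by (simp add: power_mult_distrib divide_inverse ac_simps del: fact_Suc of_nat_Suc)
    qed
    finally show "convpow (\<lambda>s. ennreal (f s)) n v * ennreal (1 / fact (Suc n)) \<le> \<dots>" .
  qed auto
  also have "\<dots> = ennreal (B * fact k * exp 1 * exp (exp 1 * mass))"
    using \<open>0 \<le> B\<close> mass_nonneg by (intro suminf_ennreal_eq sums_mult exp_converges) simp
  finally show ?thesis by (simp add: exp_add ac_simps)
qed

end

section \<open>Existence and splitting of laws\<close>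

lemma levy_truncate:
  assumes "levy_density \<mu>" "A \<in> sets borel"
  shows "levy_density (\<lambda>s. indicator A s * \<mu> s)"
  by (rule levy_density_mult[OF assms(1), where C = 1]) (use assms(2) in \<open>auto split: split_indicator\<close>)

lemma jump_density_truncate:
  assumes "levy_density \<mu>" "A \<in> sets borel" "0 < a" "\<And>s. s \<in> A \<Longrightarrow> a \<le> s"
  shows "jump_density (\<lambda>s. indicator A s * \<mu> s)"
proof
  note [measurable] = levy_densityD(1)[OF assms(1)] assms(2)
  show "(\<lambda>s. indicator A s * \<mu> s) \<in> borel_measurable borel" by measurable
  show "integrable lborel (\<lambda>s. indicator A s * \<mu> s)"
  proof (rule levy_integrable[OF assms(1)])
    show "\<bar>indicator A s\<bar> \<le> (1 + 1 / a) * min 1 s" if "0 < s" for s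
    proof -
      have "1 \<le> (1 + 1 / a) * min 1 s" if "a \<le> s"
      proof (cases "1 \<le> s")
        case False
        have "1 \<le> (1 / a) * s" using that \<open>0 < a\<close> by (simp add: pos_le_divide_eq)
        then show ?thesis using False \<open>0 < s\<close> by (simp add: ring_distribs)
      qed (use \<open>0 < a\<close> in simp)
      then show ?thesis using that \<open>0 < a\<close> assms(4)[of s] by (auto split: split_indicator)
    qed
  qed measurable
qed (use levy_densityD(2,3)[OF assms(1)] in auto)

section \<open>Existence of laws by truncation and weak compactness\<close>

lemma tendsto_lexp_truncate:
  assumes "levy_density \<mu>" "0 \<le> l"
  shows "(\<lambda>n. lexp (\<lambda>s. indicator {1 / real (Suc n)..} s * \<mu> s) l) \<longlonglongrightarrow> lexp \<mu> l"
  unfolding lexp_def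
proof (rule integral_dominated_convergence[where w = "\<lambda>s. \<bar>(1 - exp (- l * s)) * \<mu> s\<bar>"])
  note [measurable] = levy_densityD(1)[OF assms(1)]
  show "integrable lborel (\<lambda>s. \<bar>(1 - exp (- l * s)) * \<mu> s\<bar>)" using integrable_lexp[OF assms] by simp
  show "AE s in lborel. (\<lambda>n. (1 - exp (- l * s)) * (indicator {1 / real (Suc n)..} s * \<mu> s))
      \<longlonglongrightarrow> (1 - exp (- l * s)) * \<mu> s"
  proof (rule AE_I2)
    fix s :: real
    show "(\<lambda>n. (1 - exp (- l * s)) * (indicator {1 / real (Suc n)..} s * \<mu> s)) \<longlonglongrightarrow> (1 - exp (- l * s)) * \<mu> s"
    proof (cases "s \<le> 0")
      case True then show ?thesis using levy_densityD(3)[OF assms(1) True] by simp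
    next
      case False
      have "(\<lambda>n. 1 / real (Suc n)) \<longlonglongrightarrow> 0" by (rule lim_1_over_n[THEN LIMSEQ_Suc])
      then have "\<forall>\<^sub>F n in sequentially. 1 / real (Suc n) < s"
        using False by (intro order_tendstoD(2)) auto
      then show ?thesis
        by (intro tendsto_eventually) (erule eventually_mono, simp)
    qed
  qed
qed (use levy_densityD(1)[OF assms(1)] in \<open>auto simp: abs_mult split: split_indicator\<close>)

text \<open>Serves twice: as tightness of the truncated laws, and to show that \<open>H\<close>
  takes arbitrarily small values.\<close>

lemma tendsto_lexp_0:
  assumes "levy_density \<mu>"
  shows "(\<lambda>k. lexp \<mu> (1 / real (Suc k))) \<longlonglongrightarrow> 0"
proof -
  note [measurable] = levy_densityD(1)[OF assms(1)]
  have "(\<lambda>k. lexp \<mu> (1 / real (Suc k))) \<longlonglongrightarrow> (\<integral>s. (\<lambda>_::real. 0) s \<partial>lborel)"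
    unfolding lexp_def
  proof (rule integral_dominated_convergence[where w = "\<lambda>s. min 1 s * \<mu> s"])
    show "AE s in lborel. (\<lambda>k. (1 - exp (- (1 / real (Suc k)) * s)) * \<mu> s) \<longlonglongrightarrow> 0"
    proof (rule AE_I2)
      fix s
      have "(\<lambda>k. (1 - exp (- (1 / real (Suc k)) * s)) * \<mu> s) \<longlonglongrightarrow> (1 - exp (- 0 * s)) * \<mu> s"
        by (intro tendsto_intros lim_1_over_n[THEN LIMSEQ_Suc])
      then show "(\<lambda>k. (1 - exp (- (1 / real (Suc k)) * s)) * \<mu> s) \<longlonglongrightarrow> 0" by simp
    qed
    show "AE s in lborel. norm ((1 - exp (- (1 / real (Suc k)) * s)) * \<mu> s) \<le> min 1 s * \<mu> s" for k
    proof (rule AE_I2)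
      fix s :: real
      show "norm ((1 - exp (- (1 / real (Suc k)) * s)) * \<mu> s) \<le> min 1 s * \<mu> s"
      proof (cases "s \<le> 0")
        case True then show ?thesis using levy_densityD(3)[OF assms(1) True] by simp
      next
        case False
        have "\<bar>1 - exp (- (1 / real (Suc k)) * s)\<bar> \<le> max 1 (1 / real (Suc k)) * min 1 s"
          by (rule one_minus_exp_bound) (use False in auto)
        also have "max 1 (1 / real (Suc k)) = 1" by (simp add: max_def)
        finally show ?thesis using levy_densityD(2)[OF assms(1), of s]
          by (simp add: abs_mult mult_right_mono)
      qed
    qed
  qed (use levy_densityD(4)[OF assms(1)] in auto)
  then show ?thesis by simp
qed

lemma lexp_mono:
  assumes "levy_density \<mu>" "levy_density \<rho>" "\<And>s. 0 < s \<Longrightarrow> \<mu> s \<le> \<rho> s" "0 \<le> l"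
  shows "lexp \<mu> l \<le> lexp \<rho> l"
  unfolding lexp_def
proof (rule integral_mono[OF integrable_lexp[OF assms(1,4)] integrable_lexp[OF assms(2,4)]])
  fix s :: real
  show "(1 - exp (- l * s)) * \<mu> s \<le> (1 - exp (- l * s)) * \<rho> s"
    using levy_densityD(3)[OF assms(1), of s] levy_densityD(3)[OF assms(2), of s] assms(3)[of s] assms(4)
    by (cases "s \<le> 0") (auto intro!: mult_left_mono)
qed

text \<open>On \<open>x > d\<close> the function \<open>1 - exp (- x / d)\<close> is at least 1/2,
  and its mean is \<open>1 - exp (- lexp \<mu> (1/d))\<close>, which is at most the
  exponent.\<close>

lemma levy_law_tail:
  assumes "levy_density \<mu>" "levy_law P \<mu>" "0 < d"
  shows "measure P {d<..} \<le> 2 * lexp \<mu> (1 / d)"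
proof -
  interpret real_distribution P using levy_lawD(6)[OF assms(2)] .
  let ?l = "1 / d"
  have l: "0 \<le> ?l" using assms by simp
  note E = integral_exp_eq[OF levy_lawD(1-3)[OF assms(2)] l]
  have eq: "(\<integral>x. exp (- ?l * x) \<partial>P) = exp (- lexp \<mu> ?l)"
  proof -
    have "ennreal (\<integral>x. exp (- ?l * x) \<partial>P) = ennreal (exp (- lexp \<mu> ?l))"
      using E(2) levy_lawD(7)[OF assms(2) l] by simp
    then show ?thesis by (simp add: Bochner_Integration.integral_nonneg)
  qed
  have "exp (-1) \<le> (1 / 2 :: real)" using exp_ge_add_one_self[of "1::real"] by (simp add: exp_minus field_simps)
  have "measure P {d<..} / 2 = (\<integral>x. indicator {d<..} x / 2 \<partial>P)" by simp
  also have "\<dots> \<le> (\<integral>x. 1 - exp (- ?l * x) \<partial>P)"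
  proof (rule integral_mono_AE)
    show "AE x in P. indicator {d<..} x / 2 \<le> 1 - exp (- ?l * x)"
      using levy_lawD(3)[OF assms(2)]
    proof eventually_elim
      case (elim x)
      show ?case
      proof (cases "d < x")
        case True
        then have "- ?l * x \<le> -1" using \<open>0 < d\<close> by simp
        then have "exp (- ?l * x) \<le> exp (-1)" by (simp only: exp_le_cancel_iff)
        then have "exp (- ?l * x) \<le> 1 / 2" using \<open>exp (-1) \<le> 1 / 2\<close> by (rule order_trans)
        then show ?thesis using True by simp
      qed (use elim \<open>0 < d\<close> in simp)
    qed
  qed (use E(1) in \<open>auto intro!: integrable_const_bound[where B = 1] split: split_indicator\<close>)
  also have "\<dots> = 1 - exp (- lexp \<mu> ?l)" using E(1) by (simp only: eq[symmetric]) (simp add: prob_space[simplified])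
  also have "\<dots> \<le> lexp \<mu> ?l" using exp_ge_add_one_self[of "- lexp \<mu> ?l"] by simp
  finally show ?thesis by simp
qed

text \<open>Cutting off the jumps below \<open>1 / Suc n\<close> leaves compound Poisson laws. Their
  exponents are dominated by that of \<open>\<mu>\<close>, so they are tight, and any weak limit has
  the required transform.\<close>

theorem levy_law_exists:
  assumes "levy_density \<mu>"
  shows "\<exists>P. levy_law P \<mu>"
proof -
  define f where "f n s = indicator {1 / real (Suc n)..} s * \<mu> s" for n s
  have jd: "jump_density (f n)" for n
    unfolding f_def by (rule jump_density_truncate[OF assms, where a = "1 / real (Suc n)"]) auto
  have ld: "levy_density (f n)" for n using jump_density.levy[OF jd] .
  have law: "levy_law (cpois (f n)) (f n)" for n by (rule jump_density.levy_law_cpois[OF jd])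
  have lim: "(\<lambda>n. lexp (f n) l) \<longlonglongrightarrow> lexp \<mu> l" if "0 \<le> l" for l
    unfolding f_def by (rule tendsto_lexp_truncate[OF assms that])
  have le: "lexp (f n) l \<le> lexp \<mu> l" if "0 \<le> l" for n l
    by (rule lexp_mono[OF ld assms _ that]) (auto simp: f_def levy_densityD[OF assms] split: split_indicator)
  have rd: "real_distribution (cpois (f n))" for n by (rule levy_lawD(6)[OF law])
  \<comment> \<open>The tail bound involves only the exponent of \<open>\<mu>\<close>, hence one
    \<open>k\<close> serves all \<open>n\<close>; the left endpoint -1 is harmless because the laws
    live on the nonnegative half-line.\<close>
  have "tight (\<lambda>n. cpois (f n))"
    unfolding tight_def
  proof (intro conjI allI impI)
    fix \<epsilon> :: real assume "0 < \<epsilon>"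
    then have "\<forall>\<^sub>F k in sequentially. lexp \<mu> (1 / real (Suc k)) < \<epsilon> / 2"
      by (intro order_tendstoD(2)[OF tendsto_lexp_0[OF assms]]) simp
    then obtain k where k: "lexp \<mu> (1 / real (Suc k)) < \<epsilon> / 2"
      by (auto simp: eventually_sequentially)
    show "\<exists>a d. a < d \<and> (\<forall>n. 1 - \<epsilon> < measure (cpois (f n)) {a<..d})"
    proof (intro exI conjI allI)
      show "-1 < real (Suc k)" by simp
      fix n
      interpret real_distribution "cpois (f n)" by (rule rd)
      have "measure (cpois (f n)) {real (Suc k)<..} < \<epsilon>"
        using levy_law_tail[OF ld law, of "real (Suc k)" n] le[of "1 / real (Suc k)" n] k by simp
      moreover have "measure (cpois (f n)) {-1<..real (Suc k)} = measure (cpois (f n)) (UNIV - {real (Suc k)<..})"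
        using levy_lawD(3)[OF law[of n]] by (intro finite_measure_eq_AE) (auto elim!: eventually_mono)
      moreover have "measure (cpois (f n)) (UNIV - {real (Suc k)<..}) = 1 - measure (cpois (f n)) {real (Suc k)<..}"
        using prob_compl[of "{real (Suc k)<..}"] by simp
      ultimately show "1 - \<epsilon> < measure (cpois (f n)) {-1<..real (Suc k)}" by simp
    qed
  qed (rule rd)
  from tight_imp_convergent_subsubsequence[OF this strict_mono_id]
  obtain r M where r: "strict_mono r" and M: "real_distribution M"
    and weak: "weak_conv_m ((\<lambda>n. cpois (f n)) \<circ> id \<circ> r) M" by auto
  interpret M: real_distribution M by (rule M)
  have conv: "(\<lambda>n. \<integral>x. F x \<partial>cpois (f (r n))) \<longlonglongrightarrow> (\<integral>x. F x \<partial>M)"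
    if "\<And>x. isCont F x" "\<And>x. norm (F x) \<le> 1" for F :: "real \<Rightarrow> real"
    using weak_conv_imp_integral_bdd_continuous_conv[OF _ M weak, of F 1] that rd by (simp add: comp_def)
  \<comment> \<open>Weak convergence is tested on a bounded continuous function that is positive
    exactly on the negative half-line.\<close>
  have pos: "AE x in M. 0 \<le> x"
  proof -
    have "(\<integral>x. min 1 (max 0 (- x)) \<partial>cpois (f (r n))) = (\<integral>x. 0 \<partial>cpois (f (r n)))" for n
      using levy_lawD(3)[OF law[of "r n"]]
      by (intro integral_cong_AE) (auto simp: measurable_cong_sets[OF levy_lawD(2)[OF law] refl] elim!: eventually_mono)
    moreover have "isCont (\<lambda>x::real. min 1 (max 0 (- x))) x" for x
      unfolding isCont_def by (intro tendsto_intros)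
    ultimately have "(\<lambda>n::nat. 0) \<longlonglongrightarrow> (\<integral>x. min 1 (max 0 (- x)) \<partial>M)"
      using conv[of "\<lambda>x. min 1 (max 0 (- x))"] by simp
    then have "(\<integral>x. min 1 (max 0 (- x)) \<partial>M) = 0" by (simp add: LIMSEQ_const_iff)
    then have "AE x in M. min 1 (max 0 (- x)) = 0"
      by (subst (asm) integral_nonneg_eq_0_iff_AE) (auto intro!: M.integrable_const_bound[where B = 1])
    then show ?thesis by eventually_elim (auto simp: min_def max_def split: if_splits)
  qed
  have lap: "(\<integral>\<^sup>+x. ennreal (exp (- l * x)) \<partial>M) = ennreal (exp (- lexp \<mu> l))" if l: "0 \<le> l" for l
  proof -
    \<comment> \<open>\<open>exp (- l * x)\<close> is unbounded on the negative half-line; with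
      \<open>max 0 x\<close> in place of \<open>x\<close> it becomes a bounded continuous test
      function, and the integrals do not change.\<close>
    have cut: "(\<integral>x. exp (- l * max 0 x) \<partial>P) = (\<integral>x. exp (- l * x) \<partial>P)"
      if "sets P = sets borel" "AE x in P. 0 \<le> x" for P
    proof (rule integral_cong_AE)
      show "AE x in P. exp (- l * max 0 x) = exp (- l * x)"
        using that(2) by (rule eventually_mono) simp
    qed (simp_all add: measurable_cong_sets[OF that(1) refl])
    have "(\<integral>x. exp (- l * x) \<partial>cpois (f n)) = exp (- lexp (f n) l)" for n
    proof -
      have "ennreal (\<integral>x. exp (- l * x) \<partial>cpois (f n)) = ennreal (exp (- lexp (f n) l))"
        using integral_exp_eq(2)[OF levy_lawD(1-3)[OF law] l] levy_lawD(7)[OF law l] by simp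
      then show ?thesis by (simp add: Bochner_Integration.integral_nonneg)
    qed
    moreover have "(\<lambda>n. \<integral>x. exp (- l * max 0 x) \<partial>cpois (f (r n))) \<longlonglongrightarrow> (\<integral>x. exp (- l * max 0 x) \<partial>M)"
      using l by (intro conv) (auto simp: isCont_def intro!: tendsto_exp tendsto_mult tendsto_max tendsto_minus)
    ultimately have "(\<lambda>n. exp (- lexp (f (r n)) l)) \<longlonglongrightarrow> (\<integral>x. exp (- l * x) \<partial>M)"
      by (simp only: cut[OF levy_lawD(2,3)[OF law]] cut[OF M.events_eq_borel pos])
    moreover have "(\<lambda>n. exp (- lexp (f (r n)) l)) \<longlonglongrightarrow> exp (- lexp \<mu> l)"
      by (intro tendsto_intros LIMSEQ_subseq_LIMSEQ[OF lim[OF l] r, unfolded comp_def])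
    ultimately have "(\<integral>x. exp (- l * x) \<partial>M) = exp (- lexp \<mu> l)" by (rule LIMSEQ_unique)
    then show ?thesis
      using integral_exp_eq(2)[OF M.prob_space_axioms _ pos l] by simp
  qed
  show ?thesis using pos lap M.prob_space_axioms by (auto simp: levy_law_def intro!: exI[of _ M])
qed

section \<open>Convolution and splitting of laws\<close>

lemma levy_law_convolution:
  assumes "levy_density \<mu>" "levy_density \<rho>" "levy_law P \<mu>" "levy_law Q \<rho>"
  shows "levy_law (P \<star> Q) (\<lambda>s. \<mu> s + \<rho> s)"
proof -
  note P = levy_lawD[OF assms(3)] and Q = levy_lawD[OF assms(4)]
  note nn = nn_integral_convolution[OF P(5) Q(5) Q(2) P(2)]
  have lap: "(\<integral>\<^sup>+x. ennreal (exp (- l * x)) \<partial>(P \<star> Q)) = ennreal (exp (- lexp (\<lambda>s. \<mu> s + \<rho> s) l))"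
    if l: "0 \<le> l" for l
  proof -
    have "(\<integral>\<^sup>+x. ennreal (exp (- l * x)) \<partial>(P \<star> Q)) = (\<integral>\<^sup>+x. \<integral>\<^sup>+y. ennreal (exp (- l * x)) * ennreal (exp (- l * y)) \<partial>Q \<partial>P)"
      by (subst nn) (auto simp: ennreal_mult[symmetric] exp_add[symmetric] algebra_simps)
    also have "\<dots> = (\<integral>\<^sup>+x. ennreal (exp (- l * x)) * ennreal (exp (- lexp \<rho> l)) \<partial>P)"
      by (subst nn_integral_cmult) (use Q(2) Q(7)[OF l] in \<open>auto simp: measurable_cong_sets[OF Q(2) refl]\<close>)
    also have "\<dots> = ennreal (exp (- lexp \<mu> l)) * ennreal (exp (- lexp \<rho> l))"
      by (subst nn_integral_multc) (use P(2) P(7)[OF l] in \<open>auto simp: measurable_cong_sets[OF P(2) refl]\<close>)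
    finally show ?thesis
      by (simp add: ennreal_mult[symmetric] exp_add[symmetric] lexp_add[OF assms(1,2) l])
  qed
  have "prob_space (P \<star> Q)" using lap[of 0] by (intro prob_spaceI) (simp add: lexp_def)
  moreover have "AE x in P \<star> Q. 0 \<le> x"
  proof -
    have "(\<integral>\<^sup>+x. indicator {..<0} x \<partial>(P \<star> Q)) = (\<integral>\<^sup>+x. \<integral>\<^sup>+y. indicator {..<0} (x + y) \<partial>Q \<partial>P)"
      by (subst nn) auto
    also have "\<dots> = (\<integral>\<^sup>+x. 0 \<partial>P)"
    proof (rule nn_integral_cong_AE)
      show "AE x in P. (\<integral>\<^sup>+y. indicator {..<0} (x + y) \<partial>Q) = 0"
        using P(3)
      proof eventually_elim
        case (elim x)
        have "(\<integral>\<^sup>+y. indicator {..<0} (x + y) \<partial>Q) = (\<integral>\<^sup>+y. 0 \<partial>Q)"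
          by (rule nn_integral_cong_AE) (use Q(3) elim in \<open>auto elim!: eventually_mono split: split_indicator\<close>)
        then show ?case by simp
      qed
    qed
    finally have "(\<integral>\<^sup>+x. indicator {..<0} x \<partial>(P \<star> Q)) = 0" by simp
    then have "AE x in P \<star> Q. indicator {..<0} x = (0::ennreal)"
      by (subst (asm) nn_integral_0_iff_AE) auto
    then show ?thesis by eventually_elim (auto split: split_indicator_asm)
  qed
  ultimately show ?thesis using lap by (simp add: levy_law_def)
qed

text \<open>Any law of the first summand, convolved with \<open>T\<close>, has the density
  \<open>\<rho>\<close>; uniqueness identifies it with \<open>P\<close>. Thus a given law, and not
  just some law, decomposes along a decomposition of its density.\<close>

lemma levy_law_split:
  assumes "levy_law P \<rho>" "levy_density \<mu>" "levy_density \<tau>" "levy_law T \<tau>" "\<And>s. \<rho> s = \<mu> s + \<tau> s"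
  obtains Q where "levy_law Q \<mu>"
    "\<And>B. B \<in> sets borel \<Longrightarrow> emeasure P B = (\<integral>\<^sup>+u. \<integral>\<^sup>+v. indicator B (u + v) \<partial>T \<partial>Q)"
proof -
  obtain Q where Q: "levy_law Q \<mu>" using levy_law_exists[OF assms(2)] by auto
  have "levy_law (Q \<star> T) \<rho>"
    using levy_law_convolution[OF assms(2,3) Q assms(4)] by (simp add: assms(5)[symmetric])
  then have "P = (Q \<star> T)" by (rule levy_law_unique[OF assms(1)])
  then show ?thesis
    using that[OF Q] convolution_emeasure' levy_lawD[OF Q] levy_lawD[OF assms(4)] by auto
qed

lemma levy_law_split_jumps:
  assumes "levy_law P \<rho>" "levy_density \<mu>" "jump_density f" "\<And>s. \<rho> s = \<mu> s + f s"
  obtains Q where "levy_law Q \<mu>"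
    "\<And>B. B \<in> sets borel \<Longrightarrow> emeasure P B =
       (\<integral>\<^sup>+u. ennreal (exp (- (\<integral>s. f s \<partial>lborel))) *
         (indicator B u + (\<integral>\<^sup>+v. cpois_dens f v * indicator B (u + v) \<partial>lborel)) \<partial>Q)"
proof -
  interpret jump_density f by fact
  from levy_law_split[OF assms(1,2) levy levy_law_cpois assms(4)]
  obtain Q where Q: "levy_law Q \<mu>"
    "\<And>B. B \<in> sets borel \<Longrightarrow> emeasure P B = (\<integral>\<^sup>+u. \<integral>\<^sup>+v. indicator B (u + v) \<partial>cpois f \<partial>Q)"
    by blast
  show ?thesis
    by (rule that[OF Q(1)]) (simp add: Q(2) nn_integral_cpois)
qed

lemma nn_integral_indicator_shift:
  assumes [measurable]: "B \<in> sets borel"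
  shows "(\<integral>\<^sup>+v. indicator B (u + v) \<partial>lborel) = emeasure lborel (B :: real set)"
  using nn_integral_shift(2)[of "indicator B" u] by simp

text \<open>Without a jump from \<open>f\<close>, which has probability \<open>exp (- mass)\<close>,
  the remainder \<open>Q\<close> is left over. With at least one jump the law has a density of at
  most \<open>D\<close>, whatever the position of the remainder.\<close>

lemma levy_law_le_jumps:
  assumes "levy_law P \<rho>" "levy_density \<mu>" "jump_density f" "\<And>s. \<rho> s = \<mu> s + f s"
    and D: "\<And>s. f s \<le> D"
  obtains Q where "levy_law Q \<mu>"
    "\<And>B. B \<in> sets borel \<Longrightarrow> emeasure P B \<le>
       ennreal (exp (- (\<integral>s. f s \<partial>lborel))) * emeasure Q B + ennreal D * emeasure lborel B"
proof -
  interpret jump_density f by fact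
  from levy_law_split_jumps[OF assms(1-4)] obtain Q where Q: "levy_law Q \<mu>"
    "\<And>B. B \<in> sets borel \<Longrightarrow> emeasure P B =
       (\<integral>\<^sup>+u. ennreal (exp (- mass)) *
         (indicator B u + (\<integral>\<^sup>+v. cpois_dens f v * indicator B (u + v) \<partial>lborel)) \<partial>Q)" by blast
  note [measurable_cong] = levy_lawD(2)[OF Q(1)]
  show ?thesis
  proof (rule that[OF Q(1)])
    fix B :: "real set" assume B [measurable]: "B \<in> sets borel"
    have "ennreal (exp (- mass)) * (indicator B u + (\<integral>\<^sup>+v. cpois_dens f v * indicator B (u + v) \<partial>lborel))
        \<le> ennreal (exp (- mass)) * indicator B u + ennreal D * emeasure lborel B" for u
    proof -
      have "ennreal (exp (- mass)) * (\<integral>\<^sup>+v. cpois_dens f v * indicator B (u + v) \<partial>lborel)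
         = (\<integral>\<^sup>+v. ennreal (exp (- mass)) * cpois_dens f v * indicator B (u + v) \<partial>lborel)"
        by (subst nn_integral_cmult[symmetric]) (auto simp: mult.assoc)
      also have "\<dots> \<le> (\<integral>\<^sup>+v. ennreal D * indicator B (u + v) \<partial>lborel)"
        by (intro nn_integral_mono mult_right_mono dens_le[OF D]) simp
      also have "\<dots> = ennreal D * emeasure lborel B"
        by (subst nn_integral_cmult) (auto simp: nn_integral_indicator_shift)
      finally show ?thesis by (simp add: distrib_left)
    qed
    then have "emeasure P B \<le> (\<integral>\<^sup>+u. ennreal (exp (- mass)) * indicator B u + ennreal D * emeasure lborel B \<partial>Q)"
      unfolding Q(2)[OF B] by (intro nn_integral_mono)
    also have "\<dots> = ennreal (exp (- mass)) * emeasure Q B + ennreal D * emeasure lborel B"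
      using prob_space.emeasure_space_1[OF levy_lawD(1)[OF Q(1)]]
      by (subst nn_integral_add) (auto simp: nn_integral_cmult)
    finally show "emeasure P B \<le> ennreal (exp (- mass)) * emeasure Q B + ennreal D * emeasure lborel B" .
  qed
qed

text \<open>Only the event of exactly one jump from \<open>f\<close> is kept. \<open>A\<close> is a
  set where the remainder is likely to be, and \<open>K\<close> bounds from below the jump intensity
  that leads from a point of \<open>A\<close> into \<open>B\<close>.\<close>

lemma levy_law_ge_jump:
  assumes "levy_law P \<rho>" "levy_density \<mu>" "jump_density f" "\<And>s. \<rho> s = \<mu> s + f s"
  obtains Q where "levy_law Q \<mu>"
    "\<And>B A K. B \<in> sets borel \<Longrightarrow> A \<in> sets borel \<Longrightarrow> 0 \<le> K \<Longrightarrow>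
       (\<And>u. u \<in> A \<Longrightarrow> ennreal K \<le> (\<integral>\<^sup>+v. ennreal (f v) * indicator B (u + v) \<partial>lborel)) \<Longrightarrow>
       ennreal (exp (- (\<integral>s. f s \<partial>lborel)) * K) * emeasure Q A \<le> emeasure P B"
proof -
  interpret jump_density f by fact
  from levy_law_split_jumps[OF assms(1-4)] obtain Q where Q: "levy_law Q \<mu>"
    "\<And>B. B \<in> sets borel \<Longrightarrow> emeasure P B =
       (\<integral>\<^sup>+u. ennreal (exp (- mass)) *
         (indicator B u + (\<integral>\<^sup>+v. cpois_dens f v * indicator B (u + v) \<partial>lborel)) \<partial>Q)" by blast
  note [measurable_cong] = levy_lawD(2)[OF Q(1)]
  show ?thesis
  proof (rule that[OF Q(1)])
    fix A B :: "real set" and K :: real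
    assume [measurable]: "B \<in> sets borel" "A \<in> sets borel" and "0 \<le> K"
      and K: "\<And>u. u \<in> A \<Longrightarrow> ennreal K \<le> (\<integral>\<^sup>+v. ennreal (f v) * indicator B (u + v) \<partial>lborel)"
    have "ennreal (exp (- mass) * K) * emeasure Q A = (\<integral>\<^sup>+u. ennreal (exp (- mass) * K) * indicator A u \<partial>Q)"
      by (simp add: nn_integral_cmult)
    also have "\<dots> \<le> emeasure P B"
      unfolding Q(2)[OF \<open>B \<in> sets borel\<close>]
    proof (rule nn_integral_mono)
      fix u
      show "ennreal (exp (- mass) * K) * indicator A u \<le> ennreal (exp (- mass)) *
         (indicator B u + (\<integral>\<^sup>+v. cpois_dens f v * indicator B (u + v) \<partial>lborel))"
      proof (cases "u \<in> A")
        case True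
        have "ennreal K \<le> (\<integral>\<^sup>+v. cpois_dens f v * indicator B (u + v) \<partial>lborel)"
          by (rule order_trans[OF K[OF True]]) (intro nn_integral_mono mult_right_mono dens_ge, simp)
        also have "\<dots> \<le> indicator B u + \<dots>" by simp
        finally have "ennreal (exp (- mass)) * ennreal K \<le> ennreal (exp (- mass)) *
         (indicator B u + (\<integral>\<^sup>+v. cpois_dens f v * indicator B (u + v) \<partial>lborel))"
          by (rule mult_left_mono) simp
        then show ?thesis using True \<open>0 \<le> K\<close> by (simp add: ennreal_mult)
      qed simp
    qed
    finally show "ennreal (exp (- mass) * K) * emeasure Q A \<le> emeasure P B" .
  qed
qed

section \<open>Density bounds and exponential tilting\<close>

text \<open>A density of at most \<open>K\<close>, phrased through measures because the existence of
  a density is not known beforehand.\<close>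

definition dens_bound :: "real measure \<Rightarrow> real \<Rightarrow> bool" where
  "dens_bound P K \<longleftrightarrow> (\<forall>B\<in>sets borel. emeasure P B \<le> ennreal K * emeasure lborel B)"

text \<open>Convolution with a probability measure does not increase the supremum of a density, and
  Lebesgue measure is invariant under translation.\<close>

lemma dens_bound_add:
  assumes "levy_law P \<rho>" "levy_density \<mu>" "levy_density \<tau>" "levy_law T \<tau>" "\<And>s. \<rho> s = \<mu> s + \<tau> s"
    and "dens_bound T K"
  shows "dens_bound P K"
  unfolding dens_bound_def
proof
  fix B :: "real set" assume B [measurable]: "B \<in> sets borel"
  from levy_law_split[OF assms(1-5)] obtain Q where Q: "levy_law Q \<mu>"
    "\<And>B. B \<in> sets borel \<Longrightarrow> emeasure P B = (\<integral>\<^sup>+u. \<integral>\<^sup>+v. indicator B (u + v) \<partial>T \<partial>Q)" by blast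
  note [measurable_cong] = levy_lawD(2)[OF Q(1)] levy_lawD(2)[OF assms(4)]
  have "(\<integral>\<^sup>+v. indicator B (u + v) \<partial>T) \<le> ennreal K * emeasure lborel B" for u
  proof -
    have [measurable]: "{v. u + v \<in> B} \<in> sets borel" by measurable
    have "(\<integral>\<^sup>+v. indicator B (u + v) \<partial>T) = (\<integral>\<^sup>+v. indicator {v. u + v \<in> B} v \<partial>T)"
      by (intro nn_integral_cong) (auto split: split_indicator)
    also have "\<dots> = emeasure T {v. u + v \<in> B}" by simp
    also have "\<dots> \<le> ennreal K * emeasure lborel {v. u + v \<in> B}"
      using assms(6) by (simp add: dens_bound_def)
    also have "emeasure lborel {v. u + v \<in> B} = (\<integral>\<^sup>+v. indicator {v. u + v \<in> B} v \<partial>lborel)" by simp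
    also have "\<dots> = (\<integral>\<^sup>+v. indicator B (u + v) \<partial>lborel)"
      by (intro nn_integral_cong) (auto split: split_indicator)
    finally show ?thesis by (simp add: nn_integral_indicator_shift)
  qed
  then have "emeasure P B \<le> (\<integral>\<^sup>+u. ennreal K * emeasure lborel B \<partial>Q)"
    unfolding Q(2)[OF B] by (intro nn_integral_mono)
  also have "\<dots> = ennreal K * emeasure lborel B"
    using prob_space.emeasure_space_1[OF levy_lawD(1)[OF Q(1)]] by simp
  finally show "emeasure P B \<le> ennreal K * emeasure lborel B" .
qed

text \<open>The Esscher transform. Tilting by \<open>\<theta>\<close> replaces the exponent by
  \<open>lexp \<mu> (\<theta> + l) - lexp \<mu> \<theta>\<close>, and multiplying the density by
  \<open>exp (- \<theta> * s)\<close> has the same effect.\<close>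

lemma levy_law_tilt:
  assumes \<mu>: "levy_density \<mu>" and P: "levy_law P \<mu>" and "0 \<le> \<theta>"
  shows "levy_density (\<lambda>s. exp (- \<theta> * s) * \<mu> s)"
    and "levy_law (density P (\<lambda>u. ennreal (exp (lexp \<mu> \<theta> - \<theta> * u)))) (\<lambda>s. exp (- \<theta> * s) * \<mu> s)"
proof -
  show ld: "levy_density (\<lambda>s. exp (- \<theta> * s) * \<mu> s)"
    by (rule levy_density_mult[OF \<mu>, where C = 1]) (use \<open>0 \<le> \<theta>\<close> in auto)
  note [measurable_cong] = levy_lawD(2)[OF P]
  let ?T = "density P (\<lambda>u. ennreal (exp (lexp \<mu> \<theta> - \<theta> * u)))"
  have ex: "lexp (\<lambda>s. exp (- \<theta> * s) * \<mu> s) l = lexp \<mu> (\<theta> + l) - lexp \<mu> \<theta>" if "0 \<le> l" for l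
  proof -
    have "lexp \<mu> (\<theta> + l) - lexp \<mu> \<theta> = (\<integral>s. (1 - exp (- (\<theta> + l) * s)) * \<mu> s - (1 - exp (- \<theta> * s)) * \<mu> s \<partial>lborel)"
      unfolding lexp_def using that \<open>0 \<le> \<theta>\<close>
      by (intro Bochner_Integration.integral_diff[symmetric] integrable_lexp[OF \<mu>]) auto
    also have "\<dots> = lexp (\<lambda>s. exp (- \<theta> * s) * \<mu> s) l"
      unfolding lexp_def by (intro Bochner_Integration.integral_cong) (auto simp: algebra_simps exp_add[symmetric])
    finally show ?thesis ..
  qed
  have lap: "(\<integral>\<^sup>+x. ennreal (exp (- l * x)) \<partial>?T) = ennreal (exp (- lexp (\<lambda>s. exp (- \<theta> * s) * \<mu> s) l))"
    if l: "0 \<le> l" for l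
  proof -
    have "(\<integral>\<^sup>+x. ennreal (exp (- l * x)) \<partial>?T) = (\<integral>\<^sup>+x. ennreal (exp (lexp \<mu> \<theta>)) * ennreal (exp (- (\<theta> + l) * x)) \<partial>P)"
      by (subst nn_integral_density) (auto simp: ennreal_mult[symmetric] exp_add[symmetric] algebra_simps intro!: nn_integral_cong)
    also have "\<dots> = ennreal (exp (lexp \<mu> \<theta>)) * ennreal (exp (- lexp \<mu> (\<theta> + l)))"
      using l \<open>0 \<le> \<theta>\<close> by (subst nn_integral_cmult) (simp_all only: levy_lawD(7)[OF P] add_nonneg_nonneg, measurable)
    finally show ?thesis unfolding ex[OF l] by (simp add: ennreal_mult[symmetric] exp_add[symmetric])
  qed
  have "prob_space ?T"
  proof (rule prob_spaceI)
    have "emeasure ?T (space ?T) = (\<integral>\<^sup>+x. 1 \<partial>?T)" by simp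
    also have "\<dots> = 1" using lap[of 0] by (simp add: lexp_def)
    finally show "emeasure ?T (space ?T) = 1" .
  qed
  moreover have "AE x in ?T. 0 \<le> x"
    using levy_lawD(3)[OF P] by (subst AE_density) auto
  ultimately show "levy_law ?T (\<lambda>s. exp (- \<theta> * s) * \<mu> s)"
    using lap levy_lawD(2)[OF P] by (simp add: levy_law_def)
qed

text \<open>A tilt in the direction of larger values is obtained by presenting \<open>Q\<close> as
  the ordinary tilt of another law. Exponential moments of positive order thus need no transform at
  negative arguments.\<close>

lemma levy_law_untilt:
  assumes \<rho>: "levy_density (\<lambda>s. exp (\<theta> * s) * \<mu> s)" and Q: "levy_law Q \<mu>" and "0 \<le> \<theta>"
  obtains Q' where "levy_law Q' (\<lambda>s. exp (\<theta> * s) * \<mu> s)"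
    "Q = density Q' (\<lambda>u. ennreal (exp (lexp (\<lambda>s. exp (\<theta> * s) * \<mu> s) \<theta> - \<theta> * u)))"
proof -
  obtain Q' where Q': "levy_law Q' (\<lambda>s. exp (\<theta> * s) * \<mu> s)" using levy_law_exists[OF \<rho>] by auto
  from levy_law_tilt(2)[OF \<rho> Q' \<open>0 \<le> \<theta>\<close>]
  have "levy_law (density Q' (\<lambda>u. ennreal (exp (lexp (\<lambda>s. exp (\<theta> * s) * \<mu> s) \<theta> - \<theta> * u)))) \<mu>"
    by (simp add: mult.assoc[symmetric] exp_add[symmetric])
  from levy_law_unique[OF Q this] show ?thesis using that[OF Q'] by simp
qed

lemma chernoff_lower:
  assumes "levy_density \<mu>" and P: "levy_law P \<mu>" and "0 \<le> \<theta>"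
  shows "emeasure P {..a} \<le> ennreal (exp (\<theta> * a - lexp \<mu> \<theta>))"
proof -
  note [measurable_cong] = levy_lawD(2)[OF P]
  have "emeasure P {..a} = (\<integral>\<^sup>+x. indicator {..a} x \<partial>P)" by simp
  also have "\<dots> \<le> (\<integral>\<^sup>+x. ennreal (exp (\<theta> * a)) * ennreal (exp (- \<theta> * x)) \<partial>P)"
    using \<open>0 \<le> \<theta>\<close> by (intro nn_integral_mono)
      (auto split: split_indicator simp: ennreal_mult[symmetric] exp_add[symmetric] mult_left_mono simp flip: ennreal_1)
  also have "\<dots> = ennreal (exp (\<theta> * a)) * ennreal (exp (- lexp \<mu> \<theta>))"
    by (subst nn_integral_cmult) (use levy_lawD(7)[OF P] \<open>0 \<le> \<theta>\<close> in auto)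
  finally show ?thesis by (simp add: ennreal_mult[symmetric] exp_add[symmetric])
qed

text \<open>The exponent of the increased density at \<open>\<theta>\<close> is the integral of
  \<open>(exp (\<theta> * s) - 1) * \<mu> s\<close>, that is, the logarithm of the exponential
  moment of order \<open>\<theta>\<close>.\<close>

lemma chernoff_upper:
  assumes \<rho>: "levy_density (\<lambda>s. exp (\<theta> * s) * \<mu> s)" and Q: "levy_law Q \<mu>" and "0 \<le> \<theta>"
  shows "emeasure Q {a..} \<le> ennreal (exp (lexp (\<lambda>s. exp (\<theta> * s) * \<mu> s) \<theta> - \<theta> * a))"
proof -
  let ?L = "lexp (\<lambda>s. exp (\<theta> * s) * \<mu> s) \<theta>"
  obtain Q' where Q': "levy_law Q' (\<lambda>s. exp (\<theta> * s) * \<mu> s)"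
    and eq: "Q = density Q' (\<lambda>u. ennreal (exp (?L - \<theta> * u)))"
    using levy_law_untilt[OF assms] .
  note [measurable_cong] = levy_lawD(2)[OF Q']
  have "emeasure Q {a..} = (\<integral>\<^sup>+x. ennreal (exp (?L - \<theta> * x)) * indicator {a..} x \<partial>Q')"
    unfolding eq by (subst emeasure_density) auto
  also have "\<dots> \<le> (\<integral>\<^sup>+x. ennreal (exp (?L - \<theta> * a)) \<partial>Q')"
    using \<open>0 \<le> \<theta>\<close> by (intro nn_integral_mono) (auto split: split_indicator intro!: ennreal_leI mult_left_mono)
  also have "\<dots> = ennreal (exp (?L - \<theta> * a))"
    using prob_space.emeasure_space_1[OF levy_lawD(1)[OF Q']] by simp
  finally show ?thesis .
qed

text \<open>The local form of the Chernoff bound: a density bound for the untilted law is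
  transported to \<open>Q\<close> and gains the exponential factor, which is largest at the left end
  of \<open>B\<close>.\<close>

lemma untilt_bound:
  assumes \<rho>: "levy_density (\<lambda>s. exp (\<theta> * s) * \<mu> s)" and Q: "levy_law Q \<mu>" and "0 \<le> \<theta>"
    and K: "\<And>Q'. levy_law Q' (\<lambda>s. exp (\<theta> * s) * \<mu> s) \<Longrightarrow> dens_bound Q' K" and "0 \<le> K"
    and B [measurable]: "B \<in> sets borel" and x: "\<And>u. u \<in> B \<Longrightarrow> x \<le> u"
  shows "emeasure Q B \<le> ennreal (K * exp (lexp (\<lambda>s. exp (\<theta> * s) * \<mu> s) \<theta> - \<theta> * x)) * emeasure lborel B"
proof -
  let ?L = "lexp (\<lambda>s. exp (\<theta> * s) * \<mu> s) \<theta>"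
  obtain Q' where Q': "levy_law Q' (\<lambda>s. exp (\<theta> * s) * \<mu> s)"
    and eq: "Q = density Q' (\<lambda>u. ennreal (exp (?L - \<theta> * u)))"
    using levy_law_untilt[OF assms(1-3)] .
  note [measurable_cong] = levy_lawD(2)[OF Q']
  have "emeasure Q B = (\<integral>\<^sup>+u. ennreal (exp (?L - \<theta> * u)) * indicator B u \<partial>Q')"
    unfolding eq by (subst emeasure_density) auto
  also have "\<dots> \<le> (\<integral>\<^sup>+u. ennreal (exp (?L - \<theta> * x)) * indicator B u \<partial>Q')"
    using \<open>0 \<le> \<theta>\<close> x by (intro nn_integral_mono) (auto split: split_indicator intro!: ennreal_leI mult_left_mono)
  also have "\<dots> = ennreal (exp (?L - \<theta> * x)) * emeasure Q' B"
    by (subst nn_integral_cmult) auto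
  also have "\<dots> \<le> ennreal (exp (?L - \<theta> * x)) * (ennreal K * emeasure lborel B)"
    using K[OF Q'] by (intro mult_left_mono) (auto simp: dens_bound_def)
  finally show ?thesis using \<open>0 \<le> K\<close> by (simp add: ennreal_mult ac_simps)
qed

section \<open>The functions \<open>\<phi>'\<close> and \<open>H\<close>\<close>

definition lexp_deriv :: "(real \<Rightarrow> real) \<Rightarrow> real \<Rightarrow> real" where
  "lexp_deriv \<mu> l = (\<integral>s. s * exp (- l * s) * \<mu> s \<partial>lborel)"

text \<open>All three follow from \<open>x \<le> exp (x / 2)\<close>.\<close>

lemma mult_exp_minus_le:
  fixes x :: real
  assumes "0 \<le> x"
  shows "x * exp (- x) \<le> 1" "x\<^sup>2 * exp (- x) \<le> 1" "x * exp (- x) \<le> exp (- x / 2)"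
proof -
  have half: "x / 2 \<le> exp (x / 2 - 1)" using exp_ge_add_one_self[of "x / 2 - 1"] by simp
  have e: "2 * exp (-1) \<le> (1 :: real)" using exp_ge_add_one_self[of "1::real"] by (simp add: exp_minus field_simps)
  have h2: "x \<le> exp (x / 2)"
  proof -
    have "exp (x / 2 - 1) = exp (-1) * exp (x / 2)" by (simp flip: exp_add)
    then have "x \<le> (2 * exp (-1)) * exp (x / 2)" using half by linarith
    also have "\<dots> \<le> 1 * exp (x / 2)" by (rule mult_right_mono[OF e]) simp
    finally show ?thesis by simp
  qed
  have ex: "exp (x / 2) * exp (- x) = exp (- x / 2)" by (simp flip: exp_add)
  have "x * exp (- x) \<le> exp (x / 2) * exp (- x)" by (rule mult_right_mono[OF h2]) simp
  then show 3: "x * exp (- x) \<le> exp (- x / 2)" by (simp only: ex)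
  also have "exp (- x / 2) \<le> 1" using assms by (simp only: exp_le_one_iff)
  finally show "x * exp (- x) \<le> 1" .
  have "x\<^sup>2 \<le> exp (x / 2) ^ 2" using h2 assms by (rule power_mono)
  also have "\<dots> = exp x" by (simp add: power2_eq_square flip: exp_add)
  finally have "x\<^sup>2 * exp (- x) \<le> exp x * exp (- x)" by (rule mult_right_mono) simp
  then show "x\<^sup>2 * exp (- x) \<le> 1" by (simp flip: exp_add)
qed

lemma mult_exp_bounds:
  fixes s l :: real
  assumes "0 < s" "0 < l"
  shows "s * exp (- l * s) \<le> s" "s * exp (- l * s) \<le> 1 / l" "s\<^sup>2 * exp (- l * s) \<le> s / l" "s\<^sup>2 * exp (- l * s) \<le> 1 / l\<^sup>2"
proof -
  have "0 \<le> l * s" using assms by simp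
  note m = mult_exp_minus_le[OF this]
  show "s * exp (- l * s) \<le> s" using assms by simp
  show 2: "s * exp (- l * s) \<le> 1 / l" using m(1) assms by (simp add: field_simps)
  show "s\<^sup>2 * exp (- l * s) \<le> s / l"
    using mult_left_mono[OF 2, of s] assms by (simp add: power2_eq_square ac_simps)
  show "s\<^sup>2 * exp (- l * s) \<le> 1 / l\<^sup>2" using m(2) assms by (simp add: field_simps power2_eq_square)
qed

lemma integrable_lexp_deriv:
  assumes "levy_density \<mu>" "0 < l"
  shows "integrable lborel (\<lambda>s. s * exp (- l * s) * \<mu> s)"
proof (rule levy_integrable[OF assms(1), where C = "1 + 1 / l"])
  fix s :: real assume "0 < s"
  have "s * exp (- l * s) \<le> (1 + 1 / l) * min 1 s"
  proof (cases "1 \<le> s")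
    case True
    have "s * exp (- l * s) \<le> 1 + 1 / l" by (rule order_trans[OF mult_exp_bounds(2)[OF \<open>0 < s\<close> assms(2)]]) simp
    then show ?thesis using True by (simp add: min_def)
  next
    case False
    have "s * exp (- l * s) \<le> s + (1 / l) * s" using mult_exp_bounds(1)[OF \<open>0 < s\<close> assms(2)] \<open>0 < s\<close> assms(2)
      by (intro add_increasing2) auto
    then show ?thesis using False by (simp add: min_def ring_distribs)
  qed
  then show "\<bar>s * exp (- l * s)\<bar> \<le> (1 + 1 / l) * min 1 s" using \<open>0 < s\<close> by (simp add: abs_mult)
qed measurable

lemma integrable_lexp_deriv2:
  assumes "levy_density \<mu>" "0 < l"
  shows "integrable lborel (\<lambda>s. s\<^sup>2 * exp (- l * s) * \<mu> s)"
proof (rule levy_integrable[OF assms(1), where C = "1 / l + 1 / l\<^sup>2"])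
  fix s :: real assume "0 < s"
  have "s\<^sup>2 * exp (- l * s) \<le> (1 / l + 1 / l\<^sup>2) * min 1 s"
  proof (cases "1 \<le> s")
    case True
    have "s\<^sup>2 * exp (- l * s) \<le> 1 / l + 1 / l\<^sup>2"
      by (rule order_trans[OF mult_exp_bounds(4)[OF \<open>0 < s\<close> assms(2)]]) (use assms in simp)
    then show ?thesis using True by (simp add: min_def)
  next
    case False
    have "s\<^sup>2 * exp (- l * s) \<le> s / l + s / l\<^sup>2" using mult_exp_bounds(3)[OF \<open>0 < s\<close> assms(2)] \<open>0 < s\<close> assms(2)
      by (intro add_increasing2) auto
    then show ?thesis using False by (simp add: min_def ring_distribs)
  qed
  then show "\<bar>s\<^sup>2 * exp (- l * s)\<bar> \<le> (1 / l + 1 / l\<^sup>2) * min 1 s" using \<open>0 < s\<close> by (simp add: abs_mult)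
qed measurable

lemma levy_integral_mono:
  assumes "levy_density \<mu>" "integrable lborel (\<lambda>s. F s * \<mu> s)" "integrable lborel (\<lambda>s. G s * \<mu> s)"
    and "\<And>s. 0 < s \<Longrightarrow> F s \<le> G s"
  shows "(\<integral>s. F s * \<mu> s \<partial>lborel) \<le> (\<integral>s. G s * \<mu> s \<partial>lborel)"
proof (rule integral_mono[OF assms(2,3)])
  fix s :: real
  show "F s * \<mu> s \<le> G s * \<mu> s"
    using levy_densityD(2,3)[OF assms(1), of s] assms(4)[of s]
    by (cases "s \<le> 0") (auto intro!: mult_right_mono)
qed

lemma levy_integral_nonneg:
  assumes "levy_density \<mu>" "\<And>s. 0 < s \<Longrightarrow> 0 \<le> F s"
  shows "0 \<le> (\<integral>s. F s * \<mu> s \<partial>lborel)"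
proof (rule integral_nonneg_AE, rule AE_I2)
  fix s :: real
  show "0 \<le> F s * \<mu> s"
    using levy_densityD(2,3)[OF assms(1), of s] assms(2)[of s] by (cases "s \<le> 0") auto
qed

lemma lexp_deriv_nonneg: "levy_density \<mu> \<Longrightarrow> 0 \<le> lexp_deriv \<mu> l"
  unfolding lexp_deriv_def by (rule levy_integral_nonneg) auto

lemma lexp_deriv_antimono:
  assumes "levy_density \<mu>" "0 < l" "l \<le> k"
  shows "lexp_deriv \<mu> k \<le> lexp_deriv \<mu> l"
  unfolding lexp_deriv_def
  using assms by (intro levy_integral_mono integrable_lexp_deriv) (auto simp: mult_right_mono)

text \<open>The tangent inequality, obtained by integrating \<open>1 - exp (- u) \<le> u\<close>
  with \<open>u = (k - l) * s\<close>, which may be negative.\<close>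

lemma lexp_concave:
  assumes "levy_density \<mu>" "0 < l" "0 < k"
  shows "lexp \<mu> k \<le> lexp \<mu> l + (k - l) * lexp_deriv \<mu> l"
proof -
  have "lexp \<mu> k - lexp \<mu> l = (\<integral>s. (1 - exp (- k * s)) * \<mu> s - (1 - exp (- l * s)) * \<mu> s \<partial>lborel)"
    unfolding lexp_def using assms by (intro Bochner_Integration.integral_diff[symmetric] integrable_lexp) auto
  also have "\<dots> = (\<integral>s. (exp (- l * s) - exp (- k * s)) * \<mu> s \<partial>lborel)"
    by (intro Bochner_Integration.integral_cong) (auto simp: algebra_simps)
  also have "\<dots> \<le> (\<integral>s. ((k - l) * (s * exp (- l * s))) * \<mu> s \<partial>lborel)"
  proof (rule levy_integral_mono[OF assms(1)])
    have "integrable lborel (\<lambda>s. (1 - exp (- k * s)) * \<mu> s - (1 - exp (- l * s)) * \<mu> s)"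
      using assms by (intro Bochner_Integration.integrable_diff integrable_lexp) auto
    then show "integrable lborel (\<lambda>s. (exp (- l * s) - exp (- k * s)) * \<mu> s)"
      by (simp add: algebra_simps)
    show "integrable lborel (\<lambda>s. ((k - l) * (s * exp (- l * s))) * \<mu> s)"
      using integrable_mult_right[OF integrable_lexp_deriv[OF assms(1,2)], of "k - l"] by (simp add: mult.assoc)
    fix s :: real assume "0 < s"
    have "1 + - ((k - l) * s) \<le> exp (- ((k - l) * s))" by (rule exp_ge_add_one_self)
    then have "(1 - exp (- ((k - l) * s))) * exp (- l * s) \<le> ((k - l) * s) * exp (- l * s)"
      by (intro mult_right_mono) auto
    moreover have "(1 - exp (- ((k - l) * s))) * exp (- l * s) = exp (- l * s) - exp (- k * s)"
      by (simp add: algebra_simps flip: exp_add)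
    ultimately show "exp (- l * s) - exp (- k * s) \<le> (k - l) * (s * exp (- l * s))" by (simp only: mult.assoc)
  qed
  also have "\<dots> = (k - l) * lexp_deriv \<mu> l"
    unfolding lexp_deriv_def by (simp add: mult.assoc)
  finally show ?thesis by simp
qed

text \<open>The Lipschitz constant is taken at a third point \<open>l\<close> to the left, so that
  it is uniform in a neighbourhood.\<close>

lemma lexp_deriv_Lipschitz:
  assumes "levy_density \<mu>" "0 < l" "l \<le> k" "k \<le> m"
  shows "lexp_deriv \<mu> k - lexp_deriv \<mu> m \<le> (m - k) * (\<integral>s. s\<^sup>2 * exp (- l * s) * \<mu> s \<partial>lborel)"
proof -
  have "lexp_deriv \<mu> k - lexp_deriv \<mu> m = (\<integral>s. s * exp (- k * s) * \<mu> s - s * exp (- m * s) * \<mu> s \<partial>lborel)"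
    unfolding lexp_deriv_def using assms
    by (intro Bochner_Integration.integral_diff[symmetric] integrable_lexp_deriv) auto
  also have "\<dots> = (\<integral>s. (s * exp (- k * s) - s * exp (- m * s)) * \<mu> s \<partial>lborel)"
    by (intro Bochner_Integration.integral_cong) (auto simp: algebra_simps)
  also have "\<dots> \<le> (\<integral>s. ((m - k) * (s\<^sup>2 * exp (- l * s))) * \<mu> s \<partial>lborel)"
  proof (rule levy_integral_mono[OF assms(1)])
    have "integrable lborel (\<lambda>s. s * exp (- k * s) * \<mu> s - s * exp (- m * s) * \<mu> s)"
      using assms by (intro Bochner_Integration.integrable_diff integrable_lexp_deriv) auto
    then show "integrable lborel (\<lambda>s. (s * exp (- k * s) - s * exp (- m * s)) * \<mu> s)"
      by (simp add: algebra_simps)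
    show "integrable lborel (\<lambda>s. ((m - k) * (s\<^sup>2 * exp (- l * s))) * \<mu> s)"
      using integrable_mult_right[OF integrable_lexp_deriv2[OF assms(1,2)], of "m - k"] by (simp add: mult.assoc)
    fix s :: real assume "0 < s"
    have "1 + - ((m - k) * s) \<le> exp (- ((m - k) * s))" by (rule exp_ge_add_one_self)
    then have "(1 - exp (- ((m - k) * s))) * exp (- k * s) \<le> ((m - k) * s) * exp (- k * s)"
      by (intro mult_right_mono) auto
    also have "\<dots> \<le> ((m - k) * s) * exp (- l * s)"
      using assms \<open>0 < s\<close> by (intro mult_left_mono) (auto simp: mult_right_mono)
    finally have "s * ((1 - exp (- ((m - k) * s))) * exp (- k * s)) \<le> s * (((m - k) * s) * exp (- l * s))"
      using \<open>0 < s\<close> by (intro mult_left_mono) auto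
    moreover have "(1 - exp (- ((m - k) * s))) * exp (- k * s) = exp (- k * s) - exp (- m * s)"
      by (simp add: algebra_simps flip: exp_add)
    ultimately show "s * exp (- k * s) - s * exp (- m * s) \<le> (m - k) * (s\<^sup>2 * exp (- l * s))"
      by (simp add: algebra_simps power2_eq_square)
  qed
  also have "\<dots> = (m - k) * (\<integral>s. s\<^sup>2 * exp (- l * s) * \<mu> s \<partial>lborel)"
    by (simp add: mult.assoc)
  finally show ?thesis .
qed

lemma isCont_lexp_deriv:
  assumes "levy_density \<mu>" "0 < k"
  shows "isCont (lexp_deriv \<mu>) k"
proof -
  define L where "L = (\<integral>s. s\<^sup>2 * exp (- (k / 2) * s) * \<mu> s \<partial>lborel)"
  have "\<forall>\<^sub>F x in at k. \<bar>lexp_deriv \<mu> x - lexp_deriv \<mu> k\<bar> \<le> \<bar>x - k\<bar> * L"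
    unfolding eventually_at
  proof (intro exI conjI ballI impI)
    show "0 < k / 2" using assms by simp
    fix x assume "x \<noteq> k \<and> dist x k < k / 2"
    then have "k / 2 \<le> x" by (auto simp: dist_real_def abs_if split: if_splits)
    then show "\<bar>lexp_deriv \<mu> x - lexp_deriv \<mu> k\<bar> \<le> \<bar>x - k\<bar> * L"
      using lexp_deriv_Lipschitz[OF assms(1), of "k / 2" k x] lexp_deriv_Lipschitz[OF assms(1), of "k / 2" x k]
        lexp_deriv_antimono[OF assms(1), of k x] lexp_deriv_antimono[OF assms(1), of x k] assms(2)
      by (cases "x \<le> k") (auto simp: L_def)
  qed
  moreover have "((\<lambda>x. \<bar>x - k\<bar> * L) \<longlongrightarrow> 0) (at k)"
  proof -
    have "((\<lambda>x. \<bar>x - k\<bar> * L) \<longlongrightarrow> \<bar>k - k\<bar> * L) (at k)" by (intro tendsto_intros)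
    then show ?thesis by simp
  qed
  ultimately have "((\<lambda>x. lexp_deriv \<mu> x - lexp_deriv \<mu> k) \<longlongrightarrow> 0) (at k)"
    unfolding real_norm_def[symmetric] by (rule Lim_null_comparison)
  then show ?thesis unfolding isCont_def by (rule Lim_null[THEN iffD2])
qed

text \<open>The tangent inequalities at \<open>k\<close> and at \<open>y\<close> trap the difference
  quotient between the values of \<open>lexp_deriv\<close> there. Continuity of
  \<open>lexp_deriv\<close> then replaces differentiation under the integral.\<close>

lemma lexp_has_derivative:
  assumes "levy_density \<mu>" "0 < k"
  shows "(lexp \<mu> has_real_derivative lexp_deriv \<mu> k) (at k)"
  unfolding has_field_derivative_iff
proof -
  let ?q = "\<lambda>y. (lexp \<mu> y - lexp \<mu> k) / (y - k)"
  have "\<forall>\<^sub>F y in at k. \<bar>?q y - lexp_deriv \<mu> k\<bar> \<le> \<bar>lexp_deriv \<mu> y - lexp_deriv \<mu> k\<bar>"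
    unfolding eventually_at
  proof (intro exI conjI ballI impI)
    show "0 < k / 2" using assms by simp
    fix y assume y: "y \<noteq> k \<and> dist y k < k / 2"
    then have "0 < y" by (auto simp: dist_real_def abs_if split: if_splits)
    note c = lexp_concave[OF assms(1) \<open>0 < y\<close> assms(2)] lexp_concave[OF assms \<open>0 < y\<close>]
    show "\<bar>?q y - lexp_deriv \<mu> k\<bar> \<le> \<bar>lexp_deriv \<mu> y - lexp_deriv \<mu> k\<bar>"
    proof (cases "k < y")
      case True
      have "?q y \<le> lexp_deriv \<mu> k" "lexp_deriv \<mu> y \<le> ?q y"
        using c True by (auto simp: field_simps)
      then show ?thesis by simp
    next
      case False
      then have "y < k" using y by simp
      have "lexp_deriv \<mu> k \<le> ?q y" "?q y \<le> lexp_deriv \<mu> y"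
        using c \<open>y < k\<close> by (auto simp: field_simps)
      then show ?thesis by simp
    qed
  qed
  moreover have "((\<lambda>y. \<bar>lexp_deriv \<mu> y - lexp_deriv \<mu> k\<bar>) \<longlongrightarrow> 0) (at k)"
  proof -
    have "(lexp_deriv \<mu> \<longlongrightarrow> lexp_deriv \<mu> k) (at k)" using isCont_lexp_deriv[OF assms] by (simp add: isCont_def)
    then have "((\<lambda>y. lexp_deriv \<mu> y - lexp_deriv \<mu> k) \<longlongrightarrow> 0) (at k)" by (rule Lim_null[THEN iffD1])
    then show ?thesis by (rule tendsto_rabs_zero)
  qed
  ultimately have "((\<lambda>y. ?q y - lexp_deriv \<mu> k) \<longlongrightarrow> 0) (at k)"
    unfolding real_norm_def[symmetric] by (rule Lim_null_comparison)
  then show "(?q \<longlongrightarrow> lexp_deriv \<mu> k) (at k)" by (rule Lim_null[THEN iffD2])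
qed

text \<open>Provides solutions of \<open>lexp_deriv n s = x / t\<close> for small \<open>x\<close>;
  there is no drift, so the limit is 0.\<close>

lemma lexp_deriv_tendsto_0:
  assumes "levy_density \<mu>"
  shows "(\<lambda>k. lexp_deriv \<mu> (real (Suc k))) \<longlonglongrightarrow> 0"
proof -
  note [measurable] = levy_densityD(1)[OF assms]
  have "(\<lambda>k. lexp_deriv \<mu> (real (Suc k))) \<longlonglongrightarrow> (\<integral>s. (\<lambda>_::real. 0) s \<partial>lborel)"
    unfolding lexp_deriv_def
  proof (rule integral_dominated_convergence[where w = "\<lambda>s. min 1 s * \<mu> s"])
    show "AE s in lborel. (\<lambda>k. s * exp (- real (Suc k) * s) * \<mu> s) \<longlonglongrightarrow> 0"
    proof (rule AE_I2)
      fix s :: real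
      show "(\<lambda>k. s * exp (- real (Suc k) * s) * \<mu> s) \<longlonglongrightarrow> 0"
      proof (cases "s \<le> 0")
        case True then show ?thesis using levy_densityD(3)[OF assms True] by simp
      next
        case False
        have "(\<lambda>k. exp (- s) ^ Suc k) \<longlonglongrightarrow> 0"
          using False by (intro LIMSEQ_power_zero[THEN LIMSEQ_Suc]) simp
        then have "(\<lambda>k. exp (- real (Suc k) * s)) \<longlonglongrightarrow> 0"
          by (simp only: exp_of_nat_mult[symmetric] mult_minus_right mult_minus_left)
        then have "(\<lambda>k. s * exp (- real (Suc k) * s) * \<mu> s) \<longlonglongrightarrow> s * 0 * \<mu> s"
          by (intro tendsto_intros)
        then show ?thesis by simp
      qed
    qed
    show "AE s in lborel. norm (s * exp (- real (Suc k) * s) * \<mu> s) \<le> min 1 s * \<mu> s" for k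
    proof (rule AE_I2)
      fix s :: real
      show "norm (s * exp (- real (Suc k) * s) * \<mu> s) \<le> min 1 s * \<mu> s"
      proof (cases "s \<le> 0")
        case True then show ?thesis using levy_densityD(3)[OF assms True] by simp
      next
        case False
        have "1 / real (Suc k) \<le> 1" by simp
        then have "s * exp (- real (Suc k) * s) \<le> min 1 s"
          using mult_exp_bounds(1,2)[of s "real (Suc k)"] False by (auto simp del: of_nat_Suc intro: order_trans)
        then show ?thesis using levy_densityD(2)[OF assms, of s] False
          by (simp add: abs_mult mult_right_mono)
      qed
    qed
  qed (use levy_densityD(4)[OF assms] in auto)
  then show ?thesis by simp
qed

section \<open>Integral representation and size of \<open>H\<close>\<close>

definition lexp_H :: "(real \<Rightarrow> real) \<Rightarrow> real \<Rightarrow> real" where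
  "lexp_H \<mu> l = lexp \<mu> l - l * lexp_deriv \<mu> l"

text \<open>\<open>H_kernel (l * s)\<close> is the integrand of \<open>lexp_H\<close> at
  \<open>l\<close>; its derivative \<open>x * exp (- x)\<close> is positive for positive
  \<open>x\<close>.\<close>

definition H_kernel :: "real \<Rightarrow> real" where
  "H_kernel x = 1 - exp (- x) - x * exp (- x)"

lemma H_kernel_mono:
  assumes "0 \<le> x" "x \<le> y"
  shows "H_kernel x \<le> H_kernel y"
proof (rule DERIV_nonneg_imp_nondecreasing[OF assms(2)])
  fix z assume "x \<le> z" "z \<le> y"
  moreover have "(H_kernel has_real_derivative z * exp (- z)) (at z)"
    unfolding H_kernel_def by (auto intro!: derivative_eq_intros simp: algebra_simps)
  ultimately show "\<exists>d. (H_kernel has_real_derivative d) (at z) \<and> 0 \<le> d" using assms(1) by auto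
qed

lemma H_kernel_bounds:
  assumes "0 \<le> x"
  shows "H_kernel x \<le> min 1 (x\<^sup>2)" "min 1 (x\<^sup>2) / 6 \<le> H_kernel x"
proof -
  have e3: "exp 1 \<le> (3::real)" by (rule exp_le)
  have up: "H_kernel x \<le> x\<^sup>2"
  proof -
    have "exp (- x) \<ge> 1 - x" using exp_ge_add_one_self[of "- x"] by simp
    then have "(1 + x) * (1 - x) \<le> (1 + x) * exp (- x)" using assms by (intro mult_left_mono) auto
    then show ?thesis by (simp add: H_kernel_def algebra_simps power2_eq_square)
  qed
  have "0 \<le> exp (- x) + x * exp (- x)" using assms by simp
  then have "H_kernel x \<le> 1" by (simp add: H_kernel_def)
  then show "H_kernel x \<le> min 1 (x\<^sup>2)" using up by simp
  have low: "y\<^sup>2 / 6 \<le> H_kernel y" if "0 \<le> y" "y \<le> 1" for y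
  proof -
    let ?g = "\<lambda>z. H_kernel z - z\<^sup>2 / 6"
    have "?g 0 \<le> ?g y"
    proof (rule DERIV_nonneg_imp_nondecreasing[OF that(1)])
      fix z assume z: "0 \<le> z" "z \<le> y"
      \<comment> \<open>The derivative of \<open>?g\<close> is \<open>z * (exp (- z) - 1/3)\<close>;
        it is nonnegative on \<open>[0,1]\<close> because \<open>exp 1 \<le> 3\<close>. This is the
        origin of the 6.\<close>
      have "(?g has_real_derivative z * exp (- z) - z / 3) (at z)"
        unfolding H_kernel_def by (auto intro!: derivative_eq_intros simp: algebra_simps)
      moreover have "exp (-1) \<le> exp (- z)" using z that by simp
      moreover have "1 / 3 \<le> (exp (-1) :: real)" using e3 by (simp add: exp_minus field_simps)
      ultimately have "1 / 3 \<le> exp (- z)" by linarith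
      then have "z * (1 / 3) \<le> z * exp (- z)" using z by (intro mult_left_mono) auto
      with \<open>(?g has_real_derivative z * exp (- z) - z / 3) (at z)\<close>
      show "\<exists>d. (?g has_real_derivative d) (at z) \<and> 0 \<le> d" by auto
    qed
    then show ?thesis by (simp add: H_kernel_def)
  qed
  show "min 1 (x\<^sup>2) / 6 \<le> H_kernel x"
  proof (cases "x \<le> 1")
    case True then show ?thesis using low[OF assms True] by (auto simp: min_def)
  next
    case False
    then have "1 / 6 \<le> H_kernel x" using low[of 1] H_kernel_mono[of 1 x] by auto
    then show ?thesis by (auto simp: min_def)
  qed
qed

lemma lexp_H_eq:
  assumes "levy_density \<mu>" "0 < l"
  shows "lexp_H \<mu> l = (\<integral>s. H_kernel (l * s) * \<mu> s \<partial>lborel)" "integrable lborel (\<lambda>s. H_kernel (l * s) * \<mu> s)"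
proof -
  have eq: "H_kernel (l * s) * \<mu> s = (1 - exp (- l * s)) * \<mu> s - l * (s * exp (- l * s) * \<mu> s)" for s
    by (simp add: H_kernel_def algebra_simps)
  note i = integrable_lexp[OF assms(1), of l] integrable_lexp_deriv[OF assms]
  show "lexp_H \<mu> l = (\<integral>s. H_kernel (l * s) * \<mu> s \<partial>lborel)"
    unfolding eq lexp_H_def lexp_def lexp_deriv_def using i assms(2) by simp
  show "integrable lborel (\<lambda>s. H_kernel (l * s) * \<mu> s)"
    unfolding eq using i assms(2) by simp
qed

lemma lexp_H_mono:
  assumes "levy_density \<mu>" "0 < l" "l \<le> k"
  shows "lexp_H \<mu> l \<le> lexp_H \<mu> k"
proof -
  have "0 < k" using assms by linarith
  show ?thesis
    unfolding lexp_H_eq(1)[OF assms(1,2)] lexp_H_eq(1)[OF assms(1) \<open>0 < k\<close>] using assms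
    by (intro levy_integral_mono lexp_H_eq(2) H_kernel_mono) (auto simp: mult_right_mono)
qed

lemma integrable_min_sq:
  assumes "levy_density \<mu>"
  shows "integrable lborel (\<lambda>s. min 1 ((l * s)\<^sup>2) * \<mu> s)"
proof (rule levy_integrable[OF assms, where C = "1 + l\<^sup>2"])
  fix s :: real assume "0 < s"
  show "\<bar>min 1 ((l * s)\<^sup>2)\<bar> \<le> (1 + l\<^sup>2) * min 1 s"
  proof (cases "1 \<le> s")
    case True
    have "\<bar>min 1 ((l * s)\<^sup>2)\<bar> \<le> 1" by (simp add: abs_if min_def)
    also have "1 \<le> (1 + l\<^sup>2) * min 1 s" using True by (simp add: min_def)
    finally show ?thesis .
  next
    case False
    have "s * s \<le> s * 1" using \<open>0 < s\<close> False by (intro mult_left_mono) auto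
    then have "l\<^sup>2 * (s * s) \<le> l\<^sup>2 * s" by (intro mult_left_mono) auto
    then have "(l * s)\<^sup>2 \<le> (1 + l\<^sup>2) * s" using \<open>0 < s\<close>
      by (auto simp: power2_eq_square algebra_simps)
    then show ?thesis using False by (auto simp: min_def)
  qed
qed measurable

lemma lexp_H_bounds:
  assumes "levy_density \<mu>" "0 < l"
  shows "lexp_H \<mu> l \<le> (\<integral>s. min 1 ((l * s)\<^sup>2) * \<mu> s \<partial>lborel)"
    "(\<integral>s. min 1 ((l * s)\<^sup>2) * \<mu> s \<partial>lborel) / 6 \<le> lexp_H \<mu> l"
proof -
  show "lexp_H \<mu> l \<le> (\<integral>s. min 1 ((l * s)\<^sup>2) * \<mu> s \<partial>lborel)"
    unfolding lexp_H_eq(1)[OF assms] using assms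
    by (intro levy_integral_mono lexp_H_eq(2) integrable_min_sq H_kernel_bounds) auto
  have "(\<integral>s. min 1 ((l * s)\<^sup>2) * \<mu> s \<partial>lborel) / 6 = (\<integral>s. (min 1 ((l * s)\<^sup>2) / 6) * \<mu> s \<partial>lborel)"
    by simp
  also have "\<dots> \<le> lexp_H \<mu> l"
    unfolding lexp_H_eq(1)[OF assms] using assms integrable_min_sq[OF assms(1), of l]
    by (intro levy_integral_mono lexp_H_eq(2) H_kernel_bounds) auto
  finally show "(\<integral>s. min 1 ((l * s)\<^sup>2) * \<mu> s \<partial>lborel) / 6 \<le> lexp_H \<mu> l" .
qed

lemma lexp_H_le_lexp: "levy_density \<mu> \<Longrightarrow> 0 < l \<Longrightarrow> lexp_H \<mu> l \<le> lexp \<mu> l"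
  using lexp_deriv_nonneg[of \<mu> l] by (simp add: lexp_H_def)

lemma isCont_lexp_H:
  assumes "levy_density \<mu>" "0 < k"
  shows "isCont (lexp_H \<mu>) k"
  unfolding lexp_H_def
  using isCont_lexp_deriv[OF assms] DERIV_isCont[OF lexp_has_derivative[OF assms]] by (intro continuous_intros)

section \<open>Tail mass and truncated second moment\<close>

lemma has_bochner_powr:
  fixes r e :: real
  assumes "0 < r"
  shows "e < -1 \<Longrightarrow> has_bochner_integral lborel (\<lambda>s. indicator {r..} s * s powr e) (- (r powr (e + 1)) / (e + 1))"
    and "-1 < e \<Longrightarrow> has_bochner_integral lborel (\<lambda>s. indicator {0..r} s * s powr e) (r powr (e + 1) / (e + 1))"
proof -
  show "has_bochner_integral lborel (\<lambda>s. indicator {r..} s * s powr e) (- (r powr (e + 1)) / (e + 1))" if "e < -1"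
  proof (rule has_bochner_integral_nn_integral)
    show "(\<integral>\<^sup>+s. ennreal (indicator {r..} s * s powr e) \<partial>lborel) = ennreal (- (r powr (e + 1)) / (e + 1))"
      using nn_integral_has_integral_lebesgue[OF _ has_integral_powr_to_inf[OF that assms]] by simp
    show "0 \<le> - (r powr (e + 1)) / (e + 1)" using that by (intro divide_nonpos_neg) auto
  qed auto
  show "has_bochner_integral lborel (\<lambda>s. indicator {0..r} s * s powr e) (r powr (e + 1) / (e + 1))" if "-1 < e"
  proof (rule has_bochner_integral_nn_integral)
    show "(\<integral>\<^sup>+s. ennreal (indicator {0..r} s * s powr e) \<partial>lborel) = ennreal (r powr (e + 1) / (e + 1))"
      using nn_integral_has_integral_lebesgue[OF _ has_integral_powr_from_0[OF that, of r]] assms by simp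
    show "0 \<le> r powr (e + 1) / (e + 1)" using that by simp
  qed auto
qed

definition tail_mass :: "(real \<Rightarrow> real) \<Rightarrow> real \<Rightarrow> real" where
  "tail_mass \<mu> r = (\<integral>s. indicator {r<..} s * \<mu> s \<partial>lborel)"

definition trunc_moment :: "(real \<Rightarrow> real) \<Rightarrow> real \<Rightarrow> real" where
  "trunc_moment \<mu> r = (\<integral>s. (indicator {..r} s * s\<^sup>2) * \<mu> s \<partial>lborel)"

lemma integrable_indicator_away:
  assumes "levy_density \<mu>" "0 < a" "A \<in> sets borel" "\<And>s. s \<in> A \<Longrightarrow> a \<le> s"
  shows "integrable lborel (\<lambda>s. indicator A s * \<mu> s)"
  using jump_density_truncate[OF assms(1,3,2,4)] by (rule jump_density.integrable)

lemma integrable_trunc_moment: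
  assumes "levy_density \<mu>"
  shows "integrable lborel (\<lambda>s. (indicator {..r} s * s\<^sup>2) * \<mu> s)"
proof (rule levy_integrable[OF assms, where C = "1 + \<bar>r\<bar> + r\<^sup>2"])
  fix s :: real assume "0 < s"
  show "\<bar>indicator {..r} s * s\<^sup>2\<bar> \<le> (1 + \<bar>r\<bar> + r\<^sup>2) * min 1 s"
  proof (cases "s \<le> r")
    case True
    then have "s * s \<le> r * r" "s * s \<le> r * s" using \<open>0 < s\<close> by (auto intro!: mult_mono)
    then show ?thesis using True \<open>0 < s\<close>
      by (auto simp: min_def power2_eq_square algebra_simps abs_mult add_nonneg_nonneg add_increasing add_increasing2)
  qed (use \<open>0 < s\<close> in \<open>simp add: min_def\<close>)
qed measurable

lemma trunc_moment_nonneg: "levy_density \<mu> \<Longrightarrow> 0 \<le> trunc_moment \<mu> r"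
  unfolding trunc_moment_def by (rule levy_integral_nonneg) auto

lemma tail_mass_nonneg: "levy_density \<mu> \<Longrightarrow> 0 \<le> tail_mass \<mu> r"
  unfolding tail_mass_def by (rule levy_integral_nonneg) auto

text \<open>The minimum of 1 and the square of \<open>s / r\<close> is split at
  \<open>s = r\<close>. The lower bound keeps the second moment alone, which already has the right
  order for scaling densities.\<close>

lemma lexp_H_le_trunc:
  assumes "levy_density \<mu>" "0 < r"
  shows "lexp_H \<mu> (1 / r) \<le> trunc_moment \<mu> r / r\<^sup>2 + tail_mass \<mu> r"
    and "trunc_moment \<mu> r / r\<^sup>2 / 6 \<le> lexp_H \<mu> (1 / r)"
proof -
  let ?M = "\<integral>s. min 1 ((1 / r * s)\<^sup>2) * \<mu> s \<partial>lborel"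
  have l: "0 < 1 / r" using assms by simp
  have i1: "integrable lborel (\<lambda>s. (indicator {..r} s * s\<^sup>2 / r\<^sup>2) * \<mu> s)"
    using integrable_divide[OF integrable_trunc_moment[OF assms(1), of r], of "r\<^sup>2"] by simp
  have i2: "integrable lborel (\<lambda>s. indicator {r<..} s * \<mu> s)"
    by (rule integrable_indicator_away[OF assms]) auto
  have e1: "(\<integral>s. (indicator {..r} s * s\<^sup>2 / r\<^sup>2) * \<mu> s \<partial>lborel) = trunc_moment \<mu> r / r\<^sup>2"
    unfolding trunc_moment_def by simp
  have "?M \<le> (\<integral>s. (indicator {..r} s * s\<^sup>2 / r\<^sup>2 + indicator {r<..} s) * \<mu> s \<partial>lborel)"
  proof (rule levy_integral_mono[OF assms(1) integrable_min_sq[OF assms(1)]])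
    show "integrable lborel (\<lambda>s. (indicator {..r} s * s\<^sup>2 / r\<^sup>2 + indicator {r<..} s) * \<mu> s)"
      using Bochner_Integration.integrable_add[OF i1 i2] by (simp add: distrib_right)
  qed (auto simp: power_divide split: split_indicator)
  also have "\<dots> = trunc_moment \<mu> r / r\<^sup>2 + tail_mass \<mu> r"
    unfolding distrib_right Bochner_Integration.integral_add[OF i1 i2] e1 tail_mass_def ..
  finally show "lexp_H \<mu> (1 / r) \<le> trunc_moment \<mu> r / r\<^sup>2 + tail_mass \<mu> r"
    using lexp_H_bounds(1)[OF assms(1) l] by linarith
  have "trunc_moment \<mu> r / r\<^sup>2 \<le> ?M"
    unfolding e1[symmetric]
  proof (rule levy_integral_mono[OF assms(1) i1 integrable_min_sq[OF assms(1)]])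
    fix s :: real assume "0 < s"
    show "indicator {..r} s * s\<^sup>2 / r\<^sup>2 \<le> min 1 ((1 / r * s)\<^sup>2)"
    proof (cases "s \<le> r")
      case True
      then have "s\<^sup>2 \<le> r\<^sup>2" using \<open>0 < s\<close> by (intro power_mono) auto
      then show ?thesis using True \<open>0 < r\<close> by (simp add: power_divide)
    qed simp
  qed
  then show "trunc_moment \<mu> r / r\<^sup>2 / 6 \<le> lexp_H \<mu> (1 / r)"
    by (intro order_trans[OF divide_right_mono lexp_H_bounds(2)[OF assms(1) l]]) simp_all
qed

section \<open>Weakly scaling L\'evy densities\<close>

text \<open>\<open>R\<close> is a finite cutoff strictly inside the range of the scaling hypothesis.
  The bounds are products instead of quotients, and beyond \<open>R\<close> only boundedness is
  recorded.\<close>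

locale scaled_levy_density =
  fixes n :: "real \<Rightarrow> real" and R a1 a2 a3 \<alpha>1 \<alpha>2 :: real
  assumes ld: "levy_density n" and R_pos: "0 < R" and a_pos: "0 < a1" "0 < a2" "0 < a3"
    and \<alpha>: "0 < \<alpha>1" "\<alpha>1 \<le> \<alpha>2" "\<alpha>2 < 2"
    and n_pos: "0 < s \<Longrightarrow> s \<le> R \<Longrightarrow> 0 < n s"
    and scale_lo: "0 < r \<Longrightarrow> r \<le> s \<Longrightarrow> s \<le> R \<Longrightarrow> a1 * (s / r) powr (1 + \<alpha>1) * n s \<le> n r"
    and scale_hi: "0 < r \<Longrightarrow> r \<le> s \<Longrightarrow> s \<le> R \<Longrightarrow> n r \<le> a2 * (s / r) powr (1 + \<alpha>2) * n s"
    and n_le: "R \<le> s \<Longrightarrow> n s \<le> a3"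
begin

lemma n_nonneg: "0 \<le> n s" using levy_densityD(2)[OF ld] .
lemma n_nonpos: "s \<le> 0 \<Longrightarrow> n s = 0" using levy_densityD(3)[OF ld] .
lemma n_meas [measurable]: "n \<in> borel_measurable borel" using levy_densityD(1)[OF ld] .

lemma a2_ge_1: "1 \<le> a2"
  using scale_hi[of R R] n_pos[of R] R_pos by auto

lemma n_antimono: "0 < r \<Longrightarrow> r \<le> s \<Longrightarrow> s \<le> R \<Longrightarrow> a1 * n s \<le> n r"
proof -
  assume *: "0 < r" "r \<le> s" "s \<le> R"
  have "1 \<le> (s / r) powr (1 + \<alpha>1)" using * \<alpha> by (intro ge_one_powr_ge_zero) auto
  then have "a1 * 1 * n s \<le> a1 * (s / r) powr (1 + \<alpha>1) * n s"
    using a_pos n_nonneg by (intro mult_right_mono mult_left_mono) auto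
  then show ?thesis using scale_lo[OF *] by simp
qed

text \<open>The 8 is \<open>2 ^ 3\<close>, an upper bound of
  \<open>2 powr (1 + \<alpha>2)\<close>.\<close>

lemma n_doubling: "s \<le> R \<Longrightarrow> s / 2 \<le> r \<Longrightarrow> r \<le> s \<Longrightarrow> 0 < s \<Longrightarrow> n r \<le> 8 * a2 * n s"
proof -
  assume *: "s \<le> R" "s / 2 \<le> r" "r \<le> s" "0 < s"
  have "(s / r) powr (1 + \<alpha>2) \<le> (s / r) powr 3" using * \<alpha> by (intro powr_mono) auto
  also have "\<dots> \<le> 2 powr 3" using * by (intro powr_mono2) (auto simp: field_simps)
  also have "\<dots> = 8" by (simp add: powr_numeral)
  finally have "a2 * (s / r) powr (1 + \<alpha>2) * n s \<le> a2 * 8 * n s"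
    using a_pos n_nonneg by (intro mult_right_mono mult_left_mono) auto
  then show ?thesis using scale_hi[of r s] * by simp
qed

lemma powr_ratio:
  assumes "0 < r" "0 < s"
  shows "(s / r) powr x = inverse ((r / s) powr (x :: real))" "0 < (r / s) powr x"
  using assms by (simp_all add: powr_divide)

lemma n_scale_ge: "0 < r \<Longrightarrow> r \<le> s \<Longrightarrow> s \<le> R \<Longrightarrow> (r / s) powr (1 + \<alpha>2) * n r / a2 \<le> n s"
  using scale_hi[of r s] powr_ratio[of r s "1 + \<alpha>2"] a_pos by (simp add: field_simps)

lemma n_scale_le: "0 < r \<Longrightarrow> r \<le> s \<Longrightarrow> s \<le> R \<Longrightarrow> n s \<le> (r / s) powr (1 + \<alpha>1) * n r / a1"
  using scale_lo[of r s] powr_ratio[of r s "1 + \<alpha>1"] a_pos by (simp add: field_simps)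

text \<open>The jump rate \<open>r * n r\<close> decreases at least like a power of order \<alpha>1.
  This decay makes smaller scales richer in jumps.\<close>

lemma rn_scale_le: "0 < r \<Longrightarrow> r \<le> s \<Longrightarrow> s \<le> R \<Longrightarrow> s * n s \<le> (r / s) powr \<alpha>1 * (r * n r) / a1"
proof -
  assume *: "0 < r" "r \<le> s" "s \<le> R"
  have "s * n s \<le> s * ((r / s) powr (1 + \<alpha>1) * n r / a1)"
    using n_scale_le[OF *] * by (intro mult_left_mono) auto
  also have "\<dots> = (r / s) powr \<alpha>1 * (r * n r) / a1" using * by (simp add: powr_add)
  finally show ?thesis .
qed

text \<open>The rate grows at least like \<open>(v / r) powr \<alpha>1\<close> when passing from
  \<open>v\<close> down to \<open>r\<close>; an upper bound \<open>K\<close> at \<open>r\<close>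
  therefore limits how far below \<open>v\<close> the scale \<open>r\<close> can be.\<close>

lemma ratio_le_of_jump_rate:
  assumes r: "0 < r" "r \<le> v" "v \<le> R" and t: "0 < t" and c: "0 < c" "c \<le> t * (v * n v)" and K: "t * (r * n r) \<le> K"
  shows "v / r \<le> (K / (a1 * c)) powr (1 / \<alpha>1)"
proof -
  have v: "0 < v" using r by simp
  have gen: "inverse q * X \<le> Y / a" if "X \<le> q * Y / a" "0 < q" for X Y a q :: real
    using mult_left_mono[OF that(1), of "inverse q"] that(2) by (simp add: mult.assoc[symmetric])
  have "v * n v \<le> (r / v) powr \<alpha>1 * (r * n r) / a1" by (rule rn_scale_le[OF r])
  then have "(v / r) powr \<alpha>1 * (v * n v) \<le> r * n r / a1" using powr_ratio[OF r(1) v, of \<alpha>1] gen by simp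
  then have "t * ((v / r) powr \<alpha>1 * (v * n v)) \<le> t * (r * n r / a1)" using t by (intro mult_left_mono) auto
  then have "(v / r) powr \<alpha>1 * (t * (v * n v)) \<le> t * (r * n r) / a1" by (simp add: ac_simps)
  moreover have "(v / r) powr \<alpha>1 * c \<le> (v / r) powr \<alpha>1 * (t * (v * n v))" using c by (intro mult_left_mono) auto
  moreover have "t * (r * n r) / a1 \<le> K / a1" using K a_pos by (intro divide_right_mono) auto
  ultimately have "(v / r) powr \<alpha>1 * c \<le> K / a1" by linarith
  then have "(v / r) powr \<alpha>1 \<le> K / (a1 * c)" using c(1) a_pos by (simp add: field_simps)
  then have "((v / r) powr \<alpha>1) powr (1 / \<alpha>1) \<le> (K / (a1 * c)) powr (1 / \<alpha>1)" using \<alpha> by (intro powr_mono2) auto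
  then show ?thesis using \<alpha> r v by (simp add: powr_powr)
qed

lemma rn_ge: "0 < r \<Longrightarrow> r \<le> s \<Longrightarrow> s \<le> R \<Longrightarrow> a1 * (s * n s) \<le> r * n r"
proof -
  assume *: "0 < r" "r \<le> s" "s \<le> R"
  have "(r / s) powr \<alpha>1 \<le> 1" using * \<alpha> by (intro powr_le1) auto
  then have "(r / s) powr \<alpha>1 * (r * n r) / a1 \<le> 1 * (r * n r) / a1"
    using * n_nonneg a_pos by (intro divide_right_mono mult_right_mono) auto
  with rn_scale_le[OF *] have "s * n s \<le> r * n r / a1" by simp
  then show ?thesis using a_pos by (simp add: pos_le_divide_eq mult.commute)
qed

text \<open>The constants of the second moment and of the tail. The second summand of
  \<open>CT\<close> pays for the mass beyond \<open>R\<close>, measured against the rate at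
  \<open>R\<close>.\<close>

definition "CV = a2 / (2 - \<alpha>2)"
definition "CT = 1 / (a1 * \<alpha>1) + tail_mass n R / (a1 * (R * n R))"

lemma CV_pos: "0 < CV" and CT_pos: "0 < CT"
proof -
  show "0 < CV" using a_pos \<alpha> by (simp add: CV_def)
  have "0 \<le> tail_mass n R / (a1 * (R * n R))"
    using tail_mass_nonneg[OF ld] a_pos R_pos n_nonneg by (intro divide_nonneg_nonneg mult_nonneg_nonneg) auto
  moreover have "0 < 1 / (a1 * \<alpha>1)" using a_pos \<alpha> by simp
  ultimately show "0 < CT" unfolding CT_def by linarith
qed

text \<open>Up to constants, \<open>s\<^sup>2 * n s\<close> is at most
  \<open>s powr (1 - \<alpha>2)\<close>, whose integral at 0 converges because \<alpha>2 <
  2.\<close>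

lemma trunc_moment_le:
  assumes "0 < r" "r \<le> R"
  shows "trunc_moment n r \<le> CV * (r ^ 3 * n r)"
proof -
  have hb: "has_bochner_integral lborel (\<lambda>s. indicator {0..r} s * s powr (1 - \<alpha>2)) (r powr (2 - \<alpha>2) / (2 - \<alpha>2))"
    using has_bochner_powr(2)[OF assms(1), of "1 - \<alpha>2"] \<alpha> by simp
  let ?c = "a2 * r powr (1 + \<alpha>2) * n r"
  have "trunc_moment n r \<le> (\<integral>s. ?c * (indicator {0..r} s * s powr (1 - \<alpha>2)) \<partial>lborel)"
    unfolding trunc_moment_def
  proof (rule integral_mono[OF integrable_trunc_moment[OF ld]])
    show "integrable lborel (\<lambda>s. ?c * (indicator {0..r} s * s powr (1 - \<alpha>2)))"
      using hb by (intro integrable_mult_right) (simp add: has_bochner_integral_iff)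
    fix s :: real
    show "indicator {..r} s * s\<^sup>2 * n s \<le> ?c * (indicator {0..r} s * s powr (1 - \<alpha>2))"
    proof (cases "0 < s \<and> s \<le> r")
      case True
      have "s\<^sup>2 * n s \<le> s\<^sup>2 * (a2 * (r / s) powr (1 + \<alpha>2) * n r)"
        using scale_hi[of s r] True assms by (intro mult_left_mono) auto
      also have "\<dots> = ?c * (s\<^sup>2 * (1 / s) powr (1 + \<alpha>2))"
        using True assms by (simp add: powr_divide powr_mult)
      also have "s\<^sup>2 * (1 / s) powr (1 + \<alpha>2) = s powr (1 - \<alpha>2)"
      proof -
        have "(1 / s) powr (1 + \<alpha>2) = s powr (- (1 + \<alpha>2))"
          using True by (simp add: powr_minus_divide powr_divide del: minus_add_distrib)
        moreover have "s\<^sup>2 = s powr 2" using True by (simp add: powr_numeral)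
        ultimately show ?thesis by (simp add: powr_add[symmetric])
      qed
      finally show ?thesis using True by simp
    next
      case False
      then show ?thesis using n_nonpos[of s] a_pos n_nonneg[of r] by (auto split: split_indicator)
    qed
  qed
  also have "\<dots> = ?c * (r powr (2 - \<alpha>2) / (2 - \<alpha>2))"
    using hb by (simp add: has_bochner_integral_iff)
  also have "\<dots> = CV * (r powr (1 + \<alpha>2) * r powr (2 - \<alpha>2) * n r)" by (simp add: CV_def)
  also have "r powr (1 + \<alpha>2) * r powr (2 - \<alpha>2) = r ^ 3"
    using assms by (simp add: powr_add[symmetric] powr_numeral)
  finally show ?thesis .
qed

lemma trunc_moment_ge:
  assumes "0 < r" "r \<le> R"
  shows "a1 / 8 * (r ^ 3 * n r) \<le> trunc_moment n r"
proof -
  have "a1 / 8 * (r ^ 3 * n r) = (\<integral>s. indicator {r / 2<..r} s * (r\<^sup>2 / 4 * (a1 * n r)) \<partial>lborel)"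
    using assms by (simp add: power2_eq_square power3_eq_cube)
  also have "\<dots> \<le> trunc_moment n r"
    unfolding trunc_moment_def
  proof (rule integral_mono[OF _ integrable_trunc_moment[OF ld]])
    show "integrable lborel (\<lambda>s. indicator {r / 2<..r} s * (r\<^sup>2 / 4 * (a1 * n r)))"
      using assms by (intro integrable_mult_left integrable_real_indicator) auto
    fix s :: real
    show "indicator {r / 2<..r} s * (r\<^sup>2 / 4 * (a1 * n r)) \<le> indicator {..r} s * s\<^sup>2 * n s"
    proof (cases "r / 2 < s \<and> s \<le> r")
      case True
      have "(r / 2)\<^sup>2 \<le> s\<^sup>2" using True assms by (intro power_mono) auto
      then have "r\<^sup>2 / 4 * (a1 * n r) \<le> s\<^sup>2 * n s"
        using True assms n_antimono[of s r] a_pos n_nonneg by (intro mult_mono) (auto simp: power_divide)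
      then show ?thesis using True by simp
    qed (use n_nonneg in auto)
  qed
  finally show ?thesis .
qed

text \<open>Up to \<open>R\<close> the density is at most a multiple of
  \<open>s powr (- 1 - \<alpha>1)\<close>, integrable at infinity as \<alpha>1 > 0. The fixed mass
  beyond \<open>R\<close> is dominated since \<open>r * n r\<close> does not fall below a multiple
  of its value at \<open>R\<close>.\<close>

lemma tail_mass_le:
  assumes "0 < r" "r \<le> R"
  shows "tail_mass n r \<le> CT * (r * n r)"
proof -
  have hb: "has_bochner_integral lborel (\<lambda>s. indicator {r..} s * s powr (- 1 - \<alpha>1)) (r powr (- \<alpha>1) / \<alpha>1)"
    using has_bochner_powr(1)[OF assms(1), of "- 1 - \<alpha>1"] \<alpha> by simp
  let ?c = "n r / a1 * r powr (1 + \<alpha>1)"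
  have i: "integrable lborel (\<lambda>s. ?c * (indicator {r..} s * s powr (- 1 - \<alpha>1)))"
    using hb by (intro integrable_mult_right) (simp add: has_bochner_integral_iff)
  have iR: "integrable lborel (\<lambda>s. indicator {R<..} s * n s)"
    by (rule integrable_indicator_away[OF ld R_pos]) auto
  have "tail_mass n r \<le> (\<integral>s. ?c * (indicator {r..} s * s powr (- 1 - \<alpha>1)) + indicator {R<..} s * n s \<partial>lborel)"
    unfolding tail_mass_def
  proof (rule integral_mono)
    show "integrable lborel (\<lambda>s. indicator {r<..} s * n s)"
      by (rule integrable_indicator_away[OF ld assms(1)]) auto
    show "integrable lborel (\<lambda>s. ?c * (indicator {r..} s * s powr (- 1 - \<alpha>1)) + indicator {R<..} s * n s)"
      using i iR by (rule Bochner_Integration.integrable_add)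
    fix s :: real
    have nn: "0 \<le> ?c * (indicator {r..} s * s powr (- 1 - \<alpha>1))" using a_pos n_nonneg by simp
    show "indicator {r<..} s * n s \<le> ?c * (indicator {r..} s * s powr (- 1 - \<alpha>1)) + indicator {R<..} s * n s"
    proof (cases "r < s \<and> s \<le> R")
      case True
      have "n s \<le> (r / s) powr (1 + \<alpha>1) * n r / a1" using n_scale_le[of r s] True assms by simp
      also have "(r / s) powr (1 + \<alpha>1) = r powr (1 + \<alpha>1) * s powr (- 1 - \<alpha>1)"
      proof -
        have "s powr (- 1 - \<alpha>1) = s powr (- (1 + \<alpha>1))" by simp
        then show ?thesis using True assms by (simp only: powr_minus powr_divide) (simp add: divide_inverse powr_divide)
      qed
      finally show ?thesis using True by (simp add: ac_simps)
    next
      case False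
      then show ?thesis using nn n_nonneg[of s] assms by (auto split: split_indicator)
    qed
  qed
  also have "\<dots> = ?c * (r powr (- \<alpha>1) / \<alpha>1) + tail_mass n R"
    using hb i iR by (simp add: has_bochner_integral_iff tail_mass_def)
  also have "?c * (r powr (- \<alpha>1) / \<alpha>1) = 1 / (a1 * \<alpha>1) * (r powr (1 + \<alpha>1) * r powr (- \<alpha>1) * n r)" by simp
  also have "r powr (1 + \<alpha>1) * r powr (- \<alpha>1) = r" using assms by (simp add: powr_add[symmetric])
  finally have 1: "tail_mass n r \<le> 1 / (a1 * \<alpha>1) * (r * n r) + tail_mass n R" .
  have p: "0 < R * n R" using R_pos n_pos by simp
  have "tail_mass n R = tail_mass n R / (a1 * (R * n R)) * (a1 * (R * n R))" using p a_pos by (intro nonzero_divide_eq_eq[THEN iffD1] refl) auto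
  also have "\<dots> \<le> tail_mass n R / (a1 * (R * n R)) * (r * n r)"
    using rn_ge[OF assms order_refl] p a_pos tail_mass_nonneg[OF ld] by (intro mult_left_mono divide_nonneg_pos) auto
  finally show ?thesis using 1 by (simp add: CT_def distrib_right)
qed

text \<open>The bridge between the exponent and the jumps. The 48 is 6 from the kernel times 8 from
  the part \<open>(r/2, r]\<close> of the second moment.\<close>

lemma lexp_H_scale:
  assumes "0 < r" "r \<le> R"
  shows "lexp_H n (1 / r) \<le> (CV + CT) * (r * n r)" "a1 / 48 * (r * n r) \<le> lexp_H n (1 / r)"
proof -
  have e: "r ^ 3 * n r / r\<^sup>2 = r * n r" using assms by (simp add: power2_eq_square power3_eq_cube)
  have "trunc_moment n r / r\<^sup>2 \<le> CV * (r ^ 3 * n r) / r\<^sup>2" by (intro divide_right_mono trunc_moment_le assms) simp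
  also have "\<dots> = CV * (r * n r)" unfolding e[symmetric] by simp
  finally show "lexp_H n (1 / r) \<le> (CV + CT) * (r * n r)"
    using lexp_H_le_trunc(1)[OF ld assms(1)] tail_mass_le[OF assms] by (simp add: distrib_right)
  have "a1 / 8 * (r * n r) = a1 / 8 * (r ^ 3 * n r) / r\<^sup>2" unfolding e[symmetric] by simp
  also have "\<dots> \<le> trunc_moment n r / r\<^sup>2" by (intro divide_right_mono trunc_moment_ge assms) simp
  finally have "a1 / 8 * (r * n r) / 6 \<le> trunc_moment n r / r\<^sup>2 / 6" by (rule divide_right_mono) simp
  also have "\<dots> \<le> lexp_H n (1 / r)" by (rule lexp_H_le_trunc(2)[OF ld assms(1)])
  finally show "a1 / 48 * (r * n r) \<le> lexp_H n (1 / r)" by simp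
qed

lemma lexp_H_surj:
  assumes "0 < y"
  obtains l where "0 < l" "lexp_H n l = y"
proof -
  have "\<forall>\<^sub>F k in sequentially. lexp n (1 / real (Suc k)) < y"
    by (intro order_tendstoD(2)[OF tendsto_lexp_0[OF ld]] assms)
  then obtain k where k: "lexp n (1 / real (Suc k)) < y" by (auto simp: eventually_sequentially)
  define l0 where "l0 = 1 / real (Suc k)"
  have l0: "0 < l0" "lexp_H n l0 \<le> y"
    using lexp_H_le_lexp[OF ld, of l0] k by (auto simp: l0_def)
  \<comment> \<open>With \<open>r = R / z\<close> the scaling bounds give
    \<open>lexp_H n (1/r) \<ge> c * z powr \<alpha>1\<close>; \<open>z\<close> is then chosen so
    that this is at least \<open>y\<close>.\<close>
  define c where "c = a1 / 48 * (a1 * (R * n R))"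
  have c: "0 < c" using a_pos R_pos n_pos[of R] by (simp add: c_def)
  define z where "z = max 1 ((y / c) powr (1 / \<alpha>1))"
  define r where "r = R / z"
  have z: "1 \<le> z" "y / c \<le> z powr \<alpha>1"
  proof -
    show "1 \<le> z" by (simp add: z_def)
    have "((y / c) powr (1 / \<alpha>1)) powr \<alpha>1 \<le> z powr \<alpha>1"
      using \<alpha> by (intro powr_mono2) (auto simp: z_def)
    then show "y / c \<le> z powr \<alpha>1" using \<alpha> c assms by (simp add: powr_powr)
  qed
  have r: "0 < r" "r \<le> R" using z(1) R_pos by (auto simp: r_def field_simps)
  have "y \<le> c * z powr \<alpha>1" using z(2) c by (simp add: pos_divide_le_eq mult.commute)
  also have "\<dots> \<le> a1 / 48 * (r * n r)"
  proof -
    have rz: "(r / R) powr \<alpha>1 * z powr \<alpha>1 = 1"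
      using z(1) R_pos by (simp add: r_def powr_mult[symmetric])
    have "a1 * (R * n R) \<le> (r / R) powr \<alpha>1 * (r * n r)"
      using rn_scale_le[OF r order_refl] a_pos by (simp add: pos_le_divide_eq mult.commute)
    then have "a1 * (R * n R) * z powr \<alpha>1 \<le> (r / R) powr \<alpha>1 * (r * n r) * z powr \<alpha>1"
      by (rule mult_right_mono) simp
    also have "\<dots> = ((r / R) powr \<alpha>1 * z powr \<alpha>1) * (r * n r)" by (simp only: ac_simps)
    finally have "a1 * (R * n R) * z powr \<alpha>1 \<le> r * n r" unfolding rz by simp
    then have "a1 / 48 * (a1 * (R * n R) * z powr \<alpha>1) \<le> a1 / 48 * (r * n r)"
      using a_pos by (intro mult_left_mono) auto
    then show ?thesis by (simp add: c_def mult.assoc)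
  qed
  also have "\<dots> \<le> lexp_H n (1 / r)" by (rule lexp_H_scale(2)[OF r])
  finally have l1: "y \<le> lexp_H n (max l0 (1 / r))"
    using lexp_H_mono[OF ld, of "1 / r" "max l0 (1 / r)"] r by simp
  have "\<exists>l\<ge>l0. l \<le> max l0 (1 / r) \<and> lexp_H n l = y"
  proof (rule IVT[where f = "lexp_H n"])
    show "lexp_H n l0 \<le> y" "y \<le> lexp_H n (max l0 (1 / r))" by (fact l0(2), fact l1)
    show "\<forall>x. l0 \<le> x \<and> x \<le> max l0 (1 / r) \<longrightarrow> isCont (lexp_H n) x"
      using isCont_lexp_H[OF ld] l0 by (meson less_le_trans)
  qed simp
  then obtain l where "l0 \<le> l" "lexp_H n l = y" by blast
  then show ?thesis using that[of l] l0 by simp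
qed

text \<open>Extends the comparison to \<open>l < 1/R\<close>. There \<open>lexp_H n l\<close> lies
  between \<open>1/T\<close> and its value at \<open>1/R\<close>, and \<open>l\<close> stays away
  from 0, so capping the scale at \<open>R\<close> changes only constants, which depend on
  \<open>T\<close>.\<close>

lemma H_comparison:
  assumes "0 < T"
  obtains c C where "0 < c" "0 < C"
    "\<And>l. 0 < l \<Longrightarrow> 1 / T \<le> lexp_H n l \<Longrightarrow> c * lexp_H n l \<le> min (1 / l) R * n (min (1 / l) R)"
    "\<And>l. 0 < l \<Longrightarrow> 1 / T \<le> lexp_H n l \<Longrightarrow> min (1 / l) R * n (min (1 / l) R) \<le> C * lexp_H n l"
    "\<And>l. 0 < l \<Longrightarrow> 1 / T \<le> lexp_H n l \<Longrightarrow> 1 / l \<le> C * min (1 / l) R"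
proof -
  have "0 < 1 / (2 * T)" using assms by simp
  \<comment> \<open>The level is half of \<open>1/T\<close>: the strict gap lets weak monotonicity
    of \<open>lexp_H\<close> conclude \<open>lT \<le> l\<close>.\<close>
  from lexp_H_surj[OF this] obtain lT where lT: "0 < lT" "lexp_H n lT = 1 / (2 * T)" by auto
  have p: "0 < R * n R" using R_pos n_pos by simp
  have HR: "0 < lexp_H n (1 / R)"
  proof -
    have "0 < a1 / 48 * (R * n R)" using p a_pos by simp
    then show ?thesis using lexp_H_scale(2)[OF R_pos order_refl] by linarith
  qed
  define c where "c = min (1 / (CV + CT)) (R * n R / lexp_H n (1 / R))"
  define C where "C = max (max 1 (1 / (lT * R))) (max (48 / a1) (T * (R * n R)))"
  show ?thesis
  proof
    show "0 < c" using CV_pos CT_pos p HR by (simp add: c_def)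
    show "0 < C" by (simp add: C_def)
    fix l :: real assume l: "0 < l" "1 / T \<le> lexp_H n l"
    have "0 < 1 / T" using assms by simp
    then have HL: "0 < lexp_H n l" using l(2) by (rule less_le_trans)
    show "c * lexp_H n l \<le> min (1 / l) R * n (min (1 / l) R)"
    proof (cases "1 / l \<le> R")
      case True
      have "c * lexp_H n l \<le> 1 / (CV + CT) * lexp_H n l" using HL by (intro mult_right_mono) (auto simp: c_def)
      also have "\<dots> \<le> 1 / l * n (1 / l)"
        using lexp_H_scale(1)[of "1 / l"] True l CV_pos CT_pos by (simp add: pos_divide_le_eq mult.commute)
      finally show ?thesis using True by simp
    next
      case False
      then have "l \<le> 1 / R" using R_pos l by (simp add: field_simps)
      have "c * lexp_H n l \<le> R * n R / lexp_H n (1 / R) * lexp_H n (1 / R)"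
        using lexp_H_mono[OF ld l(1) \<open>l \<le> 1 / R\<close>] HL p HR by (intro mult_mono) (auto simp: c_def)
      then show ?thesis using False HR by simp
    qed
    show "min (1 / l) R * n (min (1 / l) R) \<le> C * lexp_H n l"
    proof (cases "1 / l \<le> R")
      case True
      have "1 / l * n (1 / l) \<le> 48 / a1 * lexp_H n l"
        using lexp_H_scale(2)[of "1 / l"] True l a_pos by (simp add: pos_le_divide_eq mult.commute)
      also have "\<dots> \<le> C * lexp_H n l" using HL by (intro mult_right_mono) (auto simp: C_def)
      finally show ?thesis using True by simp
    next
      case False
      have "R * n R = T * (R * n R) * (1 / T)" using assms by simp
      also have "\<dots> \<le> C * lexp_H n l" using l p assms by (intro mult_mono) (auto simp: C_def)
      finally show ?thesis using False by simp
    qed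
    have "lT \<le> l"
    proof (rule ccontr)
      assume "\<not> lT \<le> l"
      then have "lexp_H n l \<le> 1 / (2 * T)" using lexp_H_mono[OF ld l(1), of lT] lT by simp
      also have "1 / (2 * T) < 1 / T" using assms by (simp add: field_simps)
      finally show False using l by simp
    qed
    then have "1 / l \<le> 1 / lT" using lT by (intro divide_left_mono) auto
    show "1 / l \<le> C * min (1 / l) R"
    proof (cases "1 / l \<le> R")
      case True
      have "1 * (1 / l) \<le> C * (1 / l)" using l by (intro mult_right_mono) (auto simp: C_def)
      then show ?thesis using True by simp
    next
      case False
      have "1 / l \<le> 1 / (lT * R) * R" using \<open>1 / l \<le> 1 / lT\<close> R_pos by simp
      also have "\<dots> \<le> C * R" using R_pos by (intro mult_right_mono) (auto simp: C_def)
      finally show ?thesis using False by simp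
    qed
  qed
qed

end

lemma power_times_exp_le:
  fixes x q :: real
  assumes "0 < x" "0 < q"
  shows "x ^ m * exp (- q * x) \<le> fact m / q ^ m"
proof -
  have "(\<Sum>i\<in>{m}. (q * x) ^ i /\<^sub>R fact i) \<le> (\<Sum>i. (q * x) ^ i /\<^sub>R fact i)"
    using assms by (intro sum_le_suminf[OF summable_exp_generic]) auto
  then have "(q * x) ^ m / fact m \<le> exp (q * x)" by (simp add: exp_def divide_inverse ac_simps)
  then have "(q * x) ^ m \<le> fact m * exp (q * x)" by (simp add: field_simps)
  then have "(q * x) ^ m * exp (- (q * x)) \<le> fact m * exp (q * x) * exp (- (q * x))"
    by (rule mult_right_mono) simp
  also have "\<dots> = fact m" by (simp add: mult.assoc flip: exp_add)
  finally have "q ^ m * (x ^ m * exp (- q * x)) \<le> fact m" by (simp add: power_mult_distrib ac_simps)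
  then show ?thesis using assms by (simp add: pos_le_divide_eq mult.commute)
qed

section \<open>Upper bounds\<close>

lemma levy_density_truncate_le:
  assumes "levy_density \<mu>" "0 \<le> t" "0 \<le> \<sigma>" "A \<in> sets borel"
  shows "levy_density (\<lambda>s. indicator A s * (t * exp (- \<sigma> * s) * \<mu> s))"
proof -
  have "levy_density (\<lambda>s. (indicator A s * (t * exp (- \<sigma> * s))) * \<mu> s)"
    using assms by (intro levy_density_mult[OF assms(1), where C = t]) (auto split: split_indicator simp: mult_left_le)
  then show ?thesis by (simp add: mult.assoc)
qed

lemma jump_density_truncate_le:
  assumes "levy_density \<mu>" "0 \<le> t" "0 \<le> \<sigma>" "A \<in> sets borel" "0 < a" "\<And>s. s \<in> A \<Longrightarrow> a \<le> s"
  shows "jump_density (\<lambda>s. indicator A s * (t * exp (- \<sigma> * s) * \<mu> s))"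
  using jump_density_truncate[OF levy_density_truncate_le[OF assms(1,2,3), of UNIV], of A a] assms by simp

context scaled_levy_density
begin

text \<open>Jumps are exposed one dyadic scale at a time, from large to small: a jump in the scale
  \<open>(r/2, r]\<close> contributes a bounded density, and the probability of seeing none decays
  exponentially in \<open>t r n(r)\<close>.\<close>

lemma dens_bound_scale:
  assumes "0 < \<kappa>"
  obtains C where "0 < C"
    "\<And>t \<sigma> r P. 0 < t \<Longrightarrow> 0 \<le> \<sigma> \<Longrightarrow> 0 < r \<Longrightarrow> r \<le> R \<Longrightarrow> \<sigma> * r \<le> 1 \<Longrightarrow> \<kappa> \<le> t * (r * n r) \<Longrightarrow>
       levy_law P (\<lambda>s. indicator {..r} s * (t * exp (- \<sigma> * s) * n s)) \<Longrightarrow>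
       dens_bound P (C * (1 + t * (r * n r)) / r)"
proof -
  \<comment> \<open>The rate at layer \<open>k\<close> grows like
    \<open>2 powr (k * \<alpha>1)\<close>, so its power of order \<open>M\<close> exceeds a multiple
    of \<open>4 ^ k\<close>. Against the exponential decay in the rate this yields the factor
    \<open>4 ^ k\<close> in the denominator below.\<close>
  obtain M :: nat where M: "2 / \<alpha>1 \<le> real M" using real_arch_simple by blast
  \<comment> \<open>A layer has length half of \<open>\<rho> k\<close>, the tilt costs at most a
    factor 3 there as \<open>\<sigma> * r \<le> 1\<close>, and near-monotonicity costs
    \<open>a1\<close>; together \<open>a1 / 6\<close>.\<close>
  define q where "q = a1 / 6"
  have q: "0 < q" using a_pos by (simp add: q_def)
  define E where "E = fact (Suc M) / q ^ Suc M / (a1 * \<kappa>) ^ M"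
  have E: "0 < E" using q a_pos assms by (simp add: E_def)
  define C1 where "C1 = 64 * a2\<^sup>2 * E"
  define C where "C = max (8 * a2) (2 * C1)"
  have C1: "0 < C1" using E a_pos by (simp add: C1_def)
  show ?thesis
  proof (rule that[of C])
    show "0 < C" using a_pos by (simp add: C_def)
    fix t \<sigma> r P
    assume t: "0 < t" and \<sigma>: "0 \<le> \<sigma>" "\<sigma> * r \<le> 1" and r: "0 < r" "r \<le> R"
      and \<kappa>: "\<kappa> \<le> t * (r * n r)" and P: "levy_law P (\<lambda>s. indicator {..r} s * (t * exp (- \<sigma> * s) * n s))"
    define \<mu> where "\<mu> s = t * exp (- \<sigma> * s) * n s" for s
    define \<rho> where "\<rho> k = r / 2 ^ k" for k :: nat
    define x where "x k = t * (\<rho> k * n (\<rho> k))" for k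
    define f where "f k s = indicator {\<rho> (Suc k)<..\<rho> k} s * \<mu> s" for k s
    define m where "m k = (\<integral>s. f k s \<partial>lborel)" for k
    define D where "D k = 8 * a2 * (t * n (\<rho> k))" for k
    have \<rho>: "0 < \<rho> k" "\<rho> k \<le> r" "\<rho> k \<le> R" "\<rho> (Suc k) = \<rho> k / 2" for k
    proof -
      show "0 < \<rho> k" using r by (simp add: \<rho>_def)
      have "(1::real) \<le> 2 ^ k" by simp
      then show "\<rho> k \<le> r" using r by (simp add: \<rho>_def divide_le_eq mult_left_le mult_le_cancel_left1)
      then show "\<rho> k \<le> R" using r by simp
    qed (simp add: \<rho>_def)
    have np: "0 < n (\<rho> k)" for k using \<rho> n_pos by blast
    have xD: "D k = 8 * a2 * x k / \<rho> k" for k using \<rho>(1)[of k] by (simp add: D_def x_def)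
    have jd: "jump_density (f k)" for k
      unfolding f_def \<mu>_def using t \<sigma> \<rho>[of "Suc k"]
      by (intro jump_density_truncate_le[OF ld, where a = "\<rho> (Suc k)"]) auto
    have ldk: "levy_density (\<lambda>s. indicator {..\<rho> k} s * \<mu> s)" for k
      unfolding \<mu>_def using t \<sigma> by (intro levy_density_truncate_le[OF ld]) auto
    have fD: "f k s \<le> D k" for k s
    proof (cases "\<rho> (Suc k) < s \<and> s \<le> \<rho> k")
      case True
      then have "0 < s" using \<rho>(1)[of "Suc k"] by linarith
      have "n s \<le> 8 * a2 * n (\<rho> k)" using True \<rho>[of k] by (intro n_doubling) auto
      then have "t * exp (- \<sigma> * s) * n s \<le> t * 1 * (8 * a2 * n (\<rho> k))"
        using \<open>0 < s\<close> \<sigma> t n_nonneg by (intro mult_mono) auto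
      then show ?thesis using True by (simp add: f_def \<mu>_def D_def ac_simps)
    next
      case False
      then have "f k s = 0" by (auto simp: f_def)
      then show ?thesis using np[of k] t a_pos by (simp add: D_def)
    qed
    have e1: "1 / 3 \<le> (exp (-1) :: real)" using exp_le by (simp add: exp_minus field_simps)
    have mk: "q * x k \<le> m k" for k
    proof -
      have "q * x k = (\<integral>s. indicator {\<rho> (Suc k)<..\<rho> k} s * (t * (1 / 3) * (a1 * n (\<rho> k))) \<partial>lborel)"
        using \<rho>[of k] by (simp add: q_def x_def)
      also have "\<dots> \<le> m k"
        unfolding m_def
      proof (rule integral_mono[OF _ jump_density.integrable[OF jd]])
        show "integrable lborel (\<lambda>s. indicator {\<rho> (Suc k)<..\<rho> k} s * (t * (1 / 3) * (a1 * n (\<rho> k))))"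
          using \<rho>[of k] by (intro integrable_mult_left integrable_real_indicator) auto
        fix s :: real
        show "indicator {\<rho> (Suc k)<..\<rho> k} s * (t * (1 / 3) * (a1 * n (\<rho> k))) \<le> f k s"
        proof (cases "\<rho> (Suc k) < s \<and> s \<le> \<rho> k")
          case True
          then have "0 < s" "s \<le> r" using \<rho>(1)[of "Suc k"] \<rho>(2)[of k] by linarith+
          have "\<sigma> * s \<le> \<sigma> * r" using \<open>s \<le> r\<close> \<sigma> by (intro mult_left_mono) auto
          then have "exp (-1) \<le> exp (- \<sigma> * s)" using \<sigma> by (simp only: exp_le_cancel_iff)
          then have "1 / 3 \<le> exp (- \<sigma> * s)" using e1 by linarith
          moreover have "a1 * n (\<rho> k) \<le> n s" using True \<open>0 < s\<close> \<rho>[of k] by (intro n_antimono) auto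
          ultimately have "t * (1 / 3) * (a1 * n (\<rho> k)) \<le> t * exp (- \<sigma> * s) * n s"
            using t a_pos n_nonneg by (intro mult_mono) auto
          then show ?thesis using True by (simp add: f_def \<mu>_def)
        next
          case False
          then show ?thesis using jump_density.nonneg[OF jd, of k s] by auto
        qed
      qed
      finally show ?thesis .
    qed
    have xg: "a1 * \<kappa> * 2 powr (real k * \<alpha>1) \<le> x k" for k
    proof -
      have "r * n r \<le> (\<rho> k / r) powr \<alpha>1 * (\<rho> k * n (\<rho> k)) / a1" by (rule rn_scale_le[OF \<rho>(1,2) r(2)])
      moreover have "(\<rho> k / r) powr \<alpha>1 = inverse (2 powr (real k * \<alpha>1))"
        using r by (simp add: \<rho>_def powr_divide powr_powr[symmetric] powr_realpow inverse_eq_divide)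
      ultimately have "a1 * (r * n r) * 2 powr (real k * \<alpha>1) \<le> \<rho> k * n (\<rho> k)"
        using a_pos by (simp add: field_simps)
      then have "t * (a1 * (r * n r) * 2 powr (real k * \<alpha>1)) \<le> x k"
        unfolding x_def using t by (intro mult_left_mono) auto
      moreover have "a1 * 2 powr (real k * \<alpha>1) * \<kappa> \<le> a1 * 2 powr (real k * \<alpha>1) * (t * (r * n r))"
        using \<kappa> a_pos by (intro mult_left_mono) auto
      ultimately show ?thesis by (simp add: ac_simps)
    qed
    have xp: "0 < x k" for k using t \<rho>(1)[of k] np[of k] by (simp add: x_def)
    have decay: "x k * exp (- m k) \<le> E / 4 ^ k" for k
    proof -
      have gen: "X \<le> F / P / 4 ^ k" if "P * 4 ^ k * X \<le> F" "0 < P" for X F P :: real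
        using that by (simp add: field_simps)
      have "x k ^ Suc M * exp (- q * x k) \<le> fact (Suc M) / q ^ Suc M"
        by (rule power_times_exp_le[OF xp q])
      moreover have "(a1 * \<kappa>) ^ M * 4 ^ k \<le> x k ^ M"
      proof -
        have "2 \<le> \<alpha>1 * real M" using M \<alpha> by (simp add: divide_le_eq mult.commute)
        then have "real k * 2 \<le> real k * (\<alpha>1 * real M)" by (rule mult_left_mono) simp
        then have "real k * 2 \<le> real k * \<alpha>1 * real M" by (simp add: mult.assoc)
        have "(4::real) ^ k = 2 powr (real k * 2)"
        proof -
          have "2 powr (real k * 2) = 2 powr real (2 * k)" by (simp add: mult.commute)
          also have "\<dots> = 2 ^ (2 * k)" by (rule powr_realpow) simp
          finally show ?thesis by (simp add: power_mult)
        qed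
        also have "\<dots> \<le> 2 powr (real k * \<alpha>1 * real M)" using \<open>real k * 2 \<le> real k * \<alpha>1 * real M\<close> by (intro powr_mono) auto
        also have "\<dots> = (2 powr (real k * \<alpha>1)) ^ M" by (simp add: powr_powr[symmetric] powr_realpow)
        finally have "(a1 * \<kappa>) ^ M * 4 ^ k \<le> (a1 * \<kappa>) ^ M * (2 powr (real k * \<alpha>1)) ^ M"
          using a_pos assms by (intro mult_left_mono) auto
        also have "\<dots> \<le> x k ^ M"
          using xg[of k] a_pos assms by (simp add: power_mult_distrib[symmetric] power_mono)
        finally show ?thesis .
      qed
      then have "(a1 * \<kappa>) ^ M * 4 ^ k * (x k * exp (- q * x k)) \<le> x k ^ M * (x k * exp (- q * x k))"
        using xp[of k] by (intro mult_right_mono) auto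
      ultimately have "(a1 * \<kappa>) ^ M * 4 ^ k * (x k * exp (- q * x k)) \<le> fact (Suc M) / q ^ Suc M"
        by (simp add: ac_simps del: fact_Suc)
      then have "x k * exp (- q * x k) \<le> E / 4 ^ k"
        unfolding E_def using a_pos assms by (intro gen) auto
      moreover have "x k * exp (- m k) \<le> x k * exp (- q * x k)"
        using mk[of k] xp[of k] by (intro mult_left_mono) auto
      ultimately show ?thesis by linarith
    qed
    \<comment> \<open>The next layer has density of order \<open>x k / \<rho> k\<close>. Half of the
      decay \<open>4 ^ k\<close> compensates \<open>1 / \<rho> k = 2 ^ k / r\<close>, and a
      geometric series remains.\<close>
    have Dk: "exp (- m k) * D (Suc k) \<le> C1 / r / 2 ^ k" for k
    proof -
      have "n (\<rho> (Suc k)) \<le> 8 * a2 * n (\<rho> k)" using \<rho>[of k] \<rho>[of "Suc k"] by (intro n_doubling) auto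
      then have "D (Suc k) \<le> 8 * a2 * (t * (8 * a2 * n (\<rho> k)))"
        unfolding D_def using t a_pos by (intro mult_left_mono) auto
      also have "\<dots> = 64 * a2\<^sup>2 / \<rho> k * x k" using \<rho>(1)[of k] by (simp add: x_def power2_eq_square)
      finally have "exp (- m k) * D (Suc k) \<le> exp (- m k) * (64 * a2\<^sup>2 / \<rho> k * x k)" by (intro mult_left_mono) auto
      also have "\<dots> = 64 * a2\<^sup>2 / \<rho> k * (x k * exp (- m k))" by simp
      also have "\<dots> \<le> 64 * a2\<^sup>2 / \<rho> k * (E / 4 ^ k)"
        using decay[of k] \<rho>(1)[of k] by (intro mult_left_mono) auto
      also have "\<dots> = C1 / r / 2 ^ k"
      proof -
        have "(4::real) ^ k = 2 ^ k * 2 ^ k" by (simp flip: power_mult_distrib)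
        then show ?thesis using r by (simp add: C1_def \<rho>_def field_simps)
      qed
      finally show ?thesis .
    qed
    \<comment> \<open>A law for each truncation level is fixed by choice; uniqueness identifies it
      with the remainder produced by each splitting.\<close>
    define L where "L k = (SOME Q. levy_law Q (\<lambda>s. indicator {..\<rho> k} s * \<mu> s))" for k
    have L: "levy_law (L k) (\<lambda>s. indicator {..\<rho> k} s * \<mu> s)" for k
      unfolding L_def by (rule someI_ex, rule levy_law_exists[OF ldk])
    have P0: "L 0 = P" using levy_law_unique[OF L[of 0]] P by (simp add: \<rho>_def \<mu>_def)
    have split: "indicator {..\<rho> k} s * \<mu> s = indicator {..\<rho> (Suc k)} s * \<mu> s + f k s" for k s
      using \<rho>(1,4)[of k] by (auto simp: f_def split: split_indicator)
    have step: "emeasure (L k) B \<le> ennreal (exp (- m k)) * emeasure (L (Suc k)) B + ennreal (D k) * emeasure lborel B"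
      if B: "B \<in> sets borel" for k B
    proof -
      from levy_law_le_jumps[OF L[of k] ldk[of "Suc k"] jd[of k] split[of k] fD]
      obtain Q where Q: "levy_law Q (\<lambda>s. indicator {..\<rho> (Suc k)} s * \<mu> s)"
        "\<And>B. B \<in> sets borel \<Longrightarrow> emeasure (L k) B \<le>
          ennreal (exp (- m k)) * emeasure Q B + ennreal (D k) * emeasure lborel B"
        unfolding m_def by blast
      show ?thesis using Q(2)[OF B] levy_law_unique[OF Q(1) L] by simp
    qed
    show "dens_bound P (C * (1 + t * (r * n r)) / r)"
      unfolding dens_bound_def
    proof
      fix B :: "real set" assume B: "B \<in> sets borel"
      have x0: "x 0 = t * (r * n r)" by (simp add: x_def \<rho>_def)
      define K where "K k = 8 * a2 * x 0 / r + (\<Sum>j<k. C1 / r / 2 ^ j)" for k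
      \<comment> \<open>The probability of no jump in layer \<open>k\<close> is spent on the density
        of layer \<open>k + 1\<close>. Of the factors in front of the remainder only the last is
        kept; it suffices to make the remainder vanish as \<open>k\<close> grows.\<close>
      have iter: "emeasure P B \<le> ennreal (exp (- m k)) * emeasure (L (Suc k)) B + ennreal (K k) * emeasure lborel B" for k
      proof (induction k)
        case 0
        show ?case using step[OF B, of 0] by (simp add: P0 K_def xD \<rho>_def)
      next
        case (Suc k)
        have "ennreal (exp (- m k)) * emeasure (L (Suc k)) B \<le>
           ennreal (exp (- m k)) * (ennreal (exp (- m (Suc k))) * emeasure (L (Suc (Suc k))) B + ennreal (D (Suc k)) * emeasure lborel B)"
          by (intro mult_left_mono step[OF B]) simp
        also have "\<dots> \<le> ennreal (exp (- m (Suc k))) * emeasure (L (Suc (Suc k))) B + ennreal (C1 / r / 2 ^ k) * emeasure lborel B"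
        proof -
          have "0 \<le> m k" unfolding m_def by (rule jump_density.mass_nonneg[OF jd])
          then have "ennreal (exp (- m k)) * (ennreal (exp (- m (Suc k))) * emeasure (L (Suc (Suc k))) B) \<le>
            1 * (ennreal (exp (- m (Suc k))) * emeasure (L (Suc (Suc k))) B)"
            by (intro mult_right_mono) (auto simp flip: ennreal_1)
          moreover have "ennreal (exp (- m k)) * (ennreal (D (Suc k)) * emeasure lborel B) \<le> ennreal (C1 / r / 2 ^ k) * emeasure lborel B"
            unfolding mult.assoc[symmetric] using Dk[of k]
            by (intro mult_right_mono) (auto simp: ennreal_mult'[symmetric] intro!: ennreal_leI)
          ultimately show ?thesis by (simp add: distrib_left add_mono)
        qed
        finally have "emeasure P B \<le> (ennreal (exp (- m (Suc k))) * emeasure (L (Suc (Suc k))) B + ennreal (C1 / r / 2 ^ k) * emeasure lborel B)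
          + ennreal (K k) * emeasure lborel B"
          using Suc.IH by (meson add_right_mono order_trans)
        moreover have "ennreal (K (Suc k)) = ennreal (C1 / r / 2 ^ k) + ennreal (K k)"
        proof -
          have "0 \<le> K k" using a_pos xp[of 0] r C1 by (auto simp: K_def intro!: add_nonneg_nonneg sum_nonneg)
          moreover have "K (Suc k) = C1 / r / 2 ^ k + K k" by (simp add: K_def)
          moreover have "0 \<le> C1 / r / 2 ^ k" using C1 r by simp
          ultimately show ?thesis by (simp only: ennreal_plus)
        qed
        ultimately show ?case by (simp only: distrib_right add.assoc)
      qed
      have KC: "K k \<le> C * (1 + t * (r * n r)) / r" for k
      proof -
        have "(\<Sum>j<k. C1 / r / 2 ^ j) = C1 / r * (\<Sum>j<k. (1 / 2) ^ j)"
          by (simp add: sum_distrib_left power_divide)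
        also have "\<dots> \<le> C1 / r * 2"
          using C1 r by (intro mult_left_mono) (auto simp: sum_gp_strict)
        finally have "K k \<le> 8 * a2 * x 0 / r + 2 * C1 / r" by (simp add: K_def mult.commute)
        also have "\<dots> = (8 * a2 * x 0 + 2 * C1) / r" by (simp add: add_divide_distrib)
        also have "\<dots> \<le> (C * x 0 + C * 1) / r"
          using r xp[of 0] by (intro divide_right_mono add_mono mult_right_mono) (auto simp: C_def)
        finally show ?thesis by (simp add: x0 algebra_simps)
      qed
      have "emeasure P B \<le> ennreal (E / (a1 * \<kappa>) / 4 ^ k) + ennreal (C * (1 + t * (r * n r)) / r) * emeasure lborel B" for k
      proof -
        have xl: "a1 * \<kappa> \<le> x k"
        proof -
          have "a1 * \<kappa> * 1 \<le> a1 * \<kappa> * 2 powr (real k * \<alpha>1)"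
            using a_pos assms \<alpha> by (intro mult_left_mono ge_one_powr_ge_zero) auto
          then show ?thesis using xg[of k] by simp
        qed
        have "(a1 * \<kappa>) * exp (- m k) \<le> x k * exp (- m k)" using xl by (intro mult_right_mono) auto
        then have "(a1 * \<kappa>) * exp (- m k) \<le> E / 4 ^ k" using decay[of k] by linarith
        then have em: "exp (- m k) \<le> E / (a1 * \<kappa>) / 4 ^ k" using a_pos assms by (simp add: field_simps)
        have "ennreal (exp (- m k)) * emeasure (L (Suc k)) B \<le> ennreal (exp (- m k)) * 1"
          using prob_space.emeasure_le_1[OF levy_lawD(1)[OF L]] by (intro mult_left_mono) auto
        also have "\<dots> \<le> ennreal (E / (a1 * \<kappa>) / 4 ^ k)" using em by (simp add: ennreal_leI)
        finally have 1: "ennreal (exp (- m k)) * emeasure (L (Suc k)) B \<le> ennreal (E / (a1 * \<kappa>) / 4 ^ k)" .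
        have 2: "ennreal (K k) * emeasure lborel B \<le> ennreal (C * (1 + t * (r * n r)) / r) * emeasure lborel B"
          using KC[of k] by (intro mult_right_mono ennreal_leI) auto
        show ?thesis using order_trans[OF iter add_mono[OF 1 2]] .
      qed
      moreover have "(\<lambda>k. ennreal (E / (a1 * \<kappa>) / 4 ^ k) + ennreal (C * (1 + t * (r * n r)) / r) * emeasure lborel B)
        \<longlonglongrightarrow> ennreal 0 + ennreal (C * (1 + t * (r * n r)) / r) * emeasure lborel B"
      proof (intro tendsto_add tendsto_ennrealI tendsto_const)
        have "(\<lambda>k. E / (a1 * \<kappa>) * (1 / 4) ^ k) \<longlonglongrightarrow> E / (a1 * \<kappa>) * 0"
          by (intro tendsto_mult tendsto_const LIMSEQ_power_zero) simp
        then show "(\<lambda>k. E / (a1 * \<kappa>) / 4 ^ k) \<longlonglongrightarrow> 0" by (simp add: power_divide)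
      qed
      ultimately show "emeasure P B \<le> ennreal (C * (1 + t * (r * n r)) / r) * emeasure lborel B"
        by (intro LIMSEQ_le_const[of _ _ "emeasure P B"]) auto
    qed
  qed
qed

end

lemma levy_density_diff:
  assumes "levy_density \<rho>" "levy_density \<mu>" "\<And>s. \<mu> s \<le> \<rho> s"
  shows "levy_density (\<lambda>s. \<rho> s - \<mu> s)"
  using levy_densityD[OF assms(1)] levy_densityD[OF assms(2)] assms(3)
  by (auto simp: levy_density_def right_diff_distrib)

lemma levy_density_scale:
  assumes "levy_density \<mu>" "0 \<le> t"
  shows "levy_density (\<lambda>s. t * \<mu> s)"
  by (rule levy_density_mult[OF assms(1), where C = t]) (use assms in auto)

lemma dens_bound_mono: "dens_bound P K \<Longrightarrow> K \<le> K' \<Longrightarrow> dens_bound P K'"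
  unfolding dens_bound_def by (meson ennreal_leI mult_right_mono order_trans zero_le)

lemma exp_minus_one_le:
  fixes x :: real
  assumes "0 \<le> x"
  shows "exp x - 1 - x \<le> x\<^sup>2 * exp x"
proof -
  have "exp (- x) \<ge> 1 - x" using exp_ge_add_one_self[of "- x"] by simp
  then have "exp x * (1 - x) \<le> exp x * exp (- x)" by (intro mult_left_mono) auto
  then have "exp x - 1 \<le> x * exp x" by (simp add: algebra_simps flip: exp_add)
  then have "x * (exp x - 1) \<le> x * (x * exp x)" using assms by (intro mult_left_mono) auto
  moreover have "exp x - 1 - x \<le> x * (exp x - 1)" using \<open>exp x - 1 \<le> x * exp x\<close> by (simp add: algebra_simps)
  ultimately show ?thesis by (simp add: power2_eq_square)
qed

section \<open>Density bounds at the centre, to its right and to its left\<close>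

context scaled_levy_density
begin

lemma ld_trunc: "0 \<le> t \<Longrightarrow> levy_density (\<lambda>s. indicator {..r} s * (t * n s))"
  using levy_truncate[OF levy_density_scale[OF ld], of t "{..r}"] by simp

text \<open>The jumps up to \<open>v\<close> already give the bound and everything else is a
  convolution factor. Stated for any larger density so that it also covers densities increased by an
  exponential.\<close>

lemma dens_bound_ge:
  assumes "0 < c0"
  obtains C where "0 < C"
    "\<And>t v \<rho> P. 0 < t \<Longrightarrow> 0 < v \<Longrightarrow> v \<le> R \<Longrightarrow> c0 \<le> t * (v * n v) \<Longrightarrow> t * (v * n v) \<le> C0 \<Longrightarrow>
      levy_density \<rho> \<Longrightarrow> (\<And>s. indicator {..v} s * (t * n s) \<le> \<rho> s) \<Longrightarrow> levy_law P \<rho> \<Longrightarrow> dens_bound P (C / v)"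
proof -
  from dens_bound_scale[OF assms] obtain C where C: "0 < C"
    "\<And>t \<sigma> r P. 0 < t \<Longrightarrow> 0 \<le> \<sigma> \<Longrightarrow> 0 < r \<Longrightarrow> r \<le> R \<Longrightarrow> \<sigma> * r \<le> 1 \<Longrightarrow> c0 \<le> t * (r * n r) \<Longrightarrow>
       levy_law P (\<lambda>s. indicator {..r} s * (t * exp (- \<sigma> * s) * n s)) \<Longrightarrow>
       dens_bound P (C * (1 + t * (r * n r)) / r)" by blast
  show ?thesis
  proof (rule that[of "C * (1 + \<bar>C0\<bar>)"])
    show "0 < C * (1 + \<bar>C0\<bar>)" using C(1) by (intro mult_pos_pos) auto
    fix t v \<rho> P
    assume t: "0 < t" and v: "0 < v" "v \<le> R" and cv: "c0 \<le> t * (v * n v)" "t * (v * n v) \<le> C0"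
      and \<rho>: "levy_density \<rho>" "\<And>s. indicator {..v} s * (t * n s) \<le> \<rho> s" and P: "levy_law P \<rho>"
    let ?\<mu> = "\<lambda>s. indicator {..v} s * (t * n s)"
    have l: "levy_density ?\<mu>" using t by (intro ld_trunc) auto
    obtain Q where Q: "levy_law Q ?\<mu>" using levy_law_exists[OF l] by auto
    have "dens_bound Q (C * (1 + t * (v * n v)) / v)"
      using C(2)[of t 0 v Q] t v cv Q by simp
    then have Qb: "dens_bound Q (C * (1 + \<bar>C0\<bar>) / v)"
      by (rule dens_bound_mono) (use C(1) v cv in \<open>auto intro!: divide_right_mono mult_left_mono\<close>)
    show "dens_bound P (C * (1 + \<bar>C0\<bar>) / v)"
      by (rule dens_bound_add[OF P levy_density_diff[OF \<rho>(1) l \<rho>(2)] l Q _ Qb]) simp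
  qed
qed

text \<open>Near-monotonicity beyond \<open>R\<close> rests on the bound \<open>a3\<close> only,
  which is measured against \<open>n R\<close>; this is the second summand.\<close>

definition "D0 = 1 / a1 + a3 / (a1 * n R)"

lemma D0_pos: "0 < D0" using a_pos n_pos[of R] R_pos by (simp add: D0_def add_pos_pos)

lemma n_le_D0:
  assumes "0 < r" "r \<le> R" "r \<le> s"
  shows "n s \<le> D0 * n r"
proof (cases "s \<le> R")
  case True
  have "n s \<le> 1 / a1 * n r" using n_antimono[OF assms(1,3) True] a_pos by (simp add: pos_le_divide_eq mult.commute)
  also have "\<dots> \<le> D0 * n r"
    using a_pos n_nonneg by (intro mult_right_mono) (auto simp: D0_def)
  finally show ?thesis .
next
  case False
  have p: "0 < n R" using n_pos R_pos by simp
  have "n s \<le> a3" using n_le False by simp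
  also have "a3 = a3 / (a1 * n R) * (a1 * n R)" using p a_pos by simp
  also have "\<dots> \<le> a3 / (a1 * n R) * n r"
    using n_antimono[OF assms(1,2) order_refl] p a_pos by (intro mult_left_mono) auto
  also have "\<dots> \<le> D0 * n r"
    using a_pos n_nonneg by (intro mult_right_mono) (auto simp: D0_def)
  finally show ?thesis .
qed

lemma integrable_first_moment: "integrable lborel (\<lambda>s. (indicator {..r} s * s) * n s)"
proof (rule levy_integrable[OF ld, where C = "1 + \<bar>r\<bar>"])
  fix s :: real assume "0 < s"
  then show "\<bar>indicator {..r} s * s\<bar> \<le> (1 + \<bar>r\<bar>) * min 1 s"
    by (auto simp: min_def algebra_simps split: split_indicator)
qed measurable

text \<open>The centre \<open>t * lexp_deriv n h\<close> damps large jumps smoothly, whereas here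
  they are cut at \<open>r\<close>. Below \<open>v\<close> the two differ by at most
  \<open>h\<close> times the second moment, and between \<open>v\<close> and \<open>r\<close> by at
  most \<open>r\<close> times the tail.\<close>

lemma truncated_mean_le:
  assumes t: "0 < t" and h: "0 < h" and v: "0 < v" "v \<le> r" "v \<le> R" and hv: "h * v \<le> 1"
    and C0: "t * (v * n v) \<le> C0"
  shows "t * (\<integral>s. (indicator {..r} s * s) * n s \<partial>lborel) - t * lexp_deriv n h \<le> CV * C0 * v + CT * C0 * r"
proof -
  have i1: "integrable lborel (\<lambda>s. (indicator {..v} s * s\<^sup>2) * n s)" by (rule integrable_trunc_moment[OF ld])
  have i2: "integrable lborel (\<lambda>s. indicator {v<..} s * n s)" by (rule integrable_indicator_away[OF ld v(1)]) auto
  have "(\<integral>s. (indicator {..r} s * s) * n s \<partial>lborel) - lexp_deriv n h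
      = (\<integral>s. (indicator {..r} s * s) * n s - s * exp (- h * s) * n s \<partial>lborel)"
    unfolding lexp_deriv_def
    by (rule Bochner_Integration.integral_diff[symmetric, OF integrable_first_moment integrable_lexp_deriv[OF ld h]])
  also have "\<dots> \<le> (\<integral>s. h * ((indicator {..v} s * s\<^sup>2) * n s) + r * (indicator {v<..} s * n s) \<partial>lborel)"
  proof (rule integral_mono)
    show "integrable lborel (\<lambda>s. indicator {..r} s * s * n s - s * exp (- h * s) * n s)"
      by (rule Bochner_Integration.integrable_diff[OF integrable_first_moment integrable_lexp_deriv[OF ld h]])
    show "integrable lborel (\<lambda>s. h * ((indicator {..v} s * s\<^sup>2) * n s) + r * (indicator {v<..} s * n s))"
      using i1 i2 by (intro Bochner_Integration.integrable_add integrable_mult_right)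
    fix s :: real
    consider "s \<le> 0" | "0 < s" "s \<le> v" | "v < s" "s \<le> r" | "r < s" "v < s" using v by linarith
    then show "indicator {..r} s * s * n s - s * exp (- h * s) * n s
      \<le> h * ((indicator {..v} s * s\<^sup>2) * n s) + r * (indicator {v<..} s * n s)"
    proof cases
      case 1 then show ?thesis using n_nonpos[of s] by simp
    next
      case 2
      have "1 - h * s \<le> exp (- h * s)" using exp_ge_add_one_self[of "- h * s"] by simp
      then have "(s * n s) * (1 - h * s) \<le> (s * n s) * exp (- h * s)"
        using 2 n_nonneg by (intro mult_left_mono) auto
      then show ?thesis using 2 v by (simp add: algebra_simps power2_eq_square)
    next
      case 3
      have "s * n s \<le> r * n s" using 3 n_nonneg by (intro mult_right_mono) auto
      moreover have "0 \<le> s * exp (- h * s) * n s" using 3 v n_nonneg by simp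
      ultimately show ?thesis using 3 by simp
    next
      case 4
      have "0 \<le> s * exp (- h * s) * n s" "0 \<le> r * n s" using 4 v n_nonneg by simp_all
      then show ?thesis using 4 by simp
    qed
  qed
  also have "\<dots> = h * trunc_moment n v + r * tail_mass n v"
    using i1 i2 by (simp add: trunc_moment_def tail_mass_def)
  finally have "t * ((\<integral>s. (indicator {..r} s * s) * n s \<partial>lborel) - lexp_deriv n h) \<le> t * (h * trunc_moment n v + r * tail_mass n v)"
    using t by (intro mult_left_mono) auto
  also have "\<dots> \<le> t * (h * (CV * (v ^ 3 * n v)) + r * (CT * (v * n v)))"
    using t h v by (intro mult_left_mono add_mono trunc_moment_le tail_mass_le) auto
  also have "\<dots> = (CV * v) * ((h * v) * (t * (v * n v))) + (CT * r) * (t * (v * n v))"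
    by (simp add: algebra_simps power3_eq_cube)
  also have "\<dots> \<le> (CV * v) * (1 * C0) + (CT * r) * C0"
    using CV_pos CT_pos v h t hv C0 n_nonneg by (intro add_mono mult_left_mono mult_mono) auto
  finally show ?thesis by (simp add: algebra_simps)
qed

text \<open>Chernoff bound for the jumps up to \<open>r\<close>. The tilt \<open>\<theta> \<approx> ln (r/v) / r\<close> is the largest
  one for which the exponential moment stays bounded.\<close>

lemma small_jumps_bound:
  assumes "0 < c0" "0 < C0"
  obtains k K C where "1 \<le> k" "1 \<le> K" "0 < C"
    "\<And>t h v r y Q B. 0 < t \<Longrightarrow> 0 < h \<Longrightarrow> 0 < v \<Longrightarrow> v \<le> r \<Longrightarrow> r \<le> R \<Longrightarrow> c0 \<le> t * (v * n v) \<Longrightarrow> t * (v * n v) \<le> C0 \<Longrightarrow>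
      h * v \<le> 1 \<Longrightarrow> k * r \<le> y \<Longrightarrow> K * v \<le> y \<Longrightarrow> levy_law Q (\<lambda>s. indicator {..r} s * (t * n s)) \<Longrightarrow>
      B \<in> sets borel \<Longrightarrow> (\<And>u. u \<in> B \<Longrightarrow> t * lexp_deriv n h + y \<le> u) \<Longrightarrow>
      emeasure Q B \<le> ennreal (C * (t * n r) * exp (- y / (2 * r))) * emeasure lborel B"
proof -
  from dens_bound_ge[OF assms(1), of C0] obtain C1 where C1: "0 < C1"
    "\<And>t v \<rho> P. 0 < t \<Longrightarrow> 0 < v \<Longrightarrow> v \<le> R \<Longrightarrow> c0 \<le> t * (v * n v) \<Longrightarrow> t * (v * n v) \<le> C0 \<Longrightarrow>
      levy_density \<rho> \<Longrightarrow> (\<And>s. indicator {..v} s * (t * n s) \<le> \<rho> s) \<Longrightarrow> levy_law P \<rho> \<Longrightarrow> dens_bound P (C1 / v)" by blast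
  \<comment> \<open>Half of \<alpha>1: with \<open>exp (- z) = (v / r) powr \<beta>\<close> the
    decay of the rate supplies \<open>exp (- 2 * z)\<close>. One factor cancels \<open>exp z\<close>
    from the tilt, the other absorbs the polynomial in \<open>z\<close>.\<close>
  define \<beta> where "\<beta> = \<alpha>1 / 2"
  have \<beta>: "0 < \<beta>" using \<alpha> by (simp add: \<beta>_def)
  \<comment> \<open>The multiples of \<open>CT * C0\<close> here and of \<open>CV * C0\<close> in
    \<open>K\<close> keep each part of the shift of the mean below \<open>y / 4\<close>. The last
    entry turns \<open>z * y / (2 * r)\<close> into at least
    \<open>(1 + \<alpha>2) * ln (r / v)\<close>.\<close>
  define k where "k = max (max 1 (4 * CT * C0)) (2 * (1 + \<alpha>2) / \<beta>)"
  define K where "K = max 1 (4 * CV * C0)"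
  \<comment> \<open>The 12 is 3, a bound of \<open>exp 1\<close>, times 4, a bound of
    \<open>(1 + z)\<^sup>2 * exp (- z)\<close>.\<close>
  define Ci where "Ci = CV * (C0 / a1) * 12"
  define C where "C = C1 * exp Ci * (a2 / c0)"
  show ?thesis
  proof (rule that[of k K C])
    show "1 \<le> k" "1 \<le> K" by (auto simp: k_def K_def)
    show "0 < C" using C1 a_pos assms by (simp add: C_def)
    fix t h v r y Q B
    assume t: "0 < t" and h: "0 < h" and v: "0 < v" "v \<le> r" "r \<le> R"
      and cv: "c0 \<le> t * (v * n v)" "t * (v * n v) \<le> C0" and hv: "h * v \<le> 1"
      and ky: "k * r \<le> y" and Ky: "K * v \<le> y" and Q: "levy_law Q (\<lambda>s. indicator {..r} s * (t * n s))"
      and B: "B \<in> sets borel" and x: "\<And>u. u \<in> B \<Longrightarrow> t * lexp_deriv n h + y \<le> u"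
    have r: "0 < r" "v \<le> R" using v by auto
    define z where "z = \<beta> * ln (r / v)"
    define \<theta> where "\<theta> = (1 + z) / r"
    have z: "0 \<le> z" using \<beta> v by (simp add: z_def)
    have \<theta>: "0 < \<theta>" "\<theta> * r = 1 + z" using z r by (simp_all add: \<theta>_def)
    let ?\<mu> = "\<lambda>s. indicator {..r} s * (t * n s)"
    let ?\<rho> = "\<lambda>s. exp (\<theta> * s) * ?\<mu> s"
    have l\<mu>: "levy_density ?\<mu>" using t by (intro ld_trunc) auto
    have l\<rho>: "levy_density ?\<rho>"
    proof (rule levy_density_mult[OF l\<mu>, where C = "exp (\<theta> * r)"])
      fix s :: real assume "?\<mu> s \<noteq> 0"
      then have "s \<le> r" by (auto split: split_indicator_asm)
      then have "\<theta> * s \<le> \<theta> * r" using \<theta>(1) by (intro mult_left_mono) auto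
      then show "exp (\<theta> * s) \<le> exp (\<theta> * r)" by simp
    qed auto
    have ge: "indicator {..v} s * (t * n s) \<le> ?\<rho> s" for s
    proof (cases "0 < s \<and> s \<le> v")
      case True
      have "1 * (t * n s) \<le> exp (\<theta> * s) * (t * n s)"
        using True \<theta> t n_nonneg by (intro mult_right_mono) auto
      then show ?thesis using True v by simp
    qed (use n_nonpos[of s] t n_nonneg[of s] in auto)
    have i1: "integrable lborel (\<lambda>s. (indicator {..r} s * s) * n s)" by (rule integrable_first_moment)
    have i2: "integrable lborel (\<lambda>s. (indicator {..r} s * s\<^sup>2) * n s)" by (rule integrable_trunc_moment[OF ld])
    have Lle: "lexp ?\<rho> \<theta> \<le> t * (\<theta> * (\<integral>s. (indicator {..r} s * s) * n s \<partial>lborel)) + t * (\<theta>\<^sup>2 * exp (1 + z) * trunc_moment n r)"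
    proof -
      have "lexp ?\<rho> \<theta> \<le> (\<integral>s. t * (\<theta> * ((indicator {..r} s * s) * n s)) + t * (\<theta>\<^sup>2 * exp (1 + z) * ((indicator {..r} s * s\<^sup>2) * n s)) \<partial>lborel)"
        unfolding lexp_def
      proof (rule integral_mono[OF integrable_lexp[OF l\<rho>]])
        show "integrable lborel (\<lambda>s. t * (\<theta> * ((indicator {..r} s * s) * n s)) + t * (\<theta>\<^sup>2 * exp (1 + z) * ((indicator {..r} s * s\<^sup>2) * n s)))"
          by (intro Bochner_Integration.integrable_add integrable_mult_right i1 i2)
        fix s :: real
        show "(1 - exp (- \<theta> * s)) * ?\<rho> s \<le> t * (\<theta> * ((indicator {..r} s * s) * n s)) + t * (\<theta>\<^sup>2 * exp (1 + z) * ((indicator {..r} s * s\<^sup>2) * n s))"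
        proof (cases "0 < s \<and> s \<le> r")
          case True
          have "\<theta> * s \<le> \<theta> * r" using True \<theta> by (intro mult_left_mono) auto
          then have ez: "exp (\<theta> * s) \<le> exp (1 + z)" using \<theta> by simp
          have "exp (\<theta> * s) - 1 \<le> \<theta> * s + (\<theta> * s)\<^sup>2 * exp (\<theta> * s)"
            using exp_minus_one_le[of "\<theta> * s"] True \<theta> by simp
          also have "\<dots> \<le> \<theta> * s + (\<theta> * s)\<^sup>2 * exp (1 + z)" by (intro add_left_mono mult_left_mono ez) simp
          finally have "(exp (\<theta> * s) - 1) * (t * n s) \<le> (\<theta> * s + (\<theta> * s)\<^sup>2 * exp (1 + z)) * (t * n s)"
            using t n_nonneg by (intro mult_right_mono) auto
          moreover have "(1 - exp (- \<theta> * s)) * exp (\<theta> * s) = exp (\<theta> * s) - 1"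
            by (simp add: algebra_simps flip: exp_add)
          ultimately show ?thesis using True by (simp add: mult.assoc[symmetric]) (simp add: algebra_simps power_mult_distrib)
        next
          case False
          then have "n s = 0 \<or> r < s" using n_nonpos[of s] by auto
          then show ?thesis by auto
        qed
      qed (use \<theta> in simp)
      also have "\<dots> = t * (\<theta> * (\<integral>s. (indicator {..r} s * s) * n s \<partial>lborel)) + t * (\<theta>\<^sup>2 * exp (1 + z) * trunc_moment n r)"
        using i1 i2 by (simp add: trunc_moment_def)
      finally show ?thesis .
    qed
    have rv: "(v / r) powr \<beta> = exp (- z)"
      using v r by (simp add: powr_def z_def ln_div algebra_simps)
    have quad: "t * (\<theta>\<^sup>2 * exp (1 + z) * trunc_moment n r) \<le> Ci"
    proof -
      have rvz: "(v / r) powr \<alpha>1 = exp (- z) * exp (- z)"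
        using rv \<beta> by (simp add: \<beta>_def powr_add[symmetric] flip: rv)
      have "\<theta>\<^sup>2 * trunc_moment n r \<le> \<theta>\<^sup>2 * (CV * (r ^ 3 * n r))"
        using r v by (intro mult_left_mono trunc_moment_le) auto
      also have "\<dots> = CV * ((\<theta> * r)\<^sup>2 * (r * n r))" by (simp add: power2_eq_square power3_eq_cube)
      finally have "t * (\<theta>\<^sup>2 * trunc_moment n r) \<le> t * (CV * ((1 + z)\<^sup>2 * (r * n r)))"
        unfolding \<theta>(2) using t by (intro mult_left_mono) auto
      also have "\<dots> = CV * (1 + z)\<^sup>2 * (t * (r * n r))" by simp
      also have "t * (r * n r) \<le> t * ((v / r) powr \<alpha>1 * (v * n v) / a1)"
        using t v by (intro mult_left_mono rn_scale_le) auto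
      also have "\<dots> = (v / r) powr \<alpha>1 * (t * (v * n v)) / a1" by simp
      also have "\<dots> \<le> (v / r) powr \<alpha>1 * C0 / a1"
        using cv a_pos by (intro divide_right_mono mult_left_mono) auto
      finally have "t * (\<theta>\<^sup>2 * trunc_moment n r) \<le> CV * (1 + z)\<^sup>2 * ((v / r) powr \<alpha>1 * C0 / a1)"
        using CV_pos by (simp add: mult_left_mono)
      then have "exp (1 + z) * (t * (\<theta>\<^sup>2 * trunc_moment n r)) \<le> exp (1 + z) * (CV * (1 + z)\<^sup>2 * ((v / r) powr \<alpha>1 * C0 / a1))"
        by (intro mult_left_mono) auto
      also have "\<dots> = CV * (C0 / a1) * (exp 1 * ((1 + z)\<^sup>2 * exp (- z)))"
        unfolding rvz by (simp add: exp_add exp_minus field_simps)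
      also have "\<dots> \<le> CV * (C0 / a1) * (3 * 4)"
      proof (intro mult_left_mono mult_mono)
        have "(1 + z / 2)\<^sup>2 \<le> (exp (z / 2))\<^sup>2" using z exp_ge_add_one_self[of "z / 2"] by (intro power_mono) auto
        also have "(exp (z / 2))\<^sup>2 = exp z" by (simp add: power2_eq_square flip: exp_add)
        finally have "(1 + z)\<^sup>2 \<le> 4 * exp z" using z by (simp add: power2_eq_square algebra_simps)
        then have "(1 + z)\<^sup>2 * exp (- z) \<le> 4 * exp z * exp (- z)" by (intro mult_right_mono) auto
        moreover have "4 * exp z * exp (- z) = 4" by (simp add: mult.assoc flip: exp_add)
        ultimately show "(1 + z)\<^sup>2 * exp (- z) \<le> 4" by simp
      qed (use exp_le CV_pos a_pos assms in auto)
      finally show ?thesis by (simp add: Ci_def ac_simps)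
    qed
    have mean: "t * (\<integral>s. (indicator {..r} s * s) * n s \<partial>lborel) - t * lexp_deriv n h \<le> y / 2"
    proof -
      have "CV * C0 * v \<le> K * v / 4" using v by (simp add: K_def)
      moreover have "CT * C0 * r \<le> k * r / 4" using r by (simp add: k_def max_def)
      ultimately show ?thesis using truncated_mean_le[OF t h v(1,2) r(2) hv cv(2)] ky Ky by simp
    qed
    have y: "k \<le> y / r" using ky r by (simp add: pos_le_divide_eq)
    have "lexp ?\<rho> \<theta> - \<theta> * (t * lexp_deriv n h + y) \<le> Ci + \<theta> * (y / 2) - \<theta> * y"
      using Lle quad mult_left_mono[OF mean, of \<theta>] \<theta> by (simp add: algebra_simps)
    also have "\<dots> = Ci - y / (2 * r) - z * (y / r) / 2" using r by (simp add: \<theta>_def field_simps)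
    also have "\<dots> \<le> Ci - y / (2 * r) - z * k / 2" using mult_left_mono[OF y z] by (intro diff_left_mono divide_right_mono) auto
    also have "\<dots> \<le> Ci - y / (2 * r) - (1 + \<alpha>2) * ln (r / v)"
    proof -
      have "2 * (1 + \<alpha>2) / \<beta> \<le> k" by (simp add: k_def)
      then have "2 * (1 + \<alpha>2) \<le> k * \<beta>" using \<beta> by (simp add: pos_divide_le_eq)
      then have "2 * (1 + \<alpha>2) * ln (r / v) \<le> k * \<beta> * ln (r / v)" using v by (intro mult_right_mono) auto
      then show ?thesis by (simp add: z_def algebra_simps)
    qed
    finally have ex: "exp (lexp ?\<rho> \<theta> - \<theta> * (t * lexp_deriv n h + y)) \<le> exp Ci * exp (- y / (2 * r)) * (v / r) powr (1 + \<alpha>2)"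
    proof -
      assume "lexp ?\<rho> \<theta> - \<theta> * (t * lexp_deriv n h + y) \<le> Ci - y / (2 * r) - (1 + \<alpha>2) * ln (r / v)"
      then have "exp (lexp ?\<rho> \<theta> - \<theta> * (t * lexp_deriv n h + y)) \<le> exp (Ci - y / (2 * r) - (1 + \<alpha>2) * ln (r / v))" by simp
      also have "\<dots> = exp Ci * exp (- y / (2 * r)) * exp (- ((1 + \<alpha>2) * ln (r / v)))"
        by (simp add: exp_add[symmetric])
      also have "exp (- ((1 + \<alpha>2) * ln (r / v))) = (v / r) powr (1 + \<alpha>2)"
        using v r by (simp add: powr_def ln_div algebra_simps)
      finally show ?thesis .
    qed
    have "emeasure Q B \<le> ennreal (C1 / v * exp (lexp ?\<rho> \<theta> - \<theta> * (t * lexp_deriv n h + y))) * emeasure lborel B"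
    proof (rule untilt_bound[OF l\<rho> Q])
      fix Q' assume "levy_law Q' ?\<rho>"
      then show "dens_bound Q' (C1 / v)" by (rule C1(2)[OF t v(1) r(2) cv l\<rho> ge])
    qed (use \<theta> C1(1) v B x in auto)
    also have "\<dots> \<le> ennreal (C * (t * n r) * exp (- y / (2 * r))) * emeasure lborel B"
    proof (intro mult_right_mono ennreal_leI)
      have "C1 / v * exp (lexp ?\<rho> \<theta> - \<theta> * (t * lexp_deriv n h + y)) \<le> C1 / v * (exp Ci * exp (- y / (2 * r)) * (v / r) powr (1 + \<alpha>2))"
        using ex C1(1) v by (intro mult_left_mono) auto
      also have "\<dots> = C1 * exp Ci * exp (- y / (2 * r)) * ((v / r) powr (1 + \<alpha>2) * (1 / v))" by simp
      \<comment> \<open>The lower bound \<open>c0\<close> of the rate at \<open>v\<close> replaces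
        \<open>1 / v\<close> by a multiple of \<open>t * n v\<close>, and the power of
        \<open>v / r\<close> gained from the tilt carries \<open>n v\<close> down to
        \<open>n r\<close>.\<close>
      also have "(v / r) powr (1 + \<alpha>2) * (1 / v) \<le> (v / r) powr (1 + \<alpha>2) * (t * n v / c0)"
        using cv v assms by (intro mult_left_mono) (auto simp: field_simps)
      also have "(v / r) powr (1 + \<alpha>2) * (t * n v / c0) = t * a2 / c0 * ((v / r) powr (1 + \<alpha>2) * n v / a2)" using a_pos by simp
      also have "\<dots> \<le> t * a2 / c0 * n r"
        using n_scale_ge[OF v] t a_pos assms by (intro mult_left_mono) auto
      finally have "C1 / v * exp (lexp ?\<rho> \<theta> - \<theta> * (t * lexp_deriv n h + y)) \<le> C1 * exp Ci * exp (- y / (2 * r)) * (t * a2 / c0 * n r)"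
        using C1(1) by (simp add: mult_left_mono)
      then show "C1 / v * exp (lexp ?\<rho> \<theta> - \<theta> * (t * lexp_deriv n h + y)) \<le> C * (t * n r) * exp (- y / (2 * r))"
        by (simp add: C_def ac_simps)
    qed simp
    finally show "emeasure Q B \<le> ennreal (C * (t * n r) * exp (- y / (2 * r))) * emeasure lborel B" .
  qed
qed

text \<open>\<open>h\<close> is \<open>H\<^sup>-\<^sup>1(1/t)\<close>, and \<open>v\<close> is the
  jump size that occurs about once up to time \<open>t\<close>, capped where scaling ends.\<close>

definition tscale :: "real \<Rightarrow> real \<Rightarrow> real \<Rightarrow> bool" where
  "tscale t h v \<longleftrightarrow> 0 < t \<and> 0 < h \<and> lexp_H n h = 1 / t \<and> v = min (1 / h) R"

text \<open>Uniformly in \<open>t \<le> T\<close> the jump rate at \<open>v\<close> is of order one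
  and \<open>v\<close> is comparable to \<open>1 / h\<close>, despite the cap.\<close>

lemma tscale_facts:
  assumes "0 < T"
  obtains c0 C0 where "0 < c0" "0 < C0"
    "\<And>t h v. t \<le> T \<Longrightarrow> tscale t h v \<Longrightarrow> 0 < t \<and> 0 < h \<and> 0 < v \<and> v \<le> R \<and> c0 \<le> t * (v * n v) \<and> t * (v * n v) \<le> C0 \<and>
       h * v \<le> 1 \<and> 1 / h \<le> C0 * v"
proof -
  from H_comparison[OF assms] obtain c C where cC: "0 < c" "0 < C"
    "\<And>l. 0 < l \<Longrightarrow> 1 / T \<le> lexp_H n l \<Longrightarrow> c * lexp_H n l \<le> min (1 / l) R * n (min (1 / l) R)"
    "\<And>l. 0 < l \<Longrightarrow> 1 / T \<le> lexp_H n l \<Longrightarrow> min (1 / l) R * n (min (1 / l) R) \<le> C * lexp_H n l"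
    "\<And>l. 0 < l \<Longrightarrow> 1 / T \<le> lexp_H n l \<Longrightarrow> 1 / l \<le> C * min (1 / l) R" by blast
  show ?thesis
  proof (rule that[OF cC(1,2)])
    fix t h v assume t: "t \<le> T" "tscale t h v"
    then have h: "0 < t" "0 < h" "lexp_H n h = 1 / t" "v = min (1 / h) R" by (auto simp: tscale_def)
    have le: "1 / T \<le> lexp_H n h" using h t assms by (simp add: frac_le)
    have hv: "h * v \<le> h * (1 / h)" using h by (intro mult_left_mono) auto
    from cC(3-5)[OF h(2) le] show "0 < t \<and> 0 < h \<and> 0 < v \<and> v \<le> R \<and> c \<le> t * (v * n v) \<and> t * (v * n v) \<le> C \<and>
       h * v \<le> 1 \<and> 1 / h \<le> C * v"
      unfolding h(4)[symmetric] h(3) using h R_pos hv by (auto simp: field_simps)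
  qed
qed

lemma upper_sup:
  assumes "0 < T"
  obtains C where "0 < C"
    "\<And>t h v P. t \<le> T \<Longrightarrow> tscale t h v \<Longrightarrow> levy_law P (\<lambda>s. t * n s) \<Longrightarrow> dens_bound P (C * h)"
proof -
  from tscale_facts[OF assms] obtain c0 C0 where c0: "0 < c0" "0 < C0"
    "\<And>t h v. t \<le> T \<Longrightarrow> tscale t h v \<Longrightarrow> 0 < t \<and> 0 < h \<and> 0 < v \<and> v \<le> R \<and> c0 \<le> t * (v * n v) \<and> t * (v * n v) \<le> C0 \<and>
       h * v \<le> 1 \<and> 1 / h \<le> C0 * v" by blast
  from dens_bound_ge[OF c0(1), of C0] obtain C where C: "0 < C"
    "\<And>t v \<rho> P. 0 < t \<Longrightarrow> 0 < v \<Longrightarrow> v \<le> R \<Longrightarrow> c0 \<le> t * (v * n v) \<Longrightarrow> t * (v * n v) \<le> C0 \<Longrightarrow>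
      levy_density \<rho> \<Longrightarrow> (\<And>s. indicator {..v} s * (t * n s) \<le> \<rho> s) \<Longrightarrow> levy_law P \<rho> \<Longrightarrow> dens_bound P (C / v)" by blast
  show ?thesis
  proof (rule that[of "C * C0"])
    show "0 < C * C0" using C c0 by simp
    fix t h v P assume t: "t \<le> T" "tscale t h v" and P: "levy_law P (\<lambda>s. t * n s)"
    note f = c0(3)[OF t]
    have "dens_bound P (C / v)"
      by (rule C(2)[OF _ _ _ _ _ levy_density_scale[OF ld] _ P])
         (use f n_nonneg in \<open>auto split: split_indicator\<close>)
    moreover have "C / v \<le> C * C0 * h"
    proof -
      have "0 < h" "1 / h \<le> C0 * v" using f by auto
      then have "1 \<le> C0 * v * h" by (simp add: pos_divide_le_eq)
      then have "1 / v \<le> C0 * h" using f by (simp add: pos_divide_le_eq ac_simps)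
      then have "C * (1 / v) \<le> C * (C0 * h)" using C by (intro mult_left_mono) auto
      then show ?thesis by (simp add: mult.assoc)
    qed
    ultimately show "dens_bound P (C * C0 * h)" by (rule dens_bound_mono)
  qed
qed

lemma split_at:
  assumes "0 < t" "0 < r" "levy_law P (\<lambda>s. t * n s)"
  shows "jump_density (\<lambda>s. indicator {r<..} s * (t * n s))" "levy_density (\<lambda>s. indicator {..r} s * (t * n s))"
    "t * n s = indicator {..r} s * (t * n s) + indicator {r<..} s * (t * n s)"
proof -
  show "jump_density (\<lambda>s. indicator {r<..} s * (t * n s))"
    using jump_density_truncate[OF levy_density_scale[OF ld], of t "{r<..}" r] assms by auto
  show "levy_density (\<lambda>s. indicator {..r} s * (t * n s))" using assms by (intro ld_trunc) auto
qed (auto split: split_indicator)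

text \<open>For \<open>y\<close> up to a multiple of \<open>v\<close>, \<open>t * n y\<close> is at
  least a multiple of \<open>h\<close> and the uniform bound suffices. For larger \<open>y\<close>
  the jumps are split at a fixed fraction of \<open>y\<close>.\<close>

lemma upper_right:
  assumes "0 < T"
  obtains C where "0 < C"
    "\<And>t h v P y B. t \<le> T \<Longrightarrow> tscale t h v \<Longrightarrow> levy_law P (\<lambda>s. t * n s) \<Longrightarrow> 0 < y \<Longrightarrow> y \<le> R \<Longrightarrow>
       B \<in> sets borel \<Longrightarrow> (\<And>u. u \<in> B \<Longrightarrow> t * lexp_deriv n h + y \<le> u) \<Longrightarrow>
       emeasure P B \<le> ennreal (C * (t * n y)) * emeasure lborel B"
proof -
  from tscale_facts[OF assms] obtain c0 C0 where c0: "0 < c0" "0 < C0"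
    "\<And>t h v. t \<le> T \<Longrightarrow> tscale t h v \<Longrightarrow> 0 < t \<and> 0 < h \<and> 0 < v \<and> v \<le> R \<and> c0 \<le> t * (v * n v) \<and> t * (v * n v) \<le> C0 \<and>
       h * v \<le> 1 \<and> 1 / h \<le> C0 * v" by blast
  from upper_sup[OF assms] obtain C1 where C1: "0 < C1"
    "\<And>t h v P. t \<le> T \<Longrightarrow> tscale t h v \<Longrightarrow> levy_law P (\<lambda>s. t * n s) \<Longrightarrow> dens_bound P (C1 * h)" by blast
  from small_jumps_bound[OF c0(1,2)] obtain k K C2 where k: "1 \<le> k" and K: "1 \<le> K" and C2: "0 < C2"
    "\<And>t h v r y Q B. 0 < t \<Longrightarrow> 0 < h \<Longrightarrow> 0 < v \<Longrightarrow> v \<le> r \<Longrightarrow> r \<le> R \<Longrightarrow> c0 \<le> t * (v * n v) \<Longrightarrow> t * (v * n v) \<le> C0 \<Longrightarrow>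
      h * v \<le> 1 \<Longrightarrow> k * r \<le> y \<Longrightarrow> K * v \<le> y \<Longrightarrow> levy_law Q (\<lambda>s. indicator {..r} s * (t * n s)) \<Longrightarrow>
      B \<in> sets borel \<Longrightarrow> (\<And>u. u \<in> B \<Longrightarrow> t * lexp_deriv n h + y \<le> u) \<Longrightarrow>
      emeasure Q B \<le> ennreal (C2 * (t * n r) * exp (- y / (2 * r))) * emeasure lborel B" by blast
  define m where "m = max k K"
  define A where "A = a2 * m powr (1 + \<alpha>2)"
  have m: "1 \<le> m" "k \<le> m" "K \<le> m" using k by (auto simp: m_def)
  have A: "0 < A" "1 \<le> A"
  proof -
    have "1 \<le> m powr (1 + \<alpha>2)" using m \<alpha> by (intro ge_one_powr_ge_zero) auto
    then have "1 * 1 \<le> a2 * m powr (1 + \<alpha>2)" using a2_ge_1 by (intro mult_mono) auto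
    then show "0 < A" "1 \<le> A" by (simp_all add: A_def)
  qed
  have nA: "n r \<le> A * n y" if "0 < r" "r \<le> y" "y \<le> R" "y \<le> m * r" for r y
  proof -
    have "n r \<le> a2 * (y / r) powr (1 + \<alpha>2) * n y" by (rule scale_hi[OF that(1-3)])
    also have "\<dots> \<le> A * n y"
      unfolding A_def using that \<alpha> a_pos n_nonneg
      by (intro mult_right_mono mult_left_mono powr_mono2) (auto simp: pos_divide_le_eq)
    finally show ?thesis .
  qed
  define C where "C = max (C1 / c0 * max A (1 / a1)) ((C2 + D0) * A)"
  show ?thesis
  proof (rule that[of C])
    show "0 < C" using C1 c0 A by (simp add: C_def less_max_iff_disj)
    fix t h v P y B
    assume t: "t \<le> T" "tscale t h v" and P: "levy_law P (\<lambda>s. t * n s)" and y: "0 < y" "y \<le> R"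
      and B: "B \<in> sets borel" and x: "\<And>u. u \<in> B \<Longrightarrow> t * lexp_deriv n h + y \<le> u"
    from c0(3)[OF t] have f: "0 < t" "0 < h" "0 < v" "v \<le> R" "c0 \<le> t * (v * n v)" "t * (v * n v) \<le> C0" "h * v \<le> 1" by auto
    have tny: "0 \<le> t * n y" using f n_nonneg by simp
    show "emeasure P B \<le> ennreal (C * (t * n y)) * emeasure lborel B"
    proof (cases "y \<le> m * v")
      case True
      have nv: "n v \<le> max A (1 / a1) * n y"
      proof (cases "y \<le> v")
        case True
        have "n v \<le> 1 / a1 * n y" using n_antimono[OF y(1) True f(4)] a_pos by (simp add: pos_le_divide_eq mult.commute)
        also have "\<dots> \<le> max A (1 / a1) * n y" using n_nonneg by (intro mult_right_mono) auto
        finally show ?thesis .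
      next
        case False
        have "n v \<le> A * n y" using nA[of v y] False True f y by simp
        also have "\<dots> \<le> max A (1 / a1) * n y" using n_nonneg by (intro mult_right_mono) auto
        finally show ?thesis .
      qed
      have "h \<le> 1 / v" using f by (simp add: field_simps)
      also have "1 / v \<le> t * n v / c0" using f c0 by (simp add: field_simps)
      also have "\<dots> \<le> t * (max A (1 / a1) * n y) / c0" using nv f c0 by (intro divide_right_mono mult_left_mono) auto
      finally have "C1 * h \<le> C1 * (t * (max A (1 / a1) * n y) / c0)" using C1 by (intro mult_left_mono) auto
      also have "\<dots> = C1 / c0 * max A (1 / a1) * (t * n y)" by simp
      also have "\<dots> \<le> C * (t * n y)" using tny by (intro mult_right_mono) (auto simp: C_def)
      finally have "dens_bound P (C * (t * n y))" by (rule dens_bound_mono[OF C1(2)[OF t P]])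
      then show ?thesis using B by (simp add: dens_bound_def)
    next
      case False
      \<comment> \<open>The divisor \<open>m\<close> is at least \<open>k\<close> and
        \<open>K\<close>, so the bound for the small jumps applies; being fixed, it keeps
        \<open>n r\<close> comparable to \<open>n y\<close>.\<close>
      define r where "r = y / m"
      have r: "0 < r" "r \<le> y" "r \<le> R" "m * r = y" "v \<le> r"
      proof -
        show "0 < r" "m * r = y" using y m by (auto simp: r_def)
        then show "r \<le> y" using m mult_right_mono[of 1 m r] by simp
        then show "r \<le> R" using y by simp
        show "v \<le> r" using False m by (simp add: r_def pos_le_divide_eq mult.commute)
      qed
      note s = split_at[OF f(1) r(1) P]
      have "indicator {r<..} s * (t * n s) \<le> t * (D0 * n r)" for s
        using n_le_D0[of r s] r f n_nonneg D0_pos by (auto split: split_indicator)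
      from levy_law_le_jumps[OF P s(2,1,3) this]
      obtain Q where Q: "levy_law Q (\<lambda>s. indicator {..r} s * (t * n s))"
        "\<And>B. B \<in> sets borel \<Longrightarrow> emeasure P B \<le> ennreal (exp (- (\<integral>s. indicator {r<..} s * (t * n s) \<partial>lborel))) * emeasure Q B
           + ennreal (t * (D0 * n r)) * emeasure lborel B" by blast
      have "emeasure Q B \<le> ennreal (C2 * (t * n r) * exp (- y / (2 * r))) * emeasure lborel B"
      proof (rule C2(2)[OF f(1-3) r(5,3) f(5-7) _ _ Q(1) B x])
        show "k * r \<le> y" using mult_right_mono[OF m(2), of r] r by simp
        have "K * v \<le> m * v" using m(3) f by (intro mult_right_mono) auto
        then show "K * v \<le> y" using False by simp
      qed
      also have "\<dots> \<le> ennreal (C2 * (t * n r)) * emeasure lborel B"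
        using C2 f y r n_nonneg by (intro mult_right_mono ennreal_leI mult_left_le) auto
      finally have QB: "emeasure Q B \<le> ennreal (C2 * (t * n r)) * emeasure lborel B" .
      have "ennreal (exp (- (\<integral>s. indicator {r<..} s * (t * n s) \<partial>lborel))) \<le> 1"
        using jump_density.mass_nonneg[OF s(1)] by simp
      then have "ennreal (exp (- (\<integral>s. indicator {r<..} s * (t * n s) \<partial>lborel))) * emeasure Q B \<le> 1 * emeasure Q B"
        by (rule mult_right_mono) simp
      then have "emeasure P B \<le> ennreal (C2 * (t * n r)) * emeasure lborel B + ennreal (t * (D0 * n r)) * emeasure lborel B"
        using QB by (intro order_trans[OF Q(2)[OF B]] add_right_mono) simp
      also have "\<dots> = ennreal (C2 * (t * n r) + t * (D0 * n r)) * emeasure lborel B"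
        using C2 D0_pos f n_nonneg by (simp add: distrib_right)
      also have "\<dots> \<le> ennreal (C * (t * n y)) * emeasure lborel B"
      proof (intro mult_right_mono ennreal_leI)
        have "C2 * (t * n r) + t * (D0 * n r) = (C2 + D0) * t * n r" by (simp add: algebra_simps)
        also have "\<dots> \<le> (C2 + D0) * t * (A * n y)"
          using nA[of r y] r y f C2 D0_pos by (intro mult_left_mono) auto
        also have "\<dots> = (C2 + D0) * A * (t * n y)" by simp
        also have "\<dots> \<le> C * (t * n y)" using tny by (intro mult_right_mono) (auto simp: C_def)
        finally show "C2 * (t * n r) + t * (D0 * n r) \<le> C * (t * n y)" .
      qed simp
      finally show ?thesis .
    qed
  qed
qed

text \<open>For the left upper bound: \<open>1 + D * N\<close> comes from the density bound at scale
  \<open>1 / \<sigma>\<close>, and the power from comparing this scale with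
  \<open>1 / h\<close>.\<close>

lemma power_times_exp_le':
  fixes q a D :: real
  assumes "0 < q" "0 \<le> a" "0 \<le> D"
  obtains C where "0 < C" "\<And>N. 1 \<le> N \<Longrightarrow> (1 + D * N) * (D * N) powr a * exp (- q * N) \<le> C"
proof -
  obtain M :: nat where M: "a \<le> real M" using real_arch_simple by blast
  let ?E = "max 1 D"
  define C where "C = (1 + D) * ?E ^ M * (fact (Suc M) / q ^ Suc M)"
  show ?thesis
  proof (rule that[of C])
    show "0 < C" using assms by (simp add: C_def)
    fix N :: real assume N: "1 \<le> N"
    have "1 \<le> ?E * N" using N mult_mono[of 1 ?E 1 N] by simp
    have "(D * N) powr a \<le> (?E * N) powr a" using N assms by (intro powr_mono2 mult_right_mono) auto
    also have "\<dots> \<le> (?E * N) powr real M" using M \<open>1 \<le> ?E * N\<close> by (intro powr_mono) auto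
    also have "\<dots> = ?E ^ M * N ^ M" using \<open>1 \<le> ?E * N\<close> by (simp add: powr_realpow power_mult_distrib)
    finally have 1: "(D * N) powr a \<le> ?E ^ M * N ^ M" .
    have 2: "1 + D * N \<le> (1 + D) * N" using N by (simp add: algebra_simps)
    have "(1 + D * N) * (D * N) powr a * exp (- q * N) \<le> ((1 + D) * N) * (?E ^ M * N ^ M) * exp (- q * N)"
      using 1 2 N assms by (intro mult_right_mono mult_mono) auto
    also have "\<dots> = (1 + D) * ?E ^ M * (N ^ Suc M * exp (- q * N))" by simp
    also have "\<dots> \<le> C" unfolding C_def
      using power_times_exp_le[of N q "Suc M"] N assms by (intro mult_left_mono) auto
    finally show "(1 + D * N) * (D * N) powr a * exp (- q * N) \<le> C" .
  qed
qed

text \<open>Esscher transform: the law tilted by \<open>\<sigma>\<close> has mean \<open>t \<phi>'(\<sigma>)\<close>.\<close>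

lemma upper_left:
  assumes "0 < T"
  obtains C where "0 < C"
    "\<And>t h v P \<sigma> B. t \<le> T \<Longrightarrow> tscale t h v \<Longrightarrow> levy_law P (\<lambda>s. t * n s) \<Longrightarrow> h \<le> \<sigma> \<Longrightarrow>
       B \<in> sets borel \<Longrightarrow> (\<And>u. u \<in> B \<Longrightarrow> u \<le> t * lexp_deriv n \<sigma>) \<Longrightarrow>
       emeasure P B \<le> ennreal (C * (h * exp (- (t / 2) * lexp_H n \<sigma>))) * emeasure lborel B"
proof -
  from tscale_facts[OF assms] obtain c0 C0 where c0: "0 < c0" "0 < C0"
    "\<And>t h v. t \<le> T \<Longrightarrow> tscale t h v \<Longrightarrow> 0 < t \<and> 0 < h \<and> 0 < v \<and> v \<le> R \<and> c0 \<le> t * (v * n v) \<and> t * (v * n v) \<le> C0 \<and>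
       h * v \<le> 1 \<and> 1 / h \<le> C0 * v" by blast
  from H_comparison[OF assms] obtain c C where cC: "0 < c" "0 < C"
    "\<And>l. 0 < l \<Longrightarrow> 1 / T \<le> lexp_H n l \<Longrightarrow> c * lexp_H n l \<le> min (1 / l) R * n (min (1 / l) R)"
    "\<And>l. 0 < l \<Longrightarrow> 1 / T \<le> lexp_H n l \<Longrightarrow> min (1 / l) R * n (min (1 / l) R) \<le> C * lexp_H n l"
    "\<And>l. 0 < l \<Longrightarrow> 1 / T \<le> lexp_H n l \<Longrightarrow> 1 / l \<le> C * min (1 / l) R" by blast
  from dens_bound_scale[OF cC(1)] obtain C1 where C1: "0 < C1"
    "\<And>t \<sigma> r P. 0 < t \<Longrightarrow> 0 \<le> \<sigma> \<Longrightarrow> 0 < r \<Longrightarrow> r \<le> R \<Longrightarrow> \<sigma> * r \<le> 1 \<Longrightarrow> c \<le> t * (r * n r) \<Longrightarrow>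
       levy_law P (\<lambda>s. indicator {..r} s * (t * exp (- \<sigma> * s) * n s)) \<Longrightarrow>
       dens_bound P (C1 * (1 + t * (r * n r)) / r)" by blast
  define D where "D = max C (C / (a1 * c0))"
  have D: "0 < D" using cC by (simp add: D_def)
  have pre: "0 < (1 / 2 :: real)" "0 \<le> 1 / \<alpha>1" "0 \<le> D" using \<alpha> D by simp_all
  from power_times_exp_le'[OF pre]
  obtain E where E: "0 < E" "\<And>N. 1 \<le> N \<Longrightarrow> (1 + D * N) * (D * N) powr (1 / \<alpha>1) * exp (- (1 / 2) * N) \<le> E"
    by blast
  show ?thesis
  proof (rule that[of "C1 * C0 * E"])
    show "0 < C1 * C0 * E" using C1 c0 E by simp
    fix t h v P \<sigma> B
    assume t: "t \<le> T" "tscale t h v" and P: "levy_law P (\<lambda>s. t * n s)" and \<sigma>: "h \<le> \<sigma>"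
      and B: "B \<in> sets borel" and x: "\<And>u. u \<in> B \<Longrightarrow> u \<le> t * lexp_deriv n \<sigma>"
    from c0(3)[OF t] have f: "0 < t" "0 < h" "0 < v" "v \<le> R" "c0 \<le> t * (v * n v)" "1 / h \<le> C0 * v" by auto
    have h: "lexp_H n h = 1 / t" "v = min (1 / h) R" using t by (auto simp: tscale_def)
    have s: "0 < \<sigma>" using f \<sigma> by simp
    define N where "N = t * lexp_H n \<sigma>"
    have HN: "1 / t \<le> lexp_H n \<sigma>" using lexp_H_mono[OF ld f(2) \<sigma>] h by simp
    then have N: "1 \<le> N" using f by (simp add: N_def pos_divide_le_eq mult.commute)
    have "1 / T \<le> 1 / t" using f t assms by (simp add: frac_le)
    then have HT: "1 / T \<le> lexp_H n \<sigma>" using HN by simp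
    \<comment> \<open>At this scale the tilt is harmless because
      \<open>\<sigma> * r \<le> 1\<close>, and by comparison with \<open>H\<close> the jump rate is
      of order \<open>N\<close>.\<close>
    define r where "r = min (1 / \<sigma>) R"
    have r: "0 < r" "r \<le> R" "r \<le> v" "\<sigma> * r \<le> 1"
    proof -
      show "0 < r" "r \<le> R" using s R_pos by (auto simp: r_def)
      show "r \<le> v" unfolding r_def h(2) using \<sigma> f by (intro min.mono divide_left_mono) auto
      have "\<sigma> * r \<le> \<sigma> * (1 / \<sigma>)" using s by (intro mult_left_mono) (auto simp: r_def)
      then show "\<sigma> * r \<le> 1" using s by simp
    qed
    define n0 where "n0 = t * (r * n r)"
    have n0: "c * N \<le> n0" "n0 \<le> C * N"
      using mult_left_mono[OF cC(3)[OF s HT], of t] mult_left_mono[OF cC(4)[OF s HT], of t] f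
      by (auto simp: n0_def N_def r_def ac_simps)
    have "c * 1 \<le> c * N" using N cC(1) by (intro mult_left_mono) auto
    then have "c \<le> n0" using n0(1) by simp
    \<comment> \<open>The rate is bounded below at \<open>v\<close> and at most of order
      \<open>N\<close> at \<open>r\<close>, so \<open>v / r\<close> is at most a power of
      \<open>N\<close> of order \<open>1 / \<alpha>1\<close>.\<close>
    have "1 / r \<le> C0 * h * (D * N) powr (1 / \<alpha>1)"
    proof -
      have "0 < h" "1 / h \<le> C0 * v" using f by auto
      then have "1 \<le> C0 * v * h" by (simp add: pos_divide_le_eq)
      then have vi: "1 / v \<le> C0 * h" using f by (simp add: pos_divide_le_eq ac_simps)
      have "v / r \<le> (C * N / (a1 * c0)) powr (1 / \<alpha>1)"
        by (rule ratio_le_of_jump_rate[OF r(1,3) f(4,1) c0(1) f(5)]) (use n0(2) in \<open>simp add: n0_def\<close>)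
      also have "\<dots> \<le> (D * N) powr (1 / \<alpha>1)"
      proof (rule powr_mono2)
        have "C / (a1 * c0) * N \<le> D * N" using N by (intro mult_right_mono) (auto simp: D_def)
        then show "C * N / (a1 * c0) \<le> D * N" by simp
      qed (use \<alpha> a_pos c0 cC N in auto)
      finally have "v / r \<le> (D * N) powr (1 / \<alpha>1)" .
      then have "1 / v * (v / r) \<le> C0 * h * (D * N) powr (1 / \<alpha>1)"
        using vi f r c0 by (intro mult_mono) auto
      then show ?thesis using f by simp
    qed
    then have K: "C1 * (1 + n0) / r \<le> C1 * C0 * h * ((1 + D * N) * (D * N) powr (1 / \<alpha>1))"
    proof -
      assume a: "1 / r \<le> C0 * h * (D * N) powr (1 / \<alpha>1)"
      have "C * N \<le> D * N" using N by (intro mult_right_mono) (auto simp: D_def)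
      then have "n0 \<le> D * N" using n0(2) by simp
      then have "C1 * (1 + n0) * (1 / r) \<le> C1 * (1 + D * N) * (C0 * h * (D * N) powr (1 / \<alpha>1))"
        using a C1(1) r N D \<open>c \<le> n0\<close> cC(1) by (intro mult_mono) auto
      then show ?thesis by (simp add: ac_simps)
    qed
    let ?\<mu> = "\<lambda>s. t * n s" and ?\<nu> = "\<lambda>s. exp (- \<sigma> * s) * (t * n s)"
    have l\<mu>: "levy_density ?\<mu>" using f by (intro levy_density_scale[OF ld]) auto
    have s0: "0 \<le> \<sigma>" using s by simp
    note tilt = levy_law_tilt[OF l\<mu> P s0]
    have lr: "levy_density (\<lambda>s. indicator {..r} s * (t * exp (- \<sigma> * s) * n s))"
      using f s by (intro levy_density_truncate_le[OF ld]) auto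
    obtain Q where Q: "levy_law Q (\<lambda>s. indicator {..r} s * (t * exp (- \<sigma> * s) * n s))" using levy_law_exists[OF lr] by auto
    have le: "indicator {..r} s * (t * exp (- \<sigma> * s) * n s) \<le> ?\<nu> s" for s
      using f n_nonneg[of s] by (auto split: split_indicator)
    have Qb: "dens_bound Q (C1 * (1 + n0) / r)"
      unfolding n0_def by (rule C1(2)[OF f(1) s0 r(1,2,4) _ Q]) (use \<open>c \<le> n0\<close> in \<open>simp add: n0_def\<close>)
    let ?T = "density P (\<lambda>u. ennreal (exp (lexp ?\<mu> \<sigma> - \<sigma> * u)))"
    have Tb: "dens_bound ?T (C1 * (1 + n0) / r)"
      by (rule dens_bound_add[OF tilt(2) levy_density_diff[OF tilt(1) lr le] lr Q _ Qb]) simp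
    have lex: "lexp ?\<mu> \<sigma> = t * lexp n \<sigma>" unfolding lexp_def by (simp add: mult.left_commute)
    note [measurable_cong] = levy_lawD(2)[OF P]
    have "ennreal (exp N) * emeasure P B = (\<integral>\<^sup>+u. ennreal (exp N) * indicator B u \<partial>P)"
      using B levy_lawD(2)[OF P] by (subst nn_integral_cmult) auto
    also have "\<dots> \<le> (\<integral>\<^sup>+u. ennreal (exp (lexp ?\<mu> \<sigma> - \<sigma> * u)) * indicator B u \<partial>P)"
    proof (rule nn_integral_mono)
      fix u
      show "ennreal (exp N) * indicator B u \<le> ennreal (exp (lexp ?\<mu> \<sigma> - \<sigma> * u)) * indicator B u"
      proof (cases "u \<in> B")
        case True
        have "\<sigma> * u \<le> \<sigma> * (t * lexp_deriv n \<sigma>)" using x[OF True] s by (intro mult_left_mono) auto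
        then have "N \<le> lexp ?\<mu> \<sigma> - \<sigma> * u" by (simp add: N_def lexp_H_def lex algebra_simps)
        then show ?thesis using True by (simp add: ennreal_leI)
      qed simp
    qed
    also have "\<dots> = emeasure ?T B" using B levy_lawD(2)[OF P] by (subst emeasure_density) auto
    also have "\<dots> \<le> ennreal (C1 * (1 + n0) / r) * emeasure lborel B" using Tb B by (simp add: dens_bound_def)
    also have "\<dots> \<le> ennreal (C1 * C0 * h * ((1 + D * N) * (D * N) powr (1 / \<alpha>1))) * emeasure lborel B"
      by (intro mult_right_mono ennreal_leI K) simp
    finally have "ennreal (exp (- N)) * (ennreal (exp N) * emeasure P B) \<le>
      ennreal (exp (- N)) * (ennreal (C1 * C0 * h * ((1 + D * N) * (D * N) powr (1 / \<alpha>1))) * emeasure lborel B)"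
      by (rule mult_left_mono) simp
    also have "ennreal (exp (- N)) * (ennreal (exp N) * emeasure P B) = emeasure P B"
      by (simp add: mult.assoc[symmetric] ennreal_mult[symmetric] flip: exp_add)
    also have "ennreal (exp (- N)) * (ennreal (C1 * C0 * h * ((1 + D * N) * (D * N) powr (1 / \<alpha>1))) * emeasure lborel B)
      = ennreal (exp (- N) * (C1 * C0 * h * ((1 + D * N) * (D * N) powr (1 / \<alpha>1)))) * emeasure lborel B"
      using C1 c0 f D N by (simp add: mult.assoc[symmetric] ennreal_mult)
    also have "\<dots> \<le> ennreal (C1 * C0 * E * (h * exp (- (t / 2) * lexp_H n \<sigma>))) * emeasure lborel B"
    proof (intro mult_right_mono ennreal_leI)
      \<comment> \<open>Half of the exponent is given up to absorb the polynomial in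
        \<open>N\<close>; the other half is the factor in the claim.\<close>
      have "exp (- N) = exp (- (1 / 2) * N) * exp (- (1 / 2) * N)" by (simp flip: exp_add)
      then have "exp (- N) * (C1 * C0 * h * ((1 + D * N) * (D * N) powr (1 / \<alpha>1)))
        = C1 * C0 * h * exp (- (1 / 2) * N) * ((1 + D * N) * (D * N) powr (1 / \<alpha>1) * exp (- (1 / 2) * N))" by simp
      also have "\<dots> \<le> C1 * C0 * h * exp (- (1 / 2) * N) * E"
        using E(2)[OF N] C1 c0 f by (intro mult_left_mono) auto
      finally show "exp (- N) * (C1 * C0 * h * ((1 + D * N) * (D * N) powr (1 / \<alpha>1)))
        \<le> C1 * C0 * E * (h * exp (- (t / 2) * lexp_H n \<sigma>))" by (simp add: N_def ac_simps)
    qed simp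
    finally show "emeasure P B \<le> ennreal (C1 * C0 * E * (h * exp (- (t / 2) * lexp_H n \<sigma>))) * emeasure lborel B" .
  qed
qed

end

section \<open>Lower bounds\<close>

lemma exp_minus_taylor_le:
  fixes x :: real
  assumes "0 \<le> x"
  shows "x - 1 + exp (- x) \<le> x\<^sup>2"
proof (cases "x \<le> 1")
  case True
  have "exp (- x) \<le> 1 + (- x) + (- x)\<^sup>2" 
  proof -
    have "1 + x \<le> exp x" by (rule exp_ge_add_one_self)
    have "1 \<le> (1 - x + x\<^sup>2) * (1 + x)"
      using assms by (simp add: algebra_simps power2_eq_square power3_eq_cube)
    also have "\<dots> \<le> (1 - x + x\<^sup>2) * exp x"
      using \<open>1 + x \<le> exp x\<close> True by (intro mult_left_mono) auto
    finally show ?thesis by (simp add: exp_minus field_simps)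
  qed
  then show ?thesis by simp
next
  case False
  then have "x \<le> x\<^sup>2" by (simp add: power2_eq_square)
  moreover have "exp (- x) \<le> 1" using assms by simp
  ultimately show ?thesis by linarith
qed

text \<open>Exponential Chebyshev bounds on both sides with parameter \<open>4 / d\<close>. The
  assumption on the second moment bounds the quadratic error by 1, so each exponent is at most 1 - 4
  = -3, and \<open>exp (-3) \<le> 1/8\<close>. The jumps must be bounded for the upper side.\<close>

lemma concentration:
  assumes \<mu>: "levy_density \<mu>" and r: "0 < r" "\<And>s. r < s \<Longrightarrow> \<mu> s = 0" and Q: "levy_law Q \<mu>"
    and d: "0 < d" and V: "(4 / d)\<^sup>2 * exp (4 / d * r) * (\<integral>s. s\<^sup>2 * \<mu> s \<partial>lborel) \<le> 1"
  shows "ennreal (1 / 2) \<le> emeasure Q {(\<integral>s. s * \<mu> s \<partial>lborel) - d<..<(\<integral>s. s * \<mu> s \<partial>lborel) + d}"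
proof -
  define \<theta> where "\<theta> = 4 / d"
  define m where "m = (\<integral>s. s * \<mu> s \<partial>lborel)"
  define W where "W = (\<integral>s. s\<^sup>2 * \<mu> s \<partial>lborel)"
  have \<theta>: "0 < \<theta>" "\<theta> * d = 4" using d by (simp_all add: \<theta>_def)
  have cut: "F s * \<mu> s = (indicator {..r} s * F s) * \<mu> s" for F s
    using r(2)[of s] by (auto split: split_indicator)
  have im: "integrable lborel (\<lambda>s. s * \<mu> s)"
  proof (subst cut, rule levy_integrable[OF \<mu>, where C = "1 + r"])
    fix s :: real assume "0 < s"
    then show "\<bar>indicator {..r} s * s\<bar> \<le> (1 + r) * min 1 s"
      using r by (auto simp: min_def algebra_simps split: split_indicator)
  qed measurable
  have iW: "integrable lborel (\<lambda>s. s\<^sup>2 * \<mu> s)"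
    by (subst cut, rule integrable_trunc_moment[OF \<mu>])
  have W0: "0 \<le> W" unfolding W_def by (rule levy_integral_nonneg[OF \<mu>]) auto
  have e3: "exp (-3) \<le> (1 / 8 :: real)"
  proof -
    have "(2::real) ^ 3 \<le> exp 1 ^ 3" using exp_ge_add_one_self[of "1::real"] by (intro power_mono) auto
    also have "exp 1 ^ 3 = (exp 3 :: real)" by (simp flip: exp_of_nat_mult)
    finally show ?thesis by (simp add: exp_minus field_simps)
  qed
  have up: "emeasure Q {m + d..} \<le> ennreal (1 / 8)"
  proof -
    let ?\<rho> = "\<lambda>s. exp (\<theta> * s) * \<mu> s"
    have l\<rho>: "levy_density ?\<rho>"
    proof (rule levy_density_mult[OF \<mu>, where C = "exp (\<theta> * r)"])
      fix s assume "\<mu> s \<noteq> 0"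
      then have "s \<le> r" using r(2)[of s] by force
      then have "\<theta> * s \<le> \<theta> * r" using \<theta>(1) by (intro mult_left_mono) auto
      then show "exp (\<theta> * s) \<le> exp (\<theta> * r)" by simp
    qed auto
    have "lexp ?\<rho> \<theta> \<le> (\<integral>s. \<theta> * (s * \<mu> s) + \<theta>\<^sup>2 * exp (\<theta> * r) * (s\<^sup>2 * \<mu> s) \<partial>lborel)"
      unfolding lexp_def
    proof (rule integral_mono[OF integrable_lexp[OF l\<rho>]])
      show "integrable lborel (\<lambda>s. \<theta> * (s * \<mu> s) + \<theta>\<^sup>2 * exp (\<theta> * r) * (s\<^sup>2 * \<mu> s))"
        by (intro Bochner_Integration.integrable_add integrable_mult_right im iW)
      fix s :: real
      show "(1 - exp (- \<theta> * s)) * (exp (\<theta> * s) * \<mu> s) \<le> \<theta> * (s * \<mu> s) + \<theta>\<^sup>2 * exp (\<theta> * r) * (s\<^sup>2 * \<mu> s)"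
      proof (cases "0 < s \<and> s \<le> r")
        case True
        then have "\<theta> * s \<le> \<theta> * r" using \<theta>(1) by (intro mult_left_mono) auto
        then have "(\<theta> * s)\<^sup>2 * exp (\<theta> * s) \<le> (\<theta> * s)\<^sup>2 * exp (\<theta> * r)" by (intro mult_left_mono) auto
        moreover have "exp (\<theta> * s) - 1 - \<theta> * s \<le> (\<theta> * s)\<^sup>2 * exp (\<theta> * s)"
          by (rule exp_minus_one_le) (use True \<theta> in simp)
        ultimately have "exp (\<theta> * s) - 1 \<le> \<theta> * s + (\<theta> * s)\<^sup>2 * exp (\<theta> * r)" by linarith
        then have "(exp (\<theta> * s) - 1) * \<mu> s \<le> (\<theta> * s + (\<theta> * s)\<^sup>2 * exp (\<theta> * r)) * \<mu> s"
          using levy_densityD(2)[OF \<mu>] by (intro mult_right_mono) auto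
        moreover have "(1 - exp (- \<theta> * s)) * (exp (\<theta> * s) * \<mu> s) = (exp (\<theta> * s) - 1) * \<mu> s"
          by (simp add: algebra_simps flip: exp_add)
        moreover have "(\<theta> * s + (\<theta> * s)\<^sup>2 * exp (\<theta> * r)) * \<mu> s = \<theta> * (s * \<mu> s) + \<theta>\<^sup>2 * exp (\<theta> * r) * (s\<^sup>2 * \<mu> s)"
          by (simp add: algebra_simps power_mult_distrib)
        ultimately show ?thesis by linarith
      next
        case False
        then have "\<mu> s = 0" using r(2)[of s] levy_densityD(3)[OF \<mu>, of s] by force
        then show ?thesis by simp
      qed
    qed (use \<theta> in simp)
    also have "\<dots> = \<theta> * m + \<theta>\<^sup>2 * exp (\<theta> * r) * W" using im iW by (simp add: m_def W_def)
    finally have "lexp ?\<rho> \<theta> - \<theta> * (m + d) \<le> -3"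
      using V \<theta> by (simp add: \<theta>_def[symmetric] W_def distrib_left)
    then have "exp (lexp ?\<rho> \<theta> - \<theta> * (m + d)) \<le> exp (-3)" by simp
    then have "exp (lexp ?\<rho> \<theta> - \<theta> * (m + d)) \<le> 1 / 8" using e3 by linarith
    then show ?thesis
      using chernoff_upper[OF l\<rho> Q, of "m + d"] \<theta> by (meson ennreal_leI less_imp_le order_trans)
  qed
  have lo: "emeasure Q {..m - d} \<le> ennreal (1 / 8)"
  proof -
    have "\<theta> * m - lexp \<mu> \<theta> = (\<integral>s. \<theta> * (s * \<mu> s) - (1 - exp (- \<theta> * s)) * \<mu> s \<partial>lborel)"
      unfolding lexp_def m_def using im integrable_lexp[OF \<mu>, of \<theta>] \<theta> by simp
    also have "\<dots> = (\<integral>s. (\<theta> * s - 1 + exp (- \<theta> * s)) * \<mu> s \<partial>lborel)"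
      by (intro Bochner_Integration.integral_cong) (auto simp: algebra_simps)
    also have "\<dots> \<le> (\<integral>s. (\<theta>\<^sup>2 * s\<^sup>2) * \<mu> s \<partial>lborel)"
    proof (rule levy_integral_mono[OF \<mu>])
      have "integrable lborel (\<lambda>s. \<theta> * (s * \<mu> s) - (1 - exp (- \<theta> * s)) * \<mu> s)"
        using im integrable_lexp[OF \<mu>, of \<theta>] \<theta> by simp
      then show "integrable lborel (\<lambda>s. (\<theta> * s - 1 + exp (- \<theta> * s)) * \<mu> s)"
        by (simp add: algebra_simps)
      show "integrable lborel (\<lambda>s. (\<theta>\<^sup>2 * s\<^sup>2) * \<mu> s)"
        using integrable_mult_right[OF iW, of "\<theta>\<^sup>2"] by (simp add: mult.assoc)
      fix s :: real assume "0 < s"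
      then show "\<theta> * s - 1 + exp (- \<theta> * s) \<le> \<theta>\<^sup>2 * s\<^sup>2"
        using exp_minus_taylor_le[of "\<theta> * s"] \<theta> by (simp add: power_mult_distrib)
    qed
    also have "\<dots> = \<theta>\<^sup>2 * W" by (simp add: W_def mult.assoc)
    also have "\<dots> \<le> \<theta>\<^sup>2 * exp (\<theta> * r) * W"
    proof -
      have "1 \<le> exp (\<theta> * r)" using \<theta> r by simp
      then have "(\<theta>\<^sup>2 * W) * 1 \<le> (\<theta>\<^sup>2 * W) * exp (\<theta> * r)" using W0 by (intro mult_left_mono) auto
      then show ?thesis by (simp add: ac_simps)
    qed
    also have "\<dots> \<le> 1" using V by (simp add: \<theta>_def W_def)
    finally have "\<theta> * (m - d) - lexp \<mu> \<theta> \<le> -3" using \<theta> by (simp add: right_diff_distrib)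
    then have "exp (\<theta> * (m - d) - lexp \<mu> \<theta>) \<le> exp (-3)" by simp
    then have "exp (\<theta> * (m - d) - lexp \<mu> \<theta>) \<le> 1 / 8" using e3 by linarith
    then show ?thesis
      using chernoff_lower[OF \<mu> Q, of \<theta> "m - d"] \<theta> by (meson ennreal_leI less_imp_le order_trans)
  qed
  interpret Q: prob_space Q using levy_lawD(1)[OF Q] .
  note [measurable_cong] = levy_lawD(2)[OF Q]
  have "measure Q {m + d..} \<le> 1 / 8" "measure Q {..m - d} \<le> 1 / 8"
    using up lo by (simp_all add: Q.emeasure_eq_measure)
  moreover have "1 = measure Q UNIV" using Q.prob_space levy_lawD(4)[OF Q] by simp
  moreover have "measure Q UNIV \<le> measure Q {m - d<..<m + d} + measure Q ({m + d..} \<union> {..m - d})"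
    by (rule order_trans[OF Q.finite_measure_mono measure_Un_le]) (auto simp: levy_lawD(2)[OF Q])
  moreover have "measure Q ({m + d..} \<union> {..m - d}) \<le> measure Q {m + d..} + measure Q {..m - d}"
    by (rule measure_Un_le) (auto simp: levy_lawD(2)[OF Q])
  ultimately have "1 / 2 \<le> measure Q {m - d<..<m + d}" by linarith
  then show ?thesis unfolding m_def[symmetric] Q.emeasure_eq_measure by (rule ennreal_leI)
qed

text \<open>With probability at least 1/2 the remainder is within \<open>d\<close> of its mean
  \<open>m\<close>. From there one jump leads to \<open>B\<close>, and every jump that can do so
  lies in the range where \<open>f\<close> is at least \<open>\<kappa>\<close>.\<close>

lemma one_jump:
  assumes P: "levy_law P \<rho>" and \<mu>: "levy_density \<mu>" and f: "jump_density f" and split: "\<And>s. \<rho> s = \<mu> s + f s"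
    and r: "0 < r" "\<And>s. r < s \<Longrightarrow> \<mu> s = 0"
    and d: "0 < d" and V: "(4 / d)\<^sup>2 * exp (4 / d * r) * (\<integral>s. s\<^sup>2 * \<mu> s \<partial>lborel) \<le> 1"
    and m: "m = (\<integral>s. s * \<mu> s \<partial>lborel)"
    and B: "B \<in> sets borel" "emeasure lborel B = ennreal l" "0 \<le> l" and "0 \<le> \<kappa>"
    and \<kappa>: "\<And>u w. u \<in> B \<Longrightarrow> u - m - d < w \<Longrightarrow> w < u - m + d \<Longrightarrow> \<kappa> \<le> f w"
    and J: "(\<integral>s. f s \<partial>lborel) \<le> J"
  shows "ennreal (exp (- J) * \<kappa> / 2 * l) \<le> emeasure P B"
proof -
  have Af: "ennreal (\<kappa> * l) \<le> (\<integral>\<^sup>+w. ennreal (f w) * indicator B (u + w) \<partial>lborel)"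
    if "u \<in> {m - d<..<m + d}" for u
  proof -
    have "ennreal (\<kappa> * l) = ennreal \<kappa> * (\<integral>\<^sup>+w. indicator B (u + w) \<partial>lborel)"
      using B \<open>0 \<le> \<kappa>\<close> by (simp add: nn_integral_indicator_shift ennreal_mult)
    also have "\<dots> = (\<integral>\<^sup>+w. ennreal \<kappa> * indicator B (u + w) \<partial>lborel)"
      using B by (subst nn_integral_cmult) auto
    also have "\<dots> \<le> (\<integral>\<^sup>+w. ennreal (f w) * indicator B (u + w) \<partial>lborel)"
      using \<kappa>[of "u + _"] that by (intro nn_integral_mono) (auto split: split_indicator intro!: ennreal_leI \<kappa>)
    finally show ?thesis .
  qed
  from levy_law_ge_jump[OF P \<mu> f split] obtain Q where Q: "levy_law Q \<mu>"
    "\<And>B A K. B \<in> sets borel \<Longrightarrow> A \<in> sets borel \<Longrightarrow> 0 \<le> K \<Longrightarrow>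
       (\<And>u. u \<in> A \<Longrightarrow> ennreal K \<le> (\<integral>\<^sup>+v. ennreal (f v) * indicator B (u + v) \<partial>lborel)) \<Longrightarrow>
       ennreal (exp (- (\<integral>s. f s \<partial>lborel)) * K) * emeasure Q A \<le> emeasure P B" by blast
  have "ennreal (exp (- J) * \<kappa> / 2 * l) = ennreal (exp (- J) * (\<kappa> * l)) * ennreal (1 / 2)"
  proof -
    have "exp (- J) * \<kappa> / 2 * l = exp (- J) * (\<kappa> * l) * (1 / 2)" by simp
    then show ?thesis using B \<open>0 \<le> \<kappa>\<close> by (simp only: ennreal_mult) (intro ennreal_mult, auto)
  qed
  also have "\<dots> \<le> ennreal (exp (- (\<integral>s. f s \<partial>lborel)) * (\<kappa> * l)) * emeasure Q {m - d<..<m + d}"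
    using J B \<open>0 \<le> \<kappa>\<close> unfolding m
    by (intro mult_mono ennreal_leI mult_right_mono concentration[OF \<mu> r Q(1) d V]) auto
  also have "\<dots> \<le> emeasure P B"
    using B \<open>0 \<le> \<kappa>\<close> Af by (intro Q(2)) auto
  finally show ?thesis .
qed

section \<open>Lower bounds from one jump\<close>

context scaled_levy_density
begin

text \<open>Only jumps up to a small multiple \<open>\<delta> * v\<close> are left in the remainder.
  Its mean is then to the left of the target by at least \<open>2 * \<eta> * v\<close>, and its
  fluctuation is below \<open>\<eta> * v\<close>, so the connecting jump has positive size. The
  parameter \<open>\<Lambda>\<close> admits targets somewhat to the left of the centre.\<close>

lemma lower_one_jump:
  assumes "0 < T" "1 \<le> \<Lambda>"
  obtains \<eta> C c where "0 < \<eta>" "0 < C" "0 < c"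
    "\<And>t h v P x y \<kappa> B l. t \<le> T \<Longrightarrow> tscale t h v \<Longrightarrow> levy_law P (\<lambda>s. t * n s) \<Longrightarrow>
       t * lexp_deriv n (\<Lambda> / v) \<le> x \<Longrightarrow> x \<le> t * lexp_deriv n h + y \<Longrightarrow> 0 \<le> \<kappa> \<Longrightarrow>
       (\<And>s. \<eta> * v \<le> s \<Longrightarrow> s \<le> y + C * v \<Longrightarrow> \<kappa> \<le> t * n s) \<Longrightarrow>
       B \<in> sets borel \<Longrightarrow> B \<subseteq> {x..x + v} \<Longrightarrow> emeasure lborel B = ennreal l \<Longrightarrow> 0 \<le> l \<Longrightarrow>
       ennreal (c * \<kappa> * l) \<le> emeasure P B"
proof -
  from tscale_facts[OF assms(1)] obtain c0 C0 where c0: "0 < c0" "0 < C0"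
    "\<And>t h v. t \<le> T \<Longrightarrow> tscale t h v \<Longrightarrow> 0 < t \<and> 0 < h \<and> 0 < v \<and> v \<le> R \<and> c0 \<le> t * (v * n v) \<and> t * (v * n v) \<le> C0 \<and>
       h * v \<le> 1 \<and> 1 / h \<le> C0 * v" by blast
  \<comment> \<open>The jumps in \<open>(v/2, v]\<close> contribute at least
    \<open>exp (- \<Lambda>) * a1 * c0 * v / 4\<close>, which is \<open>4 * \<eta> * v\<close>, to
    \<open>t * lexp_deriv n (\<Lambda> / v)\<close>.\<close>
  define \<eta> where "\<eta> = exp (- \<Lambda>) * a1 * c0 / 16"
  have \<eta>: "0 < \<eta>" using a_pos c0 by (simp add: \<eta>_def)
  define A where "A = CV * a2 * C0"
  have A: "0 < A" using CV_pos a_pos c0 by (simp add: A_def)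
  \<comment> \<open>The variance of the remainder is at most
    \<open>A * \<delta> powr (2 - \<alpha>2) * v\<^sup>2\<close>. The first entry keeps the damping
    error of the mean below \<open>2 * \<eta> * v\<close>, the second meets the requirement for
    concentration.\<close>
  define G where "G = max (\<Lambda> * A / (2 * \<eta>)) (A * 16 * exp 4 / \<eta>\<^sup>2)"
  have G: "0 < G" using A \<eta> by (simp add: G_def less_max_iff_disj)
  define \<delta> where "\<delta> = min (min (1 / 2) \<eta>) (G powr (- 1 / (2 - \<alpha>2)))"
  have \<delta>: "0 < \<delta>" "\<delta> \<le> 1 / 2" "\<delta> \<le> \<eta>" using \<eta> G by (auto simp: \<delta>_def)
  have G\<delta>: "G * \<delta> powr (2 - \<alpha>2) \<le> 1"
  proof -
    have "\<delta> powr (2 - \<alpha>2) \<le> (G powr (- 1 / (2 - \<alpha>2))) powr (2 - \<alpha>2)"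
      using \<delta> \<alpha> by (intro powr_mono2) (auto simp: \<delta>_def)
    also have "\<dots> = G powr (-1)" using \<alpha> by (simp only: powr_powr) simp
    also have "\<dots> = 1 / G" using G by (simp add: powr_minus_divide)
    finally show ?thesis using G by (simp add: field_simps)
  qed
  have AG: "\<Lambda> * A * \<delta> powr (2 - \<alpha>2) \<le> 2 * \<eta>" "A * 16 * exp 4 / \<eta>\<^sup>2 * \<delta> powr (2 - \<alpha>2) \<le> 1"
  proof -
    have "\<Lambda> * A / (2 * \<eta>) * \<delta> powr (2 - \<alpha>2) \<le> G * \<delta> powr (2 - \<alpha>2)" by (intro mult_right_mono) (auto simp: G_def)
    with G\<delta> have "\<Lambda> * A / (2 * \<eta>) * \<delta> powr (2 - \<alpha>2) \<le> 1" by linarith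
    then show "\<Lambda> * A * \<delta> powr (2 - \<alpha>2) \<le> 2 * \<eta>" using \<eta> by (simp add: field_simps)
    have "A * 16 * exp 4 / \<eta>\<^sup>2 * \<delta> powr (2 - \<alpha>2) \<le> G * \<delta> powr (2 - \<alpha>2)" by (intro mult_right_mono) (auto simp: G_def)
    with G\<delta> show "A * 16 * exp 4 / \<eta>\<^sup>2 * \<delta> powr (2 - \<alpha>2) \<le> 1" by linarith
  qed
  define J where "J = CT * a2 * C0 * \<delta> powr (- \<alpha>2)"
  have J: "0 < J" using CT_pos a_pos c0 \<delta> by (simp add: J_def)
  show ?thesis
  proof (rule that[of \<eta> "C0 * J + 1 + \<eta>" "exp (- J) / 2"])
    show "0 < \<eta>" by fact
    show "0 < C0 * J + 1 + \<eta>" using c0 J \<eta> by (simp add: add_pos_pos)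
    show "0 < exp (- J) / 2" by simp
    fix t h v P x y \<kappa> B l
    assume t: "t \<le> T" "tscale t h v" and P: "levy_law P (\<lambda>s. t * n s)"
      and x: "t * lexp_deriv n (\<Lambda> / v) \<le> x" "x \<le> t * lexp_deriv n h + y" and "0 \<le> \<kappa>"
      and \<kappa>: "\<And>s. \<eta> * v \<le> s \<Longrightarrow> s \<le> y + (C0 * J + 1 + \<eta>) * v \<Longrightarrow> \<kappa> \<le> t * n s"
      and B: "B \<in> sets borel" "B \<subseteq> {x..x + v}" "emeasure lborel B = ennreal l" "0 \<le> l"
    from c0(3)[OF t] have f: "0 < t" "0 < h" "0 < v" "v \<le> R" "c0 \<le> t * (v * n v)" "t * (v * n v) \<le> C0" "h * v \<le> 1"
      "1 / h \<le> C0 * v" by auto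
    define r where "r = \<delta> * v"
    have r: "0 < r" "r \<le> v / 2" "r \<le> \<eta> * v" "r \<le> R" "r \<le> v"
    proof -
      show "0 < r" using \<delta> f by (simp add: r_def)
      show "r \<le> v / 2" using mult_right_mono[OF \<delta>(2), of v] f by (simp add: r_def)
      then show "r \<le> v" "r \<le> R" using f by auto
      show "r \<le> \<eta> * v" using mult_right_mono[OF \<delta>(3), of v] f by (simp add: r_def)
    qed
    have nr: "n r \<le> a2 * \<delta> powr (- (1 + \<alpha>2)) * n v"
    proof -
      have "n r \<le> a2 * (v / r) powr (1 + \<alpha>2) * n v" by (rule scale_hi[OF r(1,5) f(4)])
      also have "v / r = 1 / \<delta>" using f \<delta> by (simp add: r_def)
      also have "(1 / \<delta>) powr (1 + \<alpha>2) = \<delta> powr (- (1 + \<alpha>2))" using \<delta> by (simp only: powr_minus) (simp add: powr_divide inverse_eq_divide)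
      finally show ?thesis .
    qed
    have \<delta>p: "\<delta> * \<delta> powr (- (1 + \<alpha>2)) = \<delta> powr (- \<alpha>2)" "\<delta> ^ 3 * \<delta> powr (- (1 + \<alpha>2)) = \<delta> powr (2 - \<alpha>2)"
    proof -
      have "\<delta> * \<delta> powr (- (1 + \<alpha>2)) = \<delta> powr 1 * \<delta> powr (- (1 + \<alpha>2))" using \<delta> by simp
      also have "\<dots> = \<delta> powr (- \<alpha>2)" by (simp only: powr_add[symmetric]) simp
      finally show "\<delta> * \<delta> powr (- (1 + \<alpha>2)) = \<delta> powr (- \<alpha>2)" .
      have "\<delta> ^ 3 * \<delta> powr (- (1 + \<alpha>2)) = \<delta> powr 3 * \<delta> powr (- (1 + \<alpha>2))" using \<delta> by (simp add: powr_numeral)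
      also have "\<dots> = \<delta> powr (2 - \<alpha>2)" by (simp only: powr_add[symmetric]) simp
      finally show "\<delta> ^ 3 * \<delta> powr (- (1 + \<alpha>2)) = \<delta> powr (2 - \<alpha>2)" .
    qed
    have tail: "t * tail_mass n r \<le> J"
    proof -
      have "t * tail_mass n r \<le> t * (CT * (r * n r))" using f by (intro mult_left_mono tail_mass_le r) auto
      also have "\<dots> \<le> t * (CT * (r * (a2 * \<delta> powr (- (1 + \<alpha>2)) * n v)))"
        using nr f r CT_pos by (intro mult_left_mono) auto
      also have "\<dots> = CT * a2 * (\<delta> * \<delta> powr (- (1 + \<alpha>2))) * (t * (v * n v))" by (simp add: r_def)
      also have "\<dots> \<le> CT * a2 * (\<delta> * \<delta> powr (- (1 + \<alpha>2))) * C0"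
        using f CT_pos a_pos \<delta> by (intro mult_left_mono) auto
      finally show ?thesis unfolding \<delta>p by (simp add: J_def ac_simps)
    qed
    have var: "t * trunc_moment n r \<le> A * \<delta> powr (2 - \<alpha>2) * v\<^sup>2"
    proof -
      have "t * trunc_moment n r \<le> t * (CV * (r ^ 3 * n r))" using f by (intro mult_left_mono trunc_moment_le r) auto
      also have "\<dots> \<le> t * (CV * (r ^ 3 * (a2 * \<delta> powr (- (1 + \<alpha>2)) * n v)))"
        using nr f r CV_pos by (intro mult_left_mono) auto
      also have "\<dots> = CV * a2 * (\<delta> ^ 3 * \<delta> powr (- (1 + \<alpha>2))) * v\<^sup>2 * (t * (v * n v))"
        by (simp add: r_def power_mult_distrib power2_eq_square power3_eq_cube)
      also have "\<dots> \<le> CV * a2 * (\<delta> ^ 3 * \<delta> powr (- (1 + \<alpha>2))) * v\<^sup>2 * C0"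
        using f CV_pos a_pos \<delta> by (intro mult_left_mono) auto
      finally show ?thesis unfolding \<delta>p by (simp add: A_def ac_simps)
    qed
    let ?\<mu> = "\<lambda>s. indicator {..r} s * (t * n s)" and ?f = "\<lambda>s. indicator {r<..} s * (t * n s)"
    note s = split_at[OF f(1) r(1) P]
    define M where "M = (\<integral>s. (indicator {..r} s * s) * n s \<partial>lborel)"
    have m: "t * M = (\<integral>s. s * ?\<mu> s \<partial>lborel)"
    proof -
      have "(\<integral>s. s * ?\<mu> s \<partial>lborel) = (\<integral>s. t * ((indicator {..r} s * s) * n s) \<partial>lborel)"
        by (intro Bochner_Integration.integral_cong) auto
      then show ?thesis by (simp add: M_def)
    qed
    have W: "(\<integral>s. s\<^sup>2 * ?\<mu> s \<partial>lborel) = t * trunc_moment n r"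
    proof -
      have "(\<integral>s. s\<^sup>2 * ?\<mu> s \<partial>lborel) = (\<integral>s. t * ((indicator {..r} s * s\<^sup>2) * n s) \<partial>lborel)"
        by (intro Bochner_Integration.integral_cong) auto
      then show ?thesis by (simp add: trunc_moment_def)
    qed
    have mass: "(\<integral>s. ?f s \<partial>lborel) \<le> J"
    proof -
      have "(\<integral>s. ?f s \<partial>lborel) = (\<integral>s. t * (indicator {r<..} s * n s) \<partial>lborel)"
        by (intro Bochner_Integration.integral_cong) auto
      then show ?thesis using tail by (simp add: tail_mass_def)
    qed
    have itail: "integrable lborel (\<lambda>s. indicator {r<..} s * n s)"
      by (rule integrable_indicator_away[OF ld r(1)]) auto
    \<comment> \<open>The jumps in \<open>(v/2, v]\<close> occur in the target but not in
      \<open>M\<close>; jumps up to \<open>r\<close> are damped in the target only, which costs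
      \<open>\<Lambda> / v\<close> times their second moment.\<close>
    have low: "2 * \<eta> * v \<le> t * lexp_deriv n (\<Lambda> / v) - t * M"
    proof -
      let ?l = "\<Lambda> / v"
      have l: "0 < ?l" using assms f by simp
      let ?I = "\<lambda>s. indicator {v / 2<..v} s * (v / 2 * (exp (- \<Lambda>) * (a1 * n v)))"
      have iI: "integrable lborel ?I" by (intro integrable_mult_left integrable_real_indicator) (use f in auto)
      have i2: "integrable lborel (\<lambda>s. (indicator {..r} s * s\<^sup>2) * n s)" by (rule integrable_trunc_moment[OF ld])
      have "(\<integral>s. ?I s \<partial>lborel) - ?l * trunc_moment n r = (\<integral>s. ?I s - ?l * ((indicator {..r} s * s\<^sup>2) * n s) \<partial>lborel)"
        using iI i2 by (simp add: trunc_moment_def del: integral_mult_left_zero)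
      also have "\<dots> \<le> (\<integral>s. s * exp (- ?l * s) * n s - (indicator {..r} s * s) * n s \<partial>lborel)"
      proof (rule integral_mono)
        show "integrable lborel (\<lambda>s. ?I s - ?l * ((indicator {..r} s * s\<^sup>2) * n s))"
          using iI i2 by (intro Bochner_Integration.integrable_diff integrable_mult_right)
        show "integrable lborel (\<lambda>s. s * exp (- ?l * s) * n s - (indicator {..r} s * s) * n s)"
          by (intro Bochner_Integration.integrable_diff integrable_lexp_deriv[OF ld l] integrable_first_moment)
        fix s :: real
        consider "s \<le> 0" | "0 < s" "s \<le> r" | "r < s" "s \<le> v / 2 \<or> v < s" | "v / 2 < s" "s \<le> v" using r by linarith
        then show "?I s - ?l * ((indicator {..r} s * s\<^sup>2) * n s) \<le> s * exp (- ?l * s) * n s - (indicator {..r} s * s) * n s"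
        proof cases
          case 1 then show ?thesis using n_nonpos[of s] f by simp
        next
          case 2
          have "1 - ?l * s \<le> exp (- ?l * s)" using exp_ge_add_one_self[of "- ?l * s"] by simp
          then have "(s * n s) * (1 - ?l * s) \<le> (s * n s) * exp (- ?l * s)"
            using 2 n_nonneg by (intro mult_left_mono) auto
          then show ?thesis using 2 r by (simp add: right_diff_distrib power2_eq_square ac_simps)
        next
          case 3
          have "0 \<le> s * exp (- ?l * s) * n s" using 3 r n_nonneg by simp
          then show ?thesis using 3 by auto
        next
          case 4
          have "?l * s \<le> ?l * v" using 4 l by (intro mult_left_mono) auto
          also have "?l * v = \<Lambda>" using f by simp
          finally have "exp (- \<Lambda>) \<le> exp (- ?l * s)" by simp
          moreover have "a1 * n v \<le> n s" using 4 f by (intro n_antimono) auto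
          ultimately have "v / 2 * (exp (- \<Lambda>) * (a1 * n v)) \<le> s * (exp (- ?l * s) * n s)"
            using 4 f a_pos n_nonneg by (intro mult_mono) auto
          then show ?thesis using 4 r by (simp add: mult.assoc)
        qed
      qed
      also have "\<dots> = lexp_deriv n ?l - M"
        unfolding lexp_deriv_def M_def
        by (rule Bochner_Integration.integral_diff[OF integrable_lexp_deriv[OF ld l] integrable_first_moment])
      finally have "t * ((\<integral>s. ?I s \<partial>lborel) - ?l * trunc_moment n r) \<le> t * (lexp_deriv n ?l - M)"
        using f by (intro mult_left_mono) auto
      moreover have "(\<integral>s. ?I s \<partial>lborel) = v / 2 * (v / 2 * (exp (- \<Lambda>) * (a1 * n v)))"
        using f by simp
      ultimately have "t * (v / 2 * (v / 2 * (exp (- \<Lambda>) * (a1 * n v)))) - t * (?l * trunc_moment n r) \<le> t * lexp_deriv n ?l - t * M"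
        by (simp only: right_diff_distrib)
      moreover have "t * (v / 2 * (v / 2 * (exp (- \<Lambda>) * (a1 * n v)))) = exp (- \<Lambda>) * a1 * v / 4 * (t * (v * n v))" by simp
      moreover have "exp (- \<Lambda>) * a1 * v / 4 * (t * (v * n v)) \<ge> exp (- \<Lambda>) * a1 * v / 4 * c0"
        using f a_pos by (intro mult_left_mono) auto
      moreover have "exp (- \<Lambda>) * a1 * v / 4 * c0 = 4 * \<eta> * v" by (simp add: \<eta>_def)
      moreover have "t * (?l * trunc_moment n r) \<le> 2 * \<eta> * v"
      proof -
        have "t * (?l * trunc_moment n r) = ?l * (t * trunc_moment n r)" by simp
        also have "\<dots> \<le> ?l * (A * \<delta> powr (2 - \<alpha>2) * v\<^sup>2)" using var l by (intro mult_left_mono) auto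
        also have "\<dots> = (\<Lambda> * A * \<delta> powr (2 - \<alpha>2)) * v" using f by (simp add: power2_eq_square)
        also have "\<dots> \<le> 2 * \<eta> * v" using AG(1) f by (intro mult_right_mono) auto
        finally show ?thesis .
      qed
      ultimately show ?thesis by linarith
    qed
    \<comment> \<open>Conversely the centre exceeds \<open>M\<close> only through jumps above
      \<open>r\<close>, each counted with at most \<open>1 / h\<close> since
      \<open>s * exp (- h * s) \<le> 1 / h\<close>.\<close>
    have high: "t * lexp_deriv n h - t * M \<le> C0 * J * v"
    proof -
      have "lexp_deriv n h - M = (\<integral>s. s * exp (- h * s) * n s - (indicator {..r} s * s) * n s \<partial>lborel)"
        unfolding lexp_deriv_def M_def
        by (rule Bochner_Integration.integral_diff[symmetric, OF integrable_lexp_deriv[OF ld f(2)] integrable_first_moment])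
      also have "\<dots> \<le> (\<integral>s. 1 / h * (indicator {r<..} s * n s) \<partial>lborel)"
      proof (rule integral_mono)
        show "integrable lborel (\<lambda>s. s * exp (- h * s) * n s - (indicator {..r} s * s) * n s)"
          by (intro Bochner_Integration.integrable_diff integrable_lexp_deriv[OF ld f(2)] integrable_first_moment)
        show "integrable lborel (\<lambda>s. 1 / h * (indicator {r<..} s * n s))" by (intro integrable_mult_right itail)
        fix s :: real
        show "s * exp (- h * s) * n s - (indicator {..r} s * s) * n s \<le> 1 / h * (indicator {r<..} s * n s)"
        proof (cases "0 < s")
          case True
          have "s * exp (- h * s) * n s \<le> s * n s" "s * exp (- h * s) * n s \<le> 1 / h * n s"
            using mult_exp_bounds(1,2)[OF True f(2)] n_nonneg by (intro mult_right_mono; simp)+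
          then show ?thesis by (auto split: split_indicator)
        qed (use n_nonpos[of s] in simp)
      qed
      also have "\<dots> = 1 / h * tail_mass n r" by (simp add: tail_mass_def)
      finally have "t * (lexp_deriv n h - M) \<le> t * (1 / h * tail_mass n r)" using f by (intro mult_left_mono) auto
      also have "\<dots> = 1 / h * (t * tail_mass n r)" by simp
      also have "\<dots> \<le> (C0 * v) * J" using f tail J c0 tail_mass_nonneg[OF ld] by (intro mult_mono) auto
      finally show ?thesis by (simp add: right_diff_distrib ac_simps)
    qed
    have V: "(4 / (\<eta> * v))\<^sup>2 * exp (4 / (\<eta> * v) * r) * (\<integral>s. s\<^sup>2 * ?\<mu> s \<partial>lborel) \<le> 1"
    proof -
      have "4 / (\<eta> * v) * r \<le> 4" using r \<eta> f by (simp add: divide_le_eq mult.commute)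
      then have "exp (4 / (\<eta> * v) * r) \<le> exp 4" by simp
      then have "(4 / (\<eta> * v))\<^sup>2 * exp (4 / (\<eta> * v) * r) * (t * trunc_moment n r) \<le> (4 / (\<eta> * v))\<^sup>2 * exp 4 * (A * \<delta> powr (2 - \<alpha>2) * v\<^sup>2)"
        using f trunc_moment_nonneg[OF ld] by (intro mult_mono[OF mult_left_mono var]) auto
      also have "\<dots> = A * 16 * exp 4 / \<eta>\<^sup>2 * \<delta> powr (2 - \<alpha>2)"
        using f \<eta> by (simp add: power_divide power_mult_distrib)
      finally show ?thesis unfolding W using AG(2) by linarith
    qed
    have "ennreal (exp (- J) * \<kappa> / 2 * l) \<le> emeasure P B"
    proof (rule one_jump[OF P s(2,1,3) r(1) _ _ V m B(1,3,4) \<open>0 \<le> \<kappa>\<close> _ mass])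
      show "indicator {..r} s * (t * n s) = 0" if "r < s" for s using that by simp
      show "0 < \<eta> * v" using \<eta> f by simp
      fix u w assume u: "u \<in> B" and w: "u - t * M - \<eta> * v < w" "w < u - t * M + \<eta> * v"
      from u B have ux: "x \<le> u" "u \<le> x + v" by auto
      have w1: "\<eta> * v < w" using low x w ux by linarith
      have w2: "w \<le> y + (C0 * J + 1 + \<eta>) * v" using high x w ux by (simp add: distrib_right)
      show "\<kappa> \<le> indicator {r<..} w * (t * n w)" using \<kappa>[of w] w1 w2 r by simp
    qed
    then show "ennreal (exp (- J) / 2 * \<kappa> * l) \<le> emeasure P B" by simp
  qed
qed

text \<open>Keeps \<open>N / \<sigma>\<close> bounded for \<open>t \<le> T\<close>, so that the jump
  used on the left of the centre stays in the scaling range.\<close>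

lemma lexp_H_le_linear: "1 \<le> l \<Longrightarrow> lexp_H n l \<le> l * (\<integral>s. min 1 s * n s \<partial>lborel)"
proof -
  assume l: "1 \<le> l"
  have "lexp_H n l \<le> (\<integral>s. min 1 ((l * s)\<^sup>2) * n s \<partial>lborel)" using l by (intro lexp_H_bounds ld) auto
  also have "\<dots> \<le> (\<integral>s. (l * min 1 s) * n s \<partial>lborel)"
  proof (rule levy_integral_mono[OF ld integrable_min_sq[OF ld]])
    show "integrable lborel (\<lambda>s. l * min 1 s * n s)"
      using integrable_mult_right[OF levy_densityD(4)[OF ld], of l] by (simp add: mult.assoc)
    fix s :: real assume s: "0 < s"
    show "min 1 ((l * s)\<^sup>2) \<le> l * min 1 s"
    proof (cases "l * s \<le> 1")
      case True
      have "l * s * (l * s) \<le> l * s * 1" using True l s by (intro mult_left_mono) auto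
      moreover have "l * s \<le> l * 1"
      proof (rule mult_left_mono)
        have "1 * s \<le> l * s" using l s by (intro mult_right_mono) auto
        then show "s \<le> 1" using True by simp
      qed (use l in simp)
      ultimately show ?thesis by (auto simp: power2_eq_square min_def)
    next
      case False
      then show ?thesis using l by (auto simp: min_def)
    qed
  qed
  also have "\<dots> = l * (\<integral>s. min 1 s * n s \<partial>lborel)" by (simp add: mult.assoc)
  finally show ?thesis .
qed

text \<open>Tilting by \<open>(1 + \<epsilon>) \<sigma>\<close> instead of \<open>\<sigma>\<close> loses nothing, because \<open>\<phi>\<close> is concave, and moves the mean
  to the left of \<open>t \<phi>'(\<sigma>)\<close> by a multiple of \<open>\<epsilon> N / \<sigma>\<close>, where \<open>N = t H(\<sigma>)\<close>. This is more than a
  standard deviation, and one jump of this size costs a factor \<open>exp (- O(\<epsilon> N))\<close> only.\<close>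

lemma lower_left:
  assumes "0 < T"
  obtains K c where "1 < K" "0 < c"
    "\<And>t h v P \<sigma> B l. t \<le> T \<Longrightarrow> tscale t h v \<Longrightarrow> levy_law P (\<lambda>s. t * n s) \<Longrightarrow> 0 < \<sigma> \<Longrightarrow> K \<le> t * lexp_H n \<sigma> \<Longrightarrow>
       B \<in> sets borel \<Longrightarrow> B \<subseteq> {t * lexp_deriv n \<sigma>..t * lexp_deriv n \<sigma> + 1 / \<sigma>} \<Longrightarrow>
       emeasure lborel B = ennreal l \<Longrightarrow> 0 \<le> l \<Longrightarrow>
       ennreal (c * (h * exp (- 2 * t * lexp_H n \<sigma>)) * l) \<le> emeasure P B"
proof -
  define I where "I = (\<integral>s. min 1 s * n s \<partial>lborel)"
  have I: "0 \<le> I" unfolding I_def by (rule levy_integral_nonneg[OF ld]) auto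
  define CC where "CC = CV + CT"
  have CC: "0 < CC" using CV_pos CT_pos by (simp add: CC_def)
  \<comment> \<open>The connecting jump has size at most
    \<open>19 * \<epsilon> * N / \<sigma>\<close> and is tilted by at most
    \<open>2 * \<sigma>\<close>. The first entry makes \<open>38 * \<epsilon>\<close> at most 1/8;
    the second keeps the jump below \<open>R\<close>.\<close>
  define \<epsilon> where "\<epsilon> = min (1 / 304) (R / (19 * T * I + 1))"
  have \<epsilon>: "0 < \<epsilon>" "\<epsilon> \<le> 1 / 304" "\<epsilon> * (19 * T * I) \<le> R"
  proof -
    have p: "0 < 19 * T * I + 1" using assms I by (simp add: add_nonneg_pos)
    show "0 < \<epsilon>" using p R_pos by (simp add: \<epsilon>_def)
    show "\<epsilon> \<le> 1 / 304" unfolding \<epsilon>_def by (rule min.cobounded1)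
    have "\<epsilon> * (19 * T * I) \<le> R / (19 * T * I + 1) * (19 * T * I + 1)"
      using p R_pos assms I by (intro mult_mono) (auto simp: \<epsilon>_def)
    then show "\<epsilon> * (19 * T * I) \<le> R" using p by simp
  qed
  \<comment> \<open>Jumps are cut at \<open>\<Lambda> / \<sigma>\<close>. Since
    \<open>exp (- \<Lambda> / 2) = \<epsilon>\<close>, omitting the larger ones moves the mean by
    \<open>O(\<epsilon> N / \<sigma>)\<close> only, and their tilted mass is at most
    \<open>N / 8\<close>.\<close>
  define \<Lambda> where "\<Lambda> = 2 * ln (1 / \<epsilon>)"
  have e\<Lambda>: "exp (- \<Lambda> / 2) = \<epsilon>" "exp (- \<Lambda>) \<le> 1 / 48" "1 \<le> \<Lambda>"
  proof -
    show e1: "exp (- \<Lambda> / 2) = \<epsilon>" using \<epsilon> by (simp add: \<Lambda>_def ln_div)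
    have "exp (- \<Lambda>) = exp (- \<Lambda> / 2) * exp (- \<Lambda> / 2)" by (simp flip: exp_add)
    also have "\<dots> \<le> 1 / 304 * (1 / 304)" unfolding e1 using \<epsilon> by (intro mult_mono) auto
    finally show e2: "exp (- \<Lambda>) \<le> 1 / 48" by simp
    have "(1 / 48 :: real) \<le> 1 / 3" by simp
    also have "1 / 3 \<le> exp (-1 :: real)" using exp_le by (simp add: exp_minus field_simps)
    finally have "exp (- \<Lambda>) \<le> exp (-1)" using e2 by linarith
    then show "1 \<le> \<Lambda>" by simp
  qed
  define cz where "cz = a1 / 48 / CC"
  have cz: "0 < cz" using a_pos CC by (simp add: cz_def)
  \<comment> \<open>From \<open>K0\<close> on, \<open>1 / \<sigma> \<le> R\<close> permits scaling
    at \<open>1 / \<sigma>\<close>, and \<open>\<sigma> \<ge> 1\<close> permits the linear bound of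
    \<open>H\<close>.\<close>
  define K0 where "K0 = max 1 (1 / R)"
  \<comment> \<open>In turn: \<open>\<sigma> \<ge> K0\<close>; the width \<open>1 / \<sigma>\<close>
    of the target is at most \<open>\<epsilon> * N / \<sigma>\<close>; the distance \<open>z\<close>
    to the mean is at least eight times the largest remaining jump; the variance is small against
    \<open>z\<^sup>2\<close>.\<close>
  define K where "K = max (max (2 + T * lexp_H n K0) (1 / \<epsilon>)) (max (8 * \<Lambda> / (cz * \<epsilon>)) (1152 / (cz\<^sup>2 * \<epsilon>\<^sup>2)))"
  define c where "c = 9 / (64 * (a2 * CC))"
  have H0: "0 \<le> lexp_H n K0"
    by (rule order_trans[OF _ lexp_H_bounds(2)[OF ld]]) (auto simp: K0_def intro!: levy_integral_nonneg[OF ld])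
  have K1: "1 < K"
  proof -
    have "1 < 2 + T * lexp_H n K0" using H0 assms by (simp add: add_pos_nonneg)
    also have "\<dots> \<le> K" by (simp add: K_def)
    finally show ?thesis .
  qed
  show ?thesis
  proof (rule that[of K c])
    show "1 < K" by fact
    show "0 < c" using a_pos CC by (simp add: c_def)
    fix t h v P \<sigma> B l
    assume t: "t \<le> T" "tscale t h v" and P: "levy_law P (\<lambda>s. t * n s)" and \<sigma>: "0 < \<sigma>" "K \<le> t * lexp_H n \<sigma>"
      and B: "B \<in> sets borel" "B \<subseteq> {t * lexp_deriv n \<sigma>..t * lexp_deriv n \<sigma> + 1 / \<sigma>}"
        "emeasure lborel B = ennreal l" "0 \<le> l"
    have th: "0 < t" "0 < h" "lexp_H n h = 1 / t" using t by (auto simp: tscale_def)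
    define N where "N = t * lexp_H n \<sigma>"
    have NK: "K \<le> N" and N1: "1 < N" using \<sigma> K1 by (auto simp: N_def)
    have hs: "h \<le> \<sigma>"
    proof (rule ccontr)
      assume "\<not> h \<le> \<sigma>"
      then have "lexp_H n \<sigma> \<le> 1 / t" using lexp_H_mono[OF ld \<sigma>(1), of h] th by simp
      then have "N \<le> 1" using th by (simp add: N_def pos_le_divide_eq mult.commute)
      then show False using N1 by simp
    qed
    have K0s: "K0 \<le> \<sigma>"
    proof (rule ccontr)
      assume "\<not> K0 \<le> \<sigma>"
      then have "lexp_H n \<sigma> \<le> lexp_H n K0" using lexp_H_mono[OF ld \<sigma>(1), of K0] by simp
      then have "N \<le> T * lexp_H n K0" unfolding N_def using t th H0 assms
        by (intro order_trans[OF mult_left_mono mult_right_mono]) auto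
      moreover have "2 + T * lexp_H n K0 \<le> K" by (simp add: K_def)
      ultimately show False using NK by simp
    qed
    define q where "q = 1 / \<sigma>"
    have q: "0 < q" "q \<le> R" "1 \<le> \<sigma>" "\<sigma> * q = 1"
    proof -
      have "1 / R \<le> \<sigma>" "1 \<le> \<sigma>" using K0s by (auto simp: K0_def)
      then show "0 < q" "q \<le> R" "1 \<le> \<sigma>" "\<sigma> * q = 1" using \<sigma>(1) R_pos by (auto simp: q_def field_simps)
    qed
    have Nq: "N \<le> CC * (t * (q * n q))"
    proof -
      have "t * lexp_H n \<sigma> \<le> t * ((CV + CT) * (q * n q))"
        using lexp_H_scale(1)[OF q(1,2)] th \<sigma> by (intro mult_left_mono) (auto simp: q_def)
      then show ?thesis by (simp add: N_def CC_def ac_simps)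
    qed
    have NT: "N * q \<le> T * I"
    proof -
      have "lexp_H n \<sigma> * q \<le> \<sigma> * I * q" using lexp_H_le_linear[OF q(3)] q unfolding I_def by (intro mult_right_mono) auto
      also have "\<dots> = I" using q(4) by (simp add: mult.commute mult.left_commute)
      finally have "t * (lexp_H n \<sigma> * q) \<le> T * I" using t th I by (intro mult_mono) (auto intro!: mult_nonneg_nonneg order_trans[OF _ lexp_H_bounds(2)[OF ld \<sigma>(1)]] levy_integral_nonneg[OF ld] simp: q less_imp_le)
      then show ?thesis by (simp add: N_def mult.assoc)
    qed
    have KN: "1 / \<epsilon> \<le> N" "8 * \<Lambda> / (cz * \<epsilon>) \<le> N" "1152 / (cz\<^sup>2 * \<epsilon>\<^sup>2) \<le> N"
      using NK by (auto simp: K_def)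
    define \<sigma>' where "\<sigma>' = (1 + \<epsilon>) * \<sigma>"
    have \<sigma>': "0 < \<sigma>'" "\<sigma> \<le> \<sigma>'" "\<sigma>' \<le> 2 * \<sigma>" "\<sigma>' - \<sigma> = \<epsilon> * \<sigma>"
    proof -
      have "\<epsilon> * \<sigma> \<le> 1 * \<sigma>" using \<epsilon> \<sigma>(1) by (intro mult_right_mono) auto
      then show "0 < \<sigma>'" "\<sigma> \<le> \<sigma>'" "\<sigma>' \<le> 2 * \<sigma>" "\<sigma>' - \<sigma> = \<epsilon> * \<sigma>"
        using \<epsilon> \<sigma>(1) by (auto simp: \<sigma>'_def distrib_right add_pos_pos)
    qed
    let ?\<nu> = "\<lambda>s. exp (- \<sigma>' * s) * (t * n s)"
    have l\<mu>: "levy_density (\<lambda>s. t * n s)" using th by (intro levy_density_scale[OF ld]) auto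
    have s0: "0 \<le> \<sigma>'" using \<sigma>' by simp
    note tilt = levy_law_tilt[OF l\<mu> P s0]
    let ?T = "density P (\<lambda>u. ennreal (exp (lexp (\<lambda>s. t * n s) \<sigma>' - \<sigma>' * u)))"
    have lex: "lexp (\<lambda>s. t * n s) k = t * lexp n k" for k unfolding lexp_def by (simp add: mult.left_commute)
    define r where "r = \<Lambda> * q"
    have r: "0 < r" "q \<le> r" using q e\<Lambda>(3) mult_right_mono[of 1 \<Lambda> q] by (auto simp: r_def)
    let ?\<mu> = "\<lambda>s. indicator {..r} s * ?\<nu> s" and ?f = "\<lambda>s. indicator {r<..} s * ?\<nu> s"
    have s1: "levy_density ?\<mu>" by (rule levy_truncate[OF tilt(1)]) auto
    have s2: "jump_density ?f" by (rule jump_density_truncate[OF tilt(1) _ r(1)]) auto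
    have s3: "?\<nu> s = ?\<mu> s + ?f s" for s by (auto split: split_indicator)
    define S where "S = (\<integral>s. min 1 ((\<sigma> * s)\<^sup>2) * n s \<partial>lborel)"
    have iS: "integrable lborel (\<lambda>s. min 1 ((\<sigma> * s)\<^sup>2) * n s)" by (rule integrable_min_sq[OF ld])
    have S: "t * S \<le> 6 * N"
    proof -
      have "S \<le> 6 * lexp_H n \<sigma>" using lexp_H_bounds(2)[OF ld \<sigma>(1)] by (simp add: S_def)
      then have "t * S \<le> t * (6 * lexp_H n \<sigma>)" using th by (intro mult_left_mono) auto
      then show ?thesis by (simp add: N_def)
    qed
    have "0 \<le> S" unfolding S_def by (rule levy_integral_nonneg[OF ld]) auto
    then have S0: "0 \<le> t * S" using th by simp
    have far: "1 \<le> min 1 ((\<sigma> * s)\<^sup>2)" if "r < s" for s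
    proof -
      have "\<sigma> * q \<le> \<sigma> * s" using that r \<sigma>(1) by (intro mult_left_mono) auto
      then have "1 \<le> (\<sigma> * s)\<^sup>2" using q by (simp add: one_le_power)
      then show ?thesis by simp
    qed
    have mass: "(\<integral>s. ?f s \<partial>lborel) \<le> N / 8"
    proof -
      have "(\<integral>s. ?f s \<partial>lborel) \<le> (\<integral>s. (t * exp (- \<Lambda>)) * (min 1 ((\<sigma> * s)\<^sup>2) * n s) \<partial>lborel)"
      proof (rule integral_mono[OF jump_density.integrable[OF s2]])
        show "integrable lborel (\<lambda>s. (t * exp (- \<Lambda>)) * (min 1 ((\<sigma> * s)\<^sup>2) * n s))" using iS by (rule integrable_mult_right)
        fix s :: real
        show "?f s \<le> (t * exp (- \<Lambda>)) * (min 1 ((\<sigma> * s)\<^sup>2) * n s)"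
        proof (cases "r < s")
          case True
          have "\<sigma> * r \<le> \<sigma>' * s" using True \<sigma>' \<sigma>(1) r by (intro mult_mono) auto
          moreover have "\<sigma> * r = \<Lambda>" using q(4) by (simp add: r_def mult.left_commute)
          ultimately have "exp (- \<sigma>' * s) \<le> exp (- \<Lambda>)" by simp
          then have "exp (- \<sigma>' * s) * (t * n s) \<le> exp (- \<Lambda>) * (t * n s)" using th n_nonneg by (intro mult_right_mono) auto
          also have "\<dots> \<le> (t * exp (- \<Lambda>) * n s) * min 1 ((\<sigma> * s)\<^sup>2)"
            using mult_left_mono[OF far[OF True], of "t * exp (- \<Lambda>) * n s"] th n_nonneg by (simp add: ac_simps)
          finally show ?thesis using True by (simp add: ac_simps)
        qed (use th n_nonneg in auto)
      qed
      also have "\<dots> = exp (- \<Lambda>) * (t * S)" by (simp add: S_def)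
      also have "\<dots> \<le> 1 / 48 * (6 * N)" by (rule mult_mono[OF e\<Lambda>(2) S]) (use S0 in auto)
      finally show ?thesis by simp
    qed
    have var_le: "s\<^sup>2 * exp (- \<sigma> * s) * n s \<le> q\<^sup>2 * (min 1 ((\<sigma> * s)\<^sup>2) * n s)" for s
    proof (cases "0 < s")
      case True
      have "s\<^sup>2 * exp (- \<sigma> * s) \<le> q\<^sup>2" using mult_exp_bounds(4)[OF True \<sigma>(1)] by (simp add: q_def power_divide)
      moreover have "s\<^sup>2 * exp (- \<sigma> * s) \<le> q\<^sup>2 * (\<sigma> * s)\<^sup>2"
      proof -
        have "q\<^sup>2 * (\<sigma> * s)\<^sup>2 = (\<sigma> * q)\<^sup>2 * s\<^sup>2" by (simp add: power_mult_distrib ac_simps)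
        also have "\<dots> = s\<^sup>2" using q by simp
        finally show ?thesis using True \<sigma>(1) by (simp add: mult_left_le)
      qed
      ultimately have "s\<^sup>2 * exp (- \<sigma> * s) \<le> q\<^sup>2 * min 1 ((\<sigma> * s)\<^sup>2)" by (auto simp: min_def)
      then show ?thesis using mult_right_mono[of "s\<^sup>2 * exp (- \<sigma> * s)" "q\<^sup>2 * min 1 ((\<sigma> * s)\<^sup>2)" "n s"] n_nonneg by (simp add: mult.assoc)
    qed (use n_nonpos[of s] in simp)
    have i2: "integrable lborel (\<lambda>s. s\<^sup>2 * exp (- \<sigma> * s) * n s)" by (rule integrable_lexp_deriv2[OF ld \<sigma>(1)])
    have V2: "t * (\<integral>s. s\<^sup>2 * exp (- \<sigma> * s) * n s \<partial>lborel) \<le> 6 * N * q\<^sup>2"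
    proof -
      have "(\<integral>s. s\<^sup>2 * exp (- \<sigma> * s) * n s \<partial>lborel) \<le> (\<integral>s. q\<^sup>2 * (min 1 ((\<sigma> * s)\<^sup>2) * n s) \<partial>lborel)"
        using i2 iS var_le by (intro integral_mono integrable_mult_right) auto
      also have "\<dots> = q\<^sup>2 * S" by (simp add: S_def)
      finally have "t * (\<integral>s. s\<^sup>2 * exp (- \<sigma> * s) * n s \<partial>lborel) \<le> q\<^sup>2 * (t * S)"
        using th mult_left_mono[of _ "q\<^sup>2 * S" t] by (simp add: mult.left_commute)
      also have "\<dots> \<le> q\<^sup>2 * (6 * N)" using S by (intro mult_left_mono) auto
      finally show ?thesis by (simp add: ac_simps)
    qed
    have iW: "integrable lborel (\<lambda>s. s\<^sup>2 * ?\<mu> s)"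
    proof -
      have "integrable lborel (\<lambda>s. (indicator {..r} s * s\<^sup>2) * ?\<nu> s)" by (rule integrable_trunc_moment[OF tilt(1)])
      then show ?thesis by (simp add: ac_simps)
    qed
    have W: "(\<integral>s. s\<^sup>2 * ?\<mu> s \<partial>lborel) \<le> 6 * N * q\<^sup>2"
    proof -
      have "(\<integral>s. s\<^sup>2 * ?\<mu> s \<partial>lborel) \<le> (\<integral>s. t * (s\<^sup>2 * exp (- \<sigma> * s) * n s) \<partial>lborel)"
      proof (rule integral_mono[OF iW integrable_mult_right[OF i2]])
        fix s :: real
        show "s\<^sup>2 * ?\<mu> s \<le> t * (s\<^sup>2 * exp (- \<sigma> * s) * n s)"
        proof (cases "0 < s \<and> s \<le> r")
          case True
          have "exp (- \<sigma>' * s) \<le> exp (- \<sigma> * s)" using True \<sigma>' by (simp add: mult_right_mono)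
          then have "(s\<^sup>2 * (t * n s)) * exp (- \<sigma>' * s) \<le> (s\<^sup>2 * (t * n s)) * exp (- \<sigma> * s)"
            using th n_nonneg by (intro mult_left_mono) auto
          then show ?thesis using True by (simp add: ac_simps)
        next
          case False
          then show ?thesis using n_nonpos[of s] th n_nonneg[of s] by (cases "s \<le> 0") auto
        qed
      qed
      then show ?thesis using V2 by simp
    qed
    define m where "m = (\<integral>s. s * ?\<mu> s \<partial>lborel)"
    have im: "integrable lborel (\<lambda>s. s * ?\<mu> s)"
    proof -
      have "integrable lborel (\<lambda>s. (indicator {..r} s * (s * t)) * (exp (- \<sigma>' * s) * n s))"
      proof -
        have "levy_density (\<lambda>s. exp (- \<sigma>' * s) * n s)" using levy_density_mult[OF ld, of "\<lambda>s. exp (- \<sigma>' * s)" 1] s0 by auto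
        then show ?thesis
        proof (rule levy_integrable[where C = "(1 + r) * t"])
          fix s :: real assume "0 < s"
          then have "indicator {..r} s * s \<le> (1 + r) * min 1 s" using r
            by (auto simp: min_def algebra_simps split: split_indicator)
          then have "indicator {..r} s * s * t \<le> (1 + r) * min 1 s * t" using th by (intro mult_right_mono) auto
          then show "\<bar>indicator {..r} s * (s * t)\<bar> \<le> (1 + r) * t * min 1 s" using \<open>0 < s\<close> th by (simp add: abs_mult ac_simps)
        qed measurable
      qed
      then show ?thesis by (simp add: ac_simps)
    qed
    define x where "x = t * lexp_deriv n \<sigma>"
    have ix: "integrable lborel (\<lambda>s. t * (s * exp (- \<sigma> * s) * n s))" by (rule integrable_mult_right[OF integrable_lexp_deriv[OF ld \<sigma>(1)]])
    have xm: "x - m = (\<integral>s. t * (s * exp (- \<sigma> * s) * n s) - s * ?\<mu> s \<partial>lborel)"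
      using ix im by (simp add: x_def m_def lexp_deriv_def)
    have split2: "s * exp (- \<sigma>' * s) = s * exp (- \<sigma> * s) * exp (- (\<epsilon> * (\<sigma> * s)))" for s
      by (simp add: \<sigma>'_def algebra_simps flip: exp_add)
    \<comment> \<open>For jumps up to \<open>q\<close> the additional tilt reduces the mean by at
      least \<open>\<epsilon> * \<sigma> / 6\<close> times their second moment, where 6 is 3 from
      the old tilt times 2 from \<open>1 - exp (- u) \<ge> u / 2\<close>. By scaling this has order
      \<open>\<epsilon> * N * q\<close>.\<close>
    have z_lo: "cz * \<epsilon> * N * q \<le> x - m"
    proof -
      have i: "integrable lborel (\<lambda>s. (indicator {..q} s * s\<^sup>2) * n s)" by (rule integrable_trunc_moment[OF ld])
      have "(\<integral>s. (t * (\<epsilon> * \<sigma> / 6)) * ((indicator {..q} s * s\<^sup>2) * n s) \<partial>lborel) \<le> x - m"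
        unfolding xm
      proof (rule integral_mono[OF integrable_mult_right[OF i] Bochner_Integration.integrable_diff[OF ix im]])
        fix s :: real
        show "(t * (\<epsilon> * \<sigma> / 6)) * ((indicator {..q} s * s\<^sup>2) * n s) \<le> t * (s * exp (- \<sigma> * s) * n s) - s * ?\<mu> s"
        proof (cases "0 < s")
          case True
          have e1: "exp (- (\<epsilon> * (\<sigma> * s))) \<le> 1" using True \<epsilon> \<sigma>(1) by simp
          have ge: "s * ?\<mu> s \<le> t * (s * exp (- \<sigma>' * s) * n s)"
            using True th n_nonneg[of s] by (auto split: split_indicator)
          have "(t * (\<epsilon> * \<sigma> / 6)) * ((indicator {..q} s * s\<^sup>2) * n s) \<le> t * (s * exp (- \<sigma> * s) * (1 - exp (- (\<epsilon> * (\<sigma> * s)))) * n s)"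
          proof (cases "s \<le> q")
            case sq: True
            have sq1: "\<sigma> * s \<le> 1" using mult_left_mono[OF sq, of \<sigma>] q \<sigma>(1) by simp
            define u where "u = \<epsilon> * (\<sigma> * s)"
            have u: "0 \<le> u" "u \<le> 1" using True \<epsilon> \<sigma>(1) sq1 mult_mono[of \<epsilon> 1 "\<sigma> * s" 1] by (auto simp: u_def)
            have "(1 - u / 2) \<ge> exp (- u)"
            proof -
              have "1 + u \<le> exp u" by (rule exp_ge_add_one_self)
              have "u * u \<le> u * 1" using u by (intro mult_left_mono) auto
              then have "1 \<le> (1 - u / 2) * (1 + u)" by (simp add: algebra_simps)
              also have "\<dots> \<le> (1 - u / 2) * exp u" using \<open>1 + u \<le> exp u\<close> u by (intro mult_left_mono) auto
              finally show ?thesis by (simp add: exp_minus field_simps)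
            qed
            then have "u / 2 \<le> 1 - exp (- u)" by simp
            moreover have "1 / 3 \<le> exp (- \<sigma> * s)"
            proof -
              have "1 / 3 \<le> exp (-1 :: real)" using exp_le by (simp add: exp_minus field_simps)
              also have "\<dots> \<le> exp (- \<sigma> * s)" using sq1 by simp
              finally show ?thesis .
            qed
            ultimately have "1 / 3 * (u / 2) \<le> exp (- \<sigma> * s) * (1 - exp (- u))" using u by (intro mult_mono) auto
            then have "(t * s * n s) * (1 / 3 * (u / 2)) \<le> (t * s * n s) * (exp (- \<sigma> * s) * (1 - exp (- u)))"
              using True th n_nonneg by (intro mult_left_mono) auto
            then show ?thesis using sq by (simp add: u_def power2_eq_square ac_simps)
          next
            case False
            then show ?thesis using True th n_nonneg[of s] e1 by simp
          qed
          also have "\<dots> = t * (s * exp (- \<sigma> * s) * n s) - t * (s * exp (- \<sigma>' * s) * n s)"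
            unfolding split2 by (simp add: algebra_simps)
          finally show ?thesis using ge by linarith
        qed (use n_nonpos[of s] in simp)
      qed
      also have "(\<integral>s. (t * (\<epsilon> * \<sigma> / 6)) * ((indicator {..q} s * s\<^sup>2) * n s) \<partial>lborel) = t * (\<epsilon> * \<sigma> / 6) * trunc_moment n q"
        by (simp add: trunc_moment_def)
      finally have 1: "t * (\<epsilon> * \<sigma> / 6) * trunc_moment n q \<le> x - m" .
      have "cz * \<epsilon> * N * q \<le> cz * \<epsilon> * (CC * (t * (q * n q))) * q" using Nq cz \<epsilon> q by (intro mult_right_mono mult_left_mono) auto
      also have "\<dots> = t * (\<epsilon> * \<sigma> / 6) * (a1 / 8 * (q ^ 3 * n q))"
      proof -
        have "cz * CC = a1 / 48" using CC by (simp add: cz_def)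
        then have "cz * \<epsilon> * (CC * (t * (q * n q))) * q = a1 / 48 * \<epsilon> * t * (q * n q) * q"
          by (metis (no_types, lifting) mult.assoc mult.commute)
        also have "\<dots> = a1 / 48 * \<epsilon> * t * (q * n q) * q * (\<sigma> * q)" using q by simp
        also have "\<dots> = t * (\<epsilon> * \<sigma> / 6) * (a1 / 8 * (q ^ 3 * n q))" by (simp add: power3_eq_cube)
        finally show ?thesis .
      qed
      also have "\<dots> \<le> t * (\<epsilon> * \<sigma> / 6) * trunc_moment n q"
        using th \<epsilon> \<sigma>(1) q by (intro mult_left_mono trunc_moment_ge) auto
      finally show ?thesis using 1 by linarith
    qed
    \<comment> \<open>Two errors of \<open>6 * \<epsilon> * N * q\<close> each: the additional tilt
      of the jumps up to \<open>r\<close>, bounded by a second moment, and the omitted jumps above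
      \<open>r\<close>, bounded by the choice of \<open>\<Lambda>\<close>.\<close>
    have z_hi: "x - m \<le> 12 * \<epsilon> * N * q"
    proof -
      have "x - m \<le> (\<integral>s. (\<epsilon> * \<sigma>) * (t * (s\<^sup>2 * exp (- \<sigma> * s) * n s)) + (\<epsilon> * q) * (t * (min 1 ((\<sigma> * s)\<^sup>2) * n s)) \<partial>lborel)"
        unfolding xm
      proof (rule integral_mono[OF Bochner_Integration.integrable_diff[OF ix im]])
        show "integrable lborel (\<lambda>s. (\<epsilon> * \<sigma>) * (t * (s\<^sup>2 * exp (- \<sigma> * s) * n s)) + (\<epsilon> * q) * (t * (min 1 ((\<sigma> * s)\<^sup>2) * n s)))"
          by (intro Bochner_Integration.integrable_add integrable_mult_right i2 iS)
        fix s :: real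
        show "t * (s * exp (- \<sigma> * s) * n s) - s * ?\<mu> s \<le> (\<epsilon> * \<sigma>) * (t * (s\<^sup>2 * exp (- \<sigma> * s) * n s)) + (\<epsilon> * q) * (t * (min 1 ((\<sigma> * s)\<^sup>2) * n s))"
        proof (cases "0 < s")
          case s: True
          have p1: "0 \<le> (\<epsilon> * \<sigma>) * (t * (s\<^sup>2 * exp (- \<sigma> * s) * n s))" using \<epsilon> \<sigma>(1) th n_nonneg[of s] by simp
          have p2: "0 \<le> (\<epsilon> * q) * (t * (min 1 ((\<sigma> * s)\<^sup>2) * n s))" using \<epsilon> q th n_nonneg[of s] by simp
          show ?thesis
          proof (cases "s \<le> r")
            case True
            have "1 - exp (- (\<epsilon> * (\<sigma> * s))) \<le> \<epsilon> * (\<sigma> * s)" using exp_ge_add_one_self[of "- (\<epsilon> * (\<sigma> * s))"] by simp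
            then have "(t * s * exp (- \<sigma> * s) * n s) * (1 - exp (- (\<epsilon> * (\<sigma> * s)))) \<le> (t * s * exp (- \<sigma> * s) * n s) * (\<epsilon> * (\<sigma> * s))"
              using s th n_nonneg by (intro mult_left_mono) auto
            moreover have "s * ?\<mu> s = (t * s * exp (- \<sigma> * s) * n s) * exp (- (\<epsilon> * (\<sigma> * s)))"
            proof -
              have "s * ?\<mu> s = (s * exp (- \<sigma>' * s)) * (t * n s)" using True by simp
              also have "\<dots> = (t * s * exp (- \<sigma> * s) * n s) * exp (- (\<epsilon> * (\<sigma> * s)))" unfolding split2 by simp
              finally show ?thesis .
            qed
            ultimately have "t * (s * exp (- \<sigma> * s) * n s) - s * ?\<mu> s \<le> (\<epsilon> * \<sigma>) * (t * (s\<^sup>2 * exp (- \<sigma> * s) * n s))"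
            proof -
              assume "t * s * exp (- \<sigma> * s) * n s * (1 - exp (- (\<epsilon> * (\<sigma> * s)))) \<le> t * s * exp (- \<sigma> * s) * n s * (\<epsilon> * (\<sigma> * s))"
                and eq: "s * ?\<mu> s = (t * s * exp (- \<sigma> * s) * n s) * exp (- (\<epsilon> * (\<sigma> * s)))"
              then show ?thesis unfolding eq by (simp add: right_diff_distrib power2_eq_square ac_simps)
            qed
            then show ?thesis using p2 by linarith
          next
            case False
            then have rs: "r < s" by simp
            have "\<sigma> * r \<le> \<sigma> * s" using rs \<sigma>(1) by (intro mult_left_mono) auto
            moreover have "\<sigma> * r = \<Lambda>" using q(4) by (simp add: r_def mult.left_commute)
            ultimately have "exp (- (\<sigma> * s) / 2) \<le> exp (- \<Lambda> / 2)" by simp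
            moreover have "(\<sigma> * s) * exp (- (\<sigma> * s)) \<le> exp (- (\<sigma> * s) / 2)"
              by (rule mult_exp_minus_le(3)) (use s \<sigma>(1) in simp)
            ultimately have "(\<sigma> * s) * exp (- (\<sigma> * s)) \<le> \<epsilon>" unfolding e\<Lambda>(1) by (rule order_trans[rotated])
            then have "q * ((\<sigma> * s) * exp (- (\<sigma> * s))) \<le> q * \<epsilon>" using q by (intro mult_left_mono) auto
            moreover have "s * exp (- \<sigma> * s) = (\<sigma> * q) * (s * exp (- \<sigma> * s))" using q(4) by (simp only: mult_1)
            moreover have "\<dots> = q * ((\<sigma> * s) * exp (- (\<sigma> * s)))" by simp
            ultimately have "s * exp (- \<sigma> * s) \<le> q * \<epsilon>" by linarith
            then have "s * exp (- \<sigma> * s) \<le> \<epsilon> * q" by (simp only: mult.commute)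
            then have "(t * n s) * (s * exp (- \<sigma> * s)) \<le> (t * n s) * (\<epsilon> * q)" using th n_nonneg by (intro mult_left_mono) auto
            also have "\<dots> \<le> (t * n s * (\<epsilon> * q)) * min 1 ((\<sigma> * s)\<^sup>2)"
              using mult_left_mono[OF far[OF rs], of "t * n s * (\<epsilon> * q)"] th n_nonneg[of s] \<epsilon> q by simp
            finally have "t * (s * exp (- \<sigma> * s) * n s) \<le> (\<epsilon> * q) * (t * (min 1 ((\<sigma> * s)\<^sup>2) * n s))"
              by (simp only: ac_simps)
            moreover have "s * ?\<mu> s = 0" using rs by simp
            ultimately show ?thesis using p1 by linarith
          qed
        qed (use n_nonpos[of s] in simp)
      qed
      also have "\<dots> = (\<epsilon> * \<sigma>) * (t * (\<integral>s. s\<^sup>2 * exp (- \<sigma> * s) * n s \<partial>lborel)) + (\<epsilon> * q) * (t * S)"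
        using i2 iS by (simp add: S_def)
      also have "\<dots> \<le> (\<epsilon> * \<sigma>) * (6 * N * q\<^sup>2) + (\<epsilon> * q) * (6 * N)"
        using V2 S \<epsilon> \<sigma>(1) q by (intro add_mono mult_left_mono) auto
      also have "(\<epsilon> * \<sigma>) * (6 * N * q\<^sup>2) = (\<sigma> * q) * (6 * \<epsilon> * N * q)" by (simp add: power2_eq_square)
      finally show ?thesis using q by (simp add: ac_simps)
    qed
    define z where "z = x - m"
    have zp: "0 < cz * \<epsilon> * N * q" using cz \<epsilon> N1 q by simp
    then have z: "0 < z" using z_lo by (simp add: z_def)
    have zr: "2 * r \<le> z" "8 * r \<le> z"
    proof -
      have "8 * \<Lambda> \<le> cz * \<epsilon> * N" using KN(2) cz \<epsilon> by (simp add: pos_divide_le_eq ac_simps)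
      then have "8 * \<Lambda> * q \<le> cz * \<epsilon> * N * q" using q by (intro mult_right_mono) auto
      then show "8 * r \<le> z" using z_lo by (simp add: r_def z_def)
      then show "2 * r \<le> z" using r by simp
    qed
    have V: "(4 / (z / 2))\<^sup>2 * exp (4 / (z / 2) * r) * (\<integral>s. s\<^sup>2 * ?\<mu> s \<partial>lborel) \<le> 1"
    proof -
      have "4 / (z / 2) * r \<le> 1" using zr z by (simp add: field_simps)
      then have "exp (4 / (z / 2) * r) \<le> exp 1" by simp
      then have e3: "exp (4 / (z / 2) * r) \<le> 3" using exp_le by linarith
      have W0: "0 \<le> (\<integral>s. s\<^sup>2 * ?\<mu> s \<partial>lborel)" by (rule levy_integral_nonneg[OF s1]) auto
      have "(4 / (z / 2))\<^sup>2 * exp (4 / (z / 2) * r) * (\<integral>s. s\<^sup>2 * ?\<mu> s \<partial>lborel) \<le> (4 / (z / 2))\<^sup>2 * 3 * (6 * N * q\<^sup>2)"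
        using W0 by (intro mult_mono[OF mult_left_mono[OF e3] W]) auto
      also have "\<dots> = 1152 * N * q\<^sup>2 / z\<^sup>2" by (simp add: power_divide)
      also have "\<dots> \<le> 1"
      proof -
        have "1152 \<le> N * (cz\<^sup>2 * \<epsilon>\<^sup>2)" using KN(3) cz \<epsilon> by (simp add: pos_divide_le_eq)
        then have "1152 * (N * q\<^sup>2) \<le> N * (cz\<^sup>2 * \<epsilon>\<^sup>2) * (N * q\<^sup>2)" using N1 by (intro mult_right_mono) auto
        also have "\<dots> = (cz * \<epsilon> * N * q)\<^sup>2" by (simp add: power2_eq_square)
        also have "\<dots> \<le> z\<^sup>2" using z_lo zp by (intro power_mono) (auto simp: z_def)
        finally show ?thesis using z by (simp add: ac_simps)
      qed
      finally show ?thesis .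
    qed
    \<comment> \<open>\<open>t * n q\<close> is at least \<open>\<sigma> * N / CC\<close>, and a
      jump of size at most \<open>N * q\<close> loses \<open>N ^ 3\<close> by scaling. This leaves
      the inverse square of \<open>N\<close>; the exponential is the tilt of the jump.\<close>
    define \<kappa> where "\<kappa> = \<sigma> / (a2 * CC) / N\<^sup>2 * exp (- N / 8)"
    have \<kappa>0: "0 \<le> \<kappa>" using \<sigma>(1) a_pos CC by (simp add: \<kappa>_def)
    have lowT: "ennreal (exp (- (N / 8)) * \<kappa> / 2 * l) \<le> emeasure ?T B"
    proof (rule one_jump[OF tilt(2) s1 s2 s3 r(1) _ _ V m_def B(1,3,4) \<kappa>0 _ mass])
      show "?\<mu> s = 0" if "r < s" for s using that by simp
      show "0 < z / 2" using z by simp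
      fix u w assume u: "u \<in> B" and w: "u - m - z / 2 < w" "w < u - m + z / 2"
      have ux: "x \<le> u" "u \<le> x + q" using u B(2) by (auto simp: x_def q_def)
      have zu: "z \<le> u - m" "u - m \<le> z + q" using ux by (auto simp: z_def)
      have w1: "z / 2 < w" using w(1) zu by (simp add: field_simps)
      have rw: "r < w" using w1 zr by linarith
      \<comment> \<open>The jump is at most \<open>3/2 * z + q\<close>; with
        \<open>z \<le> 12 * \<epsilon> * N * q\<close> and \<open>q \<le> \<epsilon> * N * q\<close>
        this adds up to 19.\<close>
      have w2: "w \<le> 19 * \<epsilon> * N * q"
      proof -
        have "1 \<le> N * \<epsilon>" using KN(1) \<epsilon> by (simp add: pos_divide_le_eq)
        then have "1 * q \<le> \<epsilon> * N * q" using q by (intro mult_right_mono) (auto simp: mult.commute)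
        moreover have "w \<le> z + q + z / 2" using w(2) zu by (simp add: field_simps)
        moreover have "z \<le> 12 * (\<epsilon> * N * q)" using z_hi by (simp add: z_def)
        ultimately have "w \<le> 19 * (\<epsilon> * N * q)" by linarith
        then show ?thesis by simp
      qed
      have wR: "w \<le> R"
      proof -
        have "19 * \<epsilon> * N * q = 19 * \<epsilon> * (N * q)" by simp
        also have "\<dots> \<le> 19 * \<epsilon> * (T * I)" using NT \<epsilon> by (intro mult_left_mono) auto
        also have "\<dots> \<le> R" using \<epsilon>(3) by (simp add: ac_simps)
        finally show ?thesis using w2 by linarith
      qed
      have qw: "q \<le> w" "0 < w" using rw r by auto
      have "1 / N powr (1 + \<alpha>2) \<le> (q / w) powr (1 + \<alpha>2)"
      proof -
        have "19 * \<epsilon> * N * q \<le> 1 * N * q" using \<epsilon> N1 q by (intro mult_right_mono) auto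
        then have "w \<le> N * q" using w2 by simp
        then have "1 / N \<le> q / w" using N1 qw by (simp add: field_simps)
        then have "(1 / N) powr (1 + \<alpha>2) \<le> (q / w) powr (1 + \<alpha>2)" using N1 \<alpha> by (intro powr_mono2) auto
        then show ?thesis using N1 by (simp add: powr_divide)
      qed
      moreover have "1 / N ^ 3 \<le> 1 / N powr (1 + \<alpha>2)"
      proof -
        have "N powr (1 + \<alpha>2) \<le> N powr 3" using N1 \<alpha> by (intro powr_mono) auto
        then have "N powr (1 + \<alpha>2) \<le> N ^ 3" using N1 by (simp add: powr_numeral)
        then show ?thesis using N1 by (intro divide_left_mono) auto
      qed
      ultimately have "1 / N ^ 3 \<le> (q / w) powr (1 + \<alpha>2)" by linarith
      then have "1 / N ^ 3 * n q / a2 \<le> (q / w) powr (1 + \<alpha>2) * n q / a2"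
        using a_pos n_nonneg by (intro divide_right_mono mult_right_mono) auto
      also have "\<dots> \<le> n w" by (rule n_scale_ge[OF q(1) qw(1) wR])
      finally have nw: "1 / N ^ 3 * n q / a2 \<le> n w" .
      have "\<sigma> * N / CC \<le> t * n q"
      proof -
        have "N / CC \<le> t * (q * n q)" using Nq CC by (simp add: pos_divide_le_eq mult.commute)
        then have "\<sigma> * (N / CC) \<le> \<sigma> * (t * (q * n q))" using \<sigma>(1) by (intro mult_left_mono) auto
        also have "\<dots> = (\<sigma> * q) * (t * n q)" by simp
        finally show ?thesis using q by simp
      qed
      then have "\<sigma> * N / CC * (1 / N ^ 3 / a2) \<le> t * n q * (1 / N ^ 3 / a2)" using N1 a_pos by (intro mult_right_mono) auto
      also have "\<dots> = t * (1 / N ^ 3 * n q / a2)" by simp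
      also have "\<dots> \<le> t * n w" using nw th by (intro mult_left_mono) auto
      finally have tnw: "\<sigma> / (a2 * CC) / N\<^sup>2 \<le> t * n w" using N1 by (simp add: power2_eq_square power3_eq_cube ac_simps)
      have "exp (- N / 8) \<le> exp (- \<sigma>' * w)"
      proof -
        have "\<sigma>' * w \<le> (2 * \<sigma>) * (19 * \<epsilon> * N * q)" using \<sigma>' w2 qw by (intro mult_mono) auto
        also have "\<dots> = 38 * \<epsilon> * N * (\<sigma> * q)" by simp
        also have "\<dots> = 38 * \<epsilon> * N" using q by simp
        also have "\<dots> \<le> 38 * (1 / 304) * N" using \<epsilon> N1 by (intro mult_right_mono mult_left_mono) auto
        finally show ?thesis by simp
      qed
      then have "\<kappa> \<le> (t * n w) * exp (- \<sigma>' * w)"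
        unfolding \<kappa>_def using tnw th n_nonneg by (intro mult_mono) auto
      then show "\<kappa> \<le> ?f w" using rw by (simp add: ac_simps)
    qed
    have Bm: "B \<in> sets P" using B levy_lawD(2)[OF P] by simp
    have "emeasure ?T B = (\<integral>\<^sup>+u. ennreal (exp (lexp (\<lambda>s. t * n s) \<sigma>' - \<sigma>' * u)) * indicator B u \<partial>P)"
      using Bm levy_lawD(2)[OF P] by (intro emeasure_density) (auto simp: measurable_cong_sets[OF levy_lawD(2)[OF P] refl])
    also have "\<dots> \<le> (\<integral>\<^sup>+u. ennreal (exp N) * indicator B u \<partial>P)"
    proof (rule nn_integral_mono)
      fix u
      show "ennreal (exp (lexp (\<lambda>s. t * n s) \<sigma>' - \<sigma>' * u)) * indicator B u \<le> ennreal (exp N) * indicator B u"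
      proof (cases "u \<in> B")
        case True
        then have "t * lexp_deriv n \<sigma> \<le> u" using B by auto
        then have "\<sigma>' * (t * lexp_deriv n \<sigma>) \<le> \<sigma>' * u" using \<sigma>' by (intro mult_left_mono) auto
        \<comment> \<open>The tangent at \<open>\<sigma>\<close> shows that on \<open>B\<close> the
          tilting density is at most \<open>exp N\<close> with \<open>N\<close> taken at
          \<open>\<sigma>\<close>, although the tilt is by \<open>\<sigma>'\<close>.\<close>
        moreover have "t * lexp n \<sigma>' \<le> t * (lexp n \<sigma> + (\<sigma>' - \<sigma>) * lexp_deriv n \<sigma>)"
          using lexp_concave[OF ld \<sigma>(1) \<sigma>'(1)] th by (intro mult_left_mono) auto
        ultimately have "lexp (\<lambda>s. t * n s) \<sigma>' - \<sigma>' * u \<le> N"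
          unfolding lex N_def lexp_H_def by (simp add: algebra_simps)
        then show ?thesis using True by (simp add: ennreal_leI)
      qed simp
    qed
    also have "\<dots> = ennreal (exp N) * emeasure P B" using Bm by (simp add: nn_integral_cmult)
    finally have "ennreal (exp (- (N / 8)) * \<kappa> / 2 * l) \<le> ennreal (exp N) * emeasure P B" using lowT by (rule order_trans[rotated])
    then have "ennreal (exp (- N)) * ennreal (exp (- (N / 8)) * \<kappa> / 2 * l) \<le> ennreal (exp (- N)) * (ennreal (exp N) * emeasure P B)"
      by (rule mult_left_mono) simp
    also have "\<dots> = emeasure P B"
      by (simp add: mult.assoc[symmetric] ennreal_mult[symmetric] flip: exp_add)
    finally have fin: "ennreal (exp (- N) * (exp (- (N / 8)) * \<kappa> / 2 * l)) \<le> emeasure P B"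
      using \<kappa>0 B by (subst ennreal_mult) simp_all
    have "c * (h * exp (- 2 * t * lexp_H n \<sigma>)) * l \<le> exp (- N) * (exp (- (N / 8)) * \<kappa> / 2 * l)"
    proof -
      \<comment> \<open>The remaining \<open>3/4 * N\<close> of the exponent \<open>2 * N\<close>
        pays for the inverse square; 2 divided by the square of 3/4 is 32/9, the source of the
        constant \<open>c\<close>.\<close>
      have "N ^ 2 * exp (- (3 / 4) * N) \<le> fact 2 / (3 / 4) ^ 2" by (rule power_times_exp_le) (use N1 in auto)
      then have "9 / 32 * exp (- (3 / 4) * N) \<le> 1 / N\<^sup>2" using N1 by (simp add: field_simps power2_eq_square fact_numeral)
      then have "exp (- N) * exp (- (N / 8)) * exp (- N / 8) * (9 / 32 * exp (- (3 / 4) * N)) \<le> exp (- N) * exp (- (N / 8)) * exp (- N / 8) * (1 / N\<^sup>2)"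
        by (intro mult_left_mono) auto
      moreover have "exp (- N) * exp (- (N / 8)) * exp (- N / 8) * (9 / 32 * exp (- (3 / 4) * N)) = 9 / 32 * exp (- 2 * N)"
      proof -
        have "exp (- N) * exp (- (N / 8)) * exp (- N / 8) * exp (- (3 / 4) * N) = exp (- 2 * N)"
          by (simp only: exp_add[symmetric]) simp
        then show ?thesis by simp
      qed
      ultimately have e: "9 / 32 * exp (- 2 * N) \<le> exp (- N) * exp (- (N / 8)) * exp (- N / 8) * (1 / N\<^sup>2)" by linarith
      have "c * (h * exp (- 2 * N)) \<le> c * (\<sigma> * exp (- 2 * N))"
        using hs a_pos CC by (intro mult_left_mono mult_right_mono) (auto simp: c_def)
      also have "\<dots> = \<sigma> / (a2 * CC) / 2 * (9 / 32 * exp (- 2 * N))" by (simp add: c_def)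
      also have "\<dots> \<le> \<sigma> / (a2 * CC) / 2 * (exp (- N) * exp (- (N / 8)) * exp (- N / 8) * (1 / N\<^sup>2))"
        using e \<sigma>(1) a_pos CC by (intro mult_left_mono) auto
      also have "\<dots> = exp (- N) * (exp (- (N / 8)) * \<kappa> / 2)" by (simp add: \<kappa>_def ac_simps)
      finally have "c * (h * exp (- 2 * N)) * l \<le> exp (- N) * (exp (- (N / 8)) * \<kappa> / 2) * l" using B by (intro mult_right_mono) auto
      moreover have "- 2 * t * lexp_H n \<sigma> = - 2 * N" by (simp add: N_def)
      ultimately show ?thesis by (simp only: mult.assoc)
    qed
    then show "ennreal (c * (h * exp (- 2 * t * lexp_H n \<sigma>)) * l) \<le> emeasure P B"
      using fin by (meson ennreal_leI order_trans)
  qed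
qed

end

text \<open>A sum of \<open>j + 1\<close> independent steps, each in \<open>[d, d + l]\<close> with
  probability at least \<open>c\<close>. It carries the process beyond \<open>R\<close>, although a
  single jump is controlled only up to \<open>R\<close>.\<close>

lemma levy_law_power_interval:
  assumes \<mu>: "levy_density \<mu>" and c: "0 \<le> c" "\<And>Q. levy_law Q \<mu> \<Longrightarrow> ennreal c \<le> emeasure Q {d..d + l}"
    and Q: "levy_law Q (\<lambda>s. real (Suc j) * \<mu> s)"
  shows "ennreal (c ^ Suc j) \<le> emeasure Q {real (Suc j) * d..real (Suc j) * (d + l)}"
  using Q
proof (induction j arbitrary: Q)
  case 0
  then show ?case using c by simp
next
  case (Suc j)
  obtain T where T: "levy_law T \<mu>" using levy_law_exists[OF \<mu>] by auto
  have l: "levy_density (\<lambda>s. real (Suc j) * \<mu> s)" by (rule levy_density_scale[OF \<mu>]) simp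
  have "real (Suc (Suc j)) * \<mu> s = real (Suc j) * \<mu> s + \<mu> s" for s by (simp add: distrib_right)
  from levy_law_split[OF Suc.prems l \<mu> T this] obtain Q' where Q': "levy_law Q' (\<lambda>s. real (Suc j) * \<mu> s)"
    "\<And>B. B \<in> sets borel \<Longrightarrow> emeasure Q B = (\<integral>\<^sup>+u. \<integral>\<^sup>+v. indicator B (u + v) \<partial>T \<partial>Q')" by blast
  note [measurable_cong] = levy_lawD(2)[OF T] levy_lawD(2)[OF Q'(1)]
  let ?A = "{real (Suc j) * d..real (Suc j) * (d + l)}" and ?B = "{real (Suc (Suc j)) * d..real (Suc (Suc j)) * (d + l)}"
  have "ennreal (c ^ Suc (Suc j)) = ennreal (c ^ Suc j) * ennreal c" using c by (simp add: ennreal_mult[symmetric] mult.commute)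
  also have "\<dots> \<le> emeasure Q' ?A * emeasure T {d..d + l}"
    by (intro mult_mono Suc.IH[OF Q'(1)] c(2)[OF T]) auto
  also have "\<dots> = (\<integral>\<^sup>+u. emeasure T {d..d + l} * indicator ?A u \<partial>Q')"
    by (subst nn_integral_cmult) (auto simp: mult.commute)
  also have "\<dots> \<le> (\<integral>\<^sup>+u. \<integral>\<^sup>+v. indicator ?B (u + v) \<partial>T \<partial>Q')"
  proof (rule nn_integral_mono)
    fix u
    show "emeasure T {d..d + l} * indicator ?A u \<le> (\<integral>\<^sup>+v. indicator ?B (u + v) \<partial>T)"
    proof (cases "u \<in> ?A")
      case True
      have "emeasure T {d..d + l} = (\<integral>\<^sup>+v. indicator {d..d + l} v \<partial>T)" by simp
      also have "\<dots> \<le> (\<integral>\<^sup>+v. indicator ?B (u + v) \<partial>T)"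
        using True by (intro nn_integral_mono) (auto split: split_indicator simp: algebra_simps)
      finally show ?thesis using True by simp
    qed simp
  qed
  also have "\<dots> = emeasure Q ?B" by (rule Q'(2)[symmetric]) simp
  finally show ?case .
qed

section \<open>Times bounded away from zero, and the combined lower bound\<close>

context scaled_levy_density
begin

lemma lexp_deriv_pos:
  assumes "0 < l"
  shows "0 < lexp_deriv n l"
proof -
  have "0 < (\<integral>s. indicator {R / 2<..R} s * (R / 2 * (exp (- l * R) * (a1 * n R))) \<partial>lborel)"
    using R_pos a_pos n_pos[of R] by simp
  also have "\<dots> \<le> lexp_deriv n l"
    unfolding lexp_deriv_def
  proof (rule integral_mono[OF _ integrable_lexp_deriv[OF ld assms]])
    show "integrable lborel (\<lambda>s. indicator {R / 2<..R} s * (R / 2 * (exp (- l * R) * (a1 * n R))))"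
      using R_pos by (intro integrable_mult_left integrable_real_indicator) auto
    fix s :: real
    show "indicator {R / 2<..R} s * (R / 2 * (exp (- l * R) * (a1 * n R))) \<le> s * exp (- l * s) * n s"
    proof (cases "R / 2 < s \<and> s \<le> R")
      case True
      have "l * s \<le> l * R" using True assms by (intro mult_left_mono) auto
      then have "exp (- l * R) \<le> exp (- l * s)" by simp
      moreover have "a1 * n R \<le> n s" using True R_pos by (intro n_antimono) auto
      ultimately have "R / 2 * (exp (- l * R) * (a1 * n R)) \<le> s * (exp (- l * s) * n s)"
        using True R_pos a_pos n_nonneg by (intro mult_mono) auto
      then show ?thesis using True by (simp add: mult.assoc)
    next
      case False
      then show ?thesis using n_nonpos[of s] n_nonneg[of s] by (cases "s \<le> 0") auto
    qed
  qed
  finally show ?thesis .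
qed

text \<open>The jumps below a cutoff sum to at most \<open>l / 4\<close> with probability 1/2, and
  one jump into the middle half of the interval does the rest. The constant serves all densities
  between \<open>k0 * n\<close> and \<open>k1 * n\<close>.\<close>

lemma interval_prob:
  assumes "0 < k0" "k0 \<le> k1" "0 < l"
  obtains c where "0 < c"
    "\<And>\<rho> Q d. levy_density \<rho> \<Longrightarrow> (\<And>s. 0 < s \<Longrightarrow> k0 * n s \<le> \<rho> s \<and> \<rho> s \<le> k1 * n s) \<Longrightarrow> levy_law Q \<rho> \<Longrightarrow>
       0 \<le> d \<Longrightarrow> d + l \<le> R \<Longrightarrow> ennreal c \<le> emeasure Q {d..d + l}"
proof -
  have k1: "0 < k1" using assms by simp
  have l4: "0 < l / 4" using assms by simp
  have "\<forall>\<^sub>F k in sequentially. lexp n (1 / (l / 4)) - 1 / (4 * k1) < lexp (\<lambda>s. indicator {1 / real (Suc k)..} s * n s) (1 / (l / 4))"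
    using assms k1 by (intro order_tendstoD(1)[OF tendsto_lexp_truncate[OF ld]]) auto
  moreover have "\<forall>\<^sub>F k in sequentially. 1 / real (Suc k) < l / 4"
    using l4 by (intro order_tendstoD(2)[OF lim_1_over_n[THEN LIMSEQ_Suc]]) auto
  ultimately have "\<forall>\<^sub>F k in sequentially. lexp n (1 / (l / 4)) - 1 / (4 * k1) < lexp (\<lambda>s. indicator {1 / real (Suc k)..} s * n s) (1 / (l / 4)) \<and> 1 / real (Suc k) < l / 4"
    by (rule eventually_conj)
  then obtain k where k: "lexp n (1 / (l / 4)) - 1 / (4 * k1) < lexp (\<lambda>s. indicator {1 / real (Suc k)..} s * n s) (1 / (l / 4))"
    "1 / real (Suc k) < l / 4" using eventually_happens'[OF sequentially_bot] by blast
  \<comment> \<open>\<open>r\<close> is so small that the jumps below it have exponent at most 1/4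
    at argument \<open>4 / l\<close>; the tail bound then gives the probability 1/2.\<close>
  define r where "r = 1 / real (Suc k)"
  have r: "0 < r" "r < l / 4" using k by (auto simp: r_def)
  have small: "lexp (\<lambda>s. indicator {..<r} s * n s) (1 / (l / 4)) \<le> 1 / (4 * k1)"
  proof -
    have "lexp n (1 / (l / 4)) = lexp (\<lambda>s. indicator {..<r} s * n s + indicator {r..} s * n s) (1 / (l / 4))"
      by (rule arg_cong[where f = "\<lambda>f. lexp f _"]) (auto split: split_indicator)
    also have "\<dots> = lexp (\<lambda>s. indicator {..<r} s * n s) (1 / (l / 4)) + lexp (\<lambda>s. indicator {r..} s * n s) (1 / (l / 4))"
      using l4 by (intro lexp_add levy_truncate[OF ld]) auto
    finally show ?thesis using k(1) by (simp add: r_def)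
  qed
  define J where "J = k1 * (\<integral>s. indicator {r..} s * n s \<partial>lborel)"
  define K where "K = k0 * (a1 * n R) * (l / 2)"
  have K: "0 < K" using assms a_pos n_pos[of R] R_pos by (simp add: K_def)
  show ?thesis
  proof (rule that[of "exp (- J) * K / 2"])
    show "0 < exp (- J) * K / 2" using K by simp
    fix \<rho> Q d
    assume \<rho>: "levy_density \<rho>" "\<And>s. 0 < s \<Longrightarrow> k0 * n s \<le> \<rho> s \<and> \<rho> s \<le> k1 * n s" and Q: "levy_law Q \<rho>"
      and d: "0 \<le> d" "d + l \<le> R"
    let ?\<mu> = "\<lambda>s. indicator {..<r} s * \<rho> s" and ?f = "\<lambda>s. indicator {r..} s * \<rho> s"
    have l\<mu>: "levy_density ?\<mu>" by (rule levy_truncate[OF \<rho>(1)]) simp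
    have jf: "jump_density ?f" by (rule jump_density_truncate[OF \<rho>(1) _ r(1)]) auto
    have "\<rho> s = ?\<mu> s + ?f s" for s by (auto split: split_indicator)
    from levy_law_ge_jump[OF Q l\<mu> jf this] obtain Q' where Q': "levy_law Q' ?\<mu>"
      "\<And>B A K. B \<in> sets borel \<Longrightarrow> A \<in> sets borel \<Longrightarrow> 0 \<le> K \<Longrightarrow>
       (\<And>u. u \<in> A \<Longrightarrow> ennreal K \<le> (\<integral>\<^sup>+v. ennreal (?f v) * indicator B (u + v) \<partial>lborel)) \<Longrightarrow>
       ennreal (exp (- (\<integral>s. ?f s \<partial>lborel)) * K) * emeasure Q' A \<le> emeasure Q B" by blast
    interpret Q': prob_space Q' using levy_lawD(1)[OF Q'(1)] .
    have mass: "(\<integral>s. ?f s \<partial>lborel) \<le> J"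
    proof -
      have i: "integrable lborel (\<lambda>s. indicator {r..} s * n s)" by (rule integrable_indicator_away[OF ld r(1)]) auto
      have "(\<integral>s. ?f s \<partial>lborel) \<le> (\<integral>s. k1 * (indicator {r..} s * n s) \<partial>lborel)"
        using \<rho>(2) r by (intro integral_mono[OF jump_density.integrable[OF jf] integrable_mult_right[OF i]])
          (auto split: split_indicator)
      then show ?thesis by (simp add: J_def)
    qed
    have half: "ennreal (1 / 2) \<le> emeasure Q' {0..l / 4}"
    proof -
      have "lexp ?\<mu> (1 / (l / 4)) \<le> lexp (\<lambda>s. k1 * (indicator {..<r} s * n s)) (1 / (l / 4))"
        using \<rho>(2) k1 l4 by (intro lexp_mono[OF l\<mu>] levy_density_scale levy_truncate[OF ld]) (auto split: split_indicator)
      also have "\<dots> = k1 * lexp (\<lambda>s. indicator {..<r} s * n s) (1 / (l / 4))"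
        unfolding lexp_def by (simp add: mult.left_commute)
      also have "\<dots> \<le> k1 * (1 / (4 * k1))" using small k1 by (intro mult_left_mono) auto
      finally have "lexp ?\<mu> (1 / (l / 4)) \<le> 1 / 4" using k1 by simp
      then have t: "measure Q' {l / 4<..} \<le> 1 / 2" using levy_law_tail[OF l\<mu> Q'(1) l4] by linarith
      have "measure Q' {0..l / 4} = measure Q' (UNIV - {l / 4<..})"
        using levy_lawD(2,3)[OF Q'(1)] by (intro Q'.finite_measure_eq_AE) (auto elim!: eventually_mono)
      also have "\<dots> = 1 - measure Q' {l / 4<..}"
        using Q'.prob_compl[of "{l / 4<..}"] levy_lawD(2,4)[OF Q'(1)] by simp
      finally have "1 / 2 \<le> measure Q' {0..l / 4}" using t by simp
      then show ?thesis unfolding Q'.emeasure_eq_measure by (rule ennreal_leI)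
    qed
    have "ennreal (exp (- J) * K / 2) = ennreal (exp (- J) * K) * ennreal (1 / 2)"
    proof -
      have "exp (- J) * K / 2 = exp (- J) * K * (1 / 2)" by simp
      then show ?thesis using K by (simp only:) (intro ennreal_mult, auto)
    qed
    also have "\<dots> \<le> ennreal (exp (- (\<integral>s. ?f s \<partial>lborel)) * K) * emeasure Q' {0..l / 4}"
      using mass K by (intro mult_mono ennreal_leI mult_right_mono half) auto
    also have "\<dots> \<le> emeasure Q {d..d + l}"
    proof (rule Q'(2))
      fix u assume u: "u \<in> {0..l / 4}"
      have "ennreal K = ennreal (k0 * (a1 * n R)) * emeasure lborel {d + l / 4..d + 3 * l / 4}"
        using assms a_pos n_nonneg by (simp add: K_def ennreal_mult[symmetric])
      also have "\<dots> = (\<integral>\<^sup>+v. ennreal (k0 * (a1 * n R)) * indicator {d + l / 4..d + 3 * l / 4} v \<partial>lborel)"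
        by (simp add: nn_integral_cmult)
      also have "\<dots> \<le> (\<integral>\<^sup>+v. ennreal (?f v) * indicator {d..d + l} (u + v) \<partial>lborel)"
      proof (rule nn_integral_mono)
        fix w
        show "ennreal (k0 * (a1 * n R)) * indicator {d + l / 4..d + 3 * l / 4} w \<le> ennreal (?f w) * indicator {d..d + l} (u + w)"
        proof (cases "w \<in> {d + l / 4..d + 3 * l / 4}")
          case True
          then have w: "r \<le> w" "0 < w" "w \<le> R" using r d assms by auto
          have "k0 * (a1 * n R) \<le> k0 * n w" using n_antimono[OF w(2,3) order_refl] assms by (intro mult_left_mono) auto
          also have "\<dots> \<le> \<rho> w" using \<rho>(2)[OF w(2)] by simp
          finally show ?thesis using True u w by (auto intro: ennreal_leI)
        qed simp
      qed
      finally show "ennreal K \<le> (\<integral>\<^sup>+v. ennreal (?f v) * indicator {d..d + l} (u + v) \<partial>lborel)" .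
    qed (use K in auto)
    finally show "ennreal (exp (- J) * K / 2) \<le> emeasure Q {d..d + l}" .
  qed
qed

text \<open>For times bounded away from \<open>0\<close>, half of the jumps bring the process close to the target
  and a single jump of the other half provides the density.\<close>

lemma lower_large_time:
  assumes "0 < t0" "t0 \<le> T" "0 < x0" "x0 \<le> X"
  obtains \<delta> c where "0 < \<delta>" "0 < c"
    "\<And>t P x B l. t0 \<le> t \<Longrightarrow> t \<le> T \<Longrightarrow> levy_law P (\<lambda>s. t * n s) \<Longrightarrow> x0 \<le> x \<Longrightarrow> x \<le> X \<Longrightarrow>
       B \<in> sets borel \<Longrightarrow> B \<subseteq> {x..x + \<delta>} \<Longrightarrow> emeasure lborel B = ennreal l \<Longrightarrow> 0 \<le> l \<Longrightarrow>
       ennreal (c * l) \<le> emeasure P B"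
proof -
  define \<delta> where "\<delta> = min x0 R / 4"
  have \<delta>: "0 < \<delta>" "\<delta> \<le> x0 / 4" "\<delta> \<le> R / 4" using assms R_pos by (auto simp: \<delta>_def)
  \<comment> \<open>The whole distance \<open>X + \<delta>\<close> is divided into
    \<open>N + 1\<close> steps of length at most \<open>R\<close>.\<close>
  obtain N :: nat where N: "(X + \<delta>) / R \<le> real N" using real_arch_simple by blast
  have N0: "0 < real (Suc N)" "X + \<delta> \<le> real (Suc N) * R"
  proof -
    show "0 < real (Suc N)" by simp
    have "X + \<delta> \<le> real N * R" using N R_pos by (simp add: pos_divide_le_eq)
    also have "\<dots> \<le> real (Suc N) * R" using R_pos by (intro mult_right_mono) auto
    finally show "X + \<delta> \<le> real (Suc N) * R" .
  qed
  have "t0 / 2 / real (Suc N) \<le> T / real (Suc N)" using assms by (intro divide_right_mono) auto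
  moreover have "0 < t0 / 2 / real (Suc N)" "0 < \<delta> / real (Suc N)" using assms \<delta> by auto
  ultimately have pre: "0 < t0 / 2 / real (Suc N)" "t0 / 2 / real (Suc N) \<le> T / real (Suc N)" "0 < \<delta> / real (Suc N)" by blast+
  from interval_prob[OF pre] obtain c where c: "0 < c"
    "\<And>\<rho> Q d. levy_density \<rho> \<Longrightarrow> (\<And>s. 0 < s \<Longrightarrow> t0 / 2 / real (Suc N) * n s \<le> \<rho> s \<and> \<rho> s \<le> T / real (Suc N) * n s) \<Longrightarrow> levy_law Q \<rho> \<Longrightarrow>
       0 \<le> d \<Longrightarrow> d + \<delta> / real (Suc N) \<le> R \<Longrightarrow> ennreal c \<le> emeasure Q {d..d + \<delta> / real (Suc N)}" by blast
  define J where "J = T * (\<integral>s. indicator {\<delta>..R} s * n s \<partial>lborel)"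
  define K where "K = t0 / 2 * (a1 * n R)"
  have K: "0 < K" using assms a_pos n_pos[of R] R_pos by (simp add: K_def)
  show ?thesis
  proof (rule that[of \<delta> "exp (- J) * K * c ^ Suc N"])
    show "0 < \<delta>" by fact
    show "0 < exp (- J) * K * c ^ Suc N" using K c by simp
    fix t P x B l
    assume t: "t0 \<le> t" "t \<le> T" and P: "levy_law P (\<lambda>s. t * n s)" and x: "x0 \<le> x" "x \<le> X"
      and B: "B \<in> sets borel" "B \<subseteq> {x..x + \<delta>}" "emeasure lborel B = ennreal l" "0 \<le> l"
    have t0: "0 < t" using t assms by simp
    let ?f = "\<lambda>s. indicator {\<delta>..R} s * (t / 2 * n s)"
    have lt: "levy_density (\<lambda>s. t / 2 * n s)" using t0 by (intro levy_density_scale[OF ld]) simp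
    have jf: "jump_density ?f" by (rule jump_density_truncate[OF lt _ \<delta>(1)]) auto
    let ?\<mu> = "\<lambda>s. t * n s - ?f s"
    have f_le: "?f s \<le> t / 2 * n s" for s using t0 n_nonneg[of s] by (auto split: split_indicator)
    have l\<mu>: "levy_density ?\<mu>"
    proof (rule levy_density_diff)
      show "levy_density (\<lambda>s. t * n s)" using t0 by (intro levy_density_scale[OF ld]) simp
      show "levy_density ?f" by (rule jump_density.levy[OF jf])
      show "?f s \<le> t * n s" for s using f_le[of s] t0 n_nonneg[of s] by simp
    qed
    have "t * n s = ?\<mu> s + ?f s" for s by simp
    from levy_law_ge_jump[OF P l\<mu> jf this] obtain Q where Q: "levy_law Q ?\<mu>"
      "\<And>B A K. B \<in> sets borel \<Longrightarrow> A \<in> sets borel \<Longrightarrow> 0 \<le> K \<Longrightarrow>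
       (\<And>u. u \<in> A \<Longrightarrow> ennreal K \<le> (\<integral>\<^sup>+v. ennreal (?f v) * indicator B (u + v) \<partial>lborel)) \<Longrightarrow>
       ennreal (exp (- (\<integral>s. ?f s \<partial>lborel)) * K) * emeasure Q A \<le> emeasure P B" by blast
    have mass: "(\<integral>s. ?f s \<partial>lborel) \<le> J"
    proof -
      have nn: "0 \<le> (\<integral>s. indicator {\<delta>..R} s * n s \<partial>lborel)" by (rule levy_integral_nonneg[OF ld]) auto
      have "(\<integral>s. ?f s \<partial>lborel) = (\<integral>s. t / 2 * (indicator {\<delta>..R} s * n s) \<partial>lborel)"
        by (intro Bochner_Integration.integral_cong) auto
      also have "\<dots> = t / 2 * (\<integral>s. indicator {\<delta>..R} s * n s \<partial>lborel)" by (rule integral_mult_right_zero)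
      also have "\<dots> \<le> J" unfolding J_def using nn t t0 by (intro mult_right_mono) auto
      finally show ?thesis .
    qed
    \<comment> \<open>The first half of the jumps is steered to a point behind the target, at
      distance at most \<open>3 * R / 4\<close> and not too close, so that the last jump lies in
      \<open>[\<delta>, R]\<close>.\<close>
    define d where "d = max 0 (x - 3 * R / 4)"
    have d: "0 \<le> d" "d \<le> X" "\<delta> \<le> x - d - \<delta>" "x + \<delta> - d \<le> R"
      using x \<delta> assms R_pos unfolding d_def max_def by auto
    have int: "ennreal (c ^ Suc N) \<le> emeasure Q {d..d + \<delta>}"
    proof -
      have "ennreal (c ^ Suc N) \<le> emeasure Q {real (Suc N) * (d / real (Suc N))..real (Suc N) * (d / real (Suc N) + \<delta> / real (Suc N))}"
      proof (rule levy_law_power_interval)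
        show l1: "levy_density (\<lambda>s. 1 / real (Suc N) * ?\<mu> s)" by (rule levy_density_scale[OF l\<mu>]) simp
        show "0 \<le> c" using c by simp
        fix Q' assume Q': "levy_law Q' (\<lambda>s. 1 / real (Suc N) * ?\<mu> s)"
        show "ennreal c \<le> emeasure Q' {d / real (Suc N)..d / real (Suc N) + \<delta> / real (Suc N)}"
        proof (rule c(2)[OF l1 _ Q'])
          fix s :: real assume "0 < s"
          have "t0 / 2 * n s \<le> t / 2 * n s" "t * n s \<le> T * n s" using t n_nonneg by (auto intro!: mult_right_mono)
          moreover have "t / 2 * n s \<le> ?\<mu> s" using f_le[of s] by simp
          moreover have "?\<mu> s \<le> t * n s" using t0 n_nonneg[of s] by simp
          ultimately have "t0 / 2 * n s \<le> ?\<mu> s" "?\<mu> s \<le> T * n s" by linarith+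
          from this[THEN divide_right_mono, of "real (Suc N)"]
          show "t0 / 2 / real (Suc N) * n s \<le> 1 / real (Suc N) * ?\<mu> s \<and> 1 / real (Suc N) * ?\<mu> s \<le> T / real (Suc N) * n s"
            by (simp only: times_divide_eq_left mult_1)
        next
          show "0 \<le> d / real (Suc N)" using d by simp
          have "d + \<delta> \<le> R * real (Suc N)" using d N0 by (simp only: mult.commute)
          then show "d / real (Suc N) + \<delta> / real (Suc N) \<le> R"
            using N0(1) by (simp only: add_divide_distrib[symmetric] pos_divide_le_eq)
        qed
      next
        show "levy_law Q (\<lambda>s. real (Suc N) * (1 / real (Suc N) * ?\<mu> s))"
          using Q(1) by (simp del: of_nat_Suc)
      qed
      also have "{real (Suc N) * (d / real (Suc N))..real (Suc N) * (d / real (Suc N) + \<delta> / real (Suc N))} = {d..d + \<delta>}"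
        by (simp add: distrib_left del: of_nat_Suc)
      finally show ?thesis .
    qed
    have "ennreal (exp (- J) * K * c ^ Suc N * l) = ennreal (exp (- J) * (K * l)) * ennreal (c ^ Suc N)"
      using K c B by (simp add: ennreal_mult[symmetric] ac_simps)
    also have "\<dots> \<le> ennreal (exp (- (\<integral>s. ?f s \<partial>lborel)) * (K * l)) * emeasure Q {d..d + \<delta>}"
      using mass K B by (intro mult_mono ennreal_leI mult_right_mono int) auto
    also have "\<dots> \<le> emeasure P B"
    proof (rule Q(2)[OF B(1)])
      fix u assume u: "u \<in> {d..d + \<delta>}"
      have "ennreal (K * l) = ennreal K * (\<integral>\<^sup>+w. indicator B (u + w) \<partial>lborel)"
        using B K by (simp add: nn_integral_indicator_shift ennreal_mult)
      also have "\<dots> = (\<integral>\<^sup>+w. ennreal K * indicator B (u + w) \<partial>lborel)"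
        using B by (subst nn_integral_cmult) auto
      also have "\<dots> \<le> (\<integral>\<^sup>+w. ennreal (?f w) * indicator B (u + w) \<partial>lborel)"
      proof (rule nn_integral_mono)
        fix w
        show "ennreal K * indicator B (u + w) \<le> ennreal (?f w) * indicator B (u + w)"
        proof (cases "u + w \<in> B")
          case True
          then have "x \<le> u + w" "u + w \<le> x + \<delta>" using B by auto
          then have w: "\<delta> \<le> w" "w \<le> R" "0 < w" using u d \<delta> by auto
          have "K \<le> t / 2 * n w"
            unfolding K_def using n_antimono[OF w(3,2) order_refl] t assms a_pos n_nonneg by (intro mult_mono) auto
          then show ?thesis using True w by (simp add: ennreal_leI)
        qed simp
      qed
      finally show "ennreal (K * l) \<le> (\<integral>\<^sup>+w. ennreal (?f w) * indicator B (u + w) \<partial>lborel)" .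
    qed (use K B in auto)
    finally show "ennreal (exp (- J) * K * c ^ Suc N * l) \<le> emeasure P B" .
  qed
qed

text \<open>The right side of the shifted bound as a real number; the case \<open>y = 0\<close>
  encodes the convention of an infinite density at 0.\<close>

definition jump_bound :: "real \<Rightarrow> real \<Rightarrow> real \<Rightarrow> real" where
  "jump_bound t h y = (if y = 0 then h else min h (t * n y))"

lemma jump_bound_le:
  assumes "0 \<le> t"
  shows "jump_bound t h y \<le> h" "0 \<le> h \<Longrightarrow> 0 \<le> jump_bound t h y"
  using assms n_nonneg[of y] by (auto simp: jump_bound_def)

text \<open>For small \<open>v\<close> the connecting jump, at most \<open>y + C * v\<close>, stays
  below \<open>R\<close>. Otherwise \<open>t\<close> is bounded away from 0 and \<open>x\<close>
  ranges over a compact interval, so a constant bound suffices. The admissible width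
  \<open>\<delta>\<close> of the target differs between the cases.\<close>

lemma lower_near:
  assumes "0 < T" "1 \<le> \<Lambda>" "0 < Y" "Y < R"
  obtains c where "0 < c"
    "\<And>t h v P x y. t \<le> T \<Longrightarrow> tscale t h v \<Longrightarrow> levy_law P (\<lambda>s. t * n s) \<Longrightarrow> 0 \<le> y \<Longrightarrow> y \<le> Y \<Longrightarrow>
       t * lexp_deriv n (\<Lambda> / v) \<le> x \<Longrightarrow> x \<le> t * lexp_deriv n h + y \<Longrightarrow>
       \<exists>\<delta>>0. \<forall>B l. B \<in> sets borel \<longrightarrow> B \<subseteq> {x..x + \<delta>} \<longrightarrow> emeasure lborel B = ennreal l \<longrightarrow> 0 \<le> l \<longrightarrow>
         ennreal (c * jump_bound t h y * l) \<le> emeasure P B"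
proof -
  from tscale_facts[OF assms(1)] obtain c0 C0 where c0: "0 < c0" "0 < C0"
    "\<And>t h v. t \<le> T \<Longrightarrow> tscale t h v \<Longrightarrow> 0 < t \<and> 0 < h \<and> 0 < v \<and> v \<le> R \<and> c0 \<le> t * (v * n v) \<and> t * (v * n v) \<le> C0 \<and>
       h * v \<le> 1 \<and> 1 / h \<le> C0 * v" by blast
  from lower_one_jump[OF assms(1,2)] obtain \<eta> C c1 where c1: "0 < \<eta>" "0 < C" "0 < c1"
    "\<And>t h v P x y \<kappa> B l. t \<le> T \<Longrightarrow> tscale t h v \<Longrightarrow> levy_law P (\<lambda>s. t * n s) \<Longrightarrow>
       t * lexp_deriv n (\<Lambda> / v) \<le> x \<Longrightarrow> x \<le> t * lexp_deriv n h + y \<Longrightarrow> 0 \<le> \<kappa> \<Longrightarrow>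
       (\<And>s. \<eta> * v \<le> s \<Longrightarrow> s \<le> y + C * v \<Longrightarrow> \<kappa> \<le> t * n s) \<Longrightarrow>
       B \<in> sets borel \<Longrightarrow> B \<subseteq> {x..x + v} \<Longrightarrow> emeasure lborel B = ennreal l \<Longrightarrow> 0 \<le> l \<Longrightarrow>
       ennreal (c1 * \<kappa> * l) \<le> emeasure P B" by blast
  \<comment> \<open>The gap between \<open>Y\<close> and \<open>R\<close> leaves room for
    \<open>C * vs\<close>, which is why \<open>Y < R\<close> is strict.\<close>
  define vs where "vs = min R ((R - Y) / C)"
  have vs: "0 < vs" "vs \<le> R" "C * vs \<le> R - Y"
  proof -
    show "0 < vs" "vs \<le> R" using c1 assms R_pos by (auto simp: vs_def)
    have "C * vs \<le> C * ((R - Y) / C)" using c1 by (intro mult_left_mono) (auto simp: vs_def)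
    then show "C * vs \<le> R - Y" using c1 by simp
  qed
  define E where "E = min a1 (1 / (a2 * (1 + C) powr (1 + \<alpha>2)))"
  have E: "0 < E" using a_pos c1 by (simp add: E_def)
  \<comment> \<open>The rate at \<open>v\<close> is at least \<open>c0\<close>, and
    near-monotonicity of \<open>r * n r\<close> transfers this to \<open>vs\<close>; hence
    \<open>v \<ge> vs\<close> forces \<open>t \<ge> ts\<close>.\<close>
  define ts where "ts = min T (c0 * a1 / (vs * n vs))"
  have nvs: "0 < vs * n vs" using vs n_pos by simp
  have ts: "0 < ts" "ts \<le> T" using assms c0 a_pos nvs by (auto simp: ts_def)
  define x0 where "x0 = ts * lexp_deriv n (\<Lambda> / vs)"
  define X where "X = max x0 (T * lexp_deriv n (1 / (C0 * R)) + Y)"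
  have x0: "0 < x0" using ts lexp_deriv_pos[of "\<Lambda> / vs"] assms vs by (simp add: x0_def)
  have "x0 \<le> X" by (simp add: X_def)
  from lower_large_time[OF ts x0 this] obtain \<delta>2 c2 where c2: "0 < \<delta>2" "0 < c2"
    "\<And>t P x B l. ts \<le> t \<Longrightarrow> t \<le> T \<Longrightarrow> levy_law P (\<lambda>s. t * n s) \<Longrightarrow> x0 \<le> x \<Longrightarrow> x \<le> X \<Longrightarrow>
       B \<in> sets borel \<Longrightarrow> B \<subseteq> {x..x + \<delta>2} \<Longrightarrow> emeasure lborel B = ennreal l \<Longrightarrow> 0 \<le> l \<Longrightarrow>
       ennreal (c2 * l) \<le> emeasure P B" by blast
  define c where "c = min (c1 * (E * min 1 c0)) (c2 * vs)"
  have c: "0 < c" using c1 c2 E c0 vs by (simp add: c_def)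
  show ?thesis
  proof (rule that[OF c])
    fix t h v P x y
    assume t: "t \<le> T" "tscale t h v" and P: "levy_law P (\<lambda>s. t * n s)" and y: "0 \<le> y" "y \<le> Y"
      and x: "t * lexp_deriv n (\<Lambda> / v) \<le> x" "x \<le> t * lexp_deriv n h + y"
    from c0(3)[OF t] have f: "0 < t" "0 < h" "0 < v" "v \<le> R" "c0 \<le> t * (v * n v)" "t * (v * n v) \<le> C0" "h * v \<le> 1"
      "1 / h \<le> C0 * v" by auto
    have jb: "jump_bound t h y \<le> h" "0 \<le> jump_bound t h y" using jump_bound_le[of t h y] f by auto
    show "\<exists>\<delta>>0. \<forall>B l. B \<in> sets borel \<longrightarrow> B \<subseteq> {x..x + \<delta>} \<longrightarrow> emeasure lborel B = ennreal l \<longrightarrow> 0 \<le> l \<longrightarrow>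
         ennreal (c * jump_bound t h y * l) \<le> emeasure P B"
    proof (cases "v \<le> vs")
      case True
      define w where "w = max y v"
      have w: "0 < w" "w \<le> R" using f y assms by (auto simp: w_def)
      have "C * v \<le> C * vs" using True c1(2) by (intro mult_left_mono) auto
      then have yC: "y + C * v \<le> R" using vs(3) y by linarith
      have nw: "E * n w \<le> n s" if "\<eta> * v \<le> s" "s \<le> y + C * v" for s
      proof -
        have s: "0 < s" "s \<le> R" using that yC c1 f less_le_trans[of 0 "\<eta> * v" s] by auto
        show ?thesis
        proof (cases "s \<le> w")
          case True
          have "E * n w \<le> a1 * n w" using n_nonneg by (intro mult_right_mono) (auto simp: E_def)
          also have "\<dots> \<le> n s" by (rule n_antimono[OF s(1) True w(2)])
          finally show ?thesis .
        next
          case False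
          have "C * v \<le> C * w" using c1(2) by (intro mult_left_mono) (auto simp: w_def)
          moreover have "y \<le> w" by (simp add: w_def)
          ultimately have "s \<le> w + C * w" using that(2) by linarith
          then have "s \<le> (1 + C) * w" by (simp add: distrib_right)
          then have "1 / (1 + C) \<le> w / s" using s c1 by (simp add: field_simps)
          then have "(1 / (1 + C)) powr (1 + \<alpha>2) \<le> (w / s) powr (1 + \<alpha>2)" using c1 \<alpha> by (intro powr_mono2) auto
          then have "(1 / (1 + C)) powr (1 + \<alpha>2) * n w / a2 \<le> (w / s) powr (1 + \<alpha>2) * n w / a2"
            using a_pos n_nonneg by (intro divide_right_mono mult_right_mono) auto
          also have "\<dots> \<le> n s" using False w s by (intro n_scale_ge) auto
          finally have "1 / (a2 * (1 + C) powr (1 + \<alpha>2)) * n w \<le> n s" using c1 by (simp add: powr_divide ac_simps)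
          moreover have "E * n w \<le> 1 / (a2 * (1 + C) powr (1 + \<alpha>2)) * n w" using n_nonneg by (intro mult_right_mono) (auto simp: E_def)
          ultimately show ?thesis by linarith
        qed
      qed
      have jw: "min 1 c0 * jump_bound t h y \<le> t * n w"
      proof (cases "y \<le> v")
        case True
        have "h \<le> 1 / v" using f by (simp add: field_simps)
        have "min 1 c0 * jump_bound t h y \<le> c0 * (1 / v)" using jb \<open>h \<le> 1 / v\<close> c0 f by (intro mult_mono) auto
        also have "\<dots> \<le> t * n v" using f by (simp add: field_simps)
        finally show ?thesis using True by (simp add: w_def max_def)
      next
        case False
        then have "jump_bound t h y \<le> t * n y" using f by (simp add: jump_bound_def)
        then have "min 1 c0 * jump_bound t h y \<le> 1 * (t * n y)" using jb c0 by (intro mult_mono) auto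
        then show ?thesis using False by (simp add: w_def max_def)
      qed
      define \<kappa> where "\<kappa> = E * (min 1 c0 * jump_bound t h y)"
      have \<kappa>0: "0 \<le> \<kappa>" using E c0 jb by (simp add: \<kappa>_def)
      have \<kappa>: "\<kappa> \<le> t * n s" if "\<eta> * v \<le> s" "s \<le> y + C * v" for s
      proof -
        have "\<kappa> \<le> E * (t * n w)" unfolding \<kappa>_def using jw E by (intro mult_left_mono) auto
        also have "\<dots> = t * (E * n w)" by simp
        also have "\<dots> \<le> t * n s" using nw[OF that] f by (intro mult_left_mono) auto
        finally show ?thesis .
      qed
      show ?thesis
      proof (intro exI[of _ v] conjI allI impI)
        show "0 < v" by (rule f)
        fix B l assume B: "B \<in> sets borel" "B \<subseteq> {x..x + v}" "emeasure lborel B = ennreal l" "(0::real) \<le> l"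
        have "c * jump_bound t h y \<le> c1 * (E * min 1 c0) * jump_bound t h y" using jb by (intro mult_right_mono) (auto simp: c_def)
        then have "c * jump_bound t h y * l \<le> c1 * \<kappa> * l" using B by (intro mult_right_mono) (auto simp: \<kappa>_def ac_simps)
        then have "ennreal (c * jump_bound t h y * l) \<le> ennreal (c1 * \<kappa> * l)" by (rule ennreal_leI)
        also have "\<dots> \<le> emeasure P B" by (rule c1(4)[OF t P x \<kappa>0 \<kappa> B])
        finally show "ennreal (c * jump_bound t h y * l) \<le> emeasure P B" .
      qed
    next
      case False
      then have vv: "vs \<le> v" by simp
      have tt: "ts \<le> t"
      proof -
        have "a1 * (v * n v) \<le> vs * n vs" by (rule rn_ge[OF vs(1) vv f(4)])
        then have "t * (a1 * (v * n v)) \<le> t * (vs * n vs)" using f by (intro mult_left_mono) auto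
        moreover have "c0 * a1 \<le> t * (v * n v) * a1" using f a_pos by (intro mult_right_mono) auto
        ultimately have "c0 * a1 \<le> t * (vs * n vs)" by (simp add: ac_simps)
        then have "c0 * a1 / (vs * n vs) \<le> t" using nvs by (simp add: pos_divide_le_eq)
        then show ?thesis by (simp add: ts_def)
      qed
      have xx: "x0 \<le> x" "x \<le> X"
      proof -
        have "lexp_deriv n (\<Lambda> / vs) \<le> lexp_deriv n (\<Lambda> / v)"
          using vv vs f assms by (intro lexp_deriv_antimono[OF ld]) (auto intro!: divide_left_mono)
        then have "x0 \<le> t * lexp_deriv n (\<Lambda> / v)"
          unfolding x0_def using tt f lexp_deriv_nonneg[OF ld] by (intro mult_mono) auto
        then show "x0 \<le> x" using x by simp
        have "1 / h \<le> C0 * R" using f c0 mult_left_mono[of v R C0] by linarith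
        then have "1 / (C0 * R) \<le> h" using f c0 R_pos by (simp add: field_simps)
        then have "lexp_deriv n h \<le> lexp_deriv n (1 / (C0 * R))" using c0 R_pos by (intro lexp_deriv_antimono[OF ld]) auto
        then have "t * lexp_deriv n h \<le> T * lexp_deriv n (1 / (C0 * R))" using t f lexp_deriv_nonneg[OF ld] by (intro mult_mono) auto
        then show "x \<le> X" using x y by (simp add: X_def)
      qed
      show ?thesis
      proof (intro exI[of _ \<delta>2] conjI allI impI)
        show "0 < \<delta>2" by (rule c2)
        fix B l assume B: "B \<in> sets borel" "B \<subseteq> {x..x + \<delta>2}" "emeasure lborel B = ennreal l" "(0::real) \<le> l"
        have "c * jump_bound t h y \<le> c2 * vs * h" using jb c2 vs c by (intro mult_mono) (auto simp: c_def)
        also have "c2 * vs * h \<le> c2"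
        proof -
          have "h * vs \<le> h * v" using vv f(2) by (intro mult_left_mono) auto
          then have "vs * h \<le> 1" using f(7) by (simp add: mult.commute)
          then have "c2 * (vs * h) \<le> c2 * 1" using c2(2) by (intro mult_left_mono) auto
          then show ?thesis by (simp add: mult.assoc)
        qed
        finally have "c * jump_bound t h y * l \<le> c2 * l" using B by (intro mult_right_mono) auto
        then have "ennreal (c * jump_bound t h y * l) \<le> ennreal (c2 * l)" by (rule ennreal_leI)
        also have "\<dots> \<le> emeasure P B" by (rule c2(3)[OF tt t(1) P xx B])
        finally show "ennreal (c * jump_bound t h y * l) \<le> emeasure P B" .
      qed
    qed
  qed
qed

end

section \<open>Doubling L\'evy densities\<close>

text \<open>Near-monotonicity and doubling on the whole half-line take the place of scaling beyond
  \<open>R\<close>, where there is no power law.\<close>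

locale doubling_levy_density = scaled_levy_density +
  fixes D1 D2 :: real
  assumes D_pos: "0 < D1" "0 < D2"
    and almost_decreasing: "0 < r \<Longrightarrow> r \<le> u \<Longrightarrow> n u \<le> D1 * n r"
    and doubling: "0 < r \<Longrightarrow> n r \<le> D2 * n (2 * r)"
begin

definition \<gamma> :: nat where "\<gamma> = (SOME k. D2 \<le> 2 ^ k)"

lemma D2_le: "D2 \<le> 2 ^ \<gamma>"
  unfolding \<gamma>_def
proof (rule someI_ex)
  have "\<exists>k. D2 < 2 ^ k" by (rule real_arch_pow) simp
  then show "\<exists>k. D2 \<le> 2 ^ k" by (auto intro: less_imp_le)
qed

lemma doubling_power: "0 < r \<Longrightarrow> n r \<le> D2 ^ j * n (2 ^ j * r)"
proof (induction j)
  case (Suc j)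
  have "n r \<le> D2 ^ j * n (2 ^ j * r)" by (rule Suc.IH[OF Suc.prems])
  also have "\<dots> \<le> D2 ^ j * (D2 * n (2 * (2 ^ j * r)))"
    using Suc.prems D_pos by (intro mult_left_mono doubling) auto
  finally show ?case by (simp add: ac_simps)
qed simp

text \<open>Doubling is iterated over the dyadic steps from \<open>r\<close> to beyond
  \<open>u\<close>; the least such number \<open>j\<close> satisfies
  \<open>2 ^ j \<le> 2 * (u / r)\<close>, and near-monotonicity returns to \<open>u\<close>.\<close>

lemma n_le_power:
  assumes "0 < r" "r \<le> u"
  shows "n r \<le> D1 * (2 * (u / r)) ^ \<gamma> * n u"
proof -
  define j where "j = (LEAST j. u / r \<le> 2 ^ j)"
  have "\<exists>k. u / r < 2 ^ k" by (rule real_arch_pow) simp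
  then obtain k where "u / r < 2 ^ k" by blast
  then have "u / r \<le> 2 ^ k" by simp
  then have j: "u / r \<le> 2 ^ j" unfolding j_def by (rule LeastI)
  have "1 \<le> u / r" using assms by simp
  have up: "2 ^ j \<le> 2 * (u / r)"
  proof (cases j)
    case 0 then show ?thesis using \<open>1 \<le> u / r\<close> by simp
  next
    case (Suc i)
    then have "\<not> u / r \<le> 2 ^ i" using not_less_Least[of i "\<lambda>j. u / r \<le> 2 ^ j"] by (simp add: j_def)
    then show ?thesis using Suc by simp
  qed
  have "n r \<le> D2 ^ j * n (2 ^ j * r)" by (rule doubling_power[OF assms(1)])
  also have "\<dots> \<le> D2 ^ j * (D1 * n u)"
    using j assms D_pos by (intro mult_left_mono almost_decreasing) (auto simp: pos_divide_le_eq)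
  also have "\<dots> \<le> (2 * (u / r)) ^ \<gamma> * (D1 * n u)"
  proof (rule mult_right_mono)
    have "D2 ^ j \<le> (2 ^ \<gamma>) ^ j" using D2_le D_pos by (intro power_mono) auto
    also have "\<dots> = (2 ^ j) ^ \<gamma>" by (simp add: power_mult[symmetric] mult.commute)
    also have "\<dots> \<le> (2 * (u / r)) ^ \<gamma>" using up by (intro power_mono) auto
    finally show "D2 ^ j \<le> (2 * (u / r)) ^ \<gamma>" .
    show "0 \<le> D1 * n u" using D_pos n_nonneg by simp
  qed
  finally show ?thesis by (simp add: ac_simps)
qed

lemma n_pos_all: "0 < s \<Longrightarrow> 0 < n s"
proof -
  assume s: "0 < s"
  show ?thesis
  proof (cases "s \<le> R")
    case True then show ?thesis using n_pos s by simp
  next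
    case False
    have "0 < n R" using n_pos R_pos by simp
    also have "n R \<le> D1 * (2 * (s / R)) ^ \<gamma> * n s" using False R_pos by (intro n_le_power) auto
    finally show ?thesis using n_nonneg[of s] by (cases "n s = 0") auto
  qed
qed

text \<open>Doubling prevents decay faster than a power, so exponentially small contributions at
  distance \<open>y\<close> are absorbed into \<open>n y\<close>.\<close>

lemma exp_le_n:
  assumes "0 < a"
  obtains C where "0 < C" "\<And>y. R \<le> y \<Longrightarrow> exp (- a * y) \<le> C * n y"
proof -
  define C where "C = fact \<gamma> / a ^ \<gamma> * (D1 * (2 / R) ^ \<gamma> / n R)"
  have nR: "0 < n R" using n_pos R_pos by simp
  show ?thesis
  proof (rule that[of C])
    show "0 < C" using assms D_pos R_pos nR by (simp add: C_def)
    fix y assume y: "R \<le> y"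
    then have y0: "0 < y" using R_pos by simp
    have "n R \<le> D1 * (2 * (y / R)) ^ \<gamma> * n y" by (rule n_le_power[OF R_pos y])
    also have "2 * (y / R) = (2 / R) * y" by simp
    finally have "n R \<le> D1 * (2 / R) ^ \<gamma> * y ^ \<gamma> * n y" by (simp only: power_mult_distrib mult.assoc)
    then have 1: "1 \<le> D1 * (2 / R) ^ \<gamma> / n R * n y * y ^ \<gamma>" using nR by (simp add: pos_le_divide_eq ac_simps)
    have "exp (- a * y) \<le> D1 * (2 / R) ^ \<gamma> / n R * n y * y ^ \<gamma> * exp (- a * y)"
      using mult_right_mono[OF 1, of "exp (- a * y)"] by simp
    also have "\<dots> = D1 * (2 / R) ^ \<gamma> / n R * n y * (y ^ \<gamma> * exp (- a * y))" by simp
    also have "\<dots> \<le> D1 * (2 / R) ^ \<gamma> / n R * n y * (fact \<gamma> / a ^ \<gamma>)"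
      using D_pos R_pos nR n_nonneg by (intro mult_left_mono power_times_exp_le[OF y0 assms]) auto
    finally show "exp (- a * y) \<le> C * n y" by (simp add: C_def ac_simps)
  qed
qed

text \<open>Only the jumps up to the fixed size \<open>r\<close> are tilted here; a sum of larger jumps that is at least \<open>y/2\<close>
  has density \<open>O(t n(y))\<close>, and otherwise the small jumps contribute \<open>y/2\<close>.\<close>

lemma upper_far:
  assumes "0 < T"
  obtains C where "0 < C"
    "\<And>t h v P y B. t \<le> T \<Longrightarrow> tscale t h v \<Longrightarrow> levy_law P (\<lambda>s. t * n s) \<Longrightarrow> R \<le> y \<Longrightarrow>
       B \<in> sets borel \<Longrightarrow> (\<And>u. u \<in> B \<Longrightarrow> t * lexp_deriv n h + y \<le> u) \<Longrightarrow>
       emeasure P B \<le> ennreal (C * (t * n y)) * emeasure lborel B"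
proof -
  from tscale_facts[OF assms] obtain c0 C0 where c0: "0 < c0" "0 < C0"
    "\<And>t h v. t \<le> T \<Longrightarrow> tscale t h v \<Longrightarrow> 0 < t \<and> 0 < h \<and> 0 < v \<and> v \<le> R \<and> c0 \<le> t * (v * n v) \<and> t * (v * n v) \<le> C0 \<and>
       h * v \<le> 1 \<and> 1 / h \<le> C0 * v" by blast
  from small_jumps_bound[OF c0(1,2)] obtain k K C2 where k: "1 \<le> k" and K: "1 \<le> K" and C2: "0 < C2"
    "\<And>t h v r y Q B. 0 < t \<Longrightarrow> 0 < h \<Longrightarrow> 0 < v \<Longrightarrow> v \<le> r \<Longrightarrow> r \<le> R \<Longrightarrow> c0 \<le> t * (v * n v) \<Longrightarrow> t * (v * n v) \<le> C0 \<Longrightarrow>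
      h * v \<le> 1 \<Longrightarrow> k * r \<le> y \<Longrightarrow> K * v \<le> y \<Longrightarrow> levy_law Q (\<lambda>s. indicator {..r} s * (t * n s)) \<Longrightarrow>
      B \<in> sets borel \<Longrightarrow> (\<And>u. u \<in> B \<Longrightarrow> t * lexp_deriv n h + y \<le> u) \<Longrightarrow>
      emeasure Q B \<le> ennreal (C2 * (t * n r) * exp (- y / (2 * r))) * emeasure lborel B" by blast
  \<comment> \<open>A fixed cutoff with \<open>k * r = R \<le> y\<close>, so that the bound for the
    small jumps applies to every \<open>y\<close> considered.\<close>
  define r where "r = R / k"
  have r: "0 < r" "r \<le> R" "k * r = R" using k R_pos by (auto simp: r_def field_simps)
  define a where "a = 1 / (2 * r)"
  have a: "0 < a" using r by (simp add: a_def)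
  from exp_le_n[OF a] obtain Ca where Ca: "0 < Ca" "\<And>y. R \<le> y \<Longrightarrow> exp (- a * y) \<le> Ca * n y" by blast
  define L where "L = lexp (\<lambda>s. exp (1 / r * s) * (indicator {..r} s * n s)) (1 / r)"
  define nr where "nr = tail_mass n r"
  \<comment> \<open>For \<open>v \<le> vs\<close> the condition \<open>K * v \<le> y\<close> holds.
    For larger \<open>v\<close> the time is bounded below, and the fixed tilt \<open>1 / r\<close>
    replaces the one adapted to \<open>v\<close>.\<close>
  define vs where "vs = r / K"
  have vs: "0 < vs" "vs \<le> r" using r K by (auto simp: vs_def field_simps)
  have l\<rho>: "levy_density (\<lambda>s. exp (1 / r * s) * (indicator {..r} s * n s))"
  proof (rule levy_density_mult[OF levy_truncate[OF ld], where C = "exp 1"])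
    fix s assume "indicator {..r} s * n s \<noteq> 0"
    then have "s \<le> r" by (auto split: split_indicator_asm)
    then show "exp (1 / r * s) \<le> exp 1" using r by simp
  qed auto
  have L0: "0 \<le> L" unfolding L_def using r by (intro lexp_nonneg[OF l\<rho>]) simp
  have "0 < a1 * c0" using a_pos c0 by simp
  from dens_bound_ge[OF this, of "T * (vs * n vs)"] obtain C1 where C1: "0 < C1"
    "\<And>t v \<rho> P. 0 < t \<Longrightarrow> 0 < v \<Longrightarrow> v \<le> R \<Longrightarrow> a1 * c0 \<le> t * (v * n v) \<Longrightarrow> t * (v * n v) \<le> T * (vs * n vs) \<Longrightarrow>
      levy_density \<rho> \<Longrightarrow> (\<And>s. indicator {..v} s * (t * n s) \<le> \<rho> s) \<Longrightarrow> levy_law P \<rho> \<Longrightarrow> dens_bound P (C1 / v)" by blast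
  \<comment> \<open>The middle factor, once \<open>t\<close> is included, is at least 1 by the lower
    bound of the rate at \<open>vs\<close>; it supplies the factor \<open>t\<close> in the
    bound.\<close>
  define A where "A = C1 / vs * (vs * n vs / (a1 * c0)) * exp (T * L)"
  define CQ where "CQ = max (C2 * n r) A"
  define Cg where "Cg = D1 * D1 * 2 ^ \<gamma> * (D1 * D2) * fact \<gamma> * exp (1 + exp 1 * (T * nr))"
  define Cs where "Cs = D1 * n r * exp (T * L)"
  define C where "C = CQ * Ca + (Cg + Cs * Ca)"
  have nr0: "0 \<le> nr" unfolding nr_def by (rule tail_mass_nonneg[OF ld])
  have pos: "0 < CQ" "0 < Cg" "0 < Cs"
    using C2(1) n_pos_all[OF r(1)] D_pos by (auto simp: CQ_def Cg_def Cs_def less_max_iff_disj)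
  show ?thesis
  proof (rule that[of C])
    show "0 < C" using pos Ca by (simp add: C_def add_pos_pos)
    fix t h v P y B
    assume t: "t \<le> T" "tscale t h v" and P: "levy_law P (\<lambda>s. t * n s)" and y: "R \<le> y"
      and B: "B \<in> sets borel" and x: "\<And>u. u \<in> B \<Longrightarrow> t * lexp_deriv n h + y \<le> u"
    from c0(3)[OF t] have f: "0 < t" "0 < h" "0 < v" "v \<le> R" "c0 \<le> t * (v * n v)" "t * (v * n v) \<le> C0" "h * v \<le> 1" by auto
    have y0: "0 < y" using y R_pos by simp
    have xy: "y \<le> u" if "u \<in> B" for u
    proof -
      have "0 \<le> t * lexp_deriv n h" using lexp_deriv_nonneg[OF ld, of h] f by simp
      then show ?thesis using x[OF that] by linarith
    qed
    let ?f = "\<lambda>s. indicator {r<..} s * (t * n s)" and ?\<mu> = "\<lambda>s. indicator {..r} s * (t * n s)"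
    note s = split_at[OF f(1) r(1) P]
    interpret J: jump_density ?f by (rule s(1))
    from levy_law_split_jumps[OF P s(2,1,3)] obtain Q where Q: "levy_law Q ?\<mu>"
      "\<And>B. B \<in> sets borel \<Longrightarrow> emeasure P B = (\<integral>\<^sup>+u. ennreal (exp (- J.mass)) *
         (indicator B u + (\<integral>\<^sup>+w. cpois_dens ?f w * indicator B (u + w) \<partial>lborel)) \<partial>Q)" by blast
    interpret Q: prob_space Q using levy_lawD(1)[OF Q(1)] .
    note [measurable_cong] = levy_lawD(2)[OF Q(1)]
    let ?\<rho> = "\<lambda>s. exp (1 / r * s) * ?\<mu> s"
    have \<rho>t: "?\<rho> = (\<lambda>s. t * (exp (1 / r * s) * (indicator {..r} s * n s)))" by (simp add: ac_simps)
    have l\<rho>t: "levy_density ?\<rho>" unfolding \<rho>t using f by (intro levy_density_scale[OF l\<rho>]) auto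
    have Lt: "lexp ?\<rho> (1 / r) \<le> T * L"
    proof -
      have "lexp ?\<rho> (1 / r) = t * L" unfolding L_def lexp_def \<rho>t by (simp add: mult.left_commute)
      then show ?thesis using t L0 by (simp add: mult_right_mono)
    qed
    have r0: "0 \<le> 1 / r" using r by simp
    have QB: "emeasure Q B \<le> ennreal (CQ * t * exp (- a * y)) * emeasure lborel B"
    proof (cases "v \<le> vs")
      case True
      have "emeasure Q B \<le> ennreal (C2 * (t * n r) * exp (- y / (2 * r))) * emeasure lborel B"
      proof (rule C2(2)[OF f(1-3) _ r(2) f(5-7) _ _ Q(1) B x])
        show "v \<le> r" using True vs by simp
        show "k * r \<le> y" using r y by simp
        have "K * v \<le> K * vs" using True K by (intro mult_left_mono) auto
        also have "\<dots> = r" using K by (simp add: vs_def)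
        finally show "K * v \<le> y" using r y by simp
      qed
      also have "\<dots> \<le> ennreal (CQ * t * exp (- a * y)) * emeasure lborel B"
      proof (intro mult_right_mono ennreal_leI)
        have "C2 * n r * (t * exp (- a * y)) \<le> CQ * (t * exp (- a * y))"
          using f by (intro mult_right_mono) (auto simp: CQ_def)
        then show "C2 * (t * n r) * exp (- y / (2 * r)) \<le> CQ * t * exp (- a * y)" by (simp add: a_def ac_simps)
      qed simp
      finally show ?thesis .
    next
      case False
      then have vv: "vs \<le> v" by simp
      have vsR: "vs \<le> R" using vs r by simp
      have c1: "a1 * c0 \<le> t * (vs * n vs)"
      proof -
        have "a1 * c0 \<le> a1 * (t * (v * n v))" using f a_pos by (intro mult_left_mono) auto
        also have "\<dots> = t * (a1 * (v * n v))" by simp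
        also have "\<dots> \<le> t * (vs * n vs)" using f by (intro mult_left_mono rn_ge[OF vs(1) vv]) auto
        finally show ?thesis .
      qed
      have ge: "indicator {..vs} s * (t * n s) \<le> ?\<rho> s" for s
      proof (cases "0 < s \<and> s \<le> vs")
        case True
        have "1 * (t * n s) \<le> exp (1 / r * s) * (t * n s)"
          using True r f n_nonneg by (intro mult_right_mono) auto
        then show ?thesis using True vs by simp
      qed (use n_nonpos[of s] f n_nonneg[of s] in auto)
      have "emeasure Q B \<le> ennreal (C1 / vs * exp (lexp ?\<rho> (1 / r) - 1 / r * y)) * emeasure lborel B"
      proof (rule untilt_bound[OF l\<rho>t Q(1) r0 _ _ B xy])
        fix Q' assume "levy_law Q' ?\<rho>"
        then show "dens_bound Q' (C1 / vs)"
          using t vs n_nonneg by (intro C1(2)[OF f(1) vs(1) vsR c1 _ l\<rho>t ge]) (auto intro!: mult_right_mono)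
      qed (use C1 vs in auto)
      also have "\<dots> \<le> ennreal (CQ * t * exp (- a * y)) * emeasure lborel B"
      proof (intro mult_right_mono ennreal_leI)
        have "1 / r * y = 2 * (a * y)" "0 \<le> a * y" using a y0 by (simp_all add: a_def)
        then have "lexp ?\<rho> (1 / r) - 1 / r * y \<le> T * L + - a * y" using Lt by simp
        then have "exp (lexp ?\<rho> (1 / r) - 1 / r * y) \<le> exp (T * L + - a * y)" by (simp only: exp_le_cancel_iff)
        then have "C1 / vs * exp (lexp ?\<rho> (1 / r) - 1 / r * y) \<le> C1 / vs * exp (T * L + - a * y)"
          using C1 vs by (intro mult_left_mono) auto
        also have "\<dots> = 1 * (C1 / vs * exp (T * L) * exp (- a * y))" by (simp only: exp_add mult_1 mult.assoc)
        also have "\<dots> \<le> (t * (vs * n vs) / (a1 * c0)) * (C1 / vs * exp (T * L) * exp (- a * y))"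
          using c1 \<open>0 < a1 * c0\<close> C1 vs by (intro mult_right_mono) (auto simp: pos_le_divide_eq)
        also have "\<dots> = A * (t * exp (- a * y))" by (simp add: A_def)
        also have "\<dots> \<le> CQ * (t * exp (- a * y))" using f by (intro mult_right_mono) (auto simp: CQ_def)
        finally show "C1 / vs * exp (lexp ?\<rho> (1 / r) - 1 / r * y) \<le> CQ * t * exp (- a * y)" by (simp add: mult.assoc)
      qed simp
      finally show ?thesis .
    qed
    have mass: "J.mass \<le> T * nr"
    proof -
      have "J.mass = (\<integral>s. t * (indicator {r<..} s * n s) \<partial>lborel)"
        by (intro Bochner_Integration.integral_cong) auto
      also have "\<dots> = t * nr" by (simp add: nr_def tail_mass_def)
      finally show ?thesis using t nr0 by (simp add: mult_right_mono)
    qed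
    \<comment> \<open>Among \<open>j + 1\<close> large jumps with sum \<open>w\<close> one is at
      least \<open>w / (j + 1)\<close>, where the density exceeds \<open>n w\<close> by at most a
      power of \<open>j + 1\<close>; \<open>n w\<close> is comparable to \<open>n y\<close> by
      doubling.\<close>
    have dens: "cpois_dens ?f w \<le> ennreal (Cg * (t * n y))" if w: "y / 2 \<le> w" for w
    proof -
      have w0: "0 < w" using w y0 by simp
      have nw: "n w \<le> D1 * D2 * n y"
      proof -
        have "n w \<le> D1 * n (y / 2)" using w y0 by (intro almost_decreasing) auto
        also have "\<dots> \<le> D1 * (D2 * n (2 * (y / 2)))" using y0 D_pos by (intro mult_left_mono doubling) auto
        finally show ?thesis by simp
      qed
      let ?B = "t * (D1 * D1 * 2 ^ \<gamma> * (D1 * D2 * n y))"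
      have "cpois_dens ?f w \<le> ennreal (?B * fact \<gamma> * exp (1 + exp 1 * J.mass))"
      proof (rule J.dens_le_poly)
        show "0 \<le> ?B" using f D_pos n_nonneg by simp
        show "0 < w" by fact
        fix j s assume js: "w / real (Suc j) \<le> s"
        have q: "0 < w / real (Suc j)" using w0 by simp
        have "?f s \<le> t * n s" using f n_nonneg[of s] by (auto split: split_indicator)
        also have "\<dots> \<le> t * (D1 * n (w / real (Suc j)))"
          using f by (intro mult_left_mono almost_decreasing[OF q js]) auto
        also have "\<dots> \<le> t * (D1 * (D1 * (2 * (w / (w / real (Suc j)))) ^ \<gamma> * n w))"
        proof (intro mult_left_mono n_le_power[OF q])
          have "w * 1 \<le> w * real (Suc j)" using w0 by (intro mult_left_mono) auto
          then show "w / real (Suc j) \<le> w" by (simp add: divide_le_eq del: of_nat_Suc)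
        qed (use f D_pos in auto)
        also have "w / (w / real (Suc j)) = real (Suc j)" using w0 by simp
        also have "t * (D1 * (D1 * (2 * real (Suc j)) ^ \<gamma> * n w)) \<le> t * (D1 * (D1 * (2 * real (Suc j)) ^ \<gamma> * (D1 * D2 * n y)))"
          using nw f D_pos by (intro mult_left_mono) auto
        also have "\<dots> = ?B * real (Suc j) ^ \<gamma>" by (simp add: power_mult_distrib ac_simps del: of_nat_Suc)
        finally show "?f s \<le> ?B * real (Suc j) ^ \<gamma>" .
      qed
      also have "\<dots> \<le> ennreal (Cg * (t * n y))"
      proof (rule ennreal_leI)
        have "?B * fact \<gamma> * exp (1 + exp 1 * J.mass) \<le> ?B * fact \<gamma> * exp (1 + exp 1 * (T * nr))"
          using mass f D_pos n_nonneg by (intro mult_left_mono) auto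
        also have "\<dots> = Cg * (t * n y)" by (simp add: Cg_def ac_simps)
        finally show "?B * fact \<gamma> * exp (1 + exp 1 * J.mass) \<le> Cg * (t * n y)" .
      qed
      finally show ?thesis .
    qed
    have fD: "?f s \<le> t * (D1 * n r)" for s
    proof (cases "r < s")
      case True
      then have "n s \<le> D1 * n r" using r by (intro almost_decreasing) auto
      then show ?thesis using True f by simp
    next
      case False
      then show ?thesis using f D_pos n_nonneg[of r] by simp
    qed
    have em: "ennreal (exp (- J.mass)) \<le> 1" using J.mass_nonneg by simp
    \<comment> \<open>The point \<open>u + w\<close> of \<open>B\<close> is at least
      \<open>y\<close>, so either \<open>u \<ge> y / 2\<close>, which is exponentially unlikely, or
      \<open>w \<ge> y / 2\<close>, where the density of the large jumps is small. The first summand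
      is the case without a large jump.\<close>
    have integrand: "ennreal (exp (- J.mass)) * (indicator B u + (\<integral>\<^sup>+w. cpois_dens ?f w * indicator B (u + w) \<partial>lborel))
      \<le> indicator B u + ennreal (Cg * (t * n y)) * emeasure lborel B + ennreal (t * (D1 * n r)) * emeasure lborel B * indicator {y / 2..} u" for u
    proof -
      have "ennreal (exp (- J.mass)) * (\<integral>\<^sup>+w. cpois_dens ?f w * indicator B (u + w) \<partial>lborel)
        = (\<integral>\<^sup>+w. ennreal (exp (- J.mass)) * cpois_dens ?f w * indicator B (u + w) \<partial>lborel)"
        using B by (subst nn_integral_cmult[symmetric]) (auto simp: mult.assoc)
      also have "\<dots> \<le> (\<integral>\<^sup>+w. (ennreal (Cg * (t * n y)) + ennreal (t * (D1 * n r)) * indicator {y / 2..} u) * indicator B (u + w) \<partial>lborel)"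
      proof (rule nn_integral_mono)
        fix w
        show "ennreal (exp (- J.mass)) * cpois_dens ?f w * indicator B (u + w)
          \<le> (ennreal (Cg * (t * n y)) + ennreal (t * (D1 * n r)) * indicator {y / 2..} u) * indicator B (u + w)"
        proof (cases "u + w \<in> B")
          case True
          show ?thesis
          proof (cases "y / 2 \<le> u")
            case u: True
            have "ennreal (exp (- J.mass)) * cpois_dens ?f w \<le> ennreal (t * (D1 * n r))" by (rule J.dens_le[OF fD])
            also have "\<dots> \<le> ennreal (Cg * (t * n y)) + \<dots>" by simp
            finally show ?thesis using True u by simp
          next
            case u: False
            then have "y / 2 \<le> w" using xy[OF True] by simp
            then have "ennreal (exp (- J.mass)) * cpois_dens ?f w \<le> 1 * ennreal (Cg * (t * n y))"
              by (intro mult_mono em dens) auto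
            then show ?thesis using True u by simp
          qed
        qed simp
      qed
      also have "\<dots> = (ennreal (Cg * (t * n y)) + ennreal (t * (D1 * n r)) * indicator {y / 2..} u) * emeasure lborel B"
        using B by (subst nn_integral_cmult) (auto simp: nn_integral_indicator_shift)
      finally have 1: "ennreal (exp (- J.mass)) * (\<integral>\<^sup>+w. cpois_dens ?f w * indicator B (u + w) \<partial>lborel)
        \<le> (ennreal (Cg * (t * n y)) + ennreal (t * (D1 * n r)) * indicator {y / 2..} u) * emeasure lborel B" .
      have 2: "ennreal (exp (- J.mass)) * indicator B u \<le> 1 * indicator B u" by (intro mult_right_mono em) simp
      show ?thesis using add_mono[OF 2 1] by (simp only: distrib_left distrib_right mult_1 ac_simps)
    qed
    have tail: "emeasure Q {y / 2..} \<le> ennreal (exp (T * L) * exp (- a * y))"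
    proof -
      have "emeasure Q {y / 2..} \<le> ennreal (exp (lexp ?\<rho> (1 / r) - 1 / r * (y / 2)))"
        by (rule chernoff_upper[OF l\<rho>t Q(1) r0])
      also have "\<dots> \<le> ennreal (exp (T * L + - a * y))" using Lt r by (intro ennreal_leI) (simp add: a_def)
      finally show ?thesis by (simp only: exp_add)
    qed
    have "emeasure P B \<le> (\<integral>\<^sup>+u. indicator B u + ennreal (Cg * (t * n y)) * emeasure lborel B + ennreal (t * (D1 * n r)) * emeasure lborel B * indicator {y / 2..} u \<partial>Q)"
      unfolding Q(2)[OF B] by (rule nn_integral_mono) (rule integrand)
    also have "\<dots> = emeasure Q B + ennreal (Cg * (t * n y)) * emeasure lborel B + ennreal (t * (D1 * n r)) * emeasure lborel B * emeasure Q {y / 2..}"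
      using B Q.emeasure_space_1 by (subst nn_integral_add, measurable)+ (simp add: nn_integral_cmult)
    also have "\<dots> \<le> ennreal (CQ * t * exp (- a * y)) * emeasure lborel B + ennreal (Cg * (t * n y)) * emeasure lborel B
      + ennreal (t * (D1 * n r)) * emeasure lborel B * ennreal (exp (T * L) * exp (- a * y))"
      by (intro add_mono mult_left_mono QB tail order_refl) auto
    also have "\<dots> = ennreal (CQ * t * exp (- a * y) + Cg * (t * n y) + t * (D1 * n r) * (exp (T * L) * exp (- a * y))) * emeasure lborel B"
    proof -
      have p: "0 \<le> CQ * t * exp (- a * y)" "0 \<le> Cg * (t * n y)" "0 \<le> t * (D1 * n r)" "0 \<le> exp (T * L) * exp (- a * y)"
        using pos f D_pos n_nonneg by simp_all
      have "ennreal (t * (D1 * n r)) * emeasure lborel B * ennreal (exp (T * L) * exp (- a * y))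
        = ennreal (t * (D1 * n r) * (exp (T * L) * exp (- a * y))) * emeasure lborel B"
        unfolding ennreal_mult[OF p(3,4)] by (simp only: ac_simps)
      then show ?thesis using p by (simp add: distrib_right)
    qed
    also have "\<dots> \<le> ennreal (C * (t * n y)) * emeasure lborel B"
    proof (intro mult_right_mono ennreal_leI)
      have ey: "exp (- a * y) \<le> Ca * n y" by (rule Ca(2)[OF y])
      have "CQ * t * exp (- a * y) \<le> CQ * t * (Ca * n y)" using ey pos f by (intro mult_left_mono) auto
      moreover have "t * (D1 * n r) * (exp (T * L) * exp (- a * y)) = Cs * t * exp (- a * y)" by (simp add: Cs_def)
      moreover have "Cs * t * exp (- a * y) \<le> Cs * t * (Ca * n y)" using ey pos f by (intro mult_left_mono) auto
      moreover have "C * (t * n y) = CQ * t * (Ca * n y) + Cg * (t * n y) + Cs * t * (Ca * n y)"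
        by (simp add: C_def algebra_simps)
      ultimately show "CQ * t * exp (- a * y) + Cg * (t * n y) + t * (D1 * n r) * (exp (T * L) * exp (- a * y)) \<le> C * (t * n y)"
        by linarith
    qed simp
    finally show "emeasure P B \<le> ennreal (C * (t * n y)) * emeasure lborel B" .
  qed
qed

lemma upper_right_all:
  assumes "0 < T"
  obtains C where "0 < C"
    "\<And>t h v P y B. t \<le> T \<Longrightarrow> tscale t h v \<Longrightarrow> levy_law P (\<lambda>s. t * n s) \<Longrightarrow> 0 < y \<Longrightarrow>
       B \<in> sets borel \<Longrightarrow> (\<And>u. u \<in> B \<Longrightarrow> t * lexp_deriv n h + y \<le> u) \<Longrightarrow>
       emeasure P B \<le> ennreal (C * (t * n y)) * emeasure lborel B"
proof -
  from upper_right[OF assms] obtain C1 where C1: "0 < C1"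
    "\<And>t h v P y B. t \<le> T \<Longrightarrow> tscale t h v \<Longrightarrow> levy_law P (\<lambda>s. t * n s) \<Longrightarrow> 0 < y \<Longrightarrow> y \<le> R \<Longrightarrow>
       B \<in> sets borel \<Longrightarrow> (\<And>u. u \<in> B \<Longrightarrow> t * lexp_deriv n h + y \<le> u) \<Longrightarrow>
       emeasure P B \<le> ennreal (C1 * (t * n y)) * emeasure lborel B" by blast
  from upper_far[OF assms] obtain C2 where C2: "0 < C2"
    "\<And>t h v P y B. t \<le> T \<Longrightarrow> tscale t h v \<Longrightarrow> levy_law P (\<lambda>s. t * n s) \<Longrightarrow> R \<le> y \<Longrightarrow>
       B \<in> sets borel \<Longrightarrow> (\<And>u. u \<in> B \<Longrightarrow> t * lexp_deriv n h + y \<le> u) \<Longrightarrow>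
       emeasure P B \<le> ennreal (C2 * (t * n y)) * emeasure lborel B" by blast
  show ?thesis
  proof (rule that[of "max C1 C2"])
    show "0 < max C1 C2" using C1 by simp
    fix t h v P y B
    assume t: "t \<le> T" "tscale t h v" and P: "levy_law P (\<lambda>s. t * n s)" and y: "0 < y"
      and B: "B \<in> sets borel" and x: "\<And>u. u \<in> B \<Longrightarrow> t * lexp_deriv n h + y \<le> u"
    have tn: "0 \<le> t * n y" using t n_nonneg by (simp add: tscale_def)
    have le: "ennreal (C1 * (t * n y)) * emeasure lborel B \<le> ennreal (max C1 C2 * (t * n y)) * emeasure lborel B"
      "ennreal (C2 * (t * n y)) * emeasure lborel B \<le> ennreal (max C1 C2 * (t * n y)) * emeasure lborel B"
      using tn by (auto intro!: mult_right_mono ennreal_leI)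
    show "emeasure P B \<le> ennreal (max C1 C2 * (t * n y)) * emeasure lborel B"
    proof (cases "y \<le> R")
      case True
      show ?thesis by (rule order_trans[OF C1(2)[OF t P y True B x] le(1)])
    next
      case False
      then have "R \<le> y" by simp
      show ?thesis by (rule order_trans[OF C2(2)[OF t P \<open>R \<le> y\<close> B x] le(2)])
    qed
  qed
qed

text \<open>Near-monotonicity and doubling compare \<open>n s\<close> with
  \<open>n (max y v)\<close> at every distance, so the one-jump bound covers all \<open>y\<close>
  and all \<open>v\<close> at once.\<close>

lemma lower_near_all:
  assumes "0 < T" "1 \<le> \<Lambda>"
  obtains c where "0 < c"
    "\<And>t h v P x y. t \<le> T \<Longrightarrow> tscale t h v \<Longrightarrow> levy_law P (\<lambda>s. t * n s) \<Longrightarrow> 0 \<le> y \<Longrightarrow>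
       t * lexp_deriv n (\<Lambda> / v) \<le> x \<Longrightarrow> x \<le> t * lexp_deriv n h + y \<Longrightarrow>
       \<exists>\<delta>>0. \<forall>B l. B \<in> sets borel \<longrightarrow> B \<subseteq> {x..x + \<delta>} \<longrightarrow> emeasure lborel B = ennreal l \<longrightarrow> 0 \<le> l \<longrightarrow>
         ennreal (c * jump_bound t h y * l) \<le> emeasure P B"
proof -
  from tscale_facts[OF assms(1)] obtain c0 C0 where c0: "0 < c0" "0 < C0"
    "\<And>t h v. t \<le> T \<Longrightarrow> tscale t h v \<Longrightarrow> 0 < t \<and> 0 < h \<and> 0 < v \<and> v \<le> R \<and> c0 \<le> t * (v * n v) \<and> t * (v * n v) \<le> C0 \<and>
       h * v \<le> 1 \<and> 1 / h \<le> C0 * v" by blast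
  from lower_one_jump[OF assms(1,2)] obtain \<eta> C c1 where c1: "0 < \<eta>" "0 < C" "0 < c1"
    "\<And>t h v P x y \<kappa> B l. t \<le> T \<Longrightarrow> tscale t h v \<Longrightarrow> levy_law P (\<lambda>s. t * n s) \<Longrightarrow>
       t * lexp_deriv n (\<Lambda> / v) \<le> x \<Longrightarrow> x \<le> t * lexp_deriv n h + y \<Longrightarrow> 0 \<le> \<kappa> \<Longrightarrow>
       (\<And>s. \<eta> * v \<le> s \<Longrightarrow> s \<le> y + C * v \<Longrightarrow> \<kappa> \<le> t * n s) \<Longrightarrow>
       B \<in> sets borel \<Longrightarrow> B \<subseteq> {x..x + v} \<Longrightarrow> emeasure lborel B = ennreal l \<Longrightarrow> 0 \<le> l \<Longrightarrow>
       ennreal (c1 * \<kappa> * l) \<le> emeasure P B" by blast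
  define D where "D = max D1 (D1 * (2 * (1 + C)) ^ \<gamma>)"
  have D: "0 < D" using D_pos by (simp add: D_def)
  define c where "c = c1 * (min 1 c0 / D)"
  have c: "0 < c" using c1 D c0 by (simp add: c_def)
  show ?thesis
  proof (rule that[OF c])
    fix t h v P x y
    assume t: "t \<le> T" "tscale t h v" and P: "levy_law P (\<lambda>s. t * n s)" and y: "0 \<le> y"
      and x: "t * lexp_deriv n (\<Lambda> / v) \<le> x" "x \<le> t * lexp_deriv n h + y"
    from c0(3)[OF t] have f: "0 < t" "0 < h" "0 < v" "v \<le> R" "c0 \<le> t * (v * n v)" "t * (v * n v) \<le> C0" "h * v \<le> 1" by auto
    have jb: "jump_bound t h y \<le> h" "0 \<le> jump_bound t h y" using jump_bound_le[of t h y] f by auto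
    define w where "w = max y v"
    have w: "0 < w" using f by (simp add: w_def)
    have nw: "n w \<le> D * n s" if "\<eta> * v \<le> s" "s \<le> y + C * v" for s
    proof -
      have s: "0 < s" using that c1 f less_le_trans[of 0 "\<eta> * v" s] by auto
      show ?thesis
      proof (cases "s \<le> w")
        case True
        have "n w \<le> D1 * n s" by (rule almost_decreasing[OF s True])
        also have "\<dots> \<le> D * n s" using n_nonneg by (intro mult_right_mono) (auto simp: D_def)
        finally show ?thesis .
      next
        case False
        have "C * v \<le> C * w" using c1(2) by (intro mult_left_mono) (auto simp: w_def)
        moreover have "y \<le> w" by (simp add: w_def)
        ultimately have "s \<le> w + C * w" using that(2) by linarith
        then have "s \<le> (1 + C) * w" by (simp add: distrib_right)
        then have sw: "s / w \<le> 1 + C" using w by (simp add: pos_divide_le_eq)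
        have "n w \<le> D1 * (2 * (s / w)) ^ \<gamma> * n s" using False w by (intro n_le_power) auto
        also have "\<dots> \<le> D1 * (2 * (1 + C)) ^ \<gamma> * n s"
          using sw s w D_pos n_nonneg by (intro mult_right_mono mult_left_mono power_mono) auto
        also have "\<dots> \<le> D * n s" using n_nonneg by (intro mult_right_mono) (auto simp: D_def)
        finally show ?thesis .
      qed
    qed
    have jw: "min 1 c0 * jump_bound t h y \<le> t * n w"
    proof (cases "y \<le> v")
      case True
      have "h \<le> 1 / v" using f by (simp add: field_simps)
      have "min 1 c0 * jump_bound t h y \<le> c0 * (1 / v)" using jb \<open>h \<le> 1 / v\<close> c0 f by (intro mult_mono) auto
      also have "\<dots> \<le> t * n v" using f by (simp add: field_simps)
      finally show ?thesis using True by (simp add: w_def max_def)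
    next
      case False
      then have "jump_bound t h y \<le> t * n y" using f by (simp add: jump_bound_def)
      then have "min 1 c0 * jump_bound t h y \<le> 1 * (t * n y)" using jb c0 by (intro mult_mono) auto
      then show ?thesis using False by (simp add: w_def max_def)
    qed
    define \<kappa> where "\<kappa> = min 1 c0 / D * jump_bound t h y"
    have \<kappa>0: "0 \<le> \<kappa>" using D c0 jb by (simp add: \<kappa>_def)
    have \<kappa>: "\<kappa> \<le> t * n s" if "\<eta> * v \<le> s" "s \<le> y + C * v" for s
    proof -
      have "\<kappa> = min 1 c0 * jump_bound t h y / D" by (simp add: \<kappa>_def)
      also have "\<dots> \<le> t * n w / D" using jw D by (intro divide_right_mono) auto
      also have "\<dots> \<le> t * (D * n s) / D" using nw[OF that] f D by (intro divide_right_mono mult_left_mono) auto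
      finally show ?thesis using D by simp
    qed
    show "\<exists>\<delta>>0. \<forall>B l. B \<in> sets borel \<longrightarrow> B \<subseteq> {x..x + \<delta>} \<longrightarrow> emeasure lborel B = ennreal l \<longrightarrow> 0 \<le> l \<longrightarrow>
         ennreal (c * jump_bound t h y * l) \<le> emeasure P B"
    proof (intro exI[of _ v] conjI allI impI)
      show "0 < v" by (rule f)
      fix B l assume B: "B \<in> sets borel" "B \<subseteq> {x..x + v}" "emeasure lborel B = ennreal l" "(0::real) \<le> l"
      have "c * jump_bound t h y * l = c1 * \<kappa> * l" by (simp add: c_def \<kappa>_def)
      also have "ennreal \<dots> \<le> emeasure P B" by (rule c1(4)[OF t P x \<kappa>0 \<kappa> B])
      finally show "ennreal (c * jump_bound t h y * l) \<le> emeasure P B" .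
    qed
  qed
qed

end

section \<open>From measures of intervals to the transition density\<close>

lemma density_le_of_intervals:
  assumes P: "P = density lborel (\<lambda>x. ennreal (p x) * indicator {0<..} x)"
    and meas: "(\<lambda>x. ennreal (p x) * indicator {0<..} x) \<in> borel_measurable lborel"
    and cont: "continuous_on {0<..} p" and "0 < x" "0 \<le> K"
    and I: "\<And>\<eta>. 0 < \<eta> \<Longrightarrow> \<exists>c d. x - \<eta> < c \<and> c < d \<and> d < x + \<eta> \<and> emeasure P {c..d} \<le> ennreal (K * (d - c))"
  shows "p x \<le> K"
proof (rule ccontr)
  assume "\<not> p x \<le> K"
  define K' where "K' = (K + p x) / 2"
  have K': "K < K'" "K' < p x" using \<open>\<not> p x \<le> K\<close> by (auto simp: K'_def)
  have "isCont p x" using cont \<open>0 < x\<close> by (simp add: continuous_on_eq_continuous_at)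
  then have "\<forall>\<^sub>F y in at x. K' < p y" using K' by (intro order_tendstoD(1)) (auto simp: isCont_def)
  then obtain \<epsilon> where \<epsilon>: "0 < \<epsilon>" "\<And>y. y \<noteq> x \<Longrightarrow> dist y x < \<epsilon> \<Longrightarrow> K' < p y" unfolding eventually_at by blast
  have "0 < min \<epsilon> x" using \<epsilon> \<open>0 < x\<close> by simp
  from I[OF this] obtain c d where cd: "x - min \<epsilon> x < c" "c < d" "d < x + min \<epsilon> x" "emeasure P {c..d} \<le> ennreal (K * (d - c))" by auto
  have "ennreal (K' * (d - c)) = ennreal K' * emeasure lborel {c..d}" using cd K' \<open>0 \<le> K\<close> by (simp add: ennreal_mult)
  also have "\<dots> = (\<integral>\<^sup>+y. ennreal K' * indicator {c..d} y \<partial>lborel)" by (simp add: nn_integral_cmult)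
  also have "\<dots> \<le> (\<integral>\<^sup>+y. ennreal (p y) * indicator {0<..} y * indicator {c..d} y \<partial>lborel)"
  proof (rule nn_integral_mono)
    fix y
    show "ennreal K' * indicator {c..d} y \<le> ennreal (p y) * indicator {0<..} y * indicator {c..d} y"
    proof (cases "y \<in> {c..d}")
      case True
      then have "dist y x < \<epsilon>" "0 < y" using cd by (auto simp: dist_real_def abs_if)
      then have "K' \<le> p y" using \<epsilon>(2)[of y] K' by (cases "y = x") auto
      then show ?thesis using True \<open>0 < y\<close> by (simp add: ennreal_leI)
    qed simp
  qed
  also have "\<dots> = emeasure P {c..d}" unfolding P using meas by (simp add: emeasure_density)
  finally have "ennreal (K' * (d - c)) \<le> ennreal (K * (d - c))" using cd(4) by (rule order_trans)
  then have "K' * (d - c) \<le> K * (d - c)" using cd \<open>0 \<le> K\<close> by (simp add: ennreal_le_iff)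
  then show False using cd K' by simp
qed

lemma density_ge_of_intervals:
  assumes P: "P = density lborel (\<lambda>x. ennreal (p x) * indicator {0<..} x)"
    and meas: "(\<lambda>x. ennreal (p x) * indicator {0<..} x) \<in> borel_measurable lborel"
    and cont: "continuous_on {0<..} p" and "0 < x" "0 \<le> p x"
    and I: "\<And>\<eta>. 0 < \<eta> \<Longrightarrow> \<exists>c d. x - \<eta> < c \<and> c < d \<and> d < x + \<eta> \<and> ennreal (K * (d - c)) \<le> emeasure P {c..d}"
  shows "K \<le> p x"
proof (rule ccontr)
  assume "\<not> K \<le> p x"
  define K' where "K' = (K + p x) / 2"
  have K': "K' < K" "p x < K'" using \<open>\<not> K \<le> p x\<close> by (auto simp: K'_def)
  then have K'0: "0 \<le> K'" using \<open>0 \<le> p x\<close> by simp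
  have "isCont p x" using cont \<open>0 < x\<close> by (simp add: continuous_on_eq_continuous_at)
  then have "\<forall>\<^sub>F y in at x. p y < K'" using K' by (intro order_tendstoD(2)) (auto simp: isCont_def)
  then obtain \<epsilon> where \<epsilon>: "0 < \<epsilon>" "\<And>y. y \<noteq> x \<Longrightarrow> dist y x < \<epsilon> \<Longrightarrow> p y < K'" unfolding eventually_at by blast
  from I[OF \<epsilon>(1)] obtain c d where cd: "x - \<epsilon> < c" "c < d" "d < x + \<epsilon>" "ennreal (K * (d - c)) \<le> emeasure P {c..d}" by auto
  note cd(4)
  also have "emeasure P {c..d} = (\<integral>\<^sup>+y. ennreal (p y) * indicator {0<..} y * indicator {c..d} y \<partial>lborel)"
    unfolding P using meas by (simp add: emeasure_density)
  also have "\<dots> \<le> (\<integral>\<^sup>+y. ennreal K' * indicator {c..d} y \<partial>lborel)"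
  proof (rule nn_integral_mono)
    fix y
    show "ennreal (p y) * indicator {0<..} y * indicator {c..d} y \<le> ennreal K' * indicator {c..d} y"
    proof (cases "y \<in> {c..d}")
      case True
      then have "dist y x < \<epsilon>" using cd by (auto simp: dist_real_def abs_if)
      then have "p y \<le> K'" using \<epsilon>(2)[of y] K' by (cases "y = x") auto
      then show ?thesis using True by (auto simp: ennreal_leI split: split_indicator)
    qed simp
  qed
  also have "\<dots> = ennreal K' * emeasure lborel {c..d}" by (simp add: nn_integral_cmult)
  also have "\<dots> = ennreal (K' * (d - c))" using cd K'0 by (simp add: ennreal_mult)
  finally have "ennreal (K * (d - c)) \<le> ennreal (K' * (d - c))" .
  then have "K * (d - c) \<le> K' * (d - c)" using cd K'0 by (simp add: ennreal_le_iff)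
  then show False using cd K' by simp
qed

section \<open>The functions of the statement and the combined two-sided bounds\<close>

context scaled_levy_density
begin

text \<open>The complement of the case \<open>K \<le> t * lexp_H n \<sigma>\<close> on the left: if
  this quantity is bounded, then \<open>1 / \<sigma>\<close> is comparable to \<open>v\<close>, and
  the one-jump bound near the centre reaches the point.\<close>

lemma scale_ratio_le:
  assumes "0 < T" "0 < K"
  obtains \<Lambda> where "1 \<le> \<Lambda>"
    "\<And>t h v \<sigma>. t \<le> T \<Longrightarrow> tscale t h v \<Longrightarrow> h \<le> \<sigma> \<Longrightarrow> t * lexp_H n \<sigma> \<le> K \<Longrightarrow> \<sigma> \<le> \<Lambda> / v"
proof -
  from tscale_facts[OF assms(1)] obtain c0 C0 where c0: "0 < c0" "0 < C0"
    "\<And>t h v. t \<le> T \<Longrightarrow> tscale t h v \<Longrightarrow> 0 < t \<and> 0 < h \<and> 0 < v \<and> v \<le> R \<and> c0 \<le> t * (v * n v) \<and> t * (v * n v) \<le> C0 \<and>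
       h * v \<le> 1 \<and> 1 / h \<le> C0 * v" by blast
  from H_comparison[OF assms(1)] obtain c C where cC: "0 < c" "0 < C"
    "\<And>l. 0 < l \<Longrightarrow> 1 / T \<le> lexp_H n l \<Longrightarrow> c * lexp_H n l \<le> min (1 / l) R * n (min (1 / l) R)"
    "\<And>l. 0 < l \<Longrightarrow> 1 / T \<le> lexp_H n l \<Longrightarrow> min (1 / l) R * n (min (1 / l) R) \<le> C * lexp_H n l"
    "\<And>l. 0 < l \<Longrightarrow> 1 / T \<le> lexp_H n l \<Longrightarrow> 1 / l \<le> C * min (1 / l) R" by blast
  define \<Lambda> where "\<Lambda> = max 1 ((C * K / (a1 * c0)) powr (1 / \<alpha>1))"
  show ?thesis
  proof (rule that[of \<Lambda>])
    show "1 \<le> \<Lambda>" by (simp add: \<Lambda>_def)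
    fix t h v \<sigma> assume t: "t \<le> T" "tscale t h v" and \<sigma>: "h \<le> \<sigma>" "t * lexp_H n \<sigma> \<le> K"
    from c0(3)[OF t] have f: "0 < t" "0 < h" "0 < v" "v \<le> R" "c0 \<le> t * (v * n v)" by auto
    have h: "lexp_H n h = 1 / t" "v = min (1 / h) R" using t by (auto simp: tscale_def)
    have s: "0 < \<sigma>" using f \<sigma> by simp
    have "1 / T \<le> 1 / t" using f t assms by (simp add: frac_le)
    then have HT: "1 / T \<le> lexp_H n \<sigma>" using lexp_H_mono[OF ld f(2) \<sigma>(1)] h by simp
    define r where "r = min (1 / \<sigma>) R"
    have r: "0 < r" "r \<le> 1 / \<sigma>" "r \<le> v"
    proof -
      show "0 < r" "r \<le> 1 / \<sigma>" using s R_pos by (auto simp: r_def)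
      show "r \<le> v" unfolding r_def h(2) using \<sigma> f by (intro min.mono divide_left_mono) auto
    qed
    have "t * (r * n r) \<le> t * (C * lexp_H n \<sigma>)" using cC(4)[OF s HT] f by (intro mult_left_mono) (auto simp: r_def)
    also have "\<dots> = C * (t * lexp_H n \<sigma>)" by simp
    also have "\<dots> \<le> C * K" using \<sigma> cC by (intro mult_left_mono) auto
    finally have n0: "t * (r * n r) \<le> C * K" .
    have "v / r \<le> (C * K / (a1 * c0)) powr (1 / \<alpha>1)" by (rule ratio_le_of_jump_rate[OF r(1,3) f(4,1) c0(1) f(5) n0])
    also have "\<dots> \<le> \<Lambda>" by (simp add: \<Lambda>_def)
    finally have "v / r \<le> \<Lambda>" .
    then have "v \<le> \<Lambda> * r" using r by (simp add: pos_divide_le_eq)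
    also have "\<dots> \<le> \<Lambda> * (1 / \<sigma>)" using r by (intro mult_left_mono) (auto simp: \<Lambda>_def)
    finally show "\<sigma> \<le> \<Lambda> / v" using s f by (simp add: field_simps)
  qed
qed

text \<open>\<open>inv_into\<close> returns a genuine preimage of \<open>1 / t\<close> because
  \<open>H\<close> attains every positive value.\<close>

lemma exponent_facts:
  assumes \<phi>: "\<And>l. 0 \<le> l \<Longrightarrow> \<phi> l = lexp n l"
  shows "0 < l \<Longrightarrow> deriv \<phi> l = lexp_deriv n l" "0 < l \<Longrightarrow> H \<phi> l = lexp_H n l" "H \<phi> 0 = 0"
    and "0 < t \<Longrightarrow> tscale t (H_inv \<phi> (1 / t)) (min (1 / H_inv \<phi> (1 / t)) R)"
    and "0 < t \<Longrightarrow> b \<phi> t = lexp_deriv n (H_inv \<phi> (1 / t))"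
proof -
  show d: "deriv \<phi> l = lexp_deriv n l" if "0 < l" for l
  proof -
    have "(\<phi> has_real_derivative lexp_deriv n l) (at l)"
      by (rule has_field_derivative_transform_within_open[OF lexp_has_derivative[OF ld that], of "{0<..}"])
         (use \<phi> that in auto)
    then show ?thesis by (rule DERIV_imp_deriv)
  qed
  show h: "H \<phi> l = lexp_H n l" if "0 < l" for l using d[OF that] \<phi>[of l] that by (simp add: H_def lexp_H_def)
  show "H \<phi> 0 = 0" by (simp add: H_def)
  have inv: "0 < H_inv \<phi> (1 / t)" "lexp_H n (H_inv \<phi> (1 / t)) = 1 / t" if t: "0 < t" for t
  proof -
    have "0 < 1 / t" using t by simp
    from lexp_H_surj[OF this] obtain l where l: "0 < l" "lexp_H n l = 1 / t" by blast
    then have im: "1 / t \<in> H \<phi> ` {0<..}" using h[of l] by (intro image_eqI[of _ _ l]) auto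
    show p: "0 < H_inv \<phi> (1 / t)" using inv_into_into[OF im] by (simp add: H_inv_def)
    show "lexp_H n (H_inv \<phi> (1 / t)) = 1 / t" using f_inv_into_f[OF im] h[OF p] by (simp add: H_inv_def)
  qed
  show "0 < t \<Longrightarrow> tscale t (H_inv \<phi> (1 / t)) (min (1 / H_inv \<phi> (1 / t)) R)" using inv by (simp add: tscale_def)
  show "0 < t \<Longrightarrow> b \<phi> t = lexp_deriv n (H_inv \<phi> (1 / t))" using d inv by (simp add: b_def)
qed

text \<open>Monotonicity of the derivative makes the limit a supremum, finite or not, so comparison
  with it yields an explicit point where the derivative is large.\<close>

lemma deriv_at_0_eq:
  assumes \<phi>: "\<And>l. 0 \<le> l \<Longrightarrow> \<phi> l = lexp n l"
  shows "deriv_at_0 \<phi> = (SUP l\<in>{0<..}. ereal (lexp_deriv n l))"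
proof -
  let ?L = "SUP l\<in>{0<..}. ereal (lexp_deriv n l)"
  have "((\<lambda>l. ereal (lexp_deriv n l)) \<longlongrightarrow> ?L) (at_right 0)"
  proof (rule order_tendstoI)
    fix a assume "a < ?L"
    then obtain l where l: "0 < l" "a < ereal (lexp_deriv n l)" by (auto simp: less_SUP_iff)
    have "\<forall>\<^sub>F k in at_right 0. k \<in> {0<..<l}" using eventually_at_right_real[OF l(1)] .
    then show "\<forall>\<^sub>F k in at_right 0. a < ereal (lexp_deriv n k)"
    proof eventually_elim
      case (elim k)
      then have "lexp_deriv n l \<le> lexp_deriv n k" by (intro lexp_deriv_antimono[OF ld]) auto
      then show ?case using l(2) by (simp add: less_le_trans)
    qed
  next
    fix a assume "?L < a"
    have "\<forall>\<^sub>F k in at_right (0::real). 0 < k" by (simp add: eventually_at_right_less)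
    then show "\<forall>\<^sub>F k in at_right 0. ereal (lexp_deriv n k) < a"
    proof eventually_elim
      case (elim k)
      then have "ereal (lexp_deriv n k) \<le> ?L" by (intro SUP_upper) simp
      then show ?case using \<open>?L < a\<close> by simp
    qed
  qed
  moreover have "\<forall>\<^sub>F l in at_right 0. ereal (deriv \<phi> l) = ereal (lexp_deriv n l)"
    using eventually_at_right_less[of "0::real"]
    by eventually_elim (simp add: exponent_facts(1)[OF \<phi>])
  ultimately have "((\<lambda>l. ereal (deriv \<phi> l)) \<longlongrightarrow> ?L) (at_right 0)"
    by (subst tendsto_cong) auto
  then show ?thesis unfolding deriv_at_0_def by (intro tendsto_Lim) auto
qed

text \<open>To the left of the centre \<open>\<sigma>\<close> solves the equation of the mean and is
  at least \<open>h\<close>. To the right \<open>t * H(\<sigma>)\<close> is at most 1, so the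
  exponential factors of the full bounds are constants there.\<close>

lemma sigma_facts:
  assumes \<phi>: "\<And>l. 0 \<le> l \<Longrightarrow> \<phi> l = lexp n l" and ts: "tscale t h v" and "0 < x"
  shows "x < t * lexp_deriv n h \<Longrightarrow> 0 < sigma \<phi> t x \<and> h \<le> sigma \<phi> t x \<and> t * lexp_deriv n (sigma \<phi> t x) = x"
    and "t * lexp_deriv n h \<le> x \<Longrightarrow> 0 \<le> t * H \<phi> (sigma \<phi> t x) \<and> t * H \<phi> (sigma \<phi> t x) \<le> 1"
proof -
  have D0: "deriv_at_0 \<phi> = (SUP l\<in>{0<..}. ereal (lexp_deriv n l))" by (rule deriv_at_0_eq) (rule \<phi>)
  have t: "0 < t" "0 < h" "lexp_H n h = 1 / t" using ts by (auto simp: tscale_def)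
  have pos: "0 < sigma \<phi> t x \<and> t * lexp_deriv n (sigma \<phi> t x) = x" if lt: "ereal x < ereal t * deriv_at_0 \<phi>"
  proof -
    have "\<exists>l>0. x / t < lexp_deriv n l"
    proof (rule ccontr)
      assume "\<not> (\<exists>l>0. x / t < lexp_deriv n l)"
      then have "deriv_at_0 \<phi> \<le> ereal (x / t)" unfolding D0 by (intro SUP_least) (force simp: not_less)
      then have "ereal t * deriv_at_0 \<phi> \<le> ereal t * ereal (x / t)" using t by (intro ereal_mult_left_mono) auto
      also have "\<dots> = ereal x" using t by simp
      finally show False using lt by simp
    qed
    then obtain l where l: "0 < l" "x / t < lexp_deriv n l" by blast
    have "\<forall>\<^sub>F k in sequentially. lexp_deriv n (real (Suc k)) < x / t"
      using t \<open>0 < x\<close> by (intro order_tendstoD(2)[OF lexp_deriv_tendsto_0[OF ld]]) simp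
    then obtain k where k: "lexp_deriv n (real (Suc k)) < x / t" by (auto simp: eventually_sequentially)
    define m where "m = max l (real (Suc k))"
    have m: "l \<le> m" "lexp_deriv n m \<le> x / t"
      using lexp_deriv_antimono[OF ld, of "real (Suc k)" m] k by (auto simp: m_def)
    have "\<exists>s\<ge>l. s \<le> m \<and> lexp_deriv n s = x / t"
    proof (rule IVT2[where f = "lexp_deriv n"])
      show "\<forall>s. l \<le> s \<and> s \<le> m \<longrightarrow> isCont (lexp_deriv n) s"
        using isCont_lexp_deriv[OF ld] l by (meson less_le_trans)
    qed (use m l in auto)
    then obtain s where "l \<le> s" and s2: "lexp_deriv n s = x / t" by blast
    then have s: "0 < s" "lexp_deriv n s = x / t" using l(1) by simp_all
    then have im: "x / t \<in> deriv \<phi> ` {0<..}" using exponent_facts(1)[OF \<phi>, of s] by (intro image_eqI[of _ _ s]) auto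
    have sg: "sigma \<phi> t x = inv_into {0<..} (deriv \<phi>) (x / t)" using lt by (simp add: sigma_def)
    have p: "0 < sigma \<phi> t x" unfolding sg using inv_into_into[OF im] by simp
    have "deriv \<phi> (sigma \<phi> t x) = x / t" unfolding sg by (rule f_inv_into_f[OF im])
    then show ?thesis using p exponent_facts(1)[OF \<phi> p] t by simp
  qed
  have zero: "sigma \<phi> t x = 0" "t * lexp_deriv n h \<le> x" if nlt: "\<not> ereal x < ereal t * deriv_at_0 \<phi>"
  proof -
    show "sigma \<phi> t x = 0" using nlt by (simp add: sigma_def)
    have "ereal (lexp_deriv n h) \<le> deriv_at_0 \<phi>" unfolding D0 using t by (intro SUP_upper) simp
    then have "ereal t * ereal (lexp_deriv n h) \<le> ereal t * deriv_at_0 \<phi>" using t by (intro ereal_mult_left_mono) auto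
    also have "\<dots> \<le> ereal x" using nlt by simp
    finally show "t * lexp_deriv n h \<le> x" by simp
  qed
  show "0 < sigma \<phi> t x \<and> h \<le> sigma \<phi> t x \<and> t * lexp_deriv n (sigma \<phi> t x) = x" if x: "x < t * lexp_deriv n h"
  proof -
    have lt: "ereal x < ereal t * deriv_at_0 \<phi>" using zero(2) x by force
    note p = pos[OF lt]
    have "h \<le> sigma \<phi> t x"
    proof (rule ccontr)
      assume "\<not> h \<le> sigma \<phi> t x"
      then have "lexp_deriv n h \<le> lexp_deriv n (sigma \<phi> t x)" using p by (intro lexp_deriv_antimono[OF ld]) auto
      then have "t * lexp_deriv n h \<le> t * lexp_deriv n (sigma \<phi> t x)" using t by (intro mult_left_mono) auto
      then show False using p x by simp
    qed
    then show ?thesis using p by simp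
  qed
  show "0 \<le> t * H \<phi> (sigma \<phi> t x) \<and> t * H \<phi> (sigma \<phi> t x) \<le> 1" if x: "t * lexp_deriv n h \<le> x"
  proof (cases "ereal x < ereal t * deriv_at_0 \<phi>")
    case False
    then show ?thesis using zero(1) exponent_facts(3)[OF \<phi>] by simp
  next
    case True
    define s where "s = sigma \<phi> t x"
    have s: "0 < s" "t * lexp_deriv n s = x" using pos[OF True] by (auto simp: s_def)
    have Hs: "H \<phi> s = lexp_H n s" by (rule exponent_facts(2)[OF \<phi> s(1)])
    have le: "lexp_H n s \<le> lexp_H n h"
    proof (cases "s \<le> h")
      case True then show ?thesis by (rule lexp_H_mono[OF ld s(1)])
    next
      case False
      \<comment> \<open>If \<open>h < s\<close>, monotonicity and the position of \<open>x\<close>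
        force equal derivatives at \<open>s\<close> and \<open>h\<close>; the tangent inequality at
        \<open>h\<close> then still gives the comparison of \<open>lexp_H\<close>.\<close>
      have "t * lexp_deriv n s \<le> t * lexp_deriv n h" using False t by (intro mult_left_mono lexp_deriv_antimono[OF ld]) auto
      then have "t * lexp_deriv n s = t * lexp_deriv n h" using x s by simp
      then have eq: "lexp_deriv n s = lexp_deriv n h" using t by simp
      have "lexp n s \<le> lexp n h + (s - h) * lexp_deriv n h" by (rule lexp_concave[OF ld t(2) s(1)])
      then show ?thesis unfolding lexp_H_def eq by (simp add: algebra_simps)
    qed
    have "0 \<le> lexp_H n s"
      by (rule order_trans[OF _ lexp_H_bounds(2)[OF ld s(1)]]) (auto intro!: levy_integral_nonneg[OF ld])
    moreover have "t * lexp_H n s \<le> t * (1 / t)" using le t by (intro mult_left_mono) auto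
    ultimately show ?thesis using t by (simp add: s_def[symmetric] Hs)
  qed
qed

lemma min_nu_ext:
  assumes "0 < t" "0 \<le> y"
  shows "min (ereal a) (ereal t * nu_ext \<nu> y) = ereal (if y = 0 then a else min a (t * \<nu> y))"
  using assms by (auto simp: nu_ext_def min_def)

text \<open>\<open>Dom\<close> is the set of admissible distances to the right of the centre. It is
  a parameter so that the local and the global claim share one proof; they differ only in the
  estimates \<open>UP\<close> and \<open>LO\<close>.\<close>

theorem two_sided_bounds:
  assumes T: "0 < T" and \<phi>: "\<And>l. 0 \<le> l \<Longrightarrow> \<phi> l = lexp n l" and \<nu>: "\<And>s. 0 < s \<Longrightarrow> \<nu> s = n s"
    and law: "\<And>t. 0 < t \<Longrightarrow> levy_law (P t) (\<lambda>s. t * n s)"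
    and dens: "\<And>t. 0 < t \<Longrightarrow> P t = density lborel (\<lambda>x. ennreal (p t x) * indicator {0<..} x)"
    and meas: "\<And>t. 0 < t \<Longrightarrow> (\<lambda>x. ennreal (p t x) * indicator {0<..} x) \<in> borel_measurable lborel"
    and cont: "\<And>t. 0 < t \<Longrightarrow> continuous_on {0<..} (p t)" and p0: "\<And>t x. 0 < t \<Longrightarrow> 0 < x \<Longrightarrow> 0 \<le> p t x"
    and Dom: "0 \<in> Dom" "Dom \<subseteq> {0..}"
    and UP: "\<exists>C>0. \<forall>t h v Q y B. t \<le> T \<longrightarrow> tscale t h v \<longrightarrow> levy_law Q (\<lambda>s. t * n s) \<longrightarrow> 0 < y \<longrightarrow> y \<in> Dom \<longrightarrow>
       B \<in> sets borel \<longrightarrow> (\<forall>u\<in>B. t * lexp_deriv n h + y \<le> u) \<longrightarrow>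
       emeasure Q B \<le> ennreal (C * (t * n y)) * emeasure lborel B"
    and LO: "\<And>\<Lambda>. 1 \<le> \<Lambda> \<Longrightarrow> \<exists>c>0. \<forall>t h v Q x y. t \<le> T \<longrightarrow> tscale t h v \<longrightarrow> levy_law Q (\<lambda>s. t * n s) \<longrightarrow> y \<in> Dom \<longrightarrow>
       t * lexp_deriv n (\<Lambda> / v) \<le> x \<longrightarrow> x \<le> t * lexp_deriv n h + y \<longrightarrow>
       (\<exists>\<delta>>0. \<forall>B l. B \<in> sets borel \<longrightarrow> B \<subseteq> {x..x + \<delta>} \<longrightarrow> emeasure lborel B = ennreal l \<longrightarrow> 0 \<le> l \<longrightarrow>
         ennreal (c * jump_bound t h y * l) \<le> emeasure Q B)"
  shows "\<exists>c1>1. \<forall>t y. 0 < t \<and> t \<le> T \<and> y \<in> Dom \<longrightarrow> shifted_bounds \<phi> \<nu> p c1 t y"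
    and "\<exists>c2>1. \<forall>t x. 0 < t \<and> t \<le> T \<and> 0 < x \<and> max (x - t * b \<phi> t) 0 \<in> Dom \<longrightarrow> full_bounds \<phi> \<nu> p c2 t x"
proof -
  from upper_sup[OF T] obtain Cs where Cs: "0 < Cs"
    "\<And>t h v P. t \<le> T \<Longrightarrow> tscale t h v \<Longrightarrow> levy_law P (\<lambda>s. t * n s) \<Longrightarrow> dens_bound P (Cs * h)" by blast
  from UP obtain Cr where Cr: "0 < Cr"
    "\<And>t h v Q y B. t \<le> T \<Longrightarrow> tscale t h v \<Longrightarrow> levy_law Q (\<lambda>s. t * n s) \<Longrightarrow> 0 < y \<Longrightarrow> y \<in> Dom \<Longrightarrow>
       B \<in> sets borel \<Longrightarrow> (\<forall>u\<in>B. t * lexp_deriv n h + y \<le> u) \<Longrightarrow>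
       emeasure Q B \<le> ennreal (Cr * (t * n y)) * emeasure lborel B" by blast
  from upper_left[OF T] obtain Cl where Cl: "0 < Cl"
    "\<And>t h v P \<sigma> B. t \<le> T \<Longrightarrow> tscale t h v \<Longrightarrow> levy_law P (\<lambda>s. t * n s) \<Longrightarrow> h \<le> \<sigma> \<Longrightarrow>
       B \<in> sets borel \<Longrightarrow> (\<And>u. u \<in> B \<Longrightarrow> u \<le> t * lexp_deriv n \<sigma>) \<Longrightarrow>
       emeasure P B \<le> ennreal (Cl * (h * exp (- (t / 2) * lexp_H n \<sigma>))) * emeasure lborel B" by blast
  from lower_left[OF T] obtain K cl where cl: "1 < K" "0 < cl"
    "\<And>t h v P \<sigma> B l. t \<le> T \<Longrightarrow> tscale t h v \<Longrightarrow> levy_law P (\<lambda>s. t * n s) \<Longrightarrow> 0 < \<sigma> \<Longrightarrow> K \<le> t * lexp_H n \<sigma> \<Longrightarrow>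
       B \<in> sets borel \<Longrightarrow> B \<subseteq> {t * lexp_deriv n \<sigma>..t * lexp_deriv n \<sigma> + 1 / \<sigma>} \<Longrightarrow>
       emeasure lborel B = ennreal l \<Longrightarrow> 0 \<le> l \<Longrightarrow>
       ennreal (cl * (h * exp (- 2 * t * lexp_H n \<sigma>)) * l) \<le> emeasure P B" by blast
  have "0 < K" using cl by simp
  from scale_ratio_le[OF T this] obtain \<Lambda> where \<Lambda>: "1 \<le> \<Lambda>"
    "\<And>t h v \<sigma>. t \<le> T \<Longrightarrow> tscale t h v \<Longrightarrow> h \<le> \<sigma> \<Longrightarrow> t * lexp_H n \<sigma> \<le> K \<Longrightarrow> \<sigma> \<le> \<Lambda> / v" by blast
  from LO[OF \<Lambda>(1)] obtain cn where cn: "0 < cn"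
    "\<And>t h v Q x y. t \<le> T \<Longrightarrow> tscale t h v \<Longrightarrow> levy_law Q (\<lambda>s. t * n s) \<Longrightarrow> y \<in> Dom \<Longrightarrow>
       t * lexp_deriv n (\<Lambda> / v) \<le> x \<Longrightarrow> x \<le> t * lexp_deriv n h + y \<Longrightarrow>
       (\<exists>\<delta>>0. \<forall>B l. B \<in> sets borel \<longrightarrow> B \<subseteq> {x..x + \<delta>} \<longrightarrow> emeasure lborel B = ennreal l \<longrightarrow> 0 \<le> l \<longrightarrow>
         ennreal (cn * jump_bound t h y * l) \<le> emeasure Q B)" by blast
  define C where "C = max (max Cs Cr) Cl"
  define c where "c = min cl cn"
  have cC: "0 < c" "0 < C" "Cs \<le> C" "Cr \<le> C" "Cl \<le> C" "c \<le> cl" "c \<le> cn" using Cs cl cn by (auto simp: C_def c_def)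
  have low_int: "K \<le> p t x" if t: "0 < t" and x: "0 < x" and \<delta>: "0 < \<delta>"
    and B: "\<And>B l. B \<in> sets borel \<Longrightarrow> B \<subseteq> {x..x + \<delta>} \<Longrightarrow> emeasure lborel B = ennreal l \<Longrightarrow> 0 \<le> l \<Longrightarrow> ennreal (K * l) \<le> emeasure (P t) B"
    for t x \<delta> K
  proof (rule density_ge_of_intervals[OF dens[OF t] meas[OF t] cont[OF t] x p0[OF t x]])
    fix \<eta> :: real assume "0 < \<eta>"
    then show "\<exists>c d. x - \<eta> < c \<and> c < d \<and> d < x + \<eta> \<and> ennreal (K * (d - c)) \<le> emeasure (P t) {c..d}"
      using \<delta> by (intro exI[of _ x] exI[of _ "x + min \<eta> \<delta> / 2"] conjI B) auto
  qed
  have up_int: "p t x \<le> K" if t: "0 < t" and x: "0 < x" and K: "0 \<le> K"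
    and B: "\<And>d. 0 < d \<Longrightarrow> emeasure (P t) {x..x + d} \<le> ennreal K * emeasure lborel {x..x + d}"
    for t x K
  proof (rule density_le_of_intervals[OF dens[OF t] meas[OF t] cont[OF t] x K])
    fix \<eta> :: real assume "0 < \<eta>"
    then show "\<exists>c d. x - \<eta> < c \<and> c < d \<and> d < x + \<eta> \<and> emeasure (P t) {c..d} \<le> ennreal (K * (d - c))"
      using B[of "\<eta> / 2"] ennreal_mult[OF K, of "\<eta> / 2"] by (intro exI[of _ x] exI[of _ "x + \<eta> / 2"]) auto
  qed
  \<comment> \<open>The Esscher bound concerns sets to the left of \<open>x\<close>, so here the
    intervals end at \<open>x\<close>; in all other cases they begin there.\<close>
  have up_int': "p t x \<le> K" if t: "0 < t" and x: "0 < x" and K: "0 \<le> K"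
    and B: "\<And>d. 0 < d \<Longrightarrow> emeasure (P t) {x - d..x} \<le> ennreal K * emeasure lborel {x - d..x}"
    for t x K
  proof (rule density_le_of_intervals[OF dens[OF t] meas[OF t] cont[OF t] x K])
    fix \<eta> :: real assume "0 < \<eta>"
    then show "\<exists>c d. x - \<eta> < c \<and> c < d \<and> d < x + \<eta> \<and> emeasure (P t) {c..d} \<le> ennreal (K * (d - c))"
      using B[of "\<eta> / 2"] ennreal_mult[OF K, of "\<eta> / 2"] by (intro exI[of _ "x - \<eta> / 2"] exI[of _ x]) auto
  qed
  define h where "h t = H_inv \<phi> (1 / t)" for t
  define v where "v t = min (1 / h t) R" for t
  have ts: "tscale t (h t) (v t)" if "0 < t" for t using exponent_facts(4)[OF \<phi> that] by (simp add: h_def v_def)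
  have bt: "b \<phi> t = lexp_deriv n (h t)" if "0 < t" for t using exponent_facts(5)[OF \<phi> that] by (simp add: h_def)
  have hp: "0 < h t" if "0 < t" for t using ts[OF that] by (simp add: tscale_def)
  have bp: "0 < t * b \<phi> t" if "0 < t" for t using that bt[OF that] lexp_deriv_pos[OF hp[OF that]] by simp
  have hv: "h t \<le> 1 / v t" "0 < v t" if "0 < t" for t
  proof -
    show vp: "0 < v t" using hp[OF that] R_pos by (simp add: v_def)
    have "v t \<le> 1 / h t" by (simp add: v_def)
    then show "h t \<le> 1 / v t" using hp[OF that] vp by (simp add: field_simps)
  qed
  have right: "c * jump_bound t (h t) y \<le> p t (t * b \<phi> t + y) \<and> p t (t * b \<phi> t + y) \<le> C * jump_bound t (h t) y"
    if t: "0 < t" "t \<le> T" and y: "y \<in> Dom" for t y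
  proof
    have y0: "0 \<le> y" using y Dom by auto
    define x where "x = t * b \<phi> t + y"
    have x: "0 < x" using bp[OF t(1)] y0 by (simp add: x_def)
    have xe: "x = t * lexp_deriv n (h t) + y" by (simp add: x_def bt[OF t(1)])
    have J0: "0 \<le> jump_bound t (h t) y" using jump_bound_le(2)[of t "h t" y] t hp[OF t(1)] by simp
    have "t * lexp_deriv n (\<Lambda> / v t) \<le> t * lexp_deriv n (h t)"
    proof (intro mult_left_mono lexp_deriv_antimono[OF ld])
      have "1 / v t \<le> \<Lambda> / v t" using hv(2)[OF t(1)] \<Lambda> by (intro divide_right_mono) auto
      then show "h t \<le> \<Lambda> / v t" using hv(1)[OF t(1)] by linarith
    qed (use t hp[OF t(1)] in auto)
    then have "t * lexp_deriv n (\<Lambda> / v t) \<le> x" using y0 by (simp add: xe)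
    from cn(2)[OF t(2) ts[OF t(1)] law[OF t(1)] y this] obtain \<delta> where \<delta>: "0 < \<delta>"
      "\<And>B l. B \<in> sets borel \<Longrightarrow> B \<subseteq> {x..x + \<delta>} \<Longrightarrow> emeasure lborel B = ennreal l \<Longrightarrow> 0 \<le> l \<Longrightarrow>
         ennreal (cn * jump_bound t (h t) y * l) \<le> emeasure (P t) B" by (auto simp: xe)
    have "cn * jump_bound t (h t) y \<le> p t x" by (rule low_int[OF t(1) x \<delta>])
    moreover have "c * jump_bound t (h t) y \<le> cn * jump_bound t (h t) y" using J0 cC by (intro mult_right_mono) auto
    ultimately show "c * jump_bound t (h t) y \<le> p t (t * b \<phi> t + y)" by (simp add: x_def)
    have 1: "p t x \<le> Cs * h t"
    proof (rule up_int[OF t(1) x])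
      show "0 \<le> Cs * h t" using Cs hp[OF t(1)] by simp
      show "emeasure (P t) {x..x + d} \<le> ennreal (Cs * h t) * emeasure lborel {x..x + d}" for d
        using Cs(2)[OF t(2) ts[OF t(1)] law[OF t(1)]] by (simp add: dens_bound_def)
    qed
    also have "Cs * h t \<le> C * h t" using cC hp[OF t(1)] by (intro mult_right_mono) auto
    finally have 1: "p t x \<le> C * h t" .
    show "p t (t * b \<phi> t + y) \<le> C * jump_bound t (h t) y"
    proof (cases "y = 0")
      case True then show ?thesis using 1 by (simp add: x_def jump_bound_def)
    next
      case False
      have "p t x \<le> Cr * (t * n y)"
      proof (rule up_int[OF t(1) x])
        show "0 \<le> Cr * (t * n y)" using Cr t n_nonneg by simp
        show "emeasure (P t) {x..x + d} \<le> ennreal (Cr * (t * n y)) * emeasure lborel {x..x + d}" for d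
          using False y0 by (intro Cr(2)[OF t(2) ts[OF t(1)] law[OF t(1)] _ y]) (auto simp: xe)
      qed
      also have "\<dots> \<le> C * (t * n y)" using cC t n_nonneg by (intro mult_right_mono) auto
      finally show ?thesis using 1 False cC by (simp add: x_def jump_bound_def min_def)
    qed
  qed
  have left: "c * (h t * exp (- 2 * t * lexp_H n s)) \<le> p t x \<and> p t x \<le> C * (h t * exp (- (t / 2) * lexp_H n s))"
    if t: "0 < t" "t \<le> T" and x: "0 < x" and s: "0 < s" "h t \<le> s" "t * lexp_deriv n s = x" for t x s
  proof
    have hp': "0 \<le> h t" using hp[OF t(1)] by simp
    have H0: "0 \<le> lexp_H n s"
      by (rule order_trans[OF _ lexp_H_bounds(2)[OF ld s(1)]]) (auto intro!: levy_integral_nonneg[OF ld])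
    have "p t x \<le> Cl * (h t * exp (- (t / 2) * lexp_H n s))"
    proof (rule up_int'[OF t(1) x])
      show "0 \<le> Cl * (h t * exp (- (t / 2) * lexp_H n s))" using Cl hp' by simp
      show "emeasure (P t) {x - d..x} \<le> ennreal (Cl * (h t * exp (- (t / 2) * lexp_H n s))) * emeasure lborel {x - d..x}" for d
        by (rule Cl(2)[OF t(2) ts[OF t(1)] law[OF t(1)] s(2)]) (auto simp: s(3))
    qed
    also have "\<dots> \<le> C * (h t * exp (- (t / 2) * lexp_H n s))" using cC hp' by (intro mult_right_mono) auto
    finally show "p t x \<le> C * (h t * exp (- (t / 2) * lexp_H n s))" .
    show "c * (h t * exp (- 2 * t * lexp_H n s)) \<le> p t x"
    \<comment> \<open>For large \<open>t * lexp_H n s\<close> the tilted argument applies. Otherwise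
      the centre is near and the bound at \<open>y = 0\<close>, of order \<open>h\<close>, is
      stronger than required.\<close>
    proof (cases "K \<le> t * lexp_H n s")
      case True
      have "cl * (h t * exp (- 2 * t * lexp_H n s)) \<le> p t x"
      proof (rule low_int[OF t(1) x, of "1 / s"])
        show "0 < 1 / s" using s by simp
        show "ennreal (cl * (h t * exp (- 2 * t * lexp_H n s)) * l) \<le> emeasure (P t) B"
          if "B \<in> sets borel" "B \<subseteq> {x..x + 1 / s}" "emeasure lborel B = ennreal l" "0 \<le> l" for B l
          using cl(3)[OF t(2) ts[OF t(1)] law[OF t(1)] s(1) True that(1) _ that(3,4)] that(2) s(3) by simp
      qed
      moreover have "c * (h t * exp (- 2 * t * lexp_H n s)) \<le> cl * (h t * exp (- 2 * t * lexp_H n s))"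
        using cC hp' by (intro mult_right_mono) auto
      ultimately show ?thesis by linarith
    next
      case False
      have sL: "s \<le> \<Lambda> / v t" using False by (intro \<Lambda>(2)[OF t(2) ts[OF t(1)] s(2)]) simp
      have x1: "t * lexp_deriv n (\<Lambda> / v t) \<le> x"
        unfolding s(3)[symmetric] using t s sL by (intro mult_left_mono lexp_deriv_antimono[OF ld]) auto
      have x2: "x \<le> t * lexp_deriv n (h t) + 0"
        unfolding s(3)[symmetric] using t s hp[OF t(1)] by (auto intro!: mult_left_mono lexp_deriv_antimono[OF ld])
      from cn(2)[OF t(2) ts[OF t(1)] law[OF t(1)] Dom(1) x1 x2] obtain \<delta> where \<delta>: "0 < \<delta>"
        "\<And>B l. B \<in> sets borel \<Longrightarrow> B \<subseteq> {x..x + \<delta>} \<Longrightarrow> emeasure lborel B = ennreal l \<Longrightarrow> 0 \<le> l \<Longrightarrow>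
         ennreal (cn * jump_bound t (h t) 0 * l) \<le> emeasure (P t) B" by auto
      have "cn * jump_bound t (h t) 0 \<le> p t x" by (rule low_int[OF t(1) x \<delta>])
      moreover have "c * (h t * exp (- 2 * t * lexp_H n s)) \<le> cn * (h t * 1)"
        using cC cn hp' H0 t by (intro mult_mono) auto
      ultimately show ?thesis by (simp add: jump_bound_def)
    qed
  qed
  \<comment> \<open>The factor 2 compensates \<open>exp (- N / 2) \<ge> 1/2\<close> in the full
    upper bound to the right of the centre.\<close>
  define c' where "c' = max 2 (max (1 / c) (2 * C))"
  have c': "1 < c'" "1 / c' \<le> c" "2 * C \<le> c'" "C \<le> c'"
  proof -
    show "1 < c'" "2 * C \<le> c'" by (auto simp: c'_def)
    then show "C \<le> c'" using cC by simp
    have "1 / c \<le> c'" by (simp add: c'_def)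
    then show "1 / c' \<le> c" using cC \<open>1 < c'\<close> by (simp add: field_simps)
  qed
  have jn: "(if y = 0 then h t else min (h t) (t * \<nu> y)) = jump_bound t (h t) y" if "0 \<le> y" for t y
    using that \<nu>[of y] by (simp add: jump_bound_def)
  show "\<exists>c1>1. \<forall>t y. 0 < t \<and> t \<le> T \<and> y \<in> Dom \<longrightarrow> shifted_bounds \<phi> \<nu> p c1 t y"
  proof (intro exI[of _ c'] conjI allI impI c'(1))
    fix t y assume a: "0 < t \<and> t \<le> T \<and> y \<in> Dom"
    then have t: "0 < t" "t \<le> T" and y: "y \<in> Dom" "0 \<le> y" using Dom by auto
    have J0: "0 \<le> jump_bound t (h t) y" using jump_bound_le(2)[of t "h t" y] t hp[OF t(1)] by simp
    have "1 / c' * jump_bound t (h t) y \<le> c * jump_bound t (h t) y" "C * jump_bound t (h t) y \<le> c' * jump_bound t (h t) y"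
      by (rule mult_right_mono[OF c'(2) J0], rule mult_right_mono[OF c'(4) J0])
    then have "1 / c' * jump_bound t (h t) y \<le> p t (t * b \<phi> t + y)" "p t (t * b \<phi> t + y) \<le> c' * jump_bound t (h t) y"
      using right[OF t y(1)] by linarith+
    then show "shifted_bounds \<phi> \<nu> p c' t y"
      unfolding shifted_bounds_def min_nu_ext[OF t(1) y(2)] h_def[symmetric] jn[OF y(2)] by simp
  qed
  show "\<exists>c2>1. \<forall>t x. 0 < t \<and> t \<le> T \<and> 0 < x \<and> max (x - t * b \<phi> t) 0 \<in> Dom \<longrightarrow> full_bounds \<phi> \<nu> p c2 t x"
  proof (intro exI[of _ c'] conjI allI impI c'(1))
    fix t x assume a: "0 < t \<and> t \<le> T \<and> 0 < x \<and> max (x - t * b \<phi> t) 0 \<in> Dom"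
    then have t: "0 < t" "t \<le> T" and x: "0 < x" and D: "max (x - t * b \<phi> t) 0 \<in> Dom" by auto
    define y where "y = max (x - t * b \<phi> t) 0"
    have y: "0 \<le> y" "y \<in> Dom" using D by (auto simp: y_def)
    define s where "s = sigma \<phi> t x"
    define N where "N = t * H \<phi> s"
    have e: "- 2 * t * H \<phi> s = - 2 * N" "- (t / 2) * H \<phi> s = - N / 2" by (auto simp: N_def)
    define A where "A = (if y = 0 then h t * exp (- 2 * N) else min (h t * exp (- 2 * N)) (t * \<nu> y))"
    define B where "B = (if y = 0 then h t * exp (- N / 2) else min (h t * exp (- N / 2)) (t * \<nu> y))"
    have "1 / c' * A \<le> p t x \<and> p t x \<le> c' * B"
    proof (cases "x < t * b \<phi> t")
      case True
      then have y0: "y = 0" by (simp add: y_def)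
      from sigma_facts(1)[OF \<phi> ts[OF t(1)] x] True
      have s: "0 < s" "h t \<le> s" "t * lexp_deriv n s = x" by (auto simp: s_def bt[OF t(1)])
      have N: "N = t * lexp_H n s" using exponent_facts(2)[OF \<phi> s(1)] by (simp add: N_def)
      from left[OF t x s] have "c * A \<le> p t x" "p t x \<le> C * B"
        by (auto simp: A_def B_def y0 N mult.assoc)
      moreover have "0 \<le> A" "0 \<le> B" using hp[OF t(1)] by (simp_all add: A_def B_def y0)
      from mult_right_mono[OF c'(2) this(1)] mult_right_mono[OF c'(4) this(2)]
      have "1 / c' * A \<le> c * A" "C * B \<le> c' * B" .
      ultimately show ?thesis by linarith
    next
      case False
      then have xy: "x = t * b \<phi> t + y" by (simp add: y_def)
      from sigma_facts(2)[OF \<phi> ts[OF t(1)] x] False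
      have N: "0 \<le> N" "N \<le> 1" by (auto simp: s_def N_def bt[OF t(1)])
      note R = right[OF t y(2), folded xy]
      let ?J = "jump_bound t (h t) y"
      have J0: "0 \<le> ?J" using jump_bound_le(2)[of t "h t" y] t hp[OF t(1)] by simp
      have hh: "h t * exp (- 2 * N) \<le> h t" using hp[OF t(1)] N by simp
      have "A \<le> ?J" unfolding A_def jn[OF y(1), symmetric] using hh by (auto simp: min_def)
      then have "1 / c' * A \<le> 1 / c' * ?J" using c' by (intro mult_left_mono) auto
      also have "\<dots> \<le> c * ?J" using c' J0 by (intro mult_right_mono) auto
      finally have 1: "1 / c' * A \<le> p t x" using R by linarith
      have half: "1 / 2 \<le> exp (- N / 2)"
      proof -
        have "1 - N / 2 \<le> exp (- N / 2)" using exp_ge_add_one_self[of "- N / 2"] by simp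
        then show ?thesis using N by simp
      qed
      have "?J \<le> 2 * B"
      proof -
        have "h t * (1 / 2) \<le> h t * exp (- N / 2)" using half hp[OF t(1)] by (intro mult_left_mono) auto
        moreover have "0 \<le> t * \<nu> y" if "y \<noteq> 0" using that y \<nu>[of y] n_nonneg t by simp
        ultimately show ?thesis unfolding B_def jn[OF y(1), symmetric] by (auto simp: min_def)
      qed
      then have "C * ?J \<le> C * (2 * B)" using cC by (intro mult_left_mono) auto
      moreover have "C * (2 * B) \<le> c' * B"
      proof -
        have "0 \<le> B" using \<open>?J \<le> 2 * B\<close> J0 by simp
        then have "2 * C * B \<le> c' * B" using c' by (intro mult_right_mono) auto
        then show ?thesis by simp
      qed
      ultimately have "p t x \<le> c' * B" using R by linarith
      with 1 show ?thesis by simp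
    qed
    then show "full_bounds \<phi> \<nu> p c' t x"
      unfolding full_bounds_def y_def[symmetric] s_def[symmetric] h_def[symmetric] e min_nu_ext[OF t(1) y(1)]
      by (simp add: A_def B_def)
  qed
qed

end

lemma levy_law_of_transition_density:
  assumes sub: "subordinator M S" and lap: "has_laplace_exponent M S \<phi>" and td: "transition_density M S p"
    and n: "levy_density n" and \<phi>: "\<And>l. 0 \<le> l \<Longrightarrow> \<phi> l = lexp n l" and t: "0 < t"
  shows "levy_law (distr M borel (S t)) (\<lambda>s. t * n s)"
    and "distr M borel (S t) = density lborel (\<lambda>x. ennreal (p t x) * indicator {0<..} x)"
    and "(\<lambda>x. ennreal (p t x) * indicator {0<..} x) \<in> borel_measurable lborel"
proof -
  have M: "prob_space M" and [measurable]: "S t \<in> borel_measurable M"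
    using sub t by (auto simp: subordinator_def levy_process_def)
  interpret prob_space M by fact
  have d: "distributed M lborel (S t) (\<lambda>x. ennreal (p t x) * indicator {0<..} x)"
    using td t by (auto simp: transition_density_def)
  show meas: "(\<lambda>x. ennreal (p t x) * indicator {0<..} x) \<in> borel_measurable lborel"
    using d by (simp add: distributed_def)
  have "distr M borel (S t) = distr M lborel (S t)" by (rule distr_cong) auto
  then show dens: "distr M borel (S t) = density lborel (\<lambda>x. ennreal (p t x) * indicator {0<..} x)"
    using d by (simp add: distributed_def)
  let ?P = "distr M borel (S t)"
  have P: "prob_space ?P" by (rule prob_space_distr) simp
  have "AE x in density lborel (\<lambda>x. ennreal (p t x) * indicator {0<..} x). 0 \<le> x"
    using meas by (subst AE_density) (auto split: split_indicator)
  then have pos: "AE x in ?P. 0 \<le> x" by (simp only: dens)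
  have "(\<integral>\<^sup>+x. ennreal (exp (- l * x)) \<partial>?P) = ennreal (exp (- lexp (\<lambda>s. t * n s) l))" if l: "0 \<le> l" for l
  proof -
    have "(\<integral>\<^sup>+x. ennreal (exp (- l * x)) \<partial>?P) = ennreal (\<integral>x. exp (- l * x) \<partial>?P)"
      by (rule integral_exp_eq(2)[OF P _ pos l, symmetric]) simp
    also have "(\<integral>x. exp (- l * x) \<partial>?P) = (\<integral>\<omega>. exp (- l * S t \<omega>) \<partial>M)" by (subst integral_distr) auto
    also have "\<dots> = exp (- t * \<phi> l)" using lap t l by (simp add: has_laplace_exponent_def)
    also have "t * lexp n l = lexp (\<lambda>s. t * n s) l" unfolding lexp_def by (simp add: mult.left_commute)
    then have "- t * \<phi> l = - lexp (\<lambda>s. t * n s) l" using \<phi>[OF l] by simp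
    finally show ?thesis .
  qed
  then show "levy_law ?P (\<lambda>s. t * n s)" using P pos by (simp add: levy_law_def)
qed

lemma levy_density_of_subordinator:
  assumes "subordinator_levy_density \<nu>"
  shows "levy_density (\<lambda>s. indicator {0<..} s * \<nu> s)"
    and "laplace_exponent_of_density \<nu> l = lexp (\<lambda>s. indicator {0<..} s * \<nu> s) l"
proof -
  have "(\<lambda>s. indicator {0<..} s * (min 1 s * \<nu> s)) = (\<lambda>s::real. min 1 s * (indicator {0<..} s * \<nu> s))"
    by (simp add: ac_simps)
  then show "levy_density (\<lambda>s. indicator {0<..} s * \<nu> s)"
    using assms by (auto simp: subordinator_levy_density_def levy_density_def set_borel_measurable_def set_integrable_def split: split_indicator)
  show "laplace_exponent_of_density \<nu> l = lexp (\<lambda>s. indicator {0<..} s * \<nu> s) l"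
    unfolding laplace_exponent_of_density_def lexp_def set_lebesgue_integral_def
    by (simp add: ac_simps)
qed

theorem corollary1p7:
  fixes M :: "'a measure" and S :: "real \<Rightarrow> 'a \<Rightarrow> real"
    and \<nu> \<phi> :: "real \<Rightarrow> real" and p :: "real \<Rightarrow> real \<Rightarrow> real"
    and R1 :: ereal and a1 a2 a3 \<alpha>1 \<alpha>2 :: real
  assumes "subordinator M S"
    and "subordinator_levy_density \<nu>"
    and "has_laplace_exponent M S \<phi>"
    and "\<forall>l\<ge>0. \<phi> l = laplace_exponent_of_density \<nu> l"
    and "transition_density M S p"
    and "0 < R1"
    and "0 < a1" and "0 < a2" and "0 < a3"
    and "0 < \<alpha>1" and "\<alpha>1 \<le> \<alpha>2" and "\<alpha>2 < 2"
    and "\<forall>r. 0 < r \<and> ereal r < R1 \<longrightarrow> 0 < \<nu> r"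
    and "\<forall>r R. 0 < r \<and> r \<le> R \<and> ereal R < R1 \<longrightarrow>
           a1 * (R / r) powr (1 + \<alpha>1) \<le> \<nu> r / \<nu> R \<and>
           \<nu> r / \<nu> R \<le> a2 * (R / r) powr (1 + \<alpha>2)"
    and "\<forall>r. R1 \<le> ereal r \<longrightarrow> \<nu> r \<le> a3"
  shows
    "(\<forall>T>0.
        (\<exists>c1>1. \<forall>t y. 0 < t \<and> t \<le> T \<and> 0 \<le> y \<and> ereal y < R1 / 2 \<longrightarrow>
           shifted_bounds \<phi> \<nu> p c1 t y) \<and>
        (\<exists>c2>1. \<forall>t x. 0 < t \<and> t \<le> T \<and> 0 < x \<and> ereal x < R1 / 2 \<longrightarrow>
           full_bounds \<phi> \<nu> p c2 t x)) \<and>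
     ((\<exists>a4>0. \<exists>a5>0. \<forall>r. R1 / 2 \<le> ereal r \<longrightarrow>
           (\<forall>u\<ge>r. a4 * \<nu> u \<le> \<nu> r) \<and> a5 * \<nu> r \<le> \<nu> (2 * r)) \<longrightarrow>
      (\<forall>T>0.
        (\<exists>c1>1. \<forall>t y. 0 < t \<and> t \<le> T \<and> 0 \<le> y \<longrightarrow> shifted_bounds \<phi> \<nu> p c1 t y) \<and>
        (\<exists>c2>1. \<forall>t x. 0 < t \<and> t \<le> T \<and> 0 < x \<longrightarrow> full_bounds \<phi> \<nu> p c2 t x)))"
proof -
  define n where "n s = indicator {0<..} s * \<nu> s" for s
  have ld: "levy_density n" unfolding n_def by (rule levy_density_of_subordinator(1)[OF assms(2)])
  have \<nu>: "\<nu> s = n s" if "0 < s" for s using that by (simp add: n_def)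
  have \<phi>: "\<phi> l = lexp n l" if "0 \<le> l" for l
    unfolding n_def levy_density_of_subordinator(2)[OF assms(2), symmetric] using assms(4) that by simp
  define P where "P t = distr M borel (S t)" for t
  note law = levy_law_of_transition_density[OF assms(1,3,5) ld \<phi>, folded P_def]
  have cont: "continuous_on {0<..} (p t)" if "0 < t" for t using assms(5) that by (simp add: transition_density_def)
  have p0: "0 \<le> p t x" if "0 < t" "0 < x" for t x using assms(5) that by (simp add: transition_density_def)
  have lo: "a1 * (s / r) powr (1 + \<alpha>1) * n s \<le> n r" and hi: "n r \<le> a2 * (s / r) powr (1 + \<alpha>2) * n s"
    and np: "0 < n s" if "0 < r" "r \<le> s" "ereal s < R1" for r s
  proof -
    have s: "0 < s" using that by simp
    have "0 < \<nu> s" using assms(13) s that(3) by blast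
    then show np: "0 < n s" using \<nu>[OF s] by simp
    have "a1 * (s / r) powr (1 + \<alpha>1) \<le> n r / n s" "n r / n s \<le> a2 * (s / r) powr (1 + \<alpha>2)"
      using assms(14)[rule_format, of r s] that \<nu>[OF s] \<nu>[OF that(1)] by auto
    then show "a1 * (s / r) powr (1 + \<alpha>1) * n s \<le> n r" "n r \<le> a2 * (s / r) powr (1 + \<alpha>2) * n s"
      using np by (simp_all add: pos_le_divide_eq pos_divide_le_eq)
  qed
  have le1: "n s \<le> n r / a1" if "0 < r" "r \<le> s" "ereal s < R1" for r s
  proof -
    have "1 \<le> (s / r) powr (1 + \<alpha>1)" using that assms(10) by (intro ge_one_powr_ge_zero) auto
    then have "a1 * 1 * n s \<le> a1 * (s / r) powr (1 + \<alpha>1) * n s"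
      using np[OF that] assms(7) by (intro mult_right_mono mult_left_mono) auto
    then have "a1 * n s \<le> n r" using lo[OF that] by linarith
    then show ?thesis using assms(7) by (simp add: pos_le_divide_eq mult.commute)
  qed
  have dbl: "n r \<le> 8 * a2 * n (2 * r)" if "0 < r" "ereal (2 * r) < R1" for r
  proof -
    have "n r \<le> a2 * (2 * r / r) powr (1 + \<alpha>2) * n (2 * r)" using that by (intro hi) auto
    also have "(2 * r / r) powr (1 + \<alpha>2) \<le> 2 powr 3"
    proof -
      have "2 powr (1 + \<alpha>2) \<le> (2::real) powr 3" using assms(12) by (intro powr_mono) auto
      then show ?thesis using that by simp
    qed
    then have "a2 * (2 * r / r) powr (1 + \<alpha>2) * n (2 * r) \<le> a2 * 2 powr 3 * n (2 * r)"
      using assms(8) levy_densityD(2)[OF ld] by (intro mult_right_mono mult_left_mono) auto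
    finally show ?thesis by (simp add: powr_numeral)
  qed
  \<comment> \<open>Between \<open>R\<close> and \<open>R1\<close> the density is at most
    \<open>n R / a1\<close> by near-monotonicity, and from \<open>R1\<close> on at most
    \<open>a3\<close>; the maximum bounds it beyond \<open>R\<close>.\<close>
  have scaled: "scaled_levy_density n R a1 a2 (max a3 (n R / a1)) \<alpha>1 \<alpha>2" if R: "0 < R" "ereal R < R1" for R
  proof (unfold_locales)
    have lt: "ereal s < R1" if "s \<le> R" for s using R that by (simp add: le_less_trans[of "ereal s" "ereal R"])
    show "0 < n s" if "0 < s" "s \<le> R" for s using np[of s s] that lt by simp
    show "a1 * (s / r) powr (1 + \<alpha>1) * n s \<le> n r" if "0 < r" "r \<le> s" "s \<le> R" for r s by (rule lo[OF that(1,2) lt[OF that(3)]])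
    show "n r \<le> a2 * (s / r) powr (1 + \<alpha>2) * n s" if "0 < r" "r \<le> s" "s \<le> R" for r s by (rule hi[OF that(1,2) lt[OF that(3)]])
    show "n s \<le> max a3 (n R / a1)" if "R \<le> s" for s
    proof (cases "ereal s < R1")
      case True
      have "n s \<le> n R / a1" by (rule le1[OF R(1) that True])
      then show ?thesis by simp
    next
      case False
      then have "\<nu> s \<le> a3" using assms(15) by simp
      then show ?thesis using \<nu>[of s] that R by simp
    qed
  qed (use ld R assms in auto)
  have all: "(\<exists>c1>1. \<forall>t y. 0 < t \<and> t \<le> T \<and> 0 \<le> y \<longrightarrow> shifted_bounds \<phi> \<nu> p c1 t y) \<and>
      (\<exists>c2>1. \<forall>t x. 0 < t \<and> t \<le> T \<and> 0 < x \<longrightarrow> full_bounds \<phi> \<nu> p c2 t x)"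
    if D: "doubling_levy_density n R a1 a2 b3 \<alpha>1 \<alpha>2 D1 D2" and T: "0 < T" for R b3 D1 D2 T
  proof -
    interpret doubling_levy_density n R a1 a2 b3 \<alpha>1 \<alpha>2 D1 D2 by (rule D)
    have UP: "\<exists>C>0. \<forall>t h v Q y B. t \<le> T \<longrightarrow> tscale t h v \<longrightarrow> levy_law Q (\<lambda>s. t * n s) \<longrightarrow> 0 < y \<longrightarrow> y \<in> {0..} \<longrightarrow>
       B \<in> sets borel \<longrightarrow> (\<forall>u\<in>B. t * lexp_deriv n h + y \<le> u) \<longrightarrow>
       emeasure Q B \<le> ennreal (C * (t * n y)) * emeasure lborel B"
      by (rule upper_right_all[OF T], intro exI conjI allI impI, assumption) blast
    have LO: "\<exists>c>0. \<forall>t h v Q x y. t \<le> T \<longrightarrow> tscale t h v \<longrightarrow> levy_law Q (\<lambda>s. t * n s) \<longrightarrow> y \<in> {0..} \<longrightarrow>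
       t * lexp_deriv n (\<Lambda> / v) \<le> x \<longrightarrow> x \<le> t * lexp_deriv n h + y \<longrightarrow>
       (\<exists>\<delta>>0. \<forall>B l. B \<in> sets borel \<longrightarrow> B \<subseteq> {x..x + \<delta>} \<longrightarrow> emeasure lborel B = ennreal l \<longrightarrow> 0 \<le> l \<longrightarrow>
         ennreal (c * jump_bound t h y * l) \<le> emeasure Q B)" if "1 \<le> \<Lambda>" for \<Lambda>
      by (rule lower_near_all[OF T that], rule exI, rule conjI, assumption) (intro allI impI, simp)
    note bounds = two_sided_bounds[where P = P and Dom = "{0..}", OF T \<phi> \<nu> law cont p0 _ _ UP LO]
    show ?thesis using bounds by simp
  qed
  let "?A \<and> (?D \<longrightarrow> ?B)" = ?thesis
  show ?thesis
  proof (cases R1)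
    case MInf
    then show ?thesis using assms(6) by simp
  next
    case PInf
    interpret scaled_levy_density n 1 a1 a2 "max a3 (n 1 / a1)" \<alpha>1 \<alpha>2 by (rule scaled) (use PInf in auto)
    \<comment> \<open>Scaling on the whole half-line already gives near-monotonicity and doubling,
      so the global bounds hold and contain both parts of the claim. The cutoff 1 is
      arbitrary.\<close>
    have "doubling_levy_density n 1 a1 a2 (max a3 (n 1 / a1)) \<alpha>1 \<alpha>2 (1 / a1) (8 * a2)"
    proof (unfold_locales)
      show "n u \<le> 1 / a1 * n r" if "0 < r" "r \<le> u" for r u using le1[OF that] PInf by simp
      show "n r \<le> 8 * a2 * n (2 * r)" if "0 < r" for r using dbl[OF that] PInf by simp
    qed (use a_pos in auto)
    note far = all[OF this]
    have "?B" using far by (intro allI impI)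
    moreover have "?A"
    proof (intro allI impI)
      fix T :: real assume "0 < T"
      from far[OF this] obtain c1 c2 where "1 < c1" "\<forall>t y. 0 < t \<and> t \<le> T \<and> 0 \<le> y \<longrightarrow> shifted_bounds \<phi> \<nu> p c1 t y"
        "1 < c2" "\<forall>t x. 0 < t \<and> t \<le> T \<and> 0 < x \<longrightarrow> full_bounds \<phi> \<nu> p c2 t x" by (elim conjE exE)
      then show "(\<exists>c1>1. \<forall>t y. 0 < t \<and> t \<le> T \<and> 0 \<le> y \<and> ereal y < R1 / 2 \<longrightarrow> shifted_bounds \<phi> \<nu> p c1 t y) \<and>
          (\<exists>c2>1. \<forall>t x. 0 < t \<and> t \<le> T \<and> 0 < x \<and> ereal x < R1 / 2 \<longrightarrow> full_bounds \<phi> \<nu> p c2 t x)"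
        by (intro conjI exI[of _ c1] exI[of _ c2]) simp_all
    qed
    ultimately show ?thesis by (intro conjI impI)
  next
    case (real q)
    have q: "0 < q" using assms(6) real by simp
    have half: "R1 / 2 = ereal (q / 2)" unfolding real by simp
    \<comment> \<open>Any point strictly between \<open>q / 2\<close> and \<open>q\<close> would do:
      scaling must hold up to \<open>R\<close>, and the local lower bound needs room above
      \<open>q / 2\<close>.\<close>
    define R where "R = 3 / 4 * q"
    have R: "0 < R" "ereal R < R1" "q / 2 < R" "R < q" using q real by (auto simp: R_def)
    note sc = scaled[OF R(1,2)]
    interpret scaled_levy_density n R a1 a2 "max a3 (n R / a1)" \<alpha>1 \<alpha>2 by (rule sc)
    have near: "(\<exists>c1>1. \<forall>t y. 0 < t \<and> t \<le> T \<and> 0 \<le> y \<and> ereal y < R1 / 2 \<longrightarrow> shifted_bounds \<phi> \<nu> p c1 t y) \<and>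
        (\<exists>c2>1. \<forall>t x. 0 < t \<and> t \<le> T \<and> 0 < x \<and> ereal x < R1 / 2 \<longrightarrow> full_bounds \<phi> \<nu> p c2 t x)" if T: "0 < T" for T
    proof -
      have UP: "\<exists>C>0. \<forall>t h v Q y B. t \<le> T \<longrightarrow> tscale t h v \<longrightarrow> levy_law Q (\<lambda>s. t * n s) \<longrightarrow> 0 < y \<longrightarrow> y \<in> {0..<q / 2} \<longrightarrow>
         B \<in> sets borel \<longrightarrow> (\<forall>u\<in>B. t * lexp_deriv n h + y \<le> u) \<longrightarrow>
         emeasure Q B \<le> ennreal (C * (t * n y)) * emeasure lborel B"
        by (rule upper_right[OF T], intro exI conjI allI impI, assumption) (use R in auto)
      have q2: "0 < q / 2" using q by simp
      have LO: "\<exists>c>0. \<forall>t h v Q x y. t \<le> T \<longrightarrow> tscale t h v \<longrightarrow> levy_law Q (\<lambda>s. t * n s) \<longrightarrow> y \<in> {0..<q / 2} \<longrightarrow>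
         t * lexp_deriv n (\<Lambda> / v) \<le> x \<longrightarrow> x \<le> t * lexp_deriv n h + y \<longrightarrow>
         (\<exists>\<delta>>0. \<forall>B l. B \<in> sets borel \<longrightarrow> B \<subseteq> {x..x + \<delta>} \<longrightarrow> emeasure lborel B = ennreal l \<longrightarrow> 0 \<le> l \<longrightarrow>
           ennreal (c * jump_bound t h y * l) \<le> emeasure Q B)" if "1 \<le> \<Lambda>" for \<Lambda>
        by (rule lower_near[OF T that q2 R(3)], rule exI, rule conjI, assumption) (intro allI impI, simp)
      have Dom: "0 \<in> {0..<q / 2}" "{0..<q / 2} \<subseteq> {0..}" using q by auto
      note bounds = two_sided_bounds[where P = P, OF T \<phi> \<nu> law cont p0 Dom UP LO]
      \<comment> \<open>As \<open>t * b \<phi> t\<close> is nonnegative, \<open>x < R1 / 2\<close>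
        leaves the distance to the right of the centre below \<open>R1 / 2\<close>.\<close>
      have in_dom: "max (x - t * b \<phi> t) 0 \<in> {0..<q / 2}" if "0 < t" "0 < x" "x < q / 2" for t x
      proof -
        have "b \<phi> t = lexp_deriv n (H_inv \<phi> (1 / t))" by (rule exponent_facts(5)) (use \<phi> that in auto)
        then have "0 \<le> t * b \<phi> t" using lexp_deriv_nonneg[OF ld] that by simp
        then have "x - t * b \<phi> t < q / 2" using that by linarith
        then show ?thesis unfolding atLeastLessThan_iff max_less_iff_conj using q by simp
      qed
      show ?thesis
      proof
        show "\<exists>c1>1. \<forall>t y. 0 < t \<and> t \<le> T \<and> 0 \<le> y \<and> ereal y < R1 / 2 \<longrightarrow> shifted_bounds \<phi> \<nu> p c1 t y"
          unfolding half using bounds(1) q by simp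
        have "\<exists>c2>1. \<forall>t x. 0 < t \<and> t \<le> T \<and> 0 < x \<and> max (x - t * b \<phi> t) 0 \<in> {0..<q / 2} \<longrightarrow> full_bounds \<phi> \<nu> p c2 t x"
          by (rule bounds(2))
        then show "\<exists>c2>1. \<forall>t x. 0 < t \<and> t \<le> T \<and> 0 < x \<and> ereal x < R1 / 2 \<longrightarrow> full_bounds \<phi> \<nu> p c2 t x"
          unfolding half using in_dom by (metis less_ereal.simps(1))
      qed
    qed
    \<comment> \<open>The product in the first constant comes from pairs with \<open>r\<close> below
      \<open>q / 2\<close> and \<open>u\<close> beyond \<open>R\<close>, which are compared through
      \<open>R\<close>: scaling up to \<open>R\<close>, the additional hypothesis from
      there.\<close>
    have far: "doubling_levy_density n R a1 a2 (max a3 (n R / a1)) \<alpha>1 \<alpha>2 (max (1 / a1) (1 / a4) * max 1 (1 / a4)) (max (8 * a2) (1 / a5))"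
      if a45: "0 < a4" "0 < a5" "\<forall>r. R1 / 2 \<le> ereal r \<longrightarrow> (\<forall>u\<ge>r. a4 * \<nu> u \<le> \<nu> r) \<and> a5 * \<nu> r \<le> \<nu> (2 * r)" for a4 a5
    proof (unfold_locales)
      let ?D = "max (1 / a1) (1 / a4) * max 1 (1 / a4)"
      have far: "n u \<le> 1 / a4 * n r" "n r \<le> 1 / a5 * n (2 * r)" if "q / 2 \<le> r" "r \<le> u" for r u
      proof -
        have "R1 / 2 \<le> ereal r" unfolding half using that by simp
        then have "a4 * \<nu> u \<le> \<nu> r" "a5 * \<nu> r \<le> \<nu> (2 * r)" using a45(3) that by auto
        then show "n u \<le> 1 / a4 * n r" "n r \<le> 1 / a5 * n (2 * r)"
          using \<nu>[of u] \<nu>[of r] \<nu>[of "2 * r"] that q a45 by (auto simp: pos_le_divide_eq mult.commute)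
      qed
      show "0 < ?D" "0 < max (8 * a2) (1 / a5)" using a_pos a45 by (auto simp: less_max_iff_disj)
      have D: "1 / a1 \<le> ?D" "1 / a4 \<le> ?D" "1 / a4 * (1 / a1) \<le> ?D"
      proof -
        have nn: "0 \<le> 1 / a4" "0 \<le> max (1 / a1) (1 / a4)" using a_pos a45 by (auto simp: le_max_iff_disj)
        have "1 / a1 * 1 \<le> ?D" "1 / a4 * 1 \<le> ?D" "1 / a1 * (1 / a4) \<le> ?D"
          by (rule mult_mono; use nn in simp)+
        then show "1 / a1 \<le> ?D" "1 / a4 \<le> ?D" "1 / a4 * (1 / a1) \<le> ?D" by (simp_all add: mult.commute)
      qed
      show "n u \<le> ?D * n r" if ru: "0 < r" "r \<le> u" for r u
      proof -
        consider "q / 2 \<le> r" | "r < q / 2" "u \<le> R" | "r < q / 2" "R < u" by linarith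
        then obtain d where d: "n u \<le> d * n r" "d \<le> ?D"
        proof cases
          case 1 then show ?thesis using that[of "1 / a4"] far(1)[OF 1 ru(2)] D by simp
        next
          case 2
          have "ereal u < R1" using 2 R real by simp
          then show ?thesis using that[of "1 / a1"] le1[OF ru] D by simp
        next
          case 3
          have "n u \<le> 1 / a4 * n R" using 3 R by (intro far(1)) auto
          also have "\<dots> \<le> 1 / a4 * (n r / a1)" using 3 R ru a45 by (intro mult_left_mono le1) auto
          finally show ?thesis using that[of "1 / a4 * (1 / a1)"] D by simp
        qed
        have "d * n r \<le> ?D * n r" using d n_nonneg by (intro mult_right_mono) auto
        then show ?thesis using d by linarith
      qed
      show "n r \<le> max (8 * a2) (1 / a5) * n (2 * r)" if r: "0 < r" for r
      proof -
        obtain d where d: "n r \<le> d * n (2 * r)" "d \<le> max (8 * a2) (1 / a5)"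
        proof (cases "q / 2 \<le> r")
          case True then show ?thesis using that[of "1 / a5"] far(2)[OF True order_refl] by simp
        next
          case False
          have "ereal (2 * r) < R1" using False real by simp
          then show ?thesis using that[of "8 * a2"] dbl[OF r] by simp
        qed
        have "d * n (2 * r) \<le> max (8 * a2) (1 / a5) * n (2 * r)" using d n_nonneg by (intro mult_right_mono) auto
        then show ?thesis using d by linarith
      qed
    qed
    have B: "?B" if ?D
    proof -
      from that obtain a4 a5 where "0 < a4" "0 < a5"
        "\<forall>r. R1 / 2 \<le> ereal r \<longrightarrow> (\<forall>u\<ge>r. a4 * \<nu> u \<le> \<nu> r) \<and> a5 * \<nu> r \<le> \<nu> (2 * r)" by (elim conjE exE)
      note D = all[OF far[OF this]]
      show ?B using D by (intro allI impI)
    qed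
    have A: "?A" using near by (intro allI impI)
    show ?thesis by (rule conjI[OF A impI[OF B]])
  qed
qed

end
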